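(* Let $Q_2$ be the directed graph with three vertices $v_0^0,v_0^1,v_1^1$, one loop at $v_0^0$, one edge from $v_0^0$ to $v_0^1$, one edge from $v_0^0$ to $v_1^1$, one loop at $v_0^1$, and no other edges. The gauge-invariant subalgebra $C^*(Q_2)^{U(1)}$ has the following even K-group: $$K_0(C^*(Q_2)^{U(1)})\cong\bigoplus_{\mathbb{N}}\mathbb{Z}.$$
   Context: For a finite directed graph $E$ with vertex set $E_0$, edge set $E_1$, and source and range maps $s,r$, $C^*(E)$ is the universal C*-algebra generated by mutually orthogonal projections $P_v$ ($v\in E_0$) and partial isometries $S_e$ ($e\in E_1$) subject to $S_e^*S_e=P_{r(e)}$ for all $e\in E_1$, and $\sum_{e:\,s(e)=v}S_eS_e^*=P_v$ for every $v\in E_0$ that is not a sink (a sink is a vertex emitting no edges). The gauge action of $U(1)$ on $C^*(E)$ is $\alpha_\lambda(P_v)=P_v$, $\alpha_\lambda(S_e)=\lambda S_e$; $C^*(E)^{U(1)}$ is its fixed-point subalgebra. $\bigoplus_{\mathbb N}\mathbb Z$ is the free abelian group of countably infinite rank. *)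

theory Defs
  imports
    Complex_Main
    "HOL-Algebra.Free_Abelian_Groups"
    "HOL-Library.Poly_Mapping"
    "Graph_Theory.Digraph"
    "Jordan_Normal_Form.Matrix"
begin

section \<open>The free *-algebra on a set of generators\<close>

datatype 'g letter = Gen 'g | Adj 'g

datatype 'g star_word = Word (letters: "'g letter list")

instantiation star_word :: (type) monoid_add
begin
definition zero_star_word :: "'a star_word" where "0 = Word []"
definition plus_star_word :: "'a star_word \<Rightarrow> 'a star_word \<Rightarrow> 'a star_word"
  where "v + w = Word (letters v @ letters w)"
instance by standard (auto simp: zero_star_word_def plus_star_word_def)
end

text \<open>
  With concatenation as addition of exponents, the type below is the free \<^emph>\<open>unital\<close> complex
  *-algebra on the generators; its product is the convolution product of \<^typ>\<open>'a \<Rightarrow>\<^sub>0 'b\<close>.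
\<close>
type_synonym 'g star_poly = "'g star_word \<Rightarrow>\<^sub>0 complex"

fun letter_adj :: "'g letter \<Rightarrow> 'g letter" where
  "letter_adj (Gen g) = Adj g"
| "letter_adj (Adj g) = Gen g"

definition word_adj :: "'g star_word \<Rightarrow> 'g star_word"
  where "word_adj w = Word (rev (map letter_adj (letters w)))"

lemma letter_adj_letter_adj [simp]: "letter_adj (letter_adj l) = l"
  by (cases l) auto

lemma word_adj_word_adj [simp]: "word_adj (word_adj w) = w"
  by (cases w) (simp add: word_adj_def rev_map comp_def)

lemma word_adj_plus: "word_adj (v + w) = word_adj w + word_adj v"
  by (simp add: word_adj_def plus_star_word_def)

lift_definition poly_adj :: "'g star_poly \<Rightarrow> 'g star_poly"
  is "\<lambda>p w. cnj (p (word_adj w))"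
proof -
  fix p :: "'g star_word \<Rightarrow> complex"
  assume "finite {w. p w \<noteq> 0}"
  moreover have "{w. cnj (p (word_adj w)) \<noteq> 0} \<subseteq> word_adj ` {w. p w \<noteq> 0}"
  proof
    fix w
    assume "w \<in> {w. cnj (p (word_adj w)) \<noteq> 0}"
    then show "w \<in> word_adj ` {w. p w \<noteq> 0}"
      by (intro image_eqI[of _ _ "word_adj w"]) simp_all
  qed
  ultimately show "finite {w. cnj (p (word_adj w)) \<noteq> 0}"
    using finite_surj by blast
qed

lift_definition poly_scale :: "complex \<Rightarrow> 'g star_poly \<Rightarrow> 'g star_poly"
  is "\<lambda>c p w. c * p w"
  by (erule rev_finite_subset) auto

definition gen :: "'g \<Rightarrow> 'g star_poly"
  where "gen g = Poly_Mapping.single (Word [Gen g]) 1"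

text \<open>
  The free non-unital *-algebra: no constant term. It must be used here, since allowing constants
  would adjoin a new unit to the universal C*-algebra.
\<close>
definition star_polys :: "'g star_poly set"
  where "star_polys = {p. Poly_Mapping.lookup p 0 = 0}"

section \<open>Universal C*-algebras\<close>

record 'a star_algebra = "(complex, 'a) module" +
  star_op :: "'a \<Rightarrow> 'a"
  cnorm :: "'a \<Rightarrow> real"

definition cstar_seminorm :: "('g star_poly \<Rightarrow> real) \<Rightarrow> bool" where
  "cstar_seminorm \<nu> \<longleftrightarrow>
     (\<forall>p\<in>star_polys. 0 \<le> \<nu> p) \<and>
     (\<forall>p\<in>star_polys. \<forall>q\<in>star_polys. \<nu> (p + q) \<le> \<nu> p + \<nu> q) \<and>
     (\<forall>c. \<forall>p\<in>star_polys. \<nu> (poly_scale c p) = cmod c * \<nu> p) \<and>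
     (\<forall>p\<in>star_polys. \<forall>q\<in>star_polys. \<nu> (p * q) \<le> \<nu> p * \<nu> q) \<and>
     (\<forall>p\<in>star_polys. \<nu> (poly_adj p * p) = (\<nu> p)\<^sup>2)"

text \<open>
  The universal C*-algebra on the given generators subject to the relations \<open>r = 0\<close> for
  \<open>r \<in> R \<subseteq> star_polys\<close> is the Hausdorff completion of the free non-unital *-algebra in the largest
  C*-seminorm vanishing on \<open>R\<close>. The supremum is meaningful whenever the relations bound the
  generators in every C*-seminorm, as they do for partial isometries and projections.
\<close>
definition univ_norm :: "'g star_poly set \<Rightarrow> 'g star_poly \<Rightarrow> real" where
  "univ_norm R p = (SUP \<nu> \<in> {\<nu>. cstar_seminorm \<nu> \<and> (\<forall>r\<in>R. \<nu> r = 0)}. \<nu> p)"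

definition cauchy_seqs :: "'g star_poly set \<Rightarrow> (nat \<Rightarrow> 'g star_poly) set" where
  "cauchy_seqs R = {x. (\<forall>n. x n \<in> star_polys) \<and>
     (\<forall>\<epsilon>>0. \<exists>N. \<forall>m\<ge>N. \<forall>n\<ge>N. univ_norm R (x m - x n) < \<epsilon>)}"

definition null_rel :: "'g star_poly set \<Rightarrow> ((nat \<Rightarrow> 'g star_poly) \<times> (nat \<Rightarrow> 'g star_poly)) set"
  where "null_rel R = {(x, y). x \<in> cauchy_seqs R \<and> y \<in> cauchy_seqs R \<and>
     (\<lambda>n. univ_norm R (x n - y n)) \<longlonglongrightarrow> 0}"

definition univ_class ::
    "'g star_poly set \<Rightarrow> (nat \<Rightarrow> 'g star_poly) \<Rightarrow> (nat \<Rightarrow> 'g star_poly) set"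
  where "univ_class R x = null_rel R `` {x}"

text \<open>
  The \<^const>\<open>one\<close> field is only meaningful if the algebra has a unit, as is the case for graph
  algebras of finite graphs (the sum of the vertex projections).
\<close>
definition univ_cstar ::
    "'g star_poly set \<Rightarrow> (nat \<Rightarrow> 'g star_poly) set star_algebra" where
  "univ_cstar R =
    (let C = cauchy_seqs R // null_rel R;
         times = (\<lambda>X Y. \<Union>x\<in>X. \<Union>y\<in>Y. univ_class R (\<lambda>n. x n * y n))
     in \<lparr>carrier = C,
         monoid.mult = times,
         one = (THE U. U \<in> C \<and> (\<forall>X\<in>C. times U X = X \<and> times X U = X)),
         zero = univ_class R (\<lambda>n. 0),
         add = (\<lambda>X Y. \<Union>x\<in>X. \<Union>y\<in>Y. univ_class R (\<lambda>n. x n + y n)),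
         smult = (\<lambda>c X. \<Union>x\<in>X. univ_class R (\<lambda>n. poly_scale c (x n))),
         star_op = (\<lambda>X. \<Union>x\<in>X. univ_class R (\<lambda>n. poly_adj (x n))),
         cnorm = (\<lambda>X. THE t. \<forall>x\<in>X. (\<lambda>n. univ_norm R (x n)) \<longlonglongrightarrow> t)\<rparr>)"

section \<open>Graph C*-algebras and the gauge action\<close>

text \<open>Source and range of an edge are \<^const>\<open>tail\<close> and \<^const>\<open>head\<close>.\<close>

datatype ('v, 'e) graph_gen = Vertex 'v | Edge 'e

abbreviation genP :: "'v \<Rightarrow> ('v, 'e) graph_gen star_poly"
  where "genP v \<equiv> gen (Vertex v)"

abbreviation genS :: "'e \<Rightarrow> ('v, 'e) graph_gen star_poly"
  where "genS e \<equiv> gen (Edge e)"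

text \<open>
  The last two families discard the generators that are indexed by elements of the types
  \<^typ>\<open>'v\<close> and \<^typ>\<open>'e\<close> that are not vertices or edges of the graph.
\<close>
definition graph_relations :: "('v, 'e) pre_digraph \<Rightarrow> ('v, 'e) graph_gen star_poly set" where
  "graph_relations G =
     {poly_adj (genP v) - genP v | v. v \<in> verts G} \<union>
     {genP v * genP v - genP v | v. v \<in> verts G} \<union>
     {genP v * genP w | v w. v \<in> verts G \<and> w \<in> verts G \<and> v \<noteq> w} \<union>
     {genS e * poly_adj (genS e) * genS e - genS e | e. e \<in> arcs G} \<union>
     {poly_adj (genS e) * genS e - genP (head G e) | e. e \<in> arcs G} \<union>
     {(\<Sum>e\<in>out_arcs G v. genS e * poly_adj (genS e)) - genP v | v.
        v \<in> verts G \<and> out_arcs G v \<noteq> {}} \<union>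
     {genP v | v. v \<notin> verts G} \<union>
     {genS e | e. e \<notin> arcs G}"

type_synonym ('v, 'e) graph_elem = "(nat \<Rightarrow> ('v, 'e) graph_gen star_poly) set"

definition graph_cstar :: "('v, 'e) pre_digraph \<Rightarrow> ('v, 'e) graph_elem star_algebra"
  where "graph_cstar G = univ_cstar (graph_relations G)"

fun gauge_letter :: "complex \<Rightarrow> ('v, 'e) graph_gen letter \<Rightarrow> complex" where
  "gauge_letter z (Gen (Vertex v)) = 1"
| "gauge_letter z (Adj (Vertex v)) = 1"
| "gauge_letter z (Gen (Edge e)) = z"
| "gauge_letter z (Adj (Edge e)) = cnj z"

definition gauge_word :: "complex \<Rightarrow> ('v, 'e) graph_gen star_word \<Rightarrow> complex"
  where "gauge_word z w = (\<Prod>l\<leftarrow>letters w. gauge_letter z l)"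

text \<open>
  The *-endomorphism of the free *-algebra with \<open>P\<^sub>v \<mapsto> P\<^sub>v\<close> and \<open>S\<^sub>e \<mapsto> c S\<^sub>e\<close>; see the lemmas
  below. It preserves the relations if \<open>cmod c = 1\<close>.
\<close>
lift_definition poly_gauge ::
    "complex \<Rightarrow> ('v, 'e) graph_gen star_poly \<Rightarrow> ('v, 'e) graph_gen star_poly"
  is "\<lambda>c p w. gauge_word c w * p w"
  by (erule rev_finite_subset) auto

lemma poly_gauge_single:
  "poly_gauge c (Poly_Mapping.single w a) = Poly_Mapping.single w (gauge_word c w * a)"
  by (rule poly_mapping_eqI) (simp add: poly_gauge.rep_eq lookup_single when_def)

lemma poly_adj_single:
  "poly_adj (Poly_Mapping.single w a) = Poly_Mapping.single (word_adj w) (cnj a)"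
proof (rule poly_mapping_eqI)
  fix u
  have "w = word_adj u \<longleftrightarrow> word_adj w = u"
    using word_adj_word_adj by metis
  then show "Poly_Mapping.lookup (poly_adj (Poly_Mapping.single w a)) u =
      Poly_Mapping.lookup (Poly_Mapping.single (word_adj w) (cnj a)) u"
    by (simp add: poly_adj.rep_eq lookup_single when_def)
qed

lemma poly_gauge_genP: "poly_gauge c (genP v) = genP v"
  by (simp add: gen_def poly_gauge_single gauge_word_def)

lemma poly_gauge_genS: "poly_gauge c (genS e) = poly_scale c (genS e)"
  unfolding gen_def
  by (rule poly_mapping_eqI)
    (simp add: poly_gauge_single gauge_word_def poly_scale.rep_eq lookup_single when_def)

lemma poly_gauge_add: "poly_gauge c (p + q) = poly_gauge c p + poly_gauge c q"
  by (rule poly_mapping_eqI) (simp add: poly_gauge.rep_eq lookup_add distrib_left)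

lemma poly_gauge_scale: "poly_gauge c (poly_scale d p) = poly_scale d (poly_gauge c p)"
  by (rule poly_mapping_eqI) (simp add: poly_gauge.rep_eq poly_scale.rep_eq)

lemma poly_adj_add: "poly_adj (p + q) = poly_adj p + poly_adj q"
  by (rule poly_mapping_eqI) (simp add: poly_adj.rep_eq lookup_add)

lemma gauge_word_plus: "gauge_word c (v + w) = gauge_word c v * gauge_word c w"
  by (simp add: gauge_word_def plus_star_word_def)

lemma gauge_letter_adj: "gauge_letter c (letter_adj l) = cnj (gauge_letter c l)"
  by (induction c l rule: gauge_letter.induct) simp_all

lemma gauge_word_adj: "gauge_word c (word_adj w) = cnj (gauge_word c w)"
proof -
  have "prod_list (map (gauge_letter c) (rev (map letter_adj ls))) =
      cnj (prod_list (map (gauge_letter c) ls))" for ls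
    by (induction ls) (simp_all add: gauge_letter_adj)
  then show ?thesis
    by (simp add: gauge_word_def word_adj_def)
qed

lemma poly_gauge_adj: "poly_gauge c (poly_adj p) = poly_adj (poly_gauge c p)"
  by (rule poly_mapping_eqI) (simp add: poly_gauge.rep_eq poly_adj.rep_eq gauge_word_adj)

lemma star_poly_induct [case_names single add]:
  fixes p :: "'g star_poly"
  assumes "\<And>w a. Q (Poly_Mapping.single w a)" "\<And>p q. Q p \<Longrightarrow> Q q \<Longrightarrow> Q (p + q)"
  shows "Q p"
proof (induction p rule: update_induct)
  case const
  show ?case
    using assms(1)[of 0 0] by simp
next
  case (update p w a)
  have "Poly_Mapping.update w a p = p + Poly_Mapping.single w a"
    using update.hyps(1)
    by (intro poly_mapping_eqI) (auto simp: lookup_update lookup_add lookup_single when_def in_keys_iff)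
  then show ?case
    using assms update by simp
qed

lemma poly_gauge_mult: "poly_gauge c (p * q) = poly_gauge c p * poly_gauge c q"
proof (induction p rule: star_poly_induct)
  case (single v a)
  show ?case
    by (induction q rule: star_poly_induct)
      (simp_all add: poly_gauge_single mult_single gauge_word_plus poly_gauge_add distrib_left mult_ac)
qed (simp add: poly_gauge_add distrib_right)

lemma poly_adj_mult: "poly_adj (p * q) = poly_adj q * poly_adj p"
proof (induction p rule: star_poly_induct)
  case (single v a)
  show ?case
    by (induction q rule: star_poly_induct)
      (simp_all add: poly_adj_single mult_single word_adj_plus poly_adj_add
        distrib_left distrib_right mult.commute)
qed (simp add: poly_adj_add distrib_left distrib_right)

text \<open>The extension of \<^const>\<open>poly_gauge\<close> to the completion by continuity.\<close>
definition gauge ::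
    "('v, 'e) pre_digraph \<Rightarrow> complex \<Rightarrow> ('v, 'e) graph_elem \<Rightarrow> ('v, 'e) graph_elem"
  where "gauge G c X = (\<Union>x\<in>X. univ_class (graph_relations G) (\<lambda>n. poly_gauge c (x n)))"

definition gauge_fixed :: "('v, 'e) pre_digraph \<Rightarrow> ('v, 'e) graph_elem star_algebra" where
  "gauge_fixed G = (graph_cstar G)
     \<lparr>carrier := {X \<in> carrier (graph_cstar G). \<forall>c. cmod c = 1 \<longrightarrow> gauge G c X = X}\<rparr>"

section \<open>The group \<open>K\<^sub>0\<close> of a unital C*-algebra\<close>

text \<open>
  The matrix type of \<^theory>\<open>Jordan_Normal_Form.Matrix\<close> is used for its shape only; its arithmetic
  is for type classes, so the operations relative to a carrier are defined here.
\<close>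
definition mats_over :: "('a, 'm) star_algebra_scheme \<Rightarrow> nat \<Rightarrow> nat \<Rightarrow> 'a mat set"
  where "mats_over A m n = {M \<in> carrier_mat m n. elements_mat M \<subseteq> carrier A}"

definition mat_prod :: "('a, 'm) star_algebra_scheme \<Rightarrow> 'a mat \<Rightarrow> 'a mat \<Rightarrow> 'a mat" where
  "mat_prod A M N = mat (dim_row M) (dim_col N)
     (\<lambda>(i, j). \<Oplus>\<^bsub>A\<^esub>k\<in>{..<dim_col M}. M $$ (i, k) \<otimes>\<^bsub>A\<^esub> N $$ (k, j))"

definition mat_star :: "('a, 'm) star_algebra_scheme \<Rightarrow> 'a mat \<Rightarrow> 'a mat"
  where "mat_star A M = mat (dim_col M) (dim_row M) (\<lambda>(i, j). star_op A (M $$ (j, i)))"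

definition mat_zero :: "('a, 'm) star_algebra_scheme \<Rightarrow> nat \<Rightarrow> nat \<Rightarrow> 'a mat"
  where "mat_zero A m n = mat m n (\<lambda>_. \<zero>\<^bsub>A\<^esub>)"

definition mat_dsum :: "('a, 'm) star_algebra_scheme \<Rightarrow> 'a mat \<Rightarrow> 'a mat \<Rightarrow> 'a mat" where
  "mat_dsum A M N = four_block_mat M (mat_zero A (dim_row M) (dim_col N))
     (mat_zero A (dim_row N) (dim_col M)) N"

definition projections :: "('a, 'm) star_algebra_scheme \<Rightarrow> 'a mat set" where
  "projections A = {p. \<exists>n>0. p \<in> mats_over A n n \<and> mat_star A p = p \<and> mat_prod A p p = p}"

definition murray_von_neumann :: "('a, 'm) star_algebra_scheme \<Rightarrow> ('a mat \<times> 'a mat) set" where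
  "murray_von_neumann A = {(p, q). p \<in> projections A \<and> q \<in> projections A \<and>
     (\<exists>v\<in>mats_over A (dim_row q) (dim_row p).
        mat_prod A (mat_star A v) v = p \<and> mat_prod A v (mat_star A v) = q)}"

definition projection_monoid :: "('a, 'm) star_algebra_scheme \<Rightarrow> 'a mat set monoid" where
  "projection_monoid A =
     \<lparr>carrier = projections A // murray_von_neumann A,
      monoid.mult = (\<lambda>X Y. \<Union>p\<in>X. \<Union>q\<in>Y. murray_von_neumann A `` {mat_dsum A p q}),
      one = murray_von_neumann A `` {mat_zero A 1 1}\<rparr>"

text \<open>The Grothendieck group of a commutative monoid; the pair \<open>(a, b)\<close> stands for \<open>a - b\<close>.\<close>

definition grothendieck_rel :: "('a, 'm) monoid_scheme \<Rightarrow> (('a \<times> 'a) \<times> ('a \<times> 'a)) set" where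
  "grothendieck_rel M = {((a, b), (c, d)).
     a \<in> carrier M \<and> b \<in> carrier M \<and> c \<in> carrier M \<and> d \<in> carrier M \<and>
     (\<exists>z\<in>carrier M. a \<otimes>\<^bsub>M\<^esub> d \<otimes>\<^bsub>M\<^esub> z = c \<otimes>\<^bsub>M\<^esub> b \<otimes>\<^bsub>M\<^esub> z)}"

definition grothendieck_group :: "('a, 'm) monoid_scheme \<Rightarrow> ('a \<times> 'a) set monoid" where
  "grothendieck_group M =
     \<lparr>carrier = (carrier M \<times> carrier M) // grothendieck_rel M,
      monoid.mult = (\<lambda>X Y. \<Union>(a, b)\<in>X. \<Union>(c, d)\<in>Y.
        grothendieck_rel M `` {(a \<otimes>\<^bsub>M\<^esub> c, b \<otimes>\<^bsub>M\<^esub> d)}),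
      one = grothendieck_rel M `` {(\<one>\<^bsub>M\<^esub>, \<one>\<^bsub>M\<^esub>)}\<rparr>"

text \<open>
  This is the usual \<open>K\<^sub>0\<close> for unital algebras only. It applies to \<^const>\<open>gauge_fixed\<close> of a finite
  graph, which contains the unit \<open>\<Sum>\<^sub>v P\<^sub>v\<close> of the graph algebra.
\<close>
definition K0 :: "('a, 'm) star_algebra_scheme \<Rightarrow> ('a mat set \<times> 'a mat set) set monoid"
  where "K0 A = grothendieck_group (projection_monoid A)"

section \<open>The graph \<open>Q\<^sub>2\<close>\<close>

text \<open>The vertex \<open>Vij\<close> is written \<open>v\<^sub>i\<^sup>j\<close> in mathematical notation.\<close>

datatype Q2_vertex = V00 | V01 | V11

datatype Q2_edge = Loop00 | E00_01 | E00_11 | Loop01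

definition Q2 :: "(Q2_vertex, Q2_edge) pre_digraph" where
  "Q2 = \<lparr>verts = {V00, V01, V11},
         arcs = {Loop00, E00_01, E00_11, Loop01},
         tail = (\<lambda>e. case e of Loop00 \<Rightarrow> V00 | E00_01 \<Rightarrow> V00 | E00_11 \<Rightarrow> V00 | Loop01 \<Rightarrow> V01),
         head = (\<lambda>e. case e of Loop00 \<Rightarrow> V00 | E00_01 \<Rightarrow> V01 | E00_11 \<Rightarrow> V11 | Loop01 \<Rightarrow> V01)\<rparr>"

lemma fin_digraph_Q2: "fin_digraph Q2"
  by unfold_locales (auto simp: Q2_def split: Q2_edge.splits)

end

theory Submission
  imports Defs "HOL-Analysis.Inner_Product" "HOL-Analysis.Operator_Norm" "HOL-Analysis.Elementary_Metric_Spaces"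
begin

text \<open>
  Write \<open>e\<close>, \<open>f\<close>, \<open>g\<close>, \<open>h\<close> for the loop at \<open>V00\<close>, the edges to \<open>V01\<close> and \<open>V11\<close>, and the loop at
  \<open>V01\<close>. Words of degree \<open>0\<close> in the generators reduce to the projections \<open>a\<^sub>n = e\<^sup>n e\<^sup>*\<^sup>n\<close>, the
  matrix units \<open>e\<^sub>i\<^sub>j\<close> belonging to the paths that enter \<open>V01\<close>, and the orthogonal projections \<open>c\<^sub>i\<close>
  belonging to the paths that end in \<open>V11\<close>, with \<open>a\<^sub>n = a\<^sub>n\<^sub>+\<^sub>1 + e\<^sub>n\<^sub>+\<^sub>1\<^sub>,\<^sub>n\<^sub>+\<^sub>1 + c\<^sub>n\<^sub>+\<^sub>1\<close>. Averaging over the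
  gauge action shows that the union of the algebras \<open>F\<^sub>n\<close>, spanned by \<open>a\<^sub>n\<close> and the \<open>e\<^sub>i\<^sub>j\<close>, \<open>c\<^sub>i\<close> with
  \<open>i, j \<le> n\<close> and isomorphic to \<open>\<complex> \<oplus> M\<^sub>n\<^sub>+\<^sub>1(\<complex>) \<oplus> \<complex>\<^sup>n\<^sup>+\<^sup>1\<close>, is dense in the fixed-point algebra; a
  representation on the span of the paths shows that these generators are independent.

  Newton iterations move projections and partial isometries over the fixed-point algebra into
  matrices over some \<open>F\<^sub>n\<close>, where projections split into copies of \<open>a\<^sub>n\<close>, \<open>e\<^sub>0\<^sub>0\<close> and \<open>c\<^sub>i\<close>. Since
  \<open>1 = a\<^sub>n + \<Sum>\<^sub>i\<^sub>\<le>\<^sub>n (e\<^sub>i\<^sub>i + c\<^sub>i)\<close>, the classes of \<open>1\<close>, \<open>e\<^sub>0\<^sub>0\<close>, \<open>c\<^sub>0\<close>, \<open>c\<^sub>1\<close>, \<dots> generate \<open>K\<^sub>0\<close>, and the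
  traces of the summands of \<open>F\<^sub>n\<close> show that they form a basis.
\<close>

section \<open>The free *-algebra\<close>

text \<open>The loop at \<open>V01\<close> shapes the answer. \<open>Sh\<close> is unitary in its
  corner and absorbs differences of path lengths, so the paths into \<open>V01\<close> of all
  lengths yield one growing matrix algebra and one class. \<open>V11\<close> emits nothing: no
  element of degree 0 links paths into it of different lengths, and each length contributes a class
  of its own. The classes of the \<open>aa n\<close> vary with \<open>n\<close>; the unit stands for
  all of them in the basis. Two obstacles shape the form. Projections and partial isometries are
  corrected without functional calculus: the iterations use only polynomials and limits, stay inside
  any complete *-subalgebra, and ask for a submultiplicative norm with isometric involution. So
  matrices may carry the sum of the norms of their entries, and all sizes fit into one algebra of
  finitely supported infinite matrices. Secondly, the norm is a supremum over abstract seminorms.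
  Upper bounds come from the relations, lower bounds from one explicit representation, whose matrix
  coefficients are continuous, detect the coordinates in \<open>Fn n\<close> and show that
  \<open>Fn n\<close> is closed.\<close>

lemma lookup_scale [simp]: "Poly_Mapping.lookup (poly_scale c p) w = c * Poly_Mapping.lookup p w"
  by (simp add: poly_scale.rep_eq)

lemma lookup_adj: "Poly_Mapping.lookup (poly_adj p) w = cnj (Poly_Mapping.lookup p (word_adj w))"
  by (simp add: poly_adj.rep_eq)

lemma star_word_sum_eq_0_iff: "v + w = 0 \<longleftrightarrow> v = 0 \<and> w = 0" for v w :: "'g star_word"
  by (cases v; cases w) (auto simp: plus_star_word_def zero_star_word_def)

lemma word_adj_0 [simp]: "word_adj 0 = 0"
  by (simp add: word_adj_def zero_star_word_def)

text \<open>The empty word factors only into empty words. This is why \<open>star_polys\<close> is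
  closed under products.\<close>

lemma lookup_mult_0:
  "Poly_Mapping.lookup (p * q) 0 = Poly_Mapping.lookup p 0 * Poly_Mapping.lookup q 0"
  for p q :: "'g star_poly"
proof (induction p rule: star_poly_induct)
  case (single v a)
  show ?case
    by (induction q rule: star_poly_induct)
      (auto simp: mult_single lookup_single when_def star_word_sum_eq_0_iff distrib_left lookup_add)
qed (simp add: distrib_right lookup_add)

lemma poly_scale_single: "poly_scale c (Poly_Mapping.single w a) = Poly_Mapping.single w (c * a)"
  by (rule poly_mapping_eqI) (simp add: lookup_single when_def)

lemma poly_scale_add: "poly_scale c (p + q) = poly_scale c p + poly_scale c q"
  by (rule poly_mapping_eqI) (simp add: lookup_add distrib_left)

lemma poly_scale_diff: "poly_scale c (p - q) = poly_scale c p - poly_scale c q"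
  by (rule poly_mapping_eqI) (simp add: lookup_minus right_diff_distrib)

lemma poly_scale_add_left: "poly_scale (c + d) p = poly_scale c p + poly_scale d p"
  by (rule poly_mapping_eqI) (simp add: lookup_add distrib_right)

lemma poly_scale_scale: "poly_scale c (poly_scale d p) = poly_scale (c * d) p"
  by (rule poly_mapping_eqI) simp

lemma poly_scale_1 [simp]: "poly_scale 1 p = p"
  by (rule poly_mapping_eqI) simp

lemma poly_scale_0 [simp]: "poly_scale c 0 = 0"
  by (rule poly_mapping_eqI) simp

lemma poly_scale_0_left [simp]: "poly_scale 0 p = 0"
  by (rule poly_mapping_eqI) simp

lemma poly_scale_minus1: "poly_scale (- 1) p = - p"
  by (rule poly_mapping_eqI) simp

lemma poly_scale_mult_left: "poly_scale c p * q = poly_scale c (p * q)"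
proof (induction p rule: star_poly_induct)
  case (single v a)
  show ?case
    by (induction q rule: star_poly_induct)
      (simp_all add: poly_scale_single mult_single poly_scale_add distrib_left mult_ac)
qed (simp add: poly_scale_add distrib_right)

lemma poly_scale_mult_right: "p * poly_scale c q = poly_scale c (p * q)"
proof (induction p rule: star_poly_induct)
  case (single v a)
  show ?case
    by (induction q rule: star_poly_induct)
      (simp_all add: poly_scale_single mult_single poly_scale_add distrib_left mult_ac)
qed (simp add: poly_scale_add distrib_right)

lemma poly_adj_adj [simp]: "poly_adj (poly_adj p) = p"
  by (rule poly_mapping_eqI) (simp add: lookup_adj)

lemma poly_adj_scale: "poly_adj (poly_scale c p) = poly_scale (cnj c) (poly_adj p)"
  by (rule poly_mapping_eqI) (simp add: lookup_adj)

lemma poly_adj_diff: "poly_adj (p - q) = poly_adj p - poly_adj q"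
  by (rule poly_mapping_eqI) (simp add: lookup_adj lookup_minus)

lemma poly_gauge_0 [simp]: "poly_gauge c 0 = 0"
  by (rule poly_mapping_eqI) (simp add: poly_gauge.rep_eq)

lemma poly_gauge_diff: "poly_gauge c (p - q) = poly_gauge c p - poly_gauge c q"
  by (rule poly_mapping_eqI) (simp add: poly_gauge.rep_eq lookup_minus right_diff_distrib)

lemma star_polys_0 [simp]: "0 \<in> star_polys"
  by (simp add: star_polys_def)

lemma star_polys_add [simp]: "p \<in> star_polys \<Longrightarrow> q \<in> star_polys \<Longrightarrow> p + q \<in> star_polys"
  by (simp add: star_polys_def lookup_add)

lemma star_polys_diff [simp]: "p \<in> star_polys \<Longrightarrow> q \<in> star_polys \<Longrightarrow> p - q \<in> star_polys"
  by (simp add: star_polys_def lookup_minus)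

lemma star_polys_mult [simp]: "p \<in> star_polys \<Longrightarrow> q \<in> star_polys \<Longrightarrow> p * q \<in> star_polys"
  by (simp add: star_polys_def lookup_mult_0)

lemma star_polys_scale [simp]: "p \<in> star_polys \<Longrightarrow> poly_scale c p \<in> star_polys"
  by (simp add: star_polys_def)

lemma star_polys_adj [simp]: "p \<in> star_polys \<Longrightarrow> poly_adj p \<in> star_polys"
  by (simp add: star_polys_def lookup_adj)

lemma star_polys_gauge [simp]: "p \<in> star_polys \<Longrightarrow> poly_gauge c p \<in> star_polys"
  by (simp add: star_polys_def poly_gauge.rep_eq)

lemma star_polys_sum: "(\<And>i. i \<in> I \<Longrightarrow> f i \<in> star_polys) \<Longrightarrow> sum f I \<in> star_polys"
  by (induction I rule: infinite_finite_induct) auto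

lemma star_polys_single_iff: "Poly_Mapping.single w a \<in> star_polys \<longleftrightarrow> a = 0 \<or> w \<noteq> 0"
  by (auto simp: star_polys_def lookup_single when_def)

lemma star_polys_gen [simp]: "gen g \<in> star_polys"
  by (simp add: gen_def star_polys_single_iff zero_star_word_def)

lemma star_poly_expansion:
  "p = (\<Sum>w\<in>Poly_Mapping.keys p. Poly_Mapping.single w (Poly_Mapping.lookup p w))"
  by (rule poly_mapping_eqI)
    (auto simp: lookup_sum lookup_single when_def in_keys_iff sum.delta' intro!: sum.neutral[symmetric])

section \<open>Completion in a universal seminorm\<close>

definition rel_seminorms :: "'g star_poly set \<Rightarrow> ('g star_poly \<Rightarrow> real) set" where
  "rel_seminorms R = {\<nu>. cstar_seminorm \<nu> \<and> (\<forall>r\<in>R. \<nu> r = 0)}"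

lemma cstar_seminormD:
  assumes "cstar_seminorm \<nu>"
  shows "p \<in> star_polys \<Longrightarrow> 0 \<le> \<nu> p"
    and "p \<in> star_polys \<Longrightarrow> q \<in> star_polys \<Longrightarrow> \<nu> (p + q) \<le> \<nu> p + \<nu> q"
    and "p \<in> star_polys \<Longrightarrow> \<nu> (poly_scale c p) = cmod c * \<nu> p"
    and "p \<in> star_polys \<Longrightarrow> q \<in> star_polys \<Longrightarrow> \<nu> (p * q) \<le> \<nu> p * \<nu> q"
    and "p \<in> star_polys \<Longrightarrow> \<nu> (poly_adj p * p) = (\<nu> p)\<^sup>2"
  using assms by (auto simp: cstar_seminorm_def)

text \<open>Isometry of the adjoint is no axiom of \<open>cstar_seminorm\<close>. The C*-identity
  and submultiplicativity bound the square of \<open>\<nu> q\<close> by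
  \<open>\<nu> (poly_adj q) * \<nu> q\<close>; this is used for \<open>q\<close> and for its
  adjoint.\<close>

lemma cstar_seminorm_adj:
  assumes "cstar_seminorm \<nu>" "p \<in> star_polys"
  shows "\<nu> (poly_adj p) = \<nu> p"
proof -
  have le: "\<nu> q \<le> \<nu> (poly_adj q)" if q: "q \<in> star_polys" for q
  proof (cases "\<nu> q = 0")
    case True
    then show ?thesis using cstar_seminormD(1)[OF assms(1), of "poly_adj q"] q by simp
  next
    case False
    then have pos: "\<nu> q > 0" using cstar_seminormD(1)[OF assms(1) q] by simp
    have "\<nu> q * \<nu> q \<le> \<nu> (poly_adj q) * \<nu> q"
      using cstar_seminormD(4)[OF assms(1), of "poly_adj q" q] cstar_seminormD(5)[OF assms(1) q] q
      by (simp add: power2_eq_square)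
    then show ?thesis using pos by simp
  qed
  show ?thesis using le[OF assms(2)] le[of "poly_adj p"] assms(2) by simp
qed

text \<open>A real \<open>SUP\<close> says something only for sets bounded above; the assumption
  makes \<open>univ_norm\<close> an actual supremum. \<open>bounded_graph_relations\<close>
  discharges it.\<close>

locale bounded_relations =
  fixes R :: "'g star_poly set"
  assumes bounded: "p \<in> star_polys \<Longrightarrow> bdd_above ((\<lambda>\<nu>. \<nu> p) ` rel_seminorms R)"
begin

section \<open>The universal norm inherits the axioms of a C*-seminorm\<close>

lemma rel_seminorms_nonempty: "(\<lambda>_. 0) \<in> rel_seminorms R"
  by (simp add: rel_seminorms_def cstar_seminorm_def)

lemma univ_norm_eq: "univ_norm R p = (SUP \<nu>\<in>rel_seminorms R. \<nu> p)"
  by (simp add: univ_norm_def rel_seminorms_def)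

lemma seminorm_le: "p \<in> star_polys \<Longrightarrow> \<nu> \<in> rel_seminorms R \<Longrightarrow> \<nu> p \<le> univ_norm R p"
  unfolding univ_norm_eq by (rule cSUP_upper[OF _ bounded])

lemma norm_leI: "(\<And>\<nu>. \<nu> \<in> rel_seminorms R \<Longrightarrow> \<nu> p \<le> K) \<Longrightarrow> univ_norm R p \<le> K"
  unfolding univ_norm_eq using rel_seminorms_nonempty by (intro cSUP_least) auto

lemma norm_nonneg [simp]: "p \<in> star_polys \<Longrightarrow> 0 \<le> univ_norm R p"
  using seminorm_le[OF _ rel_seminorms_nonempty] by simp

lemma norm_triangle:
  assumes "p \<in> star_polys" "q \<in> star_polys"
  shows "univ_norm R (p + q) \<le> univ_norm R p + univ_norm R q"
proof (rule norm_leI)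
  fix \<nu> assume nu: "\<nu> \<in> rel_seminorms R"
  then have "\<nu> (p + q) \<le> \<nu> p + \<nu> q"
    using assms cstar_seminormD(2) by (auto simp: rel_seminorms_def)
  then show "\<nu> (p + q) \<le> univ_norm R p + univ_norm R q"
    using seminorm_le[OF assms(1) nu] seminorm_le[OF assms(2) nu] by linarith
qed

lemma norm_scale:
  assumes p: "p \<in> star_polys"
  shows "univ_norm R (poly_scale c p) = cmod c * univ_norm R p"
proof -
  have le: "univ_norm R (poly_scale c p) \<le> cmod c * univ_norm R p" if p: "p \<in> star_polys" for c p
  proof (rule norm_leI)
    fix \<nu> assume nu: "\<nu> \<in> rel_seminorms R"
    then show "\<nu> (poly_scale c p) \<le> cmod c * univ_norm R p"
      using cstar_seminormD(3)[of \<nu> p c] seminorm_le[OF p nu] p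
      by (simp add: rel_seminorms_def mult_left_mono)
  qed
  show ?thesis
  proof (cases "c = 0")
    case True
    have "univ_norm R 0 = 0"
      using le[of 0 0] norm_nonneg[OF star_polys_0] by simp
    then show ?thesis using True by simp
  next
    case False
    \<comment> \<open>The inequality for the inverse scalar, applied to the scaled polynomial,
      yields the reverse estimate.\<close>
    have "univ_norm R p \<le> cmod (inverse c) * univ_norm R (poly_scale c p)"
      using le[of "poly_scale c p" "inverse c"] p False by (simp add: poly_scale_scale)
    then have "cmod c * univ_norm R p \<le> cmod c * (cmod (inverse c) * univ_norm R (poly_scale c p))"
      by (rule mult_left_mono) simp
    also have "\<dots> = univ_norm R (poly_scale c p)"
      using False by (simp add: norm_mult flip: mult.assoc) (simp flip: Real_Vector_Spaces.norm_mult)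
    finally have "cmod c * univ_norm R p \<le> univ_norm R (poly_scale c p)" .
    then show ?thesis using le[OF p] by (simp add: antisym)
  qed
qed

lemma norm_0 [simp]: "univ_norm R 0 = 0"
  using norm_scale[of 0 0] by simp

lemma norm_minus: "p \<in> star_polys \<Longrightarrow> univ_norm R (- p) = univ_norm R p"
  using norm_scale[of p "- 1"] by (simp add: poly_scale_minus1)

lemma norm_diff_commute:
  "p \<in> star_polys \<Longrightarrow> q \<in> star_polys \<Longrightarrow> univ_norm R (p - q) = univ_norm R (q - p)"
  using norm_minus[of "p - q"] by simp

lemma norm_triangle_diff:
  assumes "p \<in> star_polys" "q \<in> star_polys" "r \<in> star_polys"
  shows "univ_norm R (p - r) \<le> univ_norm R (p - q) + univ_norm R (q - r)"
  using norm_triangle[of "p - q" "q - r"] assms by simp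

lemma norm_mult:
  assumes "p \<in> star_polys" "q \<in> star_polys"
  shows "univ_norm R (p * q) \<le> univ_norm R p * univ_norm R q"
proof (rule norm_leI)
  fix \<nu> assume nu: "\<nu> \<in> rel_seminorms R"
  then have cs: "cstar_seminorm \<nu>" by (simp add: rel_seminorms_def)
  have "\<nu> (p * q) \<le> \<nu> p * \<nu> q" by (rule cstar_seminormD(4)[OF cs assms])
  also have "\<dots> \<le> univ_norm R p * univ_norm R q"
    using seminorm_le[OF assms(1) nu] seminorm_le[OF assms(2) nu] cstar_seminormD(1)[OF cs] assms
    by (intro mult_mono) auto
  finally show "\<nu> (p * q) \<le> univ_norm R p * univ_norm R q" .
qed

lemma norm_cstar:
  assumes p: "p \<in> star_polys"
  shows "univ_norm R (poly_adj p * p) = (univ_norm R p)\<^sup>2"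
proof (rule antisym)
  show "univ_norm R (poly_adj p * p) \<le> (univ_norm R p)\<^sup>2"
  proof (rule norm_leI)
    fix \<nu> assume nu: "\<nu> \<in> rel_seminorms R"
    then have cs: "cstar_seminorm \<nu>" by (simp add: rel_seminorms_def)
    show "\<nu> (poly_adj p * p) \<le> (univ_norm R p)\<^sup>2"
      unfolding cstar_seminormD(5)[OF cs p]
      using seminorm_le[OF p nu] cstar_seminormD(1)[OF cs p] by (intro power_mono)
  qed
  \<comment> \<open>Bounding each \<open>\<nu> p\<close> by the square root lets the supremum be
    taken on the left without exchanging it with squaring.\<close>
  have "univ_norm R p \<le> sqrt (univ_norm R (poly_adj p * p))"
  proof (rule norm_leI)
    fix \<nu> assume nu: "\<nu> \<in> rel_seminorms R"
    then have cs: "cstar_seminorm \<nu>" by (simp add: rel_seminorms_def)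
    have "(\<nu> p)\<^sup>2 \<le> univ_norm R (poly_adj p * p)"
      unfolding cstar_seminormD(5)[OF cs p, symmetric] using p nu by (intro seminorm_le) auto
    then show "\<nu> p \<le> sqrt (univ_norm R (poly_adj p * p))"
      using cstar_seminormD(1)[OF cs p] by (simp add: real_le_rsqrt)
  qed
  then show "(univ_norm R p)\<^sup>2 \<le> univ_norm R (poly_adj p * p)"
    using norm_nonneg[OF p] norm_nonneg[of "poly_adj p * p"] p
    by (metis real_sqrt_le_iff real_sqrt_unique star_polys_adj star_polys_mult)
qed

lemma norm_adj: "p \<in> star_polys \<Longrightarrow> univ_norm R (poly_adj p) = univ_norm R p"
  unfolding univ_norm_eq by (rule SUP_cong) (auto simp: rel_seminorms_def cstar_seminorm_adj)

lemma norm_rel: "r \<in> R \<Longrightarrow> univ_norm R r = 0"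
proof -
  assume "r \<in> R"
  then have "univ_norm R r = (SUP \<nu>\<in>rel_seminorms R. 0)"
    unfolding univ_norm_eq by (intro SUP_cong) (auto simp: rel_seminorms_def)
  also have "\<dots> = 0" using rel_seminorms_nonempty by (intro cSUP_const) auto
  finally show ?thesis .
qed

lemma norm_diff_ge:
  assumes "p \<in> star_polys" "q \<in> star_polys"
  shows "\<bar>univ_norm R p - univ_norm R q\<bar> \<le> univ_norm R (p - q)"
  using norm_triangle[of "p - q" q] norm_triangle[of "q - p" p] norm_diff_commute[of p q] assms
  by simp

section \<open>Cauchy sequences and operations on them\<close>

abbreviation "C \<equiv> cauchy_seqs R"

lemma C_star_polys: "x \<in> C \<Longrightarrow> x n \<in> star_polys"
  by (simp add: cauchy_seqs_def)

lemma C_const [simp]: "p \<in> star_polys \<Longrightarrow> (\<lambda>_. p) \<in> C"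
  by (simp add: cauchy_seqs_def)

lemma C_D:
  assumes "x \<in> C" "0 < \<epsilon>"
  obtains N where "\<forall>m\<ge>N. \<forall>n\<ge>N. univ_norm R (x m - x n) < \<epsilon>"
  using assms by (auto simp: cauchy_seqs_def)

text \<open>Serves scaling, the adjoint and, later, the gauge maps at once.\<close>

lemma C_lipschitz:
  assumes x: "x \<in> C" and T: "\<And>p. p \<in> star_polys \<Longrightarrow> T p \<in> star_polys"
    and le: "\<And>p q. p \<in> star_polys \<Longrightarrow> q \<in> star_polys \<Longrightarrow>
      univ_norm R (T p - T q) \<le> K * univ_norm R (p - q)"
  shows "(\<lambda>n. T (x n)) \<in> C"
proof -
  note [simp] = C_star_polys[OF x]
  have "\<exists>N. \<forall>m\<ge>N. \<forall>n\<ge>N. univ_norm R (T (x m) - T (x n)) < \<epsilon>" if e: "\<epsilon> > 0" for \<epsilon>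
  proof -
    \<comment> \<open>\<open>\<bar>K\<bar> + 1\<close> is positive whatever the sign of
      \<open>K\<close>, so it may be divided by.\<close>
    have pos: "\<epsilon> / (\<bar>K\<bar> + 1) > 0" using e by simp
    obtain N where N: "\<forall>m\<ge>N. \<forall>n\<ge>N. univ_norm R (x m - x n) < \<epsilon> / (\<bar>K\<bar> + 1)"
      by (rule C_D[OF x pos])
    have "univ_norm R (T (x m) - T (x n)) < \<epsilon>" if "m \<ge> N" "n \<ge> N" for m n
    proof -
      have "univ_norm R (T (x m) - T (x n)) \<le> K * univ_norm R (x m - x n)"
        using x by (intro le) auto
      also have "\<dots> \<le> (\<bar>K\<bar> + 1) * univ_norm R (x m - x n)"
        using x by (intro mult_right_mono) auto
      also have "\<dots> < (\<bar>K\<bar> + 1) * (\<epsilon> / (\<bar>K\<bar> + 1))"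
        using N that by (intro mult_strict_left_mono) auto
      finally show ?thesis by simp
    qed
    then show ?thesis by blast
  qed
  then show ?thesis using x T by (auto simp: cauchy_seqs_def)
qed

lemma norm_scale_diff:
  "p \<in> star_polys \<Longrightarrow> q \<in> star_polys \<Longrightarrow>
    univ_norm R (poly_scale c p - poly_scale c q) \<le> cmod c * univ_norm R (p - q)"
  using norm_scale[of "p - q" c] by (simp add: poly_scale_diff)

lemma norm_adj_diff:
  "p \<in> star_polys \<Longrightarrow> q \<in> star_polys \<Longrightarrow>
    univ_norm R (poly_adj p - poly_adj q) \<le> 1 * univ_norm R (p - q)"
  using norm_adj[of "p - q"] by (simp add: poly_adj_diff)

lemma C_scale [simp]: "x \<in> C \<Longrightarrow> (\<lambda>n. poly_scale c (x n)) \<in> C"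
  by (erule C_lipschitz[where T = "poly_scale c", OF _ star_polys_scale norm_scale_diff])

lemma C_adj [simp]: "x \<in> C \<Longrightarrow> (\<lambda>n. poly_adj (x n)) \<in> C"
  by (erule C_lipschitz[where T = poly_adj, OF _ star_polys_adj norm_adj_diff])

lemma C_add [simp]:
  assumes x: "x \<in> C" and y: "y \<in> C"
  shows "(\<lambda>n. x n + y n) \<in> C"
proof -
  note [simp] = C_star_polys[OF x] C_star_polys[OF y]
  have "\<exists>N. \<forall>m\<ge>N. \<forall>n\<ge>N. univ_norm R (x m + y m - (x n + y n)) < \<epsilon>" if e: "\<epsilon> > 0" for \<epsilon>
  proof -
    obtain N1 where N1: "\<forall>m\<ge>N1. \<forall>n\<ge>N1. univ_norm R (x m - x n) < \<epsilon> / 2"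
      by (rule C_D[OF x half_gt_zero[OF e]])
    obtain N2 where N2: "\<forall>m\<ge>N2. \<forall>n\<ge>N2. univ_norm R (y m - y n) < \<epsilon> / 2"
      by (rule C_D[OF y half_gt_zero[OF e]])
    note N = N1 N2
    have "univ_norm R (x m + y m - (x n + y n)) < \<epsilon>" if "m \<ge> max N1 N2" "n \<ge> max N1 N2" for m n
    proof -
      have "univ_norm R ((x m - x n) + (y m - y n)) \<le> univ_norm R (x m - x n) + univ_norm R (y m - y n)"
        using x y by (intro norm_triangle) auto
      also have "\<dots> < \<epsilon> / 2 + \<epsilon> / 2" using N that by (intro add_strict_mono) auto
      finally show ?thesis by (simp add: algebra_simps)
    qed
    then show ?thesis by blast
  qed
  then show ?thesis using x y by (auto simp: cauchy_seqs_def)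
qed

lemma C_uminus [simp]: "x \<in> C \<Longrightarrow> (\<lambda>n. - x n) \<in> C"
  using C_scale[of x "- 1"] by (simp add: poly_scale_minus1)

lemma C_diff [simp]: "x \<in> C \<Longrightarrow> y \<in> C \<Longrightarrow> (\<lambda>n. x n - y n) \<in> C"
  using C_add[of x "\<lambda>n. - y n"] by simp

lemma C_norm_convergent: "x \<in> C \<Longrightarrow> convergent (\<lambda>n. univ_norm R (x n))"
proof -
  assume x: "x \<in> C"
  note [simp] = C_star_polys[OF x]
  have "Cauchy (\<lambda>n. univ_norm R (x n))"
    unfolding Cauchy_def
  proof (intro allI impI)
    fix e :: real assume "e > 0"
    obtain N where N: "\<forall>m\<ge>N. \<forall>n\<ge>N. univ_norm R (x m - x n) < e"
      by (rule C_D[OF x \<open>e > 0\<close>])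
    have "dist (univ_norm R (x m)) (univ_norm R (x n)) < e" if "m \<ge> N" "n \<ge> N" for m n
      using norm_diff_ge[of "x m" "x n"] N that x by (force simp: dist_real_def)
    then show "\<exists>M. \<forall>m\<ge>M. \<forall>n\<ge>M. dist (univ_norm R (x m)) (univ_norm R (x n)) < e" by blast
  qed
  then show ?thesis by (simp add: Cauchy_convergent_iff)
qed

lemma C_bounded:
  assumes "x \<in> C"
  shows "\<exists>K>0. \<forall>n. univ_norm R (x n) \<le> K"
proof -
  obtain K where "K > 0" "\<forall>n. norm (univ_norm R (x n)) \<le> K"
    using convergent_imp_Bseq[OF C_norm_convergent[OF assms]] by (auto simp: Bseq_def)
  then show ?thesis by (metis abs_le_D1 real_norm_def)
qed

text \<open>The shape is that of \<open>x y - x' y' = x (y - y') + (x - x') y'\<close>, which makes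
  products of classes well defined.\<close>

lemma null_mult:
  assumes x: "x \<in> C" and y: "y \<in> C" and "\<And>n. a n \<in> star_polys" "\<And>n. b n \<in> star_polys"
    and a: "(\<lambda>n. univ_norm R (a n)) \<longlonglongrightarrow> 0" and b: "(\<lambda>n. univ_norm R (b n)) \<longlonglongrightarrow> 0"
  shows "(\<lambda>n. univ_norm R (x n * b n + a n * y n)) \<longlonglongrightarrow> 0"
proof -
  note [simp] = C_star_polys[OF x] C_star_polys[OF y]
  obtain K where K: "K > 0" "\<forall>n. univ_norm R (x n) \<le> K" using C_bounded[OF x] by blast
  obtain L where L: "L > 0" "\<forall>n. univ_norm R (y n) \<le> L" using C_bounded[OF y] by blast
  have lim: "(\<lambda>n. K * univ_norm R (b n) + univ_norm R (a n) * L) \<longlonglongrightarrow> 0"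
    using tendsto_add[OF tendsto_mult[OF tendsto_const b] tendsto_mult[OF a tendsto_const]] by simp
  have le: "univ_norm R (x n * b n + a n * y n) \<le> K * univ_norm R (b n) + univ_norm R (a n) * L" for n
  proof -
    have "univ_norm R (x n * b n + a n * y n) \<le> univ_norm R (x n * b n) + univ_norm R (a n * y n)"
      using assms by (intro norm_triangle) auto
    also have "\<dots> \<le> univ_norm R (x n) * univ_norm R (b n) + univ_norm R (a n) * univ_norm R (y n)"
      using assms by (intro add_mono norm_mult) auto
    also have "\<dots> \<le> K * univ_norm R (b n) + univ_norm R (a n) * L"
      using assms K L by (intro add_mono mult_right_mono mult_left_mono) auto
    finally show ?thesis .
  qed
  show ?thesis
    by (rule tendsto_sandwich[OF _ _ tendsto_const lim]) (use assms le in \<open>auto intro!: always_eventually\<close>)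
qed

lemma C_mult [simp]:
  assumes x: "x \<in> C" and y: "y \<in> C"
  shows "(\<lambda>n. x n * y n) \<in> C"
proof -
  note [simp] = C_star_polys[OF x] C_star_polys[OF y]
  obtain K where K: "K > 0" "\<forall>n. univ_norm R (x n) \<le> K" using C_bounded[OF x] by blast
  obtain L where L: "L > 0" "\<forall>n. univ_norm R (y n) \<le> L" using C_bounded[OF y] by blast
  have "\<exists>N. \<forall>m\<ge>N. \<forall>n\<ge>N. univ_norm R (x m * y m - x n * y n) < \<epsilon>" if e: "\<epsilon> > 0" for \<epsilon>
  proof -
    have pos: "\<epsilon> / (2 * L) > 0" "\<epsilon> / (2 * K) > 0" using e K L by auto
    obtain N1 where N1: "\<forall>m\<ge>N1. \<forall>n\<ge>N1. univ_norm R (x m - x n) < \<epsilon> / (2 * L)"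
      by (rule C_D[OF x pos(1)])
    obtain N2 where N2: "\<forall>m\<ge>N2. \<forall>n\<ge>N2. univ_norm R (y m - y n) < \<epsilon> / (2 * K)"
      by (rule C_D[OF y pos(2)])
    note N = N1 N2
    have "univ_norm R (x m * y m - x n * y n) < \<epsilon>" if "m \<ge> max N1 N2" "n \<ge> max N1 N2" for m n
    proof -
      have "x m * y m - x n * y n = x m * (y m - y n) + (x m - x n) * y n"
        by (simp add: algebra_simps)
      then have "univ_norm R (x m * y m - x n * y n)
          \<le> univ_norm R (x m * (y m - y n)) + univ_norm R ((x m - x n) * y n)"
        using x y by (simp add: norm_triangle)
      also have "\<dots> \<le> univ_norm R (x m) * univ_norm R (y m - y n) + univ_norm R (x m - x n) * univ_norm R (y n)"
        using x y by (intro add_mono norm_mult) auto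
      also have "\<dots> \<le> K * univ_norm R (y m - y n) + univ_norm R (x m - x n) * L"
        using x y K L by (intro add_mono mult_right_mono mult_left_mono) auto
      also have "\<dots> < K * (\<epsilon> / (2 * K)) + \<epsilon> / (2 * L) * L"
        using N that K L by (intro add_strict_mono mult_strict_left_mono mult_strict_right_mono) auto
      also have "\<dots> = \<epsilon>" using K L by (simp add: field_simps)
      finally show ?thesis .
    qed
    then show ?thesis by blast
  qed
  then show ?thesis using x y by (auto simp: cauchy_seqs_def)
qed

section \<open>Classes of Cauchy sequences\<close>

lemma null_relD:
  assumes "(x, y) \<in> null_rel R"
  shows "x \<in> C" "y \<in> C" "(\<lambda>n. univ_norm R (x n - y n)) \<longlonglongrightarrow> 0"
  using assms by (auto simp: null_rel_def)

lemma equiv_null_rel: "equiv C (null_rel R)"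
proof (rule equivI)
  show "null_rel R \<subseteq> C \<times> C" by (auto simp: null_rel_def)
  show "refl_on C (null_rel R)" by (auto simp: refl_on_def null_rel_def)
  show "sym (null_rel R)"
    by (auto simp: sym_def null_rel_def norm_diff_commute C_star_polys)
  show "trans (null_rel R)"
  proof (rule transI)
    fix x y z assume xy: "(x, y) \<in> null_rel R" and yz: "(y, z) \<in> null_rel R"
    note mem = null_relD(1,2)[OF xy] null_relD(2)[OF yz]
    note [simp] = C_star_polys[OF mem(1)] C_star_polys[OF mem(2)] C_star_polys[OF mem(3)]
    have lim: "(\<lambda>n. univ_norm R (x n - y n) + univ_norm R (y n - z n)) \<longlonglongrightarrow> 0"
      using tendsto_add[OF null_relD(3)[OF xy] null_relD(3)[OF yz]] by simp
    have le: "univ_norm R (x n - z n) \<le> univ_norm R (x n - y n) + univ_norm R (y n - z n)" for n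
      by (rule norm_triangle_diff) simp_all
    have "(\<lambda>n. univ_norm R (x n - z n)) \<longlonglongrightarrow> 0"
      by (rule tendsto_sandwich[OF _ _ tendsto_const lim]) (use le in \<open>auto intro!: always_eventually\<close>)
    then show "(x, z) \<in> null_rel R" using mem by (simp add: null_rel_def)
  qed
qed

abbreviation "cls \<equiv> univ_class R"

lemma cls_eq_iff: "x \<in> C \<Longrightarrow> y \<in> C \<Longrightarrow> cls x = cls y \<longleftrightarrow> (\<lambda>n. univ_norm R (x n - y n)) \<longlonglongrightarrow> 0"
  unfolding univ_class_def using eq_equiv_class_iff[OF equiv_null_rel] by (auto simp: null_rel_def)

lemma cls_self: "x \<in> C \<Longrightarrow> x \<in> cls x"
  unfolding univ_class_def by (rule equiv_class_self[OF equiv_null_rel])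

lemma in_cls: "x' \<in> cls x \<longleftrightarrow> (x, x') \<in> null_rel R"
  by (simp add: univ_class_def)

abbreviation "U \<equiv> univ_cstar R"

lemma carrier_U: "carrier U = cls ` C"
  by (auto simp: univ_cstar_def Let_def univ_class_def quotient_def)

text \<open>The operations of \<open>univ_cstar\<close> are unions over all representatives. If
  every representative gives the same set, the union is that set, because a class contains
  \<open>x\<close> and so is nonempty.\<close>

lemma UN_cls:
  assumes "x \<in> C" "\<And>x'. (x, x') \<in> null_rel R \<Longrightarrow> F x' = Z"
  shows "(\<Union>x'\<in>cls x. F x') = Z"
  using assms cls_self[OF assms(1)] by (auto simp: in_cls)

lemma add_cls:
  assumes x: "x \<in> C" and y: "y \<in> C"
  shows "cls x \<oplus>\<^bsub>U\<^esub> cls y = cls (\<lambda>n. x n + y n)"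
proof -
  note [simp] = C_star_polys[OF x] C_star_polys[OF y]
  have "cls (\<lambda>n. x' n + y' n) = cls (\<lambda>n. x n + y n)"
    if x': "(x, x') \<in> null_rel R" and y': "(y, y') \<in> null_rel R" for x' y'
  proof -
    note mem = null_relD(2)[OF x'] null_relD(2)[OF y']
    note [simp] = C_star_polys[OF mem(1)] C_star_polys[OF mem(2)]
    have lim: "(\<lambda>n. univ_norm R (x n - x' n) + univ_norm R (y n - y' n)) \<longlonglongrightarrow> 0"
      using tendsto_add[OF null_relD(3)[OF x'] null_relD(3)[OF y']] by simp
    have le: "univ_norm R (x n + y n - (x' n + y' n)) \<le> univ_norm R (x n - x' n) + univ_norm R (y n - y' n)" for n
      using norm_triangle[of "x n - x' n" "y n - y' n"] x y mem by (simp add: algebra_simps)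
    have "(\<lambda>n. univ_norm R (x n + y n - (x' n + y' n))) \<longlonglongrightarrow> 0"
      by (rule tendsto_sandwich[OF _ _ tendsto_const lim]) (use x y mem le in \<open>auto intro!: always_eventually\<close>)
    then have "cls (\<lambda>n. x n + y n) = cls (\<lambda>n. x' n + y' n)"
      using x y mem by (subst cls_eq_iff) auto
    then show ?thesis ..
  qed
  then show ?thesis
    unfolding univ_cstar_def Let_def ring_record_simps using x y by (intro UN_cls) auto
qed

lemma mult_cls:
  assumes x: "x \<in> C" and y: "y \<in> C"
  shows "cls x \<otimes>\<^bsub>U\<^esub> cls y = cls (\<lambda>n. x n * y n)"
proof -
  note [simp] = C_star_polys[OF x] C_star_polys[OF y]
  have "cls (\<lambda>n. x' n * y' n) = cls (\<lambda>n. x n * y n)"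
    if x': "(x, x') \<in> null_rel R" and y': "(y, y') \<in> null_rel R" for x' y'
  proof -
    note mem = null_relD(2)[OF x'] null_relD(2)[OF y']
    note [simp] = C_star_polys[OF mem(1)] C_star_polys[OF mem(2)]
    have "(\<lambda>n. univ_norm R (x n * (y n - y' n) + (x n - x' n) * y' n)) \<longlonglongrightarrow> 0"
      using x y mem null_relD(3)[OF x'] null_relD(3)[OF y'] by (intro null_mult) auto
    then have "cls (\<lambda>n. x n * y n) = cls (\<lambda>n. x' n * y' n)"
      using x y mem by (subst cls_eq_iff) (auto simp: algebra_simps)
    then show ?thesis ..
  qed
  then show ?thesis
    unfolding univ_cstar_def Let_def monoid.simps using x y by (intro UN_cls) auto
qed

lemma U_simps:
  "\<zero>\<^bsub>U\<^esub> = cls (\<lambda>n. 0)"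
  "smult U = (\<lambda>c X. \<Union>x\<in>X. cls (\<lambda>n. poly_scale c (x n)))"
  "star_op U = (\<lambda>X. \<Union>x\<in>X. cls (\<lambda>n. poly_adj (x n)))"
  "cnorm U = (\<lambda>X. THE t. \<forall>x\<in>X. (\<lambda>n. univ_norm R (x n)) \<longlonglongrightarrow> t)"
  unfolding univ_cstar_def Let_def by (simp_all only: ring.simps module.simps star_algebra.simps)

lemma cls_lipschitz:
  assumes x: "x \<in> C" and x': "(x, x') \<in> null_rel R" and T: "\<And>p. p \<in> star_polys \<Longrightarrow> T p \<in> star_polys"
    and le: "\<And>p q. p \<in> star_polys \<Longrightarrow> q \<in> star_polys \<Longrightarrow>
      univ_norm R (T p - T q) \<le> K * univ_norm R (p - q)"
  shows "cls (\<lambda>n. T (x' n)) = cls (\<lambda>n. T (x n))"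
proof -
  note [simp] = C_star_polys[OF x] C_star_polys[OF null_relD(2)[OF x']]
  have lim: "(\<lambda>n. K * univ_norm R (x n - x' n)) \<longlonglongrightarrow> 0"
    using tendsto_mult[OF tendsto_const null_relD(3)[OF x']] by simp
  have "(\<lambda>n. univ_norm R (T (x n) - T (x' n))) \<longlonglongrightarrow> 0"
    by (rule tendsto_sandwich[OF _ _ tendsto_const lim])
      (use x null_relD(2)[OF x'] in \<open>auto intro!: always_eventually le simp: T\<close>)
  moreover have Tx: "(\<lambda>n. T (x n)) \<in> C"
    by (rule C_lipschitz[of x T K, OF x T le])
  moreover have Tx': "(\<lambda>n. T (x' n)) \<in> C"
    by (rule C_lipschitz[of x' T K, OF null_relD(2)[OF x'] T le])
  ultimately show ?thesis using cls_eq_iff[OF Tx Tx'] by simp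
qed

lemma smult_cls: "x \<in> C \<Longrightarrow> c \<odot>\<^bsub>U\<^esub> cls x = cls (\<lambda>n. poly_scale c (x n))"
  unfolding U_simps
proof (rule UN_cls)
  fix x' assume x: "x \<in> C" and x': "(x, x') \<in> null_rel R"
  show "cls (\<lambda>n. poly_scale c (x' n)) = cls (\<lambda>n. poly_scale c (x n))"
    by (rule cls_lipschitz[where T = "poly_scale c", OF x x' star_polys_scale norm_scale_diff])
qed

lemma star_cls: "x \<in> C \<Longrightarrow> star_op U (cls x) = cls (\<lambda>n. poly_adj (x n))"
  unfolding U_simps
proof (rule UN_cls)
  fix x' assume x: "x \<in> C" and x': "(x, x') \<in> null_rel R"
  show "cls (\<lambda>n. poly_adj (x' n)) = cls (\<lambda>n. poly_adj (x n))"
    by (rule cls_lipschitz[where T = poly_adj, OF x x' star_polys_adj norm_adj_diff])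
qed

lemma norm_cls:
  assumes x: "x \<in> C"
  shows "(\<lambda>n. univ_norm R (x n)) \<longlonglongrightarrow> cnorm U (cls x)"
proof -
  note [simp] = C_star_polys[OF x]
  obtain t where t: "(\<lambda>n. univ_norm R (x n)) \<longlonglongrightarrow> t"
    using C_norm_convergent[OF x] by (auto simp: convergent_def)
  have "(\<lambda>n. univ_norm R (x' n)) \<longlonglongrightarrow> t" if "x' \<in> cls x" for x'
  proof -
    have x': "(x, x') \<in> null_rel R" using that by (simp add: in_cls)
    note [simp] = C_star_polys[OF null_relD(2)[OF x']]
    have "norm (univ_norm R (x' n) - univ_norm R (x n)) \<le> norm (univ_norm R (x n - x' n)) * 1" for n
      using norm_diff_ge[of "x' n" "x n"] norm_diff_commute[of "x' n" "x n"] by simp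
    then have "(\<lambda>n. univ_norm R (x' n) - univ_norm R (x n)) \<longlonglongrightarrow> 0"
      by (intro tendsto_0_le[OF null_relD(3)[OF x']] always_eventually allI)
    from tendsto_add[OF this t] show ?thesis by simp
  qed
  moreover have "x \<in> cls x" using x by (rule cls_self)
  ultimately have "(THE t. \<forall>x\<in>cls x. (\<lambda>n. univ_norm R (x n)) \<longlonglongrightarrow> t) = t"
    by (intro the_equality) (auto intro: LIMSEQ_unique)
  then show ?thesis using t by (simp add: U_simps)
qed

lemma norm_cls_const: "p \<in> star_polys \<Longrightarrow> cnorm U (cls (\<lambda>_. p)) = univ_norm R p"
  using norm_cls[of "\<lambda>_. p"] by (simp add: LIMSEQ_const_iff)

text \<open>Completeness: a Cauchy sequence of classes is approximated by constants, which form a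
  Cauchy sequence representing the limit.\<close>

lemma complete_U:
  assumes X: "\<And>k. x k \<in> C"
    and cau: "\<And>\<epsilon>. \<epsilon> > 0 \<Longrightarrow> \<exists>N. \<forall>k\<ge>N. \<forall>l\<ge>N. cnorm U (cls (\<lambda>n. x k n - x l n)) < \<epsilon>"
  shows "\<exists>y\<in>C. (\<lambda>k. cnorm U (cls (\<lambda>n. x k n - y n))) \<longlonglongrightarrow> 0"
proof -
  note [simp] = C_star_polys[OF X]
  have "\<exists>N. \<forall>m\<ge>N. univ_norm R (x k m - x k N) < inverse (real (Suc k))" for k
  proof -
    have "inverse (real (Suc k)) > 0" by simp
    then obtain N where "\<forall>m\<ge>N. \<forall>n\<ge>N. univ_norm R (x k m - x k n) < inverse (real (Suc k))"
      by (rule C_D[OF X])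
    then show ?thesis by blast
  qed
  then obtain N where N: "\<And>k m. m \<ge> N k \<Longrightarrow> univ_norm R (x k m - x k (N k)) < inverse (real (Suc k))"
    by metis
  define y where "y k = x k (N k)" for k
  have y_sp: "y k \<in> star_polys" for k using X by (simp add: y_def)
  have close: "cnorm U (cls (\<lambda>n. x k n - y k)) \<le> inverse (real (Suc k))" for k
  proof -
    have "(\<lambda>n. univ_norm R (x k n - y k)) \<longlonglongrightarrow> cnorm U (cls (\<lambda>n. x k n - y k))"
      using X y_sp by (intro norm_cls C_diff) auto
    then show ?thesis
      by (rule LIMSEQ_le_const2) (use N in \<open>auto simp: y_def intro!: less_imp_le\<close>)
  qed
  have tri: "cnorm U (cls (\<lambda>n. a n - c n)) \<le> cnorm U (cls (\<lambda>n. a n - b n)) + cnorm U (cls (\<lambda>n. b n - c n))"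
    if a: "a \<in> C" and b: "b \<in> C" and c: "c \<in> C" for a b c
  proof (rule LIMSEQ_le)
    note that = a b c
    show "(\<lambda>n. univ_norm R (a n - c n)) \<longlonglongrightarrow> cnorm U (cls (\<lambda>n. a n - c n))"
      using that by (intro norm_cls) auto
    show "(\<lambda>n. univ_norm R (a n - b n) + univ_norm R (b n - c n)) \<longlonglongrightarrow>
       cnorm U (cls (\<lambda>n. a n - b n)) + cnorm U (cls (\<lambda>n. b n - c n))"
      using that by (intro tendsto_add norm_cls) auto
    show "\<exists>N. \<forall>n\<ge>N. univ_norm R (a n - c n) \<le> univ_norm R (a n - b n) + univ_norm R (b n - c n)"
      using that by (auto intro!: norm_triangle_diff C_star_polys)
  qed
  have sym: "cnorm U (cls (\<lambda>n. a n - b n)) = cnorm U (cls (\<lambda>n. b n - a n))" if "a \<in> C" "b \<in> C" for a b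
  proof (rule LIMSEQ_unique)
    show "(\<lambda>n. univ_norm R (a n - b n)) \<longlonglongrightarrow> cnorm U (cls (\<lambda>n. a n - b n))"
      using that by (intro norm_cls) auto
    show "(\<lambda>n. univ_norm R (a n - b n)) \<longlonglongrightarrow> cnorm U (cls (\<lambda>n. b n - a n))"
      using norm_cls[of "\<lambda>n. b n - a n"] that
        norm_diff_commute[OF C_star_polys C_star_polys, of a b] by simp
  qed
  have inv0: "(\<lambda>k. inverse (real (Suc k))) \<longlonglongrightarrow> 0" by (rule LIMSEQ_inverse_real_of_nat)
  have yC: "y \<in> C"
    unfolding cauchy_seqs_def
  proof (intro CollectI conjI allI impI y_sp)
    fix \<epsilon> :: real assume e: "\<epsilon> > 0"
    obtain M1 where M1: "\<forall>k\<ge>M1. \<forall>l\<ge>M1. cnorm U (cls (\<lambda>n. x k n - x l n)) < \<epsilon> / 3"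
      using cau[of "\<epsilon>/3"] e by auto
    obtain M2 where M2: "\<forall>k\<ge>M2. inverse (real (Suc k)) < \<epsilon> / 3"
      using LIMSEQ_D[OF inv0, of "\<epsilon>/3"] e by auto
    have "univ_norm R (y k - y l) < \<epsilon>" if "k \<ge> max M1 M2" "l \<ge> max M1 M2" for k l
    proof -
      have "univ_norm R (y k - y l) = cnorm U (cls (\<lambda>n. y k - y l))"
        using y_sp by (simp add: norm_cls_const)
      also have "\<dots> \<le> cnorm U (cls (\<lambda>n. y k - x k n)) + cnorm U (cls (\<lambda>n. x k n - y l))"
        using X y_sp by (intro tri) auto
      also have "cnorm U (cls (\<lambda>n. x k n - y l)) \<le> cnorm U (cls (\<lambda>n. x k n - x l n)) + cnorm U (cls (\<lambda>n. x l n - y l))"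
        using X y_sp by (intro tri) auto
      also have "cnorm U (cls (\<lambda>n. y k - x k n)) < \<epsilon> / 3"
        using sym[of "\<lambda>n. y k" "x k"] close[of k] M2 X y_sp that by fastforce
      also have "cnorm U (cls (\<lambda>n. x l n - y l)) < \<epsilon> / 3"
        using close[of l] M2 that by fastforce
      also have "cnorm U (cls (\<lambda>n. x k n - x l n)) < \<epsilon> / 3"
        using M1 that by auto
      finally show ?thesis by simp
    qed
    then show "\<exists>N. \<forall>m\<ge>N. \<forall>n\<ge>N. univ_norm R (y m - y n) < \<epsilon>" by blast
  qed
  \<comment> \<open>The terms of a Cauchy sequence, taken as constant sequences, converge to the
    class of the sequence itself.\<close>
  have const_lim: "(\<lambda>k. cnorm U (cls (\<lambda>n. y k - y n))) \<longlonglongrightarrow> 0"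
  proof (rule LIMSEQ_I)
    fix r :: real assume r: "r > 0"
    obtain M where M: "\<forall>m\<ge>M. \<forall>n\<ge>M. univ_norm R (y m - y n) < r / 2"
      by (rule C_D[OF yC half_gt_zero[OF r]])
    have "norm (cnorm U (cls (\<lambda>n. y k - y n)) - 0) < r" if k: "k \<ge> M" for k
    proof -
      have l: "(\<lambda>n. univ_norm R (y k - y n)) \<longlonglongrightarrow> cnorm U (cls (\<lambda>n. y k - y n))"
        using yC y_sp by (intro norm_cls C_diff) auto
      have "cnorm U (cls (\<lambda>n. y k - y n)) \<le> r / 2"
        by (rule LIMSEQ_le_const2[OF l]) (use M k in \<open>auto intro!: exI[of _ M] less_imp_le\<close>)
      moreover have "0 \<le> cnorm U (cls (\<lambda>n. y k - y n))"
        by (rule LIMSEQ_le_const[OF l]) (use y_sp in auto)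
      ultimately show ?thesis using r by simp
    qed
    then show "\<exists>no. \<forall>k\<ge>no. norm (cnorm U (cls (\<lambda>n. y k - y n)) - 0) < r" by blast
  qed
  have lim: "(\<lambda>k. inverse (real (Suc k)) + cnorm U (cls (\<lambda>n. y k - y n))) \<longlonglongrightarrow> 0"
    using tendsto_add[OF inv0 const_lim] by simp
  have le: "cnorm U (cls (\<lambda>n. x k n - y n)) \<le> inverse (real (Suc k)) + cnorm U (cls (\<lambda>n. y k - y n))" for k
    using tri[OF X[of k] C_const[OF y_sp[of k]] yC] close[of k] by simp
  have ge: "0 \<le> cnorm U (cls (\<lambda>n. x k n - y n))" for k
    by (rule LIMSEQ_le_const[OF norm_cls[OF C_diff[OF X yC]]]) (use C_star_polys[OF yC] in auto)
  have "(\<lambda>k. cnorm U (cls (\<lambda>n. x k n - y n))) \<longlonglongrightarrow> 0"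
    by (rule tendsto_sandwich[OF _ _ tendsto_const lim]) (use le ge in \<open>auto intro!: always_eventually\<close>)
  then show ?thesis using yC by blast
qed

end

section \<open>Normed *-algebras\<close>

text \<open>The C*-identity is left to \<open>cstar_algebra\<close>, because matrices will be normed
  by the sum of the norms of their entries, for which it fails in general. There is no unit either:
  the finitely supported matrices have none.\<close>

class star_normed_algebra = real_normed_algebra +
  fixes star :: "'a \<Rightarrow> 'a"  ("(_\<^sup>\<star>)" [1000] 999)
    and cscale :: "complex \<Rightarrow> 'a \<Rightarrow> 'a"  (infixr "*\<^sub>C" 75)
  assumes star_star [simp]: "(x\<^sup>\<star>)\<^sup>\<star> = x"
    and star_add: "(x + y)\<^sup>\<star> = x\<^sup>\<star> + y\<^sup>\<star>"
    and star_mult: "(x * y)\<^sup>\<star> = y\<^sup>\<star> * x\<^sup>\<star>"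
    and star_cscale: "(c *\<^sub>C x)\<^sup>\<star> = cnj c *\<^sub>C x\<^sup>\<star>"
    and norm_star [simp]: "norm (x\<^sup>\<star>) = norm x"
    and cscale_add_left: "(c + d) *\<^sub>C x = c *\<^sub>C x + d *\<^sub>C x"
    and cscale_add_right: "c *\<^sub>C (x + y) = c *\<^sub>C x + c *\<^sub>C y"
    and cscale_cscale [simp]: "c *\<^sub>C d *\<^sub>C x = (c * d) *\<^sub>C x"
    and cscale_of_real: "complex_of_real r *\<^sub>C x = r *\<^sub>R x"
    and mult_cscale_left [simp]: "c *\<^sub>C x * y = c *\<^sub>C (x * y)"
    and mult_cscale_right [simp]: "x * c *\<^sub>C y = c *\<^sub>C (x * y)"
    and norm_cscale [simp]: "norm (c *\<^sub>C x) = cmod c * norm x"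

lemma cscale_0_left [simp]: "0 *\<^sub>C x = 0"
  using cscale_of_real[of 0 x] by simp

lemma cscale_1 [simp]: "1 *\<^sub>C x = x"
  using cscale_of_real[of 1 x] by simp

lemma cscale_0_right [simp]: "c *\<^sub>C 0 = 0"
  using cscale_add_right[of c 0 0] by simp

lemma cscale_minus_right [simp]: "c *\<^sub>C (- x) = - (c *\<^sub>C x)"
  using cscale_add_right[of c x "- x"] by (simp add: eq_neg_iff_add_eq_0 add.commute)

lemma cscale_minus_left [simp]: "(- c) *\<^sub>C x = - (c *\<^sub>C x)"
  using cscale_add_left[of c "- c" x] by (simp add: eq_neg_iff_add_eq_0 add.commute)

lemma cscale_diff_right: "c *\<^sub>C (x - y) = c *\<^sub>C x - c *\<^sub>C y"
  using cscale_add_right[of c x "- y"] by simp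

lemma cscale_diff_left: "(c - d) *\<^sub>C x = c *\<^sub>C x - d *\<^sub>C x"
  using cscale_add_left[of c "- d" x] by simp

lemma cscale_sum_right: "c *\<^sub>C (\<Sum>i\<in>I. f i) = (\<Sum>i\<in>I. c *\<^sub>C f i)"
  by (induction I rule: infinite_finite_induct) (simp_all add: cscale_add_right)

lemma cscale_sum_left: "(\<Sum>i\<in>I. f i) *\<^sub>C x = (\<Sum>i\<in>I. f i *\<^sub>C x)"
  by (induction I rule: infinite_finite_induct) (simp_all add: cscale_add_left)

lemma cscale_eq_0_iff [simp]: "c *\<^sub>C x = 0 \<longleftrightarrow> c = 0 \<or> x = 0"
  using norm_cscale[of c x] by (metis mult_eq_0_iff norm_eq_zero)

lemma star_0 [simp]: "0\<^sup>\<star> = 0"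
  using star_add[of 0 0] by simp

lemma star_uminus: "(- x)\<^sup>\<star> = - x\<^sup>\<star>"
  using star_add[of x "- x"] by (simp add: eq_neg_iff_add_eq_0 add.commute)

lemma star_diff: "(x - y)\<^sup>\<star> = x\<^sup>\<star> - y\<^sup>\<star>"
  using star_add[of x "- y"] by (simp add: star_uminus)

lemma star_scaleR: "(r *\<^sub>R x)\<^sup>\<star> = r *\<^sub>R x\<^sup>\<star>"
  using star_cscale[of "complex_of_real r" x] by (simp add: cscale_of_real)

lemma star_sum: "(\<Sum>i\<in>I. f i)\<^sup>\<star> = (\<Sum>i\<in>I. (f i)\<^sup>\<star>)"
  by (induction I rule: infinite_finite_induct) (simp_all add: star_add)

lemma star_eq_0_iff [simp]: "x\<^sup>\<star> = 0 \<longleftrightarrow> x = 0"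
  by (metis star_0 star_star)

definition is_proj :: "'a::star_normed_algebra \<Rightarrow> bool" where "is_proj p \<longleftrightarrow> p\<^sup>\<star> = p \<and> p * p = p"

lemma is_projD: "is_proj p \<Longrightarrow> p\<^sup>\<star> = p" "is_proj p \<Longrightarrow> p * p = p"
  by (auto simp: is_proj_def)

lemma is_proj_0 [simp]: "is_proj 0"
  by (simp add: is_proj_def)

lemma bounded_linear_star: "bounded_linear (star :: 'a::star_normed_algebra \<Rightarrow> 'a)"
  by (rule bounded_linear_intro[of _ 1]) (simp_all add: star_add star_scaleR)

lemmas tendsto_star = bounded_linear.tendsto[OF bounded_linear_star]

class cstar_algebra = star_normed_algebra +
  assumes cstar: "norm (x\<^sup>\<star> * x) = (norm x)\<^sup>2"

section \<open>Orthogonality of projections whose sum is a projection\<close>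

text \<open>The defining relations of a graph algebra give the orthogonality of the projections
  \<open>S\<^sub>e S\<^sub>e\<^sup>*\<close> only through the fact that they add up to a projection.\<close>

lemma norm_proj_le_1: "is_proj p \<Longrightarrow> norm p \<le> 1" for p :: "'a::cstar_algebra"
proof -
  assume "is_proj p"
  then have "norm p * norm p = norm p * 1"
    using cstar[of p] by (simp add: is_proj_def power2_eq_square)
  then show ?thesis by (metis mult_cancel_left norm_zero order.refl zero_le_one norm_eq_zero)
qed

text \<open>\<open>y - r * y\<close> is \<open>(1 - r) y\<close> written without a unit. As
  \<open>1 - r\<close> is a projection, the C*-identity turns the square of the norm into the norm
  of \<open>y\<^sup>\<star> * (y - r * y)\<close>.\<close>

lemma norm_compl_proj_le:
  fixes r y :: "'a::cstar_algebra"
  assumes "is_proj r" shows "norm (y - r * y) \<le> norm y"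
proof (cases "norm (y - r * y) = 0")
  case False
  have rr: "r * (r * z) = r * z" for z
    using is_projD(2)[OF assms] by (metis mult.assoc)
  have "(y - r * y)\<^sup>\<star> * (y - r * y) = y\<^sup>\<star> * (y - r * y)"
    using is_projD[OF assms] by (simp add: star_diff star_mult algebra_simps rr)
  then have "norm (y - r * y) * norm (y - r * y) \<le> norm y * norm (y - r * y)"
    using cstar[of "y - r * y"] norm_mult_ineq[of "y\<^sup>\<star>" "y - r * y"] by (simp add: power2_eq_square)
  then show ?thesis using False by (simp add: mult_le_cancel_right)
qed auto

text \<open>A projection is an extreme point of the unit ball of the corner it defines. The element
  below is the mean of \<open>(c + s)\<^sup>2 \<Prod>\<^sub>i (q + \<epsilon>\<^sub>i u)\<close> over all signs
  \<open>\<epsilon>\<^sub>1, \<dots>, \<epsilon>\<^sub>n\<close>, with \<open>s = \<Sum>\<^sub>i \<epsilon>\<^sub>i\<close>.\<close>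

lemma norm_sign_mean_le:
  fixes q u :: "'a::star_normed_algebra"
  assumes q: "q * q = q" "q * u = u" "u * q = u" and le: "norm (q + u) \<le> 1" "norm (q - u) \<le> 1"
  shows "norm ((c\<^sup>2 + real n) *\<^sub>R q + (2 * c * real n) *\<^sub>R u + (real n * (real n - 1)) *\<^sub>R (u * u)) \<le> c\<^sup>2 + real n"
proof (induction n arbitrary: c)
  case 0
  have "norm (q + u + (q - u)) \<le> 2"
    using norm_triangle_ineq[of "q + u" "q - u"] le by simp
  then have "norm (2 *\<^sub>R q) \<le> 2" by (simp add: scaleR_2)
  then have "norm q \<le> 1" by simp
  then show ?case using mult_left_mono[of "norm q" 1 "c\<^sup>2"] by simp
next
  case (Suc n)
  define y where "y c = (c\<^sup>2 + real n) *\<^sub>R q + (2 * c * real n) *\<^sub>R u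
    + (real n * (real n - 1)) *\<^sub>R (u * u)" for c
  have quu: "q * (u * u) = u * u" using q by (metis mult.assoc)
  have plus: "(q + u) * y d = (d\<^sup>2 + real n) *\<^sub>R q + (2 * d * real n + (d\<^sup>2 + real n)) *\<^sub>R u
    + (real n * (real n - 1) + 2 * d * real n) *\<^sub>R (u * u)
    + (real n * (real n - 1)) *\<^sub>R (u * (u * u))" for d
    by (simp add: y_def distrib_left distrib_right quu q scaleR_left_distrib scaleR_add_right mult.commute)
  have minus: "(q - u) * y d = (d\<^sup>2 + real n) *\<^sub>R q + (2 * d * real n - (d\<^sup>2 + real n)) *\<^sub>R u
    + (real n * (real n - 1) - 2 * d * real n) *\<^sub>R (u * u)
    + (- (real n * (real n - 1))) *\<^sub>R (u * (u * u))" for d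
    by (simp add: y_def distrib_left left_diff_distrib quu q scaleR_left_distrib scaleR_left_diff_distrib
        scaleR_diff_right scaleR_add_right mult.commute)
  \<comment> \<open>The cubic terms in \<open>u\<close> carry opposite signs and cancel in the
    mean.\<close>
  have comb: "(1/2) *\<^sub>R (a *\<^sub>R x1 + b *\<^sub>R x2 + c *\<^sub>R x3 + d *\<^sub>R x4
      + (a' *\<^sub>R x1 + b' *\<^sub>R x2 + c' *\<^sub>R x3 + (- d) *\<^sub>R x4))
    = ((a + a') / 2) *\<^sub>R x1 + ((b + b') / 2) *\<^sub>R x2 + ((c + c') / 2) *\<^sub>R x3"
    for a b c d a' b' c' :: real and x1 x2 x3 x4 :: 'a
    by (simp add: scaleR_add_right scaleR_left_distrib add_divide_distrib)
  \<comment> \<open>The mean over the last sign: its factor \<open>q + u\<close> or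
    \<open>q - u\<close> goes with a shift of \<open>c\<close> by 1 or -1.\<close>
  have "(c\<^sup>2 + real (Suc n)) *\<^sub>R q + (2 * c * real (Suc n)) *\<^sub>R u
      + (real (Suc n) * (real (Suc n) - 1)) *\<^sub>R (u * u)
    = (1/2) *\<^sub>R ((q + u) * y (c + 1) + (q - u) * y (c - 1))"
    unfolding plus minus comb
    by (intro arg_cong2[where f = "(+)"] arg_cong2[where f = scaleR] refl)
      (simp_all add: field_simps power2_eq_square)
  also have "norm \<dots> \<le> (1/2) * (norm (q + u) * norm (y (c + 1)) + norm (q - u) * norm (y (c - 1)))"
    using norm_triangle_ineq[of "(q + u) * y (c + 1)" "(q - u) * y (c - 1)"]
      norm_mult_ineq[of "q + u" "y (c + 1)"] norm_mult_ineq[of "q - u" "y (c - 1)"] by simp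
  also have "\<dots> \<le> (1/2) * (1 * ((c + 1)\<^sup>2 + real n) + 1 * ((c - 1)\<^sup>2 + real n))"
    using Suc[of "c + 1"] Suc[of "c - 1"] le unfolding y_def
    by (intro mult_left_mono add_mono mult_mono) auto
  also have "\<dots> = c\<^sup>2 + real (Suc n)" by (simp add: power2_eq_square algebra_simps)
  finally show ?case .
qed

text \<open>The sign mean with \<open>c = 0\<close> and \<open>n + 1\<close> signs bounds the norm
  of \<open>q + n u^2\<close> by 1 for every \<open>n\<close>, which forces \<open>u^2 = 0\<close>;
  for self-adjoint \<open>u\<close> the C*-identity then gives \<open>u = 0\<close>.\<close>

lemma proj_extreme:
  fixes q u :: "'a::cstar_algebra"
  assumes q: "q * q = q" "q * u = u" "u * q = u" and le: "norm (q + u) \<le> 1" "norm (q - u) \<le> 1"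
    and u: "u\<^sup>\<star> = u"
  shows "u = 0"
proof -
  have "norm q \<le> 1"
    using norm_sign_mean_le[OF q le, of 1 0] by simp
  have bound: "norm (u * u) * real n \<le> 2" for n
  proof -
    have "norm (real (Suc n) *\<^sub>R (q + real n *\<^sub>R (u * u))) \<le> real (Suc n)"
      using norm_sign_mean_le[OF q le, of 0 "Suc n"] by (simp add: scaleR_add_right)
    then have "norm (q + real n *\<^sub>R (u * u)) \<le> 1"
      unfolding norm_scaleR by (simp add: mult_le_cancel_left1)
    then have "norm (real n *\<^sub>R (u * u)) \<le> 2"
      using norm_triangle_ineq4[of "q + real n *\<^sub>R (u * u)" q] \<open>norm q \<le> 1\<close> by simp
    then show ?thesis by (simp add: mult.commute)
  qed
  have "norm (u * u) = 0"
  proof (rule ccontr)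
    assume "norm (u * u) \<noteq> 0"
    then obtain n where "2 < real n * norm (u * u)" using ex_less_of_nat_mult[of "norm (u * u)" 2] by auto
    then show False using bound[of n] by (simp add: mult.commute)
  qed
  then show "u = 0" using cstar[of u] u by simp
qed

text \<open>In the corner of \<open>q\<close>, the compressions \<open>b\<close> of \<open>r\<close>
  and \<open>c\<close> of \<open>s\<close> make \<open>q - b\<close>, \<open>q - c\<close> and
  \<open>q + b + c\<close> contractions. Hence \<open>q + b/2\<close> and \<open>q - b/2\<close> are
  means of contractions, and extremality of \<open>q\<close> gives \<open>b = 0\<close>. Norm
  estimates take the place of the order on self-adjoint elements. There are three summands because
  \<open>V00\<close> emits three edges.\<close>

lemma proj_sum_orthogonal:
  fixes p q r s :: "'a::cstar_algebra"
  assumes q: "is_proj q" and r: "is_proj r" and s: "is_proj s" and p: "is_proj p"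
    and sum: "q + r + s = p"
  shows "r * q = 0"
proof -
  define b where "b = q * r * q"
  define c where "c = q * s * q"
  have qq: "q * (q * z) = q * z" for z using is_projD(2)[OF q] by (metis mult.assoc)
  have le: "norm (q - q * t * q) \<le> 1" if t: "is_proj t" for t
  proof -
    have "q - q * t * q = q * (q - t * q)"
      using is_projD(2)[OF q] by (simp add: algebra_simps)
    then have "norm (q - q * t * q) \<le> norm q * norm (q - t * q)"
      by (simp add: norm_mult_ineq)
    also have "\<dots> \<le> 1 * 1"
      using norm_proj_le_1[OF q] norm_compl_proj_le[OF t, of q] by (intro mult_mono) auto
    finally show ?thesis by simp
  qed
  have qpq: "q * p * q = q + b + c"
    using is_projD(2)[OF q] by (simp add: sum[symmetric] b_def c_def distrib_left distrib_right)
  have "norm (q * p * q) \<le> norm q * norm p * norm q"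
    by (meson mult_right_mono norm_ge_zero norm_mult_ineq order_trans)
  also have "\<dots> \<le> 1 * 1 * 1"
    using norm_proj_le_1 p q by (intro mult_mono) auto
  finally have lep: "norm (q + b + c) \<le> 1" by (simp add: qpq)
  have "(1/2) *\<^sub>R b = 0"
  proof (rule proj_extreme)
    show "q * q = q" "q * (1/2) *\<^sub>R b = (1/2) *\<^sub>R b" "(1/2) *\<^sub>R b * q = (1/2) *\<^sub>R b"
      "((1/2) *\<^sub>R b)\<^sup>\<star> = (1/2) *\<^sub>R b"
      using is_projD[OF q] is_projD[OF r]
      by (simp_all add: b_def star_scaleR star_mult mult.assoc qq)
    have "q + (1/2) *\<^sub>R b = (1/2) *\<^sub>R ((q - c) + (q + b + c))"
      by (simp add: algebra_simps flip: scaleR_2)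
    also have "norm \<dots> \<le> (1/2) * (1 + 1)"
      using norm_triangle_ineq[of "q - c" "q + b + c"] le[OF s] lep by (simp add: c_def)
    finally show "norm (q + (1/2) *\<^sub>R b) \<le> 1" by simp
    have "q - (1/2) *\<^sub>R b = (1/2) *\<^sub>R (q + (q - b))"
      by (simp add: algebra_simps flip: scaleR_2)
    also have "norm \<dots> \<le> (1/2) * (1 + 1)"
      using norm_triangle_ineq[of q "q - b"] le[OF r] norm_proj_le_1[OF q] by (simp add: b_def)
    finally show "norm (q - (1/2) *\<^sub>R b) \<le> 1" by simp
  qed
  then have "(r * q)\<^sup>\<star> * (r * q) = 0"
    using is_projD[OF q] is_projD[OF r] by (simp add: star_mult b_def) (metis mult.assoc)
  then show ?thesis using cstar[of "r * q"] by simp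
qed

section \<open>Newton iterations for projections and partial isometries\<close>

text \<open>\<open>2 * c\<close> is the sum of the geometric bounds. Completeness is asked of
  \<open>S\<close>, which keeps the limit in the algebra at hand; the finitely supported matrices as
  a whole are in general not complete.\<close>

lemma geometric_limit:
  fixes u :: "nat \<Rightarrow> 'a::real_normed_vector"
  assumes step: "\<And>n. norm (u (Suc n) - u n) \<le> c * (1/2)^n" and S: "complete S" "\<And>n. u n \<in> S"
  shows "\<exists>l\<in>S. u \<longlonglongrightarrow> l \<and> norm (l - u 0) \<le> 2 * c"
proof -
  have c: "c \<ge> 0" using step[of 0] order_trans[OF norm_ge_zero] by fastforce
  have diff: "norm (u (n + k) - u n) \<le> 2 * c * (1/2)^n * (1 - (1/2)^k)" for n k
  proof (induction k)
    case (Suc k)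
    have "norm (u (n + Suc k) - u n) \<le> norm (u (Suc (n + k)) - u (n + k)) + norm (u (n + k) - u n)"
      using norm_triangle_ineq[of "u (Suc (n + k)) - u (n + k)" "u (n + k) - u n"] by simp
    also have "\<dots> \<le> c * (1/2)^(n + k) + 2 * c * (1/2)^n * (1 - (1/2)^k)"
      using step[of "n + k"] Suc by simp
    also have "\<dots> = 2 * c * (1/2)^n * (1 - (1/2)^Suc k)"
      by (simp add: power_add algebra_simps)
    finally show ?case .
  qed simp
  have diff': "norm (u (n + k) - u n) \<le> 2 * c * (1/2)^n" for n k
  proof -
    have "2 * c * (1/2)^n * (1 - (1/2)^k) \<le> 2 * c * (1/2)^n * 1"
      using c by (intro mult_left_mono) auto
    then show ?thesis using diff[of n k] by simp
  qed
  have "Cauchy u"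
  proof (rule metric_CauchyI)
    fix e :: real assume e: "e > 0"
    have "(\<lambda>n. 2 * c * (1/2)^n) \<longlonglongrightarrow> 2 * c * 0"
      by (intro tendsto_mult tendsto_const LIMSEQ_realpow_zero) auto
    then have "\<exists>M. \<forall>n\<ge>M. norm (2 * c * (1/2)^n - 0) < e / 2"
      using LIMSEQ_D[of _ 0 "e/2"] e by fastforce
    then obtain M where M: "norm (2 * c * (1/2)^M - 0) < e / 2" by blast
    have near: "dist (u m) (u M) < e / 2" if "m \<ge> M" for m
      using diff'[of M "m - M"] M that by (simp add: dist_norm)
    have "dist (u m) (u n) < e" if "m \<ge> M" "n \<ge> M" for m n
      using near[OF that(1)] near[OF that(2)] by (rule dist_triangle_half_l)
    then show "\<exists>M. \<forall>m\<ge>M. \<forall>n\<ge>M. dist (u m) (u n) < e" by blast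
  qed
  then obtain l where l: "l \<in> S" "u \<longlonglongrightarrow> l"
    using S by (auto simp: complete_def)
  have "(\<lambda>n. norm (u n - u 0)) \<longlonglongrightarrow> norm (l - u 0)"
    by (intro tendsto_norm tendsto_diff l tendsto_const)
  then have "norm (l - u 0) \<le> 2 * c"
    by (rule LIMSEQ_le_const2) (use diff'[of 0] in auto)
  then show ?thesis using l by blast
qed

lemma tendsto_zero_geometric:
  fixes x :: "nat \<Rightarrow> 'a::real_normed_vector"
  assumes "\<And>n. norm (x n) \<le> c * (1/2)^n" shows "x \<longlonglongrightarrow> 0"
proof (rule tendsto_0_le)
  show "(\<lambda>n. (1/2 :: real)^n) \<longlonglongrightarrow> 0" by (rule LIMSEQ_realpow_zero) auto
  show "\<forall>\<^sub>F n in sequentially. norm (x n) \<le> norm ((1/2 :: real)^n) * c"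
    using assms by (simp add: mult.commute)
qed

definition subalgebra :: "'a::star_normed_algebra set \<Rightarrow> bool" where
  "subalgebra S \<longleftrightarrow> 0 \<in> S \<and> (\<forall>x\<in>S. \<forall>y\<in>S. x + y \<in> S \<and> x * y \<in> S) \<and>
     (\<forall>x\<in>S. x\<^sup>\<star> \<in> S \<and> (\<forall>c. c *\<^sub>C x \<in> S))"

lemma subalgebraD:
  assumes "subalgebra S"
  shows "0 \<in> S" "x \<in> S \<Longrightarrow> y \<in> S \<Longrightarrow> x + y \<in> S" "x \<in> S \<Longrightarrow> y \<in> S \<Longrightarrow> x * y \<in> S"
    "x \<in> S \<Longrightarrow> x\<^sup>\<star> \<in> S" "x \<in> S \<Longrightarrow> c *\<^sub>C x \<in> S" "x \<in> S \<Longrightarrow> r *\<^sub>R x \<in> S"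
    "x \<in> S \<Longrightarrow> y \<in> S \<Longrightarrow> x - y \<in> S"
proof -
  show "0 \<in> S" "x \<in> S \<Longrightarrow> y \<in> S \<Longrightarrow> x + y \<in> S" "x \<in> S \<Longrightarrow> y \<in> S \<Longrightarrow> x * y \<in> S"
    "x \<in> S \<Longrightarrow> x\<^sup>\<star> \<in> S" "x \<in> S \<Longrightarrow> c *\<^sub>C x \<in> S"
    using assms by (auto simp: subalgebra_def)
  show "x \<in> S \<Longrightarrow> r *\<^sub>R x \<in> S"
    using assms by (auto simp: subalgebra_def simp flip: cscale_of_real)
  have "x + (- 1) *\<^sub>C y \<in> S" if "x \<in> S" "y \<in> S" using assms that unfolding subalgebra_def by blast
  then show "x \<in> S \<Longrightarrow> y \<in> S \<Longrightarrow> x - y \<in> S" by simp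
qed

lemma subalgebra_sum: "subalgebra S \<Longrightarrow> (\<And>i. i \<in> I \<Longrightarrow> f i \<in> S) \<Longrightarrow> sum f I \<in> S"
  by (induction I rule: infinite_finite_induct) (auto intro: subalgebraD)

lemma scaleR_3: "3 *\<^sub>R x = x + x + x" and scaleR_4: "4 *\<^sub>R x = x + x + x + x"
  for x :: "'a::real_vector"
  using scaleR_left_distrib[of 2 1 x] scaleR_left_distrib[of 2 2 x] by (simp_all add: scaleR_2)

text \<open>The iteration is \<open>x -> 3 x^2 - 2 x^3\<close>, for which 0 and 1 are
  superattracting fixed points. The defect \<open>y = x^2 - x\<close> becomes
  \<open>4 y^3 - 3 y^2\<close>, so it is at least halved once its norm is at most 1/8.\<close>

lemma newton_projection:
  fixes x :: "'a::star_normed_algebra"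
  assumes S: "subalgebra S" "complete S" "x \<in> S" and x: "x\<^sup>\<star> = x"
    and d: "norm (x * x - x) \<le> \<delta>" "\<delta> \<le> 1/8" "2 * (1 + 2 * (norm x + 1)) * \<delta> \<le> \<epsilon>" "\<epsilon> \<le> 1"
  shows "\<exists>e\<in>S. is_proj e \<and> norm (e - x) \<le> \<epsilon>"
proof -
  define f :: "'a \<Rightarrow> 'a" where "f x = x + (x * x - x) - 2 *\<^sub>R (x * (x * x - x))" for x
  define u where "u n = (f ^^ n) x" for n
  define y where "y n = u n * u n - u n" for n
  \<comment> \<open>\<open>K\<close> bounds \<open>1 + 2 * norm (u n)\<close> as long as
    \<open>norm (u n) \<le> norm x + 1\<close>; the total movement \<open>2 * K * \<delta>\<close>
    is at most \<open>\<epsilon> \<le> 1\<close>, which guarantees this.\<close>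
  define K where "K = 1 + 2 * (norm x + 1)"
  have u_Suc: "u (Suc n) = u n + y n - 2 *\<^sub>R (u n * y n)" for n
    by (simp add: u_def y_def f_def)
  have K: "K > 0" by (simp add: K_def add_pos_nonneg)
  have d0: "\<delta> \<ge> 0" using d(1) norm_ge_zero order_trans by blast
  have uS: "u n \<in> S" and us: "(u n)\<^sup>\<star> = u n" for n
    using S x by (induction n) (auto simp: u_Suc y_def u_def[of 0] intro!: subalgebraD
        simp: star_add star_diff star_scaleR star_mult algebra_simps)
  have y_Suc: "y (Suc n) = 4 *\<^sub>R (y n * y n * y n) - 3 *\<^sub>R (y n * y n)" for n
  proof -
    define a b where "a = u n" and "b = y n"
    have aa: "a * a = a + b" by (simp add: a_def b_def y_def)
    have aaz: "a * (a * z) = a * z + b * z" for z by (simp add: aa distrib_right flip: mult.assoc)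
    have ba: "b * a = a * b" by (simp add: a_def b_def y_def algebra_simps)
    have baz: "b * (a * z) = a * (b * z)" for z by (simp add: ba flip: mult.assoc)
    have "(a + b - 2 *\<^sub>R (a * b)) * (a + b - 2 *\<^sub>R (a * b)) - (a + b - 2 *\<^sub>R (a * b))
      = 4 *\<^sub>R (b * b * b) - 3 *\<^sub>R (b * b)"
      by (simp add: distrib_left distrib_right left_diff_distrib right_diff_distrib mult.assoc aa aaz ba baz
          scaleR_add_right scaleR_diff_right)
        (simp add: algebra_simps scaleR_2 scaleR_3 scaleR_4)
    then show ?thesis unfolding y_def[of "Suc n"] u_Suc a_def b_def .
  qed
  have y_half: "norm (y (Suc n)) \<le> norm (y n) / 2" if "norm (y n) \<le> 1/8" for n
  proof -
    let ?t = "norm (y n)"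
    have "norm (y n * y n) \<le> ?t * ?t" "norm (y n * y n * y n) \<le> ?t * ?t * ?t"
      by (rule norm_mult_ineq, rule order_trans[OF norm_mult_ineq mult_right_mono[OF norm_mult_ineq norm_ge_zero]])
    then have "norm (y (Suc n)) \<le> 4 * (?t * ?t * ?t) + 3 * (?t * ?t)"
      unfolding y_Suc using norm_triangle_ineq4[of "4 *\<^sub>R (y n * y n * y n)" "3 *\<^sub>R (y n * y n)"] by simp
    \<comment> \<open>\<open>4/64 + 3/8 = 7/16\<close>, just below one half.\<close>
    also have "\<dots> \<le> 4 * (?t * (1/8) * (1/8)) + 3 * (?t * (1/8))"
      using that by (intro add_mono mult_left_mono mult_mono) auto
    also have "\<dots> \<le> ?t / 2" by simp
    finally show ?thesis .
  qed
  have y_le: "norm (y n) \<le> \<delta> * (1/2)^n" for n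
  proof (induction n)
    case 0 then show ?case using d by (simp add: y_def u_def)
  next
    case (Suc n)
    have "\<delta> * (1/2)^n \<le> 1/8 * 1" using d d0 by (intro mult_mono power_le_one) auto
    then have "norm (y (Suc n)) \<le> norm (y n) / 2" using Suc by (intro y_half) simp
    then show ?case using Suc by simp
  qed
  have diff: "norm (u (Suc n) - u n) \<le> (1 + 2 * norm (u n)) * norm (y n)" for n
    using norm_triangle_ineq4[of "y n" "2 *\<^sub>R (u n * y n)"] norm_mult_ineq[of "u n" "y n"]
    by (simp add: u_Suc algebra_simps)
  \<comment> \<open>The geometric factor keeps the movement so far below
    \<open>2 * K * \<delta> \<le> 1\<close>, so that \<open>K\<close> remains valid for the next
    step.\<close>
  have u_le: "norm (u n) \<le> norm x + 2 * K * \<delta> * (1 - (1/2)^n)" for n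
  proof (induction n)
    case 0 then show ?case by (simp add: u_def)
  next
    case (Suc n)
    have "2 * K * \<delta> * (1 - (1/2)^n) \<le> 1 * 1"
      using d d0 K unfolding K_def[symmetric] by (intro mult_mono) (auto simp: power_le_one)
    then have "1 + 2 * norm (u n) \<le> K" using Suc by (simp add: K_def)
    then have "norm (u (Suc n) - u n) \<le> K * (\<delta> * (1/2)^n)"
      using diff[of n] y_le[of n] K by (meson mult_mono norm_ge_zero order_trans less_imp_le)
    then have "norm (u (Suc n)) \<le> norm (u n) + K * (\<delta> * (1/2)^n)"
      using norm_triangle_ineq[of "u (Suc n) - u n" "u n"] by simp
    then show ?case using Suc by (simp add: algebra_simps)
  qed
  have step: "norm (u (Suc n) - u n) \<le> K * \<delta> * (1/2)^n" for n
  proof -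
    have "2 * K * \<delta> * (1 - (1/2)^n) \<le> 1 * 1"
      using d d0 K unfolding K_def[symmetric] by (intro mult_mono) (auto simp: power_le_one)
    then have "1 + 2 * norm (u n) \<le> K" using u_le[of n] by (simp add: K_def)
    then have "norm (u (Suc n) - u n) \<le> K * (\<delta> * (1/2)^n)"
      using diff[of n] y_le[of n] K by (meson mult_mono norm_ge_zero order_trans less_imp_le)
    then show ?thesis by (simp add: mult.assoc)
  qed
  obtain e where e: "e \<in> S" "u \<longlonglongrightarrow> e" "norm (e - u 0) \<le> 2 * (K * \<delta>)"
    using geometric_limit[OF step S(2) uS] by blast
  have "y \<longlonglongrightarrow> 0" by (rule tendsto_zero_geometric[OF y_le])
  moreover have "y \<longlonglongrightarrow> e * e - e" unfolding y_def by (intro tendsto_intros e)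
  ultimately have "e * e - e = 0" using LIMSEQ_unique by blast
  moreover have "e\<^sup>\<star> = e"
    using tendsto_star[OF e(2)] e(2) by (simp add: us LIMSEQ_unique)
  moreover have "norm (e - x) \<le> \<epsilon>"
  proof -
    have "2 * (K * \<delta>) = 2 * (1 + 2 * (norm x + 1)) * \<delta>" by (simp only: K_def mult.assoc)
    then have "2 * (K * \<delta>) \<le> \<epsilon>" using d(3) by linarith
    moreover have "u 0 = x" by (simp add: u_def)
    ultimately show ?thesis using e(3) by simp
  qed
  ultimately show ?thesis using e(1) by (auto simp: is_proj_def)
qed

text \<open>The Newton-Schulz step towards the partial isometry of the polar decomposition. It
  multiplies \<open>v\<close> from the right by \<open>p + E/2\<close>, and the defect
  \<open>E\<close> becomes \<open>(3 E^2 + E^3) / 4\<close>.\<close>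

lemma polar_step:
  fixes v p :: "'a::star_normed_algebra"
  assumes p: "is_proj p" "v * p = v"
  defines "E \<equiv> p - v\<^sup>\<star> * v" and "w \<equiv> (3/2) *\<^sub>R v - (1/2) *\<^sub>R (v * v\<^sup>\<star> * v)"
  shows "w = v + (1/2) *\<^sub>R (v * E)"
    and "p - w\<^sup>\<star> * w = (3/4) *\<^sub>R (E * E) + (1/4) *\<^sub>R (E * E * E)"
    and "w * p = w"
proof -
  have "(3/2) *\<^sub>R v = (1 + 1/2) *\<^sub>R v" by simp
  also have "\<dots> = 1 *\<^sub>R v + (1/2) *\<^sub>R v" by (rule scaleR_left_distrib)
  finally show w: "w = v + (1/2) *\<^sub>R (v * E)"
    using p(2) by (simp add: w_def E_def right_diff_distrib mult.assoc scaleR_diff_right)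
  have ps: "p\<^sup>\<star> = p" "p * p = p" using is_projD[OF p(1)] by auto
  have pv: "p * v\<^sup>\<star> = v\<^sup>\<star>" using p(2) ps by (metis star_mult)
  have pE: "p * E = E" "E * p = E"
    using ps pv p(2) by (simp_all add: E_def left_diff_distrib right_diff_distrib mult.assoc)
      (simp flip: mult.assoc add: pv)
  have Es: "E\<^sup>\<star> = E" by (simp add: E_def star_diff star_mult ps)
  have h: "v\<^sup>\<star> * v = p - E" by (simp add: E_def)
  have hz: "v\<^sup>\<star> * (v * z) = p * z - E * z" for z by (simp add: h left_diff_distrib flip: mult.assoc)
  have pEz: "p * (E * z) = E * z" for z by (simp add: pE flip: mult.assoc)
  have ws: "w\<^sup>\<star> = v\<^sup>\<star> + (1/2) *\<^sub>R (E * v\<^sup>\<star>)" by (simp add: w star_add star_scaleR star_mult Es)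
  have "w\<^sup>\<star> * w = p - E + (1/2) *\<^sub>R (E - E * E) + (1/2) *\<^sub>R (E - E * E) + (1/4) *\<^sub>R (E * E - E * E * E)"
    unfolding ws by (simp add: w distrib_left distrib_right mult.assoc h hz pE pEz right_diff_distrib left_diff_distrib scaleR_add_right)
  then have ww: "w\<^sup>\<star> * w = p - E + E - E * E + (1/4) *\<^sub>R (E * E) - (1/4) *\<^sub>R (E * E * E)"
    by (simp add: scaleR_diff_right flip: scaleR_left_distrib) (simp add: algebra_simps flip: scaleR_left_distrib)
  have "(3/4) *\<^sub>R (E * E) = (1 - 1/4) *\<^sub>R (E * E)" by simp
  also have "\<dots> = 1 *\<^sub>R (E * E) - (1/4) *\<^sub>R (E * E)" by (rule scaleR_left_diff_distrib)
  finally show "p - w\<^sup>\<star> * w = (3/4) *\<^sub>R (E * E) + (1/4) *\<^sub>R (E * E * E)"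
    by (simp add: ww)
  show "w * p = w" using p(2) pE by (simp add: w distrib_right mult.assoc)
qed

text \<open>One sequence drives both defects to 0: the adjoint of a step is the step for the
  adjoint, so \<open>polar_step\<close> applies to \<open>v\<close> with \<open>p\<close> and to
  \<open>v\<^sup>\<star>\<close> with \<open>q\<close>.\<close>

lemma polar_limit:
  fixes v :: "'a::star_normed_algebra"
  assumes S: "subalgebra S" "complete S" "v \<in> S" and p: "is_proj p" "v * p = v" and q: "is_proj q" "q * v = v"
    and E: "norm (p - v\<^sup>\<star> * v) \<le> 1/2" and F: "norm (q - v * v\<^sup>\<star>) \<le> 1/2"
  shows "\<exists>w\<in>S. w\<^sup>\<star> * w = p \<and> w * w\<^sup>\<star> = q"
proof -
  define f :: "'a \<Rightarrow> 'a" where "f v = (3/2) *\<^sub>R v - (1/2) *\<^sub>R (v * v\<^sup>\<star> * v)" for v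
  define u where "u n = (f ^^ n) v" for n
  have u_Suc: "u (Suc n) = (3/2) *\<^sub>R u n - (1/2) *\<^sub>R (u n * (u n)\<^sup>\<star> * u n)" for n
    by (simp add: u_def f_def)
  have us_Suc: "(u (Suc n))\<^sup>\<star> = (3/2) *\<^sub>R (u n)\<^sup>\<star> - (1/2) *\<^sub>R ((u n)\<^sup>\<star> * ((u n)\<^sup>\<star>)\<^sup>\<star> * (u n)\<^sup>\<star>)" for n
    by (simp add: u_Suc star_diff star_scaleR star_mult mult.assoc)
  have uS: "u n \<in> S" for n
    using S by (induction n) (auto simp: u_Suc u_def[of 0] intro!: subalgebraD)
  have up: "u n * p = u n" for n
  proof (induction n)
    case (Suc n) then show ?case unfolding u_Suc by (rule polar_step(3)[OF p(1)])
  qed (simp add: u_def p)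
  have qu: "(u n)\<^sup>\<star> * q = (u n)\<^sup>\<star>" for n
  proof (induction n)
    case 0 then show ?case using q by (metis is_projD(1) star_mult u_def funpow_0)
  next
    case (Suc n) then show ?case unfolding us_Suc by (rule polar_step(3)[OF q(1)])
  qed
  \<comment> \<open>\<open>3/8 + 1/16 = 7/16\<close>: a defect of norm at most 1/2 is at least
    halved.\<close>
  have half: "norm ((3/4) *\<^sub>R (x * x) + (1/4) *\<^sub>R (x * x * x)) \<le> norm x / 2" if "norm x \<le> 1/2" for x :: 'a
  proof -
    let ?t = "norm x"
    have "norm (x * x) \<le> ?t * ?t" "norm (x * x * x) \<le> ?t * ?t * ?t"
      by (rule norm_mult_ineq, rule order_trans[OF norm_mult_ineq mult_right_mono[OF norm_mult_ineq norm_ge_zero]])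
    then have "norm ((3/4) *\<^sub>R (x * x) + (1/4) *\<^sub>R (x * x * x)) \<le> 3/4 * (?t * ?t) + 1/4 * (?t * ?t * ?t)"
      using norm_triangle_ineq[of "(3/4) *\<^sub>R (x * x)" "(1/4) *\<^sub>R (x * x * x)"] by simp
    also have "\<dots> \<le> 3/4 * (?t * (1/2)) + 1/4 * (?t * (1/2) * (1/2))"
      using that by (intro add_mono mult_left_mono mult_mono) auto
    also have "\<dots> \<le> ?t / 2" by simp
    finally show ?thesis .
  qed
  have iter: "norm (g n) \<le> 1/2 * (1/2)^n" if g: "norm (g 0) \<le> 1/2"
    "\<And>n. g (Suc n) = (3/4) *\<^sub>R (g n * g n) + (1/4) *\<^sub>R (g n * g n * g n)" for g :: "nat \<Rightarrow> 'a" and n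
  proof (induction n)
    case (Suc n)
    have "(1/2::real) * (1/2)^n \<le> 1/2 * 1" by (intro mult_left_mono power_le_one) auto
    then have "norm (g (Suc n)) \<le> norm (g n) / 2" unfolding g(2) using Suc by (intro half) simp
    then show ?case using Suc by simp
  qed (use g in simp)
  have Ele: "norm (p - (u n)\<^sup>\<star> * u n) \<le> 1/2 * (1/2)^n" for n
    using E by (intro iter[of "\<lambda>n. p - (u n)\<^sup>\<star> * u n"])
      (simp_all only: u_Suc polar_step(2)[OF p(1) up], simp add: u_def)
  have Fle: "norm (q - u n * (u n)\<^sup>\<star>) \<le> 1/2 * (1/2)^n" for n
  proof -
    have "q - u (Suc n) * (u (Suc n))\<^sup>\<star> = (3/4) *\<^sub>R ((q - u n * (u n)\<^sup>\<star>) * (q - u n * (u n)\<^sup>\<star>)) +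
      (1/4) *\<^sub>R ((q - u n * (u n)\<^sup>\<star>) * (q - u n * (u n)\<^sup>\<star>) * (q - u n * (u n)\<^sup>\<star>))" for n
      using polar_step(2)[OF q(1) qu[of n]] unfolding us_Suc[symmetric] by simp
    then show ?thesis using F by (intro iter[of "\<lambda>n. q - u n * (u n)\<^sup>\<star>"]) (simp_all add: u_def)
  qed
  have diff: "norm (u (Suc n) - u n) \<le> norm (u n) * (1/4 * (1/2)^n)" for n
  proof -
    have "u (Suc n) - u n = (1/2) *\<^sub>R (u n * (p - (u n)\<^sup>\<star> * u n))"
      unfolding u_Suc polar_step(1)[OF p(1) up] by simp
    then have "norm (u (Suc n) - u n) \<le> (1/2) * (norm (u n) * norm (p - (u n)\<^sup>\<star> * u n))"
      by (simp add: norm_mult_ineq)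
    also have "\<dots> \<le> (1/2) * (norm (u n) * (1/2 * (1/2)^n))"
      using Ele by (intro mult_left_mono) auto
    finally show ?thesis by simp
  qed
  \<comment> \<open>As long as the bound holds, step \<open>n\<close> moves by at most
    \<open>norm v * (1/2)^(n + 1)\<close>, and these add up to at most
    \<open>norm v\<close>.\<close>
  have u_le: "norm (u n) \<le> 2 * norm v" for n
  proof -
    have "norm (u n) \<le> norm v + norm v * (1 - (1/2)^n)"
    proof (induction n)
      case (Suc n)
      have "norm v * (1 - (1/2)^n) \<le> norm v * 1" by (intro mult_left_mono) auto
      then have "norm (u n) \<le> 2 * norm v" using Suc by simp
      then have "norm (u n) * (1/4 * (1/2)^n) \<le> 2 * norm v * (1/4 * (1/2)^n)" by (intro mult_right_mono) auto
      moreover have "norm (u (Suc n)) \<le> norm (u (Suc n) - u n) + norm (u n)"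
        using norm_triangle_ineq[of "u (Suc n) - u n" "u n"] by (simp only: diff_add_cancel)
      ultimately have "norm (u (Suc n)) \<le> norm (u n) + 2 * norm v * (1/4 * (1/2)^n)"
        using diff[of n] by linarith
      then show ?case using Suc by (simp add: algebra_simps)
    qed (simp add: u_def)
    also have "norm v * (1 - (1/2)^n) \<le> norm v * 1" by (intro mult_left_mono) auto
    finally show ?thesis by simp
  qed
  have step: "norm (u (Suc n) - u n) \<le> (norm v / 2) * (1/2)^n" for n
  proof -
    have "norm (u n) * (1/4 * (1/2)^n) \<le> 2 * norm v * (1/4 * (1/2)^n)"
      using u_le by (intro mult_right_mono) auto
    then show ?thesis using diff[of n] by linarith
  qed
  obtain w where w: "w \<in> S" "u \<longlonglongrightarrow> w"
    using geometric_limit[OF step S(2) uS] by blast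
  have "(\<lambda>n. p - (u n)\<^sup>\<star> * u n) \<longlonglongrightarrow> p - w\<^sup>\<star> * w"
    "(\<lambda>n. q - u n * (u n)\<^sup>\<star>) \<longlonglongrightarrow> q - w * w\<^sup>\<star>"
    by (intro tendsto_intros tendsto_star w)+
  moreover have "(\<lambda>n. p - (u n)\<^sup>\<star> * u n) \<longlonglongrightarrow> 0" "(\<lambda>n. q - u n * (u n)\<^sup>\<star>) \<longlonglongrightarrow> 0"
    by (rule tendsto_zero_geometric[OF Ele], rule tendsto_zero_geometric[OF Fle])
  ultimately have "p - w\<^sup>\<star> * w = 0" "q - w * w\<^sup>\<star> = 0" using LIMSEQ_unique by blast+
  then show ?thesis using w by auto
qed

section \<open>Murray-von Neumann equivalence\<close>

text \<open>Relative to \<open>S\<close>, so that stages and core can be compared inside one type.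
  For a subalgebra \<open>S\<close> the witness puts \<open>p\<close> and \<open>q\<close> into
  \<open>S\<close> too.\<close>

definition mvn :: "'a::star_normed_algebra set \<Rightarrow> 'a \<Rightarrow> 'a \<Rightarrow> bool" where
  "mvn S p q \<longleftrightarrow> is_proj p \<and> is_proj q \<and> (\<exists>v\<in>S. v\<^sup>\<star> * v = p \<and> v * v\<^sup>\<star> = q)"

lemma mvnI: "is_proj p \<Longrightarrow> is_proj q \<Longrightarrow> v \<in> S \<Longrightarrow> v\<^sup>\<star> * v = p \<Longrightarrow> v * v\<^sup>\<star> = q \<Longrightarrow> mvn S p q"
  by (auto simp: mvn_def)

lemma mvn_proj: "mvn S p q \<Longrightarrow> is_proj p" "mvn S p q \<Longrightarrow> is_proj q"
  by (auto simp: mvn_def)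

lemma mvn_refl: "is_proj p \<Longrightarrow> p \<in> S \<Longrightarrow> mvn S p p"
  unfolding mvn_def is_proj_def by (metis (no_types))

lemma mvn_mono: "mvn S p q \<Longrightarrow> S \<subseteq> T \<Longrightarrow> mvn T p q"
  by (auto simp: mvn_def)

lemma mvn_sym:
  assumes "subalgebra S" "mvn S p q" shows "mvn S q p"
proof -
  obtain v where "v \<in> S" "v\<^sup>\<star> * v = p" "v * v\<^sup>\<star> = q" using assms(2) by (auto simp: mvn_def)
  then show ?thesis
    using assms mvn_proj by (intro mvnI[of _ _ "v\<^sup>\<star>"]) (auto intro: subalgebraD)
qed

text \<open>In the absence of the C*-identity, \<open>v\<^sup>\<star> * v = p\<close> does not yield
  \<open>v * p = v\<close>. Replacing \<open>v\<close> by \<open>v * p = q * v\<close> repairs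
  this.\<close>

lemma mvn_normalize:
  assumes "subalgebra S" "mvn S p q"
  shows "\<exists>v\<in>S. v\<^sup>\<star> * v = p \<and> v * v\<^sup>\<star> = q \<and> v * p = v \<and> q * v = v"
proof -
  obtain v where v: "v \<in> S" "v\<^sup>\<star> * v = p" "v * v\<^sup>\<star> = q" using assms(2) by (auto simp: mvn_def)
  have p: "p\<^sup>\<star> = p" "p * p = p" and q: "q * q = q"
    using mvn_proj[OF assms(2)] by (auto simp: is_proj_def)
  define w where "w = v * p"
  have w': "w = q * v" by (simp add: w_def v(2,3)[symmetric] mult.assoc)
  have "w\<^sup>\<star> * w = p * (v\<^sup>\<star> * v) * p" by (simp add: w_def star_mult p mult.assoc)
  then have 1: "w\<^sup>\<star> * w = p" using v(2) p by simp
  have "w * w\<^sup>\<star> = v * p * v\<^sup>\<star>" using p by (simp add: w_def star_mult mult.assoc) (metis mult.assoc)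
  also have "\<dots> = q * q" by (simp add: v(2,3)[symmetric] mult.assoc)
  finally have 2: "w * w\<^sup>\<star> = q" using q by simp
  have "w \<in> S" using v assms(1) unfolding w_def v(2)[symmetric] by (intro subalgebraD)
  moreover have "w * p = w" using p by (simp add: w_def mult.assoc)
  moreover have "q * w = w" using q by (simp add: w' flip: mult.assoc)
  ultimately show ?thesis using 1 2 by blast
qed

lemma mvn_trans:
  assumes S: "subalgebra S" and pq: "mvn S p q" and qr: "mvn S q r" shows "mvn S p r"
proof -
  obtain v where v: "v \<in> S" "v\<^sup>\<star> * v = p" "v * v\<^sup>\<star> = q" "q * v = v"
    using mvn_normalize[OF S pq] by auto
  obtain w where w: "w \<in> S" "w\<^sup>\<star> * w = q" "w * w\<^sup>\<star> = r" "w * q = w"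
    using mvn_normalize[OF S qr] by auto
  have "(w * v)\<^sup>\<star> * (w * v) = v\<^sup>\<star> * (w\<^sup>\<star> * w) * v" by (simp add: star_mult mult.assoc)
  then have "(w * v)\<^sup>\<star> * (w * v) = p" using v w by (simp add: mult.assoc)
  moreover have "(w * v) * (w * v)\<^sup>\<star> = w * (v * v\<^sup>\<star>) * w\<^sup>\<star>" by (simp add: star_mult mult.assoc)
  then have "(w * v) * (w * v)\<^sup>\<star> = r" using v w by simp
  moreover have "w * v \<in> S" using v w S by (intro subalgebraD)
  ultimately show ?thesis using mvn_proj pq qr by (intro mvnI[of _ _ "w * v"]) auto
qed

lemma is_proj_add: "is_proj p \<Longrightarrow> is_proj q \<Longrightarrow> p * q = 0 \<Longrightarrow> is_proj (p + q)"
proof -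
  assume p: "is_proj p" and q: "is_proj q" and 0: "p * q = 0"
  have "q * p = (p * q)\<^sup>\<star>" using p q by (simp add: star_mult is_proj_def)
  then show ?thesis using p q 0 by (simp add: is_proj_def star_add distrib_left distrib_right)
qed

text \<open>The sum of normalized witnesses works: their cross terms contain the factor
  \<open>q * q'\<close> or \<open>p * p'\<close> and vanish.\<close>

lemma mvn_add:
  assumes S: "subalgebra S" and pq: "mvn S p q" and pq': "mvn S p' q'"
    and orth: "p * p' = 0" "q * q' = 0"
  shows "mvn S (p + p') (q + q')"
proof -
  obtain v where v: "v \<in> S" "v\<^sup>\<star> * v = p" "v * v\<^sup>\<star> = q" "v * p = v" "q * v = v"
    using mvn_normalize[OF S pq] by auto
  obtain w where w: "w \<in> S" "w\<^sup>\<star> * w = p'" "w * w\<^sup>\<star> = q'" "w * p' = w" "q' * w = w"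
    using mvn_normalize[OF S pq'] by auto
  have q: "q\<^sup>\<star> = q" and p': "p'\<^sup>\<star> = p'"
    using mvn_proj[OF pq] mvn_proj[OF pq'] by (auto simp: is_proj_def)
  have "v\<^sup>\<star> * w = (q * v)\<^sup>\<star> * (q' * w)" using v w by simp
  also have "\<dots> = v\<^sup>\<star> * (q * q') * w" by (simp add: star_mult q mult.assoc)
  finally have vw: "v\<^sup>\<star> * w = 0" using orth by simp
  then have wv: "w\<^sup>\<star> * v = 0" using star_mult[of "w\<^sup>\<star>" v] star_mult[of "v\<^sup>\<star>" w] by (metis star_star star_0)
  have "v * w\<^sup>\<star> = (v * p) * (w * p')\<^sup>\<star>" using v w by simp
  also have "\<dots> = v * (p * p') * w\<^sup>\<star>" by (simp add: star_mult p' mult.assoc)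
  finally have vw': "v * w\<^sup>\<star> = 0" using orth by simp
  then have wv': "w * v\<^sup>\<star> = 0" using star_mult[of v "w\<^sup>\<star>"] by simp
  show ?thesis
  proof (rule mvnI)
    show "v + w \<in> S" using v w S by (intro subalgebraD)
    show "(v + w)\<^sup>\<star> * (v + w) = p + p'" "(v + w) * (v + w)\<^sup>\<star> = q + q'"
      using v w vw wv vw' wv' by (simp_all add: star_add distrib_left distrib_right)
    show "is_proj (p + p')" "is_proj (q + q')"
      using mvn_proj[OF pq] mvn_proj[OF pq'] orth by (auto intro: is_proj_add)
  qed
qed

section \<open>Finitely supported matrices\<close>

text \<open>One algebra holds the matrices of all sizes. Padding by zeros is invisible in it, so
  equivalence of projections of different sizes is a relation within one type.\<close>

typedef (overloaded) 'a fmat = "{f :: nat \<Rightarrow> nat \<Rightarrow> 'a::zero. \<exists>k. \<forall>i j. f i j \<noteq> 0 \<longrightarrow> i < k \<and> j < k}"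
  morphisms ent Fmat
  by (intro exI[of _ "\<lambda>_ _. 0"]) simp

setup_lifting type_definition_fmat

definition supp :: "nat \<Rightarrow> 'a::zero fmat \<Rightarrow> bool" where
  "supp k M \<longleftrightarrow> (\<forall>i j. ent M i j \<noteq> 0 \<longrightarrow> i < k \<and> j < k)"

lemma supp_ex: "\<exists>k. supp k M"
  using ent[of M] by (simp add: supp_def)

lemma supp_mono: "supp k M \<Longrightarrow> k \<le> l \<Longrightarrow> supp l M"
  unfolding supp_def using order_less_le_trans by blast

lemma supp_common: "\<exists>k. supp k A \<and> supp k B \<and> supp k C"
proof -
  obtain a b c where "supp a A" "supp b B" "supp c C" using supp_ex by metis
  then have "supp (a + b + c) A" "supp (a + b + c) B" "supp (a + b + c) C"
    by (auto elim: supp_mono)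
  then show ?thesis by blast
qed

lemma suppD: "supp k M \<Longrightarrow> i \<ge> k \<Longrightarrow> ent M i j = 0" "supp k M \<Longrightarrow> j \<ge> k \<Longrightarrow> ent M i j = 0"
  unfolding supp_def using not_less by blast+

lemma fmat_eqI: "(\<And>i j. ent A i j = ent B i j) \<Longrightarrow> A = B"
  by (simp add: ent_inject[symmetric] fun_eq_iff)

instantiation fmat :: (real_normed_algebra) real_algebra
begin

lift_definition zero_fmat :: "'a fmat" is "\<lambda>_ _. 0" by simp

lift_definition plus_fmat :: "'a fmat \<Rightarrow> 'a fmat \<Rightarrow> 'a fmat" is "\<lambda>A B i j. A i j + B i j"
proof -
  fix A B :: "nat \<Rightarrow> nat \<Rightarrow> 'a"
  assume "\<exists>k. \<forall>i j. A i j \<noteq> 0 \<longrightarrow> i < k \<and> j < k" "\<exists>k. \<forall>i j. B i j \<noteq> 0 \<longrightarrow> i < k \<and> j < k"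
  then obtain k l where "\<forall>i j. A i j \<noteq> 0 \<longrightarrow> i < k \<and> j < k" "\<forall>i j. B i j \<noteq> 0 \<longrightarrow> i < l \<and> j < l"
    by blast
  then show "\<exists>k. \<forall>i j. A i j + B i j \<noteq> 0 \<longrightarrow> i < k \<and> j < k"
    by (intro exI[of _ "k + l"]) (metis add.right_neutral add.left_neutral trans_less_add1 trans_less_add2)
qed

lift_definition uminus_fmat :: "'a fmat \<Rightarrow> 'a fmat" is "\<lambda>A i j. - A i j" by simp

lift_definition minus_fmat :: "'a fmat \<Rightarrow> 'a fmat \<Rightarrow> 'a fmat" is "\<lambda>A B i j. A i j - B i j"
proof -
  fix A B :: "nat \<Rightarrow> nat \<Rightarrow> 'a"
  assume "\<exists>k. \<forall>i j. A i j \<noteq> 0 \<longrightarrow> i < k \<and> j < k" "\<exists>k. \<forall>i j. B i j \<noteq> 0 \<longrightarrow> i < k \<and> j < k"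
  then obtain k l where "\<forall>i j. A i j \<noteq> 0 \<longrightarrow> i < k \<and> j < k" "\<forall>i j. B i j \<noteq> 0 \<longrightarrow> i < l \<and> j < l"
    by blast
  then show "\<exists>k. \<forall>i j. A i j - B i j \<noteq> 0 \<longrightarrow> i < k \<and> j < k"
    by (intro exI[of _ "k + l"]) (metis diff_zero diff_0_right trans_less_add1 trans_less_add2)
qed

lift_definition scaleR_fmat :: "real \<Rightarrow> 'a fmat \<Rightarrow> 'a fmat" is "\<lambda>r A i j. r *\<^sub>R A i j" by auto

text \<open>The index set is the support of row \<open>i\<close> of \<open>A\<close>: it is finite
  and involves no choice of a size.\<close>

lift_definition times_fmat :: "'a fmat \<Rightarrow> 'a fmat \<Rightarrow> 'a fmat"
  is "\<lambda>A B i j. \<Sum>l | A i l \<noteq> 0. A i l * B l j"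
proof -
  fix A B :: "nat \<Rightarrow> nat \<Rightarrow> 'a"
  assume "\<exists>k. \<forall>i j. A i j \<noteq> 0 \<longrightarrow> i < k \<and> j < k" "\<exists>k. \<forall>i j. B i j \<noteq> 0 \<longrightarrow> i < k \<and> j < k"
  then obtain k l where A: "\<forall>i j. A i j \<noteq> 0 \<longrightarrow> i < k \<and> j < k" and B: "\<forall>i j. B i j \<noteq> 0 \<longrightarrow> i < l \<and> j < l"
    by blast
  have "i < k + l \<and> j < k + l" if "(\<Sum>l | A i l \<noteq> 0. A i l * B l j) \<noteq> 0" for i j
  proof -
    from that obtain m where "A i m * B m j \<noteq> 0" by (meson sum.not_neutral_contains_not_neutral)
    then have "A i m \<noteq> 0" "B m j \<noteq> 0" by auto
    then show ?thesis using A B by (meson trans_less_add1 trans_less_add2)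
  qed
  then show "\<exists>k. \<forall>i j. (\<Sum>l | A i l \<noteq> 0. A i l * B l j) \<noteq> 0 \<longrightarrow> i < k \<and> j < k" by blast
qed

lemma ent_simps_aux:
  "ent (0 :: 'a fmat) i j = 0" "ent (A + B) i j = ent A i j + ent B i j"
  "ent (- A) i j = - ent A i j" "ent (A - B) i j = ent A i j - ent B i j" "ent (r *\<^sub>R A) i j = r *\<^sub>R ent A i j"
  by (simp_all add: zero_fmat.rep_eq plus_fmat.rep_eq uminus_fmat.rep_eq minus_fmat.rep_eq scaleR_fmat.rep_eq)

lemma ent_times: "supp k A \<Longrightarrow> ent (A * B) i j = (\<Sum>l<k. ent A i l * ent B l j)" for A :: "'a fmat"
  unfolding times_fmat.rep_eq by (intro sum.mono_neutral_left) (auto simp: supp_def)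

lemma supp_times: "supp k A \<Longrightarrow> supp k B \<Longrightarrow> supp k (A * B)" for A B :: "'a fmat"
  unfolding supp_def[of _ "A * B"] by (auto simp: ent_times suppD intro: ccontr)

instance
proof
  fix A B D :: "'a fmat" and r s :: real
  show "A + B + D = A + (B + D)" "A + B = B + A" "0 + A = A" "- A + A = 0" "A - B = A + - B"
    "r *\<^sub>R (A + B) = r *\<^sub>R A + r *\<^sub>R B" "(r + s) *\<^sub>R A = r *\<^sub>R A + s *\<^sub>R A"
    "r *\<^sub>R s *\<^sub>R A = (r * s) *\<^sub>R A" "1 *\<^sub>R A = A"
    by (rule fmat_eqI; simp add: ent_simps_aux algebra_simps)+
  obtain k where k: "supp k A" "supp k B" "supp k D" using supp_common by blast
  have k_add: "supp k (X + Y)" if "supp k X" "supp k Y" for X Y :: "'a fmat"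
    using that unfolding supp_def by (simp add: ent_simps_aux) (metis add.right_neutral)
  have k_scale: "supp k (t *\<^sub>R X)" if "supp k X" for X :: "'a fmat" and t
    using that unfolding supp_def by (simp add: ent_simps_aux) blast
  note kt = supp_times[of k]
  show "A * B * D = A * (B * D)"
  proof (rule fmat_eqI)
    fix i j
    have "ent (A * B * D) i j = (\<Sum>l<k. \<Sum>m<k. ent A i m * ent B m l * ent D l j)"
      using k kt by (simp add: ent_times[of k] sum_distrib_right)
    also have "\<dots> = (\<Sum>m<k. \<Sum>l<k. ent A i m * ent B m l * ent D l j)" by (rule sum.swap)
    also have "\<dots> = ent (A * (B * D)) i j"
      using k kt by (simp add: ent_times[of k] sum_distrib_left mult.assoc)
    finally show "ent (A * B * D) i j = ent (A * (B * D)) i j" .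
  qed
  show "(A + B) * D = A * D + B * D" "A * (B + D) = A * B + A * D"
    "r *\<^sub>R A * B = r *\<^sub>R (A * B)" "A * r *\<^sub>R B = r *\<^sub>R (A * B)"
    using k k_add k_scale by (auto intro!: fmat_eqI simp: ent_times[of k] ent_simps_aux algebra_simps
        sum.distrib scaleR_sum_right)
qed

end

instantiation fmat :: (real_normed_algebra) real_normed_algebra
begin

text \<open>Not a C*-norm in general, but submultiplicative and isometric under the involution, as
  the iterations for projections and partial isometries require.\<close>

definition norm_fmat :: "'a fmat \<Rightarrow> real" where
  "norm_fmat A = (\<Sum>(i, j) | ent A i j \<noteq> 0. norm (ent A i j))"

definition sgn_fmat :: "'a fmat \<Rightarrow> 'a fmat" where "sgn_fmat A = inverse (norm A) *\<^sub>R A"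
definition dist_fmat :: "'a fmat \<Rightarrow> 'a fmat \<Rightarrow> real" where "dist_fmat A B = norm (A - B)"
definition uniformity_fmat :: "('a fmat \<times> 'a fmat) filter" where
  "uniformity_fmat = (INF e\<in>{0 <..}. principal {(A, B). dist A B < e})"
definition open_fmat :: "'a fmat set \<Rightarrow> bool" where
  "open_fmat U \<longleftrightarrow> (\<forall>x\<in>U. eventually (\<lambda>(x', y). x' = x \<longrightarrow> y \<in> U) uniformity)"

lemma norm_fmat_eq: "supp k A \<Longrightarrow> norm A = (\<Sum>i<k. \<Sum>j<k. norm (ent A i j))" for A :: "'a fmat"
  unfolding norm_fmat_def sum.cartesian_product by (intro sum.mono_neutral_left) (auto simp: supp_def)

instance
proof
  fix A B :: "'a fmat" and r :: real
  show "dist A B = norm (A - B)" "sgn A = inverse (norm A) *\<^sub>R A"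
    by (simp_all add: dist_fmat_def sgn_fmat_def)
  show "uniformity = (INF e\<in>{0 <..}. principal {(A, B :: 'a fmat). dist A B < e})"
    by (rule uniformity_fmat_def)
  show "open U \<longleftrightarrow> (\<forall>x\<in>U. eventually (\<lambda>(x', y). x' = x \<longrightarrow> y \<in> U) uniformity)" for U :: "'a fmat set"
    by (rule open_fmat_def)
  obtain k where k: "supp k A" "supp k B" using supp_common by blast
  have k_add: "supp k (X + Y)" if "supp k X" "supp k Y" for X Y :: "'a fmat"
    using that unfolding supp_def by (simp add: ent_simps_aux) (metis add.right_neutral)
  have k_scale: "supp k (t *\<^sub>R X)" if "supp k X" for X :: "'a fmat" and t
    using that unfolding supp_def by (simp add: ent_simps_aux) blast
  note kt = supp_times[of k]
  have norm_eq: "norm X = (\<Sum>i<k. \<Sum>j<k. norm (ent X i j))" if "supp k X" for X :: "'a fmat"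
    using that by (rule norm_fmat_eq)
  show "norm (A + B) \<le> norm A + norm B"
    using k k_add by (simp add: norm_eq ent_simps_aux sum_mono norm_triangle_ineq flip: sum.distrib)
  show "norm (r *\<^sub>R A) = \<bar>r\<bar> * norm A"
    using k k_scale by (simp add: norm_eq ent_simps_aux sum_distrib_left)
  show "norm A = 0 \<longleftrightarrow> A = 0"
  proof
    assume "norm A = 0"
    then have "\<forall>i<k. \<forall>j<k. ent A i j = 0"
      using k by (simp add: norm_eq sum_nonneg_eq_0_iff sum_nonneg)
    then show "A = 0" using suppD[OF k(1)] by (intro fmat_eqI) (metis ent_simps_aux(1) not_le)
  qed (simp add: norm_fmat_def ent_simps_aux)
  have row: "(\<Sum>j<k. norm (ent B l j)) \<le> norm B" if "l < k" for l
    unfolding norm_eq[OF k(2)] using that by (intro member_le_sum) (auto intro: sum_nonneg)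
  have "norm (A * B) = (\<Sum>i<k. \<Sum>j<k. norm (\<Sum>l<k. ent A i l * ent B l j))"
    using k by (subst norm_eq) (simp_all add: kt ent_times[of k])
  also have "\<dots> \<le> (\<Sum>i<k. \<Sum>j<k. \<Sum>l<k. norm (ent A i l) * norm (ent B l j))"
    by (intro sum_mono order_trans[OF norm_sum] norm_mult_ineq)
  also have "\<dots> = (\<Sum>i<k. \<Sum>l<k. norm (ent A i l) * (\<Sum>j<k. norm (ent B l j)))"
    unfolding sum_distrib_left by (intro sum.cong refl sum.swap)
  also have "\<dots> \<le> (\<Sum>i<k. \<Sum>l<k. norm (ent A i l) * norm B)"
    using row by (intro sum_mono mult_left_mono) auto
  also have "\<dots> = norm A * norm B"
    by (simp add: norm_eq[OF k(1)] sum_distrib_right)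
  finally show "norm (A * B) \<le> norm A * norm B" .
qed

end

lemmas ent_simps [simp] = ent_simps_aux

lemma ent_sum [simp]: "ent (\<Sum>x\<in>X. f x) i j = (\<Sum>x\<in>X. ent (f x) i j)"
  for f :: "_ \<Rightarrow> 'a::real_normed_algebra fmat"
  by (induction X rule: infinite_finite_induct) simp_all

instantiation fmat :: (star_normed_algebra) star_normed_algebra
begin

lift_definition star_fmat :: "'a fmat \<Rightarrow> 'a fmat" is "\<lambda>A i j. (A j i)\<^sup>\<star>" by auto
lift_definition cscale_fmat :: "complex \<Rightarrow> 'a fmat \<Rightarrow> 'a fmat" is "\<lambda>c A i j. c *\<^sub>C A i j" by auto

lemma ent_star_aux: "ent (A\<^sup>\<star>) i j = (ent A j i)\<^sup>\<star>" "ent (c *\<^sub>C A) i j = c *\<^sub>C ent A i j" for A :: "'a fmat"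
  by (simp_all add: star_fmat.rep_eq cscale_fmat.rep_eq)

instance
proof
  fix A B :: "'a fmat" and c d :: complex and r :: real
  show "(A\<^sup>\<star>)\<^sup>\<star> = A" "(A + B)\<^sup>\<star> = A\<^sup>\<star> + B\<^sup>\<star>" "(c *\<^sub>C A)\<^sup>\<star> = cnj c *\<^sub>C A\<^sup>\<star>"
    "(c + d) *\<^sub>C A = c *\<^sub>C A + d *\<^sub>C A" "c *\<^sub>C (A + B) = c *\<^sub>C A + c *\<^sub>C B" "c *\<^sub>C d *\<^sub>C A = (c * d) *\<^sub>C A"
    "complex_of_real r *\<^sub>C A = r *\<^sub>R A"
    by (rule fmat_eqI; simp add: ent_star_aux star_add star_cscale cscale_add_left cscale_add_right cscale_of_real)+
  obtain k where k: "supp k A" "supp k B" using supp_common by blast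
  have k_star: "supp k (X\<^sup>\<star>)" "supp k (c *\<^sub>C X)" if "supp k X" for X :: "'a fmat"
    using that by (auto simp: supp_def ent_star_aux)
  show "(A * B)\<^sup>\<star> = B\<^sup>\<star> * A\<^sup>\<star>" "c *\<^sub>C A * B = c *\<^sub>C (A * B)" "A * c *\<^sub>C B = c *\<^sub>C (A * B)"
    using k k_star by (auto intro!: fmat_eqI simp: ent_times[of k] ent_star_aux star_sum star_mult cscale_sum_right)
  show "norm (A\<^sup>\<star>) = norm A"
    using k k_star by (simp add: norm_fmat_eq[of k] ent_star_aux) (rule sum.swap)
  show "norm (c *\<^sub>C A) = cmod c * norm A"
    using k k_star by (simp add: norm_fmat_eq[of k] ent_star_aux sum_distrib_left)
qed

end

lemmas ent_star [simp] = ent_star_aux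

lemma supp_0 [simp]: "supp k 0"
  by (simp add: supp_def)

lemma supp_add: "supp k A \<Longrightarrow> supp k B \<Longrightarrow> supp k (A + B)" for A B :: "'a::real_normed_algebra fmat"
  unfolding supp_def by (simp, metis add.right_neutral)

lemma supp_star: "supp k A \<Longrightarrow> supp k (A\<^sup>\<star>)" and supp_cscale: "supp k A \<Longrightarrow> supp k (c *\<^sub>C A)"
  by (auto simp: supp_def)

lemma norm_ent_le: "norm (ent A i j) \<le> norm A" for A :: "'a::real_normed_algebra fmat"
proof (cases "ent A i j = 0")
  case False
  obtain k where k: "supp k A" using supp_ex by blast
  then have "i < k" "j < k" using False by (auto simp: supp_def)
  have "norm (ent A i j) \<le> (\<Sum>j<k. norm (ent A i j))" using \<open>j < k\<close> by (intro member_le_sum) auto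
  also have "\<dots> \<le> norm A" unfolding norm_fmat_eq[OF k]
    using \<open>i < k\<close> by (intro member_le_sum[of i _ "\<lambda>i. \<Sum>j<k. norm (ent A i j)"]) (auto intro: sum_nonneg)
  finally show ?thesis .
qed auto

text \<open>The bounded size makes the matrices over a complete \<open>S\<close> complete. The
  iterations run in \<open>mats\<close>, while equivalences over the core are stated in
  \<open>fmats\<close>.\<close>

definition mats :: "nat \<Rightarrow> 'a::star_normed_algebra set \<Rightarrow> 'a fmat set" where
  "mats k S = {M. supp k M \<and> (\<forall>i j. ent M i j \<in> S)}"

definition fmats :: "'a::star_normed_algebra set \<Rightarrow> 'a fmat set" where
  "fmats S = {M. \<forall>i j. ent M i j \<in> S}"

lemma mats_subset_fmats: "mats k S \<subseteq> fmats S"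
  by (auto simp: mats_def fmats_def)

lemma subalgebra_fmats:
  assumes S: "subalgebra S" shows "subalgebra (fmats S)"
  unfolding subalgebra_def
proof (intro conjI ballI allI)
  fix A B :: "'a fmat" and c assume A: "A \<in> fmats S" and B: "B \<in> fmats S"
  obtain k where k: "supp k A" using supp_ex by blast
  show "A + B \<in> fmats S" "A\<^sup>\<star> \<in> fmats S" "c *\<^sub>C A \<in> fmats S"
    using A B S by (auto simp: fmats_def intro: subalgebraD)
  show "A * B \<in> fmats S"
    using A B S by (auto simp: fmats_def ent_times[OF k] intro!: subalgebra_sum subalgebraD)
qed (use S in \<open>simp add: fmats_def subalgebraD(1)\<close>)

lemma subalgebra_mats:
  assumes S: "subalgebra S" shows "subalgebra (mats k S)"
proof -
  have "mats k S = fmats S \<inter> {M. supp k M}" by (auto simp: mats_def fmats_def)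
  then show ?thesis
    using subalgebra_fmats[OF S] unfolding subalgebra_def
    by (auto simp: supp_add supp_times supp_star supp_cscale)
qed

lemma complete_mats:
  fixes S :: "'a::star_normed_algebra set"
  assumes S: "subalgebra S" "complete S" shows "complete (mats k S)"
  unfolding complete_def
proof (intro allI impI)
  fix f :: "nat \<Rightarrow> 'a fmat" assume f: "(\<forall>n. f n \<in> mats k S) \<and> Cauchy f"
  have "\<exists>l\<in>S. (\<lambda>n. ent (f n) i j) \<longlonglongrightarrow> l" for i j
  proof -
    have "Cauchy (\<lambda>n. ent (f n) i j)"
    proof (rule metric_CauchyI)
      fix e :: real assume "e > 0"
      then obtain M where M: "\<forall>m\<ge>M. \<forall>n\<ge>M. dist (f m) (f n) < e" using f by (meson metric_CauchyD)
      have "dist (ent (f m) i j) (ent (f n) i j) \<le> dist (f m) (f n)" for m n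
        using norm_ent_le[of "f m - f n" i j] by (simp add: dist_norm)
      then show "\<exists>M. \<forall>m\<ge>M. \<forall>n\<ge>M. dist (ent (f m) i j) (ent (f n) i j) < e"
        using M order_le_less_trans by blast
    qed
    then show ?thesis using S f by (simp add: complete_def mats_def)
  qed
  then obtain l where l: "\<And>i j. l i j \<in> S" "\<And>i j. (\<lambda>n. ent (f n) i j) \<longlonglongrightarrow> l i j" by metis
  define L where "L = Fmat (\<lambda>i j. if i < k \<and> j < k then l i j else 0)"
  have entL: "ent L i j = (if i < k \<and> j < k then l i j else 0)" for i j
    unfolding L_def by (subst Fmat_inverse) auto
  have suppL: "supp k L" by (simp add: supp_def entL)
  have L: "L \<in> mats k S" using l S by (auto simp: mats_def entL suppL intro: subalgebraD)
  have supp: "supp k (f n - L)" for n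
    using subalgebraD(7)[OF subalgebra_mats[OF S(1)], of "f n" k L] f L by (simp add: mats_def)
  have "(\<lambda>n. norm (f n - L)) \<longlonglongrightarrow> (\<Sum>i<k. \<Sum>j<k. norm (l i j - ent L i j))"
    unfolding norm_fmat_eq[OF supp] ent_simps by (intro tendsto_sum tendsto_norm tendsto_diff l tendsto_const)
  then have "(\<lambda>n. norm (f n - L)) \<longlonglongrightarrow> 0" by (simp add: entL)
  then have "(\<lambda>n. f n - L) \<longlonglongrightarrow> 0" by (rule tendsto_norm_zero_cancel)
  then have "f \<longlonglongrightarrow> L" by (rule LIM_zero_cancel)
  then show "\<exists>l\<in>mats k S. f \<longlonglongrightarrow> l" using L by blast
qed

section \<open>Matrix units and shifted blocks\<close>

lift_definition emat :: "nat \<Rightarrow> nat \<Rightarrow> 'a::zero \<Rightarrow> 'a fmat" is "\<lambda>i j a i' j'. if i' = i \<and> j' = j then a else 0"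
proof -
  fix i j :: nat and a :: 'a
  show "\<exists>k. \<forall>i' j'. (if i' = i \<and> j' = j then a else 0) \<noteq> 0 \<longrightarrow> i' < k \<and> j' < k"
    by (intro exI[of _ "Suc (max i j)"]) auto
qed

lemma ent_emat [simp]: "ent (emat i j a) i' j' = (if i' = i \<and> j' = j then a else 0)"
  by (simp add: emat.rep_eq)

lemma supp_emat: "i < k \<Longrightarrow> j < k \<Longrightarrow> supp k (emat i j a)"
  by (auto simp: supp_def)

lemma ent_emat_mult: "ent (emat i j a * A) i' j' = (if i' = i then a * ent A j j' else 0)"
  for A :: "'a::real_normed_algebra fmat"
proof -
  have k: "supp (Suc (max i j)) (emat i j a)" by (intro supp_emat) auto
  have "ent (emat i j a * A) i' j' = (\<Sum>l<Suc (max i j). if l = j then (if i' = i then a * ent A l j' else 0) else 0)"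
    unfolding ent_times[OF k] by (intro sum.cong) auto
  also have "\<dots> = (if i' = i then a * ent A j j' else 0)"
    unfolding sum.delta[OF finite_lessThan] by (simp add: less_Suc_eq_le)
  finally show ?thesis .
qed

lemma emat_mult: "emat i j a * emat k l b = (if j = k then emat i l (a * b) else 0)"
  for a b :: "'a::real_normed_algebra"
  by (rule fmat_eqI) (auto simp: ent_emat_mult)

lemma emat_0 [simp]: "emat i j 0 = 0"
  and emat_add: "emat i j (a + b) = emat i j a + emat i j b"
  for a b :: "'a::real_normed_algebra"
  by (auto intro: fmat_eqI)

lemma emat_star: "(emat i j a)\<^sup>\<star> = emat j i (a\<^sup>\<star>)"
  and emat_cscale: "c *\<^sub>C emat i j a = emat i j (c *\<^sub>C a)"
  for a :: "'a::star_normed_algebra"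
  by (auto intro: fmat_eqI)

lemma ent_mult_emat: "ent (A * emat i j a) i' j' = (if j' = j then ent A i' i * a else 0)"
  for A :: "'a::star_normed_algebra fmat"
proof -
  have "ent (A * emat i j a) i' j' = (ent ((emat i j a)\<^sup>\<star> * A\<^sup>\<star>) j' i')\<^sup>\<star>"
    by (metis ent_star_aux(1) star_mult star_star)
  then show ?thesis by (simp add: emat_star ent_emat_mult star_mult)
qed

lemma emat_in_fmats: "subalgebra S \<Longrightarrow> a \<in> S \<Longrightarrow> emat i j a \<in> fmats S"
  by (auto simp: fmats_def intro: subalgebraD)

lift_definition shift :: "nat \<Rightarrow> 'a::zero fmat \<Rightarrow> 'a fmat"
  is "\<lambda>n A i j. if n \<le> i \<and> n \<le> j then A (i - n) (j - n) else 0"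
proof -
  fix n and A :: "nat \<Rightarrow> nat \<Rightarrow> 'a" assume "\<exists>k. \<forall>i j. A i j \<noteq> 0 \<longrightarrow> i < k \<and> j < k"
  then obtain k where k: "A i j \<noteq> 0 \<Longrightarrow> i < k \<and> j < k" for i j by blast
  show "\<exists>k. \<forall>i j. (if n \<le> i \<and> n \<le> j then A (i - n) (j - n) else 0) \<noteq> 0 \<longrightarrow> i < k \<and> j < k"
    by (intro exI[of _ "n + k"]) (auto dest: k simp: less_diff_conv2 add.commute split: if_splits)
qed

text \<open>Left multiplication by the shift isometry, which is itself not finitely supported.
  Applied to a projection it yields the witness in \<open>mvn_shift\<close>.\<close>

lift_definition row_shift :: "nat \<Rightarrow> 'a::zero fmat \<Rightarrow> 'a fmat"
  is "\<lambda>n A i j. if n \<le> i then A (i - n) j else 0"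
proof -
  fix n and A :: "nat \<Rightarrow> nat \<Rightarrow> 'a" assume "\<exists>k. \<forall>i j. A i j \<noteq> 0 \<longrightarrow> i < k \<and> j < k"
  then obtain k where k: "A i j \<noteq> 0 \<Longrightarrow> i < k \<and> j < k" for i j by blast
  show "\<exists>k. \<forall>i j. (if n \<le> i then A (i - n) j else 0) \<noteq> 0 \<longrightarrow> i < k \<and> j < k"
    by (intro exI[of _ "n + k"]) (auto dest: k simp: less_diff_conv2 add.commute split: if_splits)
qed

lemma ent_shift: "ent (shift n A) i j = (if n \<le> i \<and> n \<le> j then ent A (i - n) (j - n) else 0)"
  by (simp add: shift.rep_eq)

lemma ent_row_shift: "ent (row_shift n A) i j = (if n \<le> i then ent A (i - n) j else 0)"
  by (simp add: row_shift.rep_eq)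

lemma supp_shift:
  assumes "supp k A" shows "supp (n + k) (shift n A)"
proof -
  have k: "ent A i j \<noteq> 0 \<Longrightarrow> i < k \<and> j < k" for i j using assms by (simp add: supp_def)
  show ?thesis
    by (auto dest: k simp: supp_def ent_shift less_diff_conv2 add.commute split: if_splits)
qed

lemma supp_row_shift:
  assumes "supp k A" shows "supp (n + k) (row_shift n A)"
proof -
  have k: "ent A i j \<noteq> 0 \<Longrightarrow> i < k \<and> j < k" for i j using assms by (simp add: supp_def)
  show ?thesis
    by (auto dest: k simp: supp_def ent_row_shift less_diff_conv2 add.commute split: if_splits)
qed

lemma shift_0 [simp]: "shift n 0 = (0 :: 'a::real_normed_algebra fmat)"
  by (rule fmat_eqI) (simp add: ent_shift)

lemma shift_add: "shift n (A + B) = shift n A + shift n B" for A B :: "'a::real_normed_algebra fmat"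
  by (rule fmat_eqI) (simp add: ent_shift)

lemma shift_shift: "shift m (shift n A) = shift (m + n) A"
  by (rule fmat_eqI) (auto simp: ent_shift add.commute)

lemma shift_zero_index: "shift 0 A = A"
  by (rule fmat_eqI) (simp add: ent_shift)

lemma row_shift_star_mult: "(row_shift n A)\<^sup>\<star> * row_shift n A = A\<^sup>\<star> * A"
  for A :: "'a::star_normed_algebra fmat"
proof (rule fmat_eqI)
  fix i j
  obtain k where k: "supp k A" using supp_ex by blast
  have "ent ((row_shift n A)\<^sup>\<star> * row_shift n A) i j
      = (\<Sum>l<n + k. if n \<le> l then (ent A (l - n) i)\<^sup>\<star> * ent A (l - n) j else 0)"
    unfolding ent_times[OF supp_star[OF supp_row_shift[OF k]]] by (intro sum.cong) (auto simp: ent_row_shift)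
  also have "\<dots> = (\<Sum>l\<in>{n..<n + k}. (ent A (l - n) i)\<^sup>\<star> * ent A (l - n) j)"
    by (intro sum.mono_neutral_cong_right) auto
  also have "\<dots> = (\<Sum>l<k. (ent A l i)\<^sup>\<star> * ent A l j)"
    by (rule sum.reindex_bij_witness[of _ "\<lambda>l. l + n" "\<lambda>l. l - n"]) auto
  finally show "ent ((row_shift n A)\<^sup>\<star> * row_shift n A) i j = ent (A\<^sup>\<star> * A) i j"
    by (simp add: ent_times[OF supp_star[OF k]])
qed

lemma row_shift_mult_star: "row_shift n A * (row_shift n A)\<^sup>\<star> = shift n (A * A\<^sup>\<star>)"
  for A :: "'a::star_normed_algebra fmat"
proof (rule fmat_eqI)
  fix i j
  obtain k where k: "supp k A" using supp_ex by blast
  have k': "supp (n + k) A" using k by (rule supp_mono) simp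
  show "ent (row_shift n A * (row_shift n A)\<^sup>\<star>) i j = ent (shift n (A * A\<^sup>\<star>)) i j"
    by (cases "n \<le> i"; cases "n \<le> j")
      (simp_all add: ent_times[OF supp_row_shift[OF k]] ent_row_shift ent_shift ent_times[OF k'])
qed

lemma shift_star: "(shift n A)\<^sup>\<star> = shift n (A\<^sup>\<star>)" for A :: "'a::star_normed_algebra fmat"
  by (rule fmat_eqI) (auto simp: ent_shift)

lemma shift_mult: "shift n A * shift n B = shift n (A * B)" for A B :: "'a::star_normed_algebra fmat"
proof (rule fmat_eqI)
  fix i j
  obtain k where k: "supp k A" using supp_ex by blast
  have "ent (shift n A * shift n B) i j
      = (\<Sum>l<n + k. if n \<le> l then (if n \<le> i \<and> n \<le> j then ent A (i - n) (l - n) * ent B (l - n) (j - n) else 0) else 0)"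
    unfolding ent_times[OF supp_shift[OF k]] by (intro sum.cong) (auto simp: ent_shift)
  also have "\<dots> = (\<Sum>l\<in>{n..<n + k}. (if n \<le> i \<and> n \<le> j then ent A (i - n) (l - n) * ent B (l - n) (j - n) else 0))"
    by (intro sum.mono_neutral_cong_right) auto
  also have "\<dots> = (\<Sum>l<k. (if n \<le> i \<and> n \<le> j then ent A (i - n) l * ent B l (j - n) else 0))"
    by (rule sum.reindex_bij_witness[of _ "\<lambda>l. l + n" "\<lambda>l. l - n"]) auto
  finally show "ent (shift n A * shift n B) i j = ent (shift n (A * B)) i j"
    by (cases "n \<le> i \<and> n \<le> j") (auto simp: ent_shift ent_times[OF k])
qed

lemma shift_orth: "supp n A \<Longrightarrow> A * shift n B = 0" for A B :: "'a::star_normed_algebra fmat"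
  by (rule fmat_eqI) (simp add: ent_times ent_shift)

lemma is_proj_shift: "is_proj A \<Longrightarrow> is_proj (shift n A)"
  by (simp add: is_proj_def shift_star shift_mult)

lemma shift_in_fmats: "subalgebra S \<Longrightarrow> A \<in> fmats S \<Longrightarrow> shift n A \<in> fmats S"
  by (auto simp: fmats_def ent_shift intro: subalgebraD)

lemma mvn_shift:
  assumes "subalgebra S" "is_proj A" "A \<in> fmats S"
  shows "mvn (fmats S) A (shift n A)"
proof (rule mvnI)
  show "row_shift n A \<in> fmats S" using assms by (auto simp: fmats_def ent_row_shift intro: subalgebraD)
  show "(row_shift n A)\<^sup>\<star> * row_shift n A = A" "row_shift n A * (row_shift n A)\<^sup>\<star> = shift n A"
    using is_projD[OF assms(2)] by (simp_all add: row_shift_star_mult row_shift_mult_star)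
qed (use assms in \<open>auto intro: is_proj_shift\<close>)

section \<open>The graph algebra as a type\<close>

lemma seminorm_sum_le:
  assumes "cstar_seminorm \<nu>" "finite I" "\<And>i. i \<in> I \<Longrightarrow> f i \<in> star_polys"
  shows "\<nu> (\<Sum>i\<in>I. f i) \<le> (\<Sum>i\<in>I. \<nu> (f i))"
  using assms(2,3)
proof (induction I)
  case empty
  then show ?case using cstar_seminormD(3)[OF assms(1) star_polys_0, of 0] by simp
next
  case (insert i I)
  have "\<nu> (f i + sum f I) \<le> \<nu> (f i) + \<nu> (sum f I)"
    using insert by (intro cstar_seminormD(2)[OF assms(1)] star_polys_sum) auto
  then show ?case using insert by simp
qed

text \<open>The relations bound the square of the seminorm of a vertex generator by the seminorm
  itself, and the square for an edge by the seminorm of its range. Generators outside the graph are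
  themselves relations and have seminorm 0.\<close>

lemma graph_seminorm_le_1:
  assumes nu: "\<nu> \<in> rel_seminorms (graph_relations G)"
  shows "\<nu> (gen x) \<le> 1"
proof -
  have cs: "cstar_seminorm \<nu>" and rel: "\<And>r. r \<in> graph_relations G \<Longrightarrow> \<nu> r = 0"
    using nu by (auto simp: rel_seminorms_def)
  note D = cstar_seminormD[OF cs]
  have le_of_diff: "\<nu> p \<le> \<nu> q" if "\<nu> (p - q) = 0" "p \<in> star_polys" "q \<in> star_polys" for p q
    using D(2)[of "p - q" q] that by simp
  have P: "\<nu> (genP v) \<le> 1" for v
  proof (cases "v \<in> verts G")
    case True
    let ?p = "genP v :: ('a, 'b) graph_gen star_poly"
    have 1: "\<nu> (poly_adj ?p - ?p) = 0" and 2: "\<nu> (?p * ?p - ?p) = 0"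
      using True by (auto intro!: rel simp: graph_relations_def)
    have "\<nu> ((poly_adj ?p - ?p) * ?p) \<le> \<nu> (poly_adj ?p - ?p) * \<nu> ?p" by (intro D(4)) auto
    then have "\<nu> (poly_adj ?p * ?p - ?p * ?p) = 0"
      using 1 D(1)[of "(poly_adj ?p - ?p) * ?p"] by (simp add: left_diff_distrib)
    then have "\<nu> (poly_adj ?p * ?p) \<le> \<nu> (?p * ?p)" by (intro le_of_diff) auto
    also have "\<dots> \<le> \<nu> ?p" using 2 by (intro le_of_diff) auto
    finally have "\<nu> ?p * \<nu> ?p \<le> 1 * \<nu> ?p" using D(5)[of ?p] by (simp add: power2_eq_square)
    then show ?thesis using D(1)[of ?p] by (cases "\<nu> ?p = 0") (simp_all add: mult_le_cancel_right)
  next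
    case False
    then have "\<nu> (genP v) = 0" by (auto intro!: rel simp: graph_relations_def)
    then show ?thesis by simp
  qed
  have S: "\<nu> (genS e) \<le> 1" for e
  proof (cases "e \<in> arcs G")
    case True
    let ?s = "genS e :: ('a, 'b) graph_gen star_poly"
    have "\<nu> (poly_adj ?s * ?s - genP (head G e)) = 0"
      using True by (intro rel) (auto simp: graph_relations_def)
    then have "\<nu> (poly_adj ?s * ?s) \<le> \<nu> (genP (head G e))" by (intro le_of_diff) auto
    then have "(\<nu> ?s)\<^sup>2 \<le> 1\<^sup>2" using P D(5)[of ?s] by (simp add: order_trans)
    then show ?thesis by (rule power2_le_imp_le) simp
  next
    case False
    then have "\<nu> (genS e) = 0" by (auto intro!: rel simp: graph_relations_def)
    then show ?thesis by simp
  qed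
  show ?thesis using P S by (cases x) auto
qed

lemma graph_seminorm_word_le_1:
  assumes nu: "\<nu> \<in> rel_seminorms (graph_relations G)" and "ls \<noteq> []"
  shows "\<nu> (Poly_Mapping.single (Word ls) 1) \<le> 1"
  using assms(2)
proof (induction ls rule: list_nonempty_induct)
  case (single l)
  have cs: "cstar_seminorm \<nu>" using nu by (simp add: rel_seminorms_def)
  show ?case
  proof (cases l)
    case (Gen x) then show ?thesis using graph_seminorm_le_1[OF nu, of x] by (simp add: gen_def)
  next
    case (Adj x)
    have "Poly_Mapping.single (Word [l]) 1 = poly_adj (gen x)"
      by (simp add: gen_def poly_adj_single word_adj_def Adj)
    then show ?thesis using graph_seminorm_le_1[OF nu, of x] cstar_seminorm_adj[OF cs, of "gen x"] by simp
  qed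
next
  case (cons l ls)
  have cs: "cstar_seminorm \<nu>" using nu by (simp add: rel_seminorms_def)
  have l: "\<nu> (Poly_Mapping.single (Word [l]) 1) \<le> 1"
  proof (cases l)
    case (Gen x) then show ?thesis using graph_seminorm_le_1[OF nu, of x] by (simp add: gen_def)
  next
    case (Adj x)
    have "Poly_Mapping.single (Word [l]) 1 = poly_adj (gen x)"
      by (simp add: gen_def poly_adj_single word_adj_def Adj)
    then show ?thesis using graph_seminorm_le_1[OF nu, of x] cstar_seminorm_adj[OF cs, of "gen x"] by simp
  qed
  have eq: "Poly_Mapping.single (Word (l # ls)) 1
      = Poly_Mapping.single (Word [l]) 1 * Poly_Mapping.single (Word ls) (1::complex)"
    by (simp add: mult_single plus_star_word_def)
  have sp: "Poly_Mapping.single (Word ls) (1::complex) \<in> star_polys" "Poly_Mapping.single (Word [l]) (1::complex) \<in> star_polys"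
    using cons.hyps by (auto simp: star_polys_single_iff zero_star_word_def)
  have "\<nu> (Poly_Mapping.single (Word (l # ls)) 1) \<le> \<nu> (Poly_Mapping.single (Word [l]) 1) * \<nu> (Poly_Mapping.single (Word ls) 1)"
    unfolding eq using sp by (intro cstar_seminormD(4)[OF cs])
  also have "\<dots> \<le> 1 * 1" using l cons.IH cstar_seminormD(1)[OF cs] sp by (intro mult_mono) auto
  finally show ?case by simp
qed

text \<open>No nonempty word exceeds 1, so the sum of the moduli of the coefficients bounds all
  admissible seminorms at once.\<close>

lemma bounded_graph_relations: "bounded_relations (graph_relations G)"
proof
  fix p :: "('a, 'b) graph_gen star_poly" assume p: "p \<in> star_polys"
  show "bdd_above ((\<lambda>\<nu>. \<nu> p) ` rel_seminorms (graph_relations G))"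
  proof (rule bdd_aboveI2)
    fix \<nu> :: "('a, 'b) graph_gen star_poly \<Rightarrow> real" assume nu: "\<nu> \<in> rel_seminorms (graph_relations G)"
    then have cs: "cstar_seminorm \<nu>" by (simp add: rel_seminorms_def)
    have word: "w \<noteq> 0" if "w \<in> Poly_Mapping.keys p" for w
      using p that by (auto simp: star_polys_def in_keys_iff)
    have le: "\<nu> (Poly_Mapping.single w (Poly_Mapping.lookup p w)) \<le> cmod (Poly_Mapping.lookup p w)"
      if w: "w \<in> Poly_Mapping.keys p" for w
    proof -
      have "\<nu> (Poly_Mapping.single w 1) \<le> 1"
        using graph_seminorm_word_le_1[OF nu, of "letters w"] word[OF w]
        by (cases w) (auto simp: zero_star_word_def)
      moreover have "\<nu> (Poly_Mapping.single w (Poly_Mapping.lookup p w))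
          = cmod (Poly_Mapping.lookup p w) * \<nu> (Poly_Mapping.single w 1)"
        using cstar_seminormD(3)[OF cs, of "Poly_Mapping.single w 1" "Poly_Mapping.lookup p w"] word[OF w]
        by (simp add: poly_scale_single star_polys_single_iff)
      ultimately show ?thesis by (simp add: mult_left_le)
    qed
    have "\<nu> p = \<nu> (\<Sum>w\<in>Poly_Mapping.keys p. Poly_Mapping.single w (Poly_Mapping.lookup p w))"
      by (simp flip: star_poly_expansion)
    also have "\<dots> \<le> (\<Sum>w\<in>Poly_Mapping.keys p. \<nu> (Poly_Mapping.single w (Poly_Mapping.lookup p w)))"
      using word by (intro seminorm_sum_le[OF cs]) (auto simp: star_polys_single_iff)
    also have "\<dots> \<le> (\<Sum>w\<in>Poly_Mapping.keys p. cmod (Poly_Mapping.lookup p w))"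
      by (intro sum_mono le)
    finally show "\<nu> p \<le> (\<Sum>w\<in>Poly_Mapping.keys p. cmod (Poly_Mapping.lookup p w))" .
  qed
qed

interpretation Q2: bounded_relations "graph_relations Q2"
  by (rule bounded_graph_relations)

type_synonym q2_poly = "(Q2_vertex, Q2_edge) graph_gen star_poly"

abbreviation "R2 \<equiv> graph_relations Q2"

text \<open>As a type, the graph algebra can be an instance of \<open>cstar_algebra\<close> and
  \<open>banach\<close>, and \<open>fmat\<close> can be formed over it.\<close>

typedef q2alg = "carrier (graph_cstar Q2)" morphisms Rep_q2 Abs_q2
  unfolding graph_cstar_def Q2.carrier_U using Q2.C_const[OF star_polys_0] by blast

definition cl :: "(nat \<Rightarrow> q2_poly) \<Rightarrow> q2alg" where "cl x = Abs_q2 (univ_class R2 x)"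

lemma Rep_cl: "x \<in> cauchy_seqs R2 \<Longrightarrow> Rep_q2 (cl x) = univ_class R2 x"
  unfolding cl_def by (rule Abs_q2_inverse) (simp add: graph_cstar_def Q2.carrier_U)

lemma q2_cases: obtains x where "x \<in> cauchy_seqs R2" "X = cl x"
proof -
  have "Rep_q2 X \<in> univ_class R2 ` cauchy_seqs R2"
    using Rep_q2[of X] by (simp add: graph_cstar_def Q2.carrier_U)
  then obtain x where "x \<in> cauchy_seqs R2" "Rep_q2 X = univ_class R2 x" by blast
  then show ?thesis using that by (metis Rep_q2_inverse cl_def)
qed

lemma cl_eq_iff:
  "x \<in> cauchy_seqs R2 \<Longrightarrow> y \<in> cauchy_seqs R2 \<Longrightarrow> cl x = cl y \<longleftrightarrow> (\<lambda>n. univ_norm R2 (x n - y n)) \<longlonglongrightarrow> 0"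
  by (simp add: Rep_q2_inject[symmetric] Rep_cl Q2.cls_eq_iff)

instantiation q2alg :: real_algebra
begin

definition zero_q2alg :: q2alg where "zero_q2alg = cl (\<lambda>_. 0)"
definition plus_q2alg :: "q2alg \<Rightarrow> q2alg \<Rightarrow> q2alg"
  where "plus_q2alg X Y = Abs_q2 (Rep_q2 X \<oplus>\<^bsub>graph_cstar Q2\<^esub> Rep_q2 Y)"
definition times_q2alg :: "q2alg \<Rightarrow> q2alg \<Rightarrow> q2alg"
  where "times_q2alg X Y = Abs_q2 (Rep_q2 X \<otimes>\<^bsub>graph_cstar Q2\<^esub> Rep_q2 Y)"
definition uminus_q2alg :: "q2alg \<Rightarrow> q2alg"
  where "uminus_q2alg X = Abs_q2 ((- 1) \<odot>\<^bsub>graph_cstar Q2\<^esub> Rep_q2 X)"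
definition scaleR_q2alg :: "real \<Rightarrow> q2alg \<Rightarrow> q2alg"
  where "scaleR_q2alg r X = Abs_q2 (complex_of_real r \<odot>\<^bsub>graph_cstar Q2\<^esub> Rep_q2 X)"
definition minus_q2alg :: "q2alg \<Rightarrow> q2alg \<Rightarrow> q2alg"
  where "minus_q2alg X Y = Abs_q2 (Rep_q2 X \<oplus>\<^bsub>graph_cstar Q2\<^esub> Rep_q2 (- Y))"

lemma cl_unary_aux:
  assumes "x \<in> cauchy_seqs R2"
  shows "- cl x = cl (\<lambda>n. - x n)" "r *\<^sub>R cl x = cl (\<lambda>n. poly_scale (complex_of_real r) (x n))"
  using assms by (simp_all add: uminus_q2alg_def scaleR_q2alg_def Rep_cl graph_cstar_def Q2.smult_cls
      poly_scale_minus1) (simp_all add: cl_def)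

lemma cl_binary_aux:
  assumes "x \<in> cauchy_seqs R2" "y \<in> cauchy_seqs R2"
  shows "cl x + cl y = cl (\<lambda>n. x n + y n)" "cl x * cl y = cl (\<lambda>n. x n * y n)"
    "cl x - cl y = cl (\<lambda>n. x n - y n)"
  using assms by (simp_all add: plus_q2alg_def times_q2alg_def minus_q2alg_def cl_unary_aux Rep_cl
      graph_cstar_def Q2.add_cls Q2.mult_cls) (simp_all add: cl_def)

instance
proof
  fix X Y Z :: q2alg and r s :: real
  obtain x where x: "x \<in> cauchy_seqs R2" "X = cl x" by (rule q2_cases)
  obtain y where y: "y \<in> cauchy_seqs R2" "Y = cl y" by (rule q2_cases)
  obtain z where z: "z \<in> cauchy_seqs R2" "Z = cl z" by (rule q2_cases)
  note defs = x y z cl_unary_aux cl_binary_aux zero_q2alg_def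
  show "X + Y + Z = X + (Y + Z)" "X + Y = Y + X" "0 + X = X" "- X + X = 0" "X - Y = X + - Y"
    "X * Y * Z = X * (Y * Z)" "(X + Y) * Z = X * Z + Y * Z" "X * (Y + Z) = X * Y + X * Z"
    "r *\<^sub>R (X + Y) = r *\<^sub>R X + r *\<^sub>R Y" "(r + s) *\<^sub>R X = r *\<^sub>R X + s *\<^sub>R X"
    "r *\<^sub>R s *\<^sub>R X = (r * s) *\<^sub>R X" "1 *\<^sub>R X = X"
    "r *\<^sub>R X * Y = r *\<^sub>R (X * Y)" "X * r *\<^sub>R Y = r *\<^sub>R (X * Y)"
    by (simp_all add: defs algebra_simps poly_scale_add poly_scale_add_left poly_scale_scale
        poly_scale_mult_left poly_scale_mult_right)
qed

end

lemmas cl_simps = cl_binary_aux cl_unary_aux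

instantiation q2alg :: real_normed_algebra
begin

definition norm_q2alg :: "q2alg \<Rightarrow> real" where "norm_q2alg X = cnorm (graph_cstar Q2) (Rep_q2 X)"
definition sgn_q2alg :: "q2alg \<Rightarrow> q2alg" where "sgn_q2alg X = inverse (norm X) *\<^sub>R X"
definition dist_q2alg :: "q2alg \<Rightarrow> q2alg \<Rightarrow> real" where "dist_q2alg X Y = norm (X - Y)"
definition uniformity_q2alg :: "(q2alg \<times> q2alg) filter" where
  "uniformity_q2alg = (INF e\<in>{0 <..}. principal {(X, Y). dist X Y < e})"
definition open_q2alg :: "q2alg set \<Rightarrow> bool" where
  "open_q2alg U \<longleftrightarrow> (\<forall>x\<in>U. eventually (\<lambda>(x', y). x' = x \<longrightarrow> y \<in> U) uniformity)"

lemma norm_cl: "x \<in> cauchy_seqs R2 \<Longrightarrow> norm (cl x) = cnorm (univ_cstar R2) (univ_class R2 x)"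
  by (simp add: norm_q2alg_def Rep_cl graph_cstar_def)

lemma norm_cl_tendsto: "x \<in> cauchy_seqs R2 \<Longrightarrow> (\<lambda>n. univ_norm R2 (x n)) \<longlonglongrightarrow> norm (cl x)"
  unfolding norm_cl by (rule Q2.norm_cls)

instance
proof
  fix X Y :: q2alg and r :: real
  obtain x where x: "x \<in> cauchy_seqs R2" "X = cl x" by (rule q2_cases)
  obtain y where y: "y \<in> cauchy_seqs R2" "Y = cl y" by (rule q2_cases)
  note [simp] = Q2.C_star_polys[OF x(1)] Q2.C_star_polys[OF y(1)]
  show "dist X Y = norm (X - Y)" "sgn X = inverse (norm X) *\<^sub>R X"
    by (simp_all add: dist_q2alg_def sgn_q2alg_def)
  show "uniformity = (INF e\<in>{0 <..}. principal {(X, Y :: q2alg). dist X Y < e})"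
    by (rule uniformity_q2alg_def)
  show "open U \<longleftrightarrow> (\<forall>x\<in>U. eventually (\<lambda>(x', y). x' = x \<longrightarrow> y \<in> U) uniformity)" for U :: "q2alg set"
    by (rule open_q2alg_def)
  have "norm X = 0 \<longleftrightarrow> (\<lambda>n. univ_norm R2 (x n)) \<longlonglongrightarrow> 0"
    using norm_cl_tendsto[OF x(1)] LIMSEQ_unique x(2) by auto
  also have "\<dots> \<longleftrightarrow> X = 0"
    using cl_eq_iff[of x "\<lambda>_. 0"] x by (simp add: zero_q2alg_def)
  finally show "norm X = 0 \<longleftrightarrow> X = 0" .
  show "norm (X + Y) \<le> norm X + norm Y"
    unfolding x y cl_simps(1)[OF x(1) y(1)]
    by (rule LIMSEQ_le[OF norm_cl_tendsto[OF Q2.C_add[OF x(1) y(1)]]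
          tendsto_add[OF norm_cl_tendsto[OF x(1)] norm_cl_tendsto[OF y(1)]]])
      (simp add: Q2.norm_triangle)
  show "norm (X * Y) \<le> norm X * norm Y"
    unfolding x y cl_simps(2)[OF x(1) y(1)]
    by (rule LIMSEQ_le[OF norm_cl_tendsto[OF Q2.C_mult[OF x(1) y(1)]]
          tendsto_mult[OF norm_cl_tendsto[OF x(1)] norm_cl_tendsto[OF y(1)]]])
      (simp add: Q2.norm_mult)
  show "norm (r *\<^sub>R X) = \<bar>r\<bar> * norm X"
    unfolding x cl_simps(5)[OF x(1)]
  proof (rule LIMSEQ_unique[OF norm_cl_tendsto[OF Q2.C_scale[OF x(1)]]])
    show "(\<lambda>n. univ_norm R2 (poly_scale (complex_of_real r) (x n))) \<longlonglongrightarrow> \<bar>r\<bar> * norm (cl x)"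
      using tendsto_mult[OF tendsto_const norm_cl_tendsto[OF x(1)], of "\<bar>r\<bar>"] by (simp add: Q2.norm_scale)
  qed
qed

end

instance q2alg :: banach
proof
  fix X :: "nat \<Rightarrow> q2alg" assume X: "Cauchy X"
  have "\<exists>x. x \<in> cauchy_seqs R2 \<and> X k = cl x" for k by (metis q2_cases)
  then obtain x where x: "\<And>k. x k \<in> cauchy_seqs R2" "\<And>k. X k = cl (x k)" by metis
  have n: "norm (X k - cl y) = cnorm (univ_cstar R2) (univ_class R2 (\<lambda>n. x k n - y n))"
    if "y \<in> cauchy_seqs R2" for k y
    using x that by (simp add: cl_simps norm_cl)
  have "\<exists>y\<in>cauchy_seqs R2. (\<lambda>k. cnorm (univ_cstar R2) (univ_class R2 (\<lambda>n. x k n - y n))) \<longlonglongrightarrow> 0"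
  proof (rule Q2.complete_U)
    fix e :: real assume "e > 0"
    then obtain N where N: "\<forall>k\<ge>N. \<forall>l\<ge>N. dist (X k) (X l) < e"
      using X by (meson metric_CauchyD)
    have "cnorm (univ_cstar R2) (univ_class R2 (\<lambda>n. x k n - x l n)) < e" if "k \<ge> N" "l \<ge> N" for k l
      using N[rule_format, OF that] n[OF x(1)[of l], of k] by (simp add: dist_norm x(2))
    then show "\<exists>N. \<forall>k\<ge>N. \<forall>l\<ge>N. cnorm (univ_cstar R2) (univ_class R2 (\<lambda>n. x k n - x l n)) < e" by blast
  qed (rule x)
  then obtain y where y: "y \<in> cauchy_seqs R2" "(\<lambda>k. norm (X k - cl y)) \<longlonglongrightarrow> 0"
    using n by auto
  from y(2) have "(\<lambda>k. X k - cl y) \<longlonglongrightarrow> 0" by (rule tendsto_norm_zero_cancel)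
  then have "X \<longlonglongrightarrow> cl y" by (rule LIM_zero_cancel)
  then show "convergent X" by (rule convergentI)
qed

instantiation q2alg :: cstar_algebra
begin

definition star_q2alg :: "q2alg \<Rightarrow> q2alg" where "star_q2alg X = Abs_q2 (star_op (graph_cstar Q2) (Rep_q2 X))"
definition cscale_q2alg :: "complex \<Rightarrow> q2alg \<Rightarrow> q2alg"
  where "cscale_q2alg c X = Abs_q2 (c \<odot>\<^bsub>graph_cstar Q2\<^esub> Rep_q2 X)"

lemma star_cl_aux: "x \<in> cauchy_seqs R2 \<Longrightarrow> (cl x)\<^sup>\<star> = cl (\<lambda>n. poly_adj (x n))"
  by (simp add: star_q2alg_def Rep_cl graph_cstar_def Q2.star_cls) (simp add: cl_def)

lemma cscale_cl_aux: "x \<in> cauchy_seqs R2 \<Longrightarrow> c *\<^sub>C cl x = cl (\<lambda>n. poly_scale c (x n))"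
  by (simp add: cscale_q2alg_def Rep_cl graph_cstar_def Q2.smult_cls) (simp add: cl_def)

instance
proof
  fix X Y :: q2alg and c d :: complex and r :: real
  obtain x where x: "x \<in> cauchy_seqs R2" "X = cl x" by (rule q2_cases)
  obtain y where y: "y \<in> cauchy_seqs R2" "Y = cl y" by (rule q2_cases)
  note [simp] = Q2.C_star_polys[OF x(1)] Q2.C_star_polys[OF y(1)]
  note defs = x y cl_simps star_cl_aux cscale_cl_aux
  show "(X\<^sup>\<star>)\<^sup>\<star> = X" "(X + Y)\<^sup>\<star> = X\<^sup>\<star> + Y\<^sup>\<star>" "(X * Y)\<^sup>\<star> = Y\<^sup>\<star> * X\<^sup>\<star>" "(c *\<^sub>C X)\<^sup>\<star> = cnj c *\<^sub>C X\<^sup>\<star>"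
    "(c + d) *\<^sub>C X = c *\<^sub>C X + d *\<^sub>C X" "c *\<^sub>C (X + Y) = c *\<^sub>C X + c *\<^sub>C Y"
    "c *\<^sub>C d *\<^sub>C X = (c * d) *\<^sub>C X" "complex_of_real r *\<^sub>C X = r *\<^sub>R X"
    "c *\<^sub>C X * Y = c *\<^sub>C (X * Y)" "X * c *\<^sub>C Y = c *\<^sub>C (X * Y)"
    by (simp_all add: defs poly_adj_add poly_adj_mult poly_adj_scale poly_scale_add poly_scale_add_left
        poly_scale_scale poly_scale_mult_left poly_scale_mult_right)
  show "norm (X\<^sup>\<star>) = norm X"
    unfolding x star_cl_aux[OF x(1)]
    using LIMSEQ_unique[OF norm_cl_tendsto[OF Q2.C_adj[OF x(1)]], of "norm (cl x)"] norm_cl_tendsto[OF x(1)]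
    by (simp add: Q2.norm_adj)
  show "norm (c *\<^sub>C X) = cmod c * norm X"
    unfolding x cscale_cl_aux[OF x(1)]
    using LIMSEQ_unique[OF norm_cl_tendsto[OF Q2.C_scale[OF x(1)]], of c "cmod c * norm (cl x)"]
      tendsto_mult[OF tendsto_const norm_cl_tendsto[OF x(1)], of "cmod c"]
    by (simp add: Q2.norm_scale)
  show "norm (X\<^sup>\<star> * X) = (norm X)\<^sup>2"
    unfolding x star_cl_aux[OF x(1)] cl_simps(2)[OF Q2.C_adj[OF x(1)] x(1)]
    using LIMSEQ_unique[OF norm_cl_tendsto[OF Q2.C_mult[OF Q2.C_adj[OF x(1)] x(1)]], of "(norm (cl x))\<^sup>2"]
      tendsto_power[OF norm_cl_tendsto[OF x(1)], of 2]
    by (simp add: Q2.norm_cstar)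
qed

end

lemmas star_cl = star_cl_aux
lemmas cscale_cl = cscale_cl_aux

definition elt :: "q2_poly \<Rightarrow> q2alg" where "elt p = cl (\<lambda>_. p)"

lemma elt_binary:
  assumes "p \<in> star_polys" "q \<in> star_polys"
  shows "elt (p + q) = elt p + elt q" "elt (p * q) = elt p * elt q" "elt (p - q) = elt p - elt q"
  using assms by (simp_all add: elt_def cl_simps)

lemma elt_unary:
  assumes "p \<in> star_polys"
  shows "elt (poly_adj p) = (elt p)\<^sup>\<star>" "elt (poly_scale c p) = c *\<^sub>C elt p" "norm (elt p) = univ_norm R2 p"
  using assms by (simp_all add: elt_def star_cl cscale_cl norm_cl Q2.norm_cls_const)

lemmas elt_simps = elt_binary elt_unary

lemma elt_0 [simp]: "elt 0 = 0"
  by (simp add: elt_def zero_q2alg_def)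

lemma elt_sum: "(\<And>i. i \<in> I \<Longrightarrow> f i \<in> star_polys) \<Longrightarrow> elt (\<Sum>i\<in>I. f i) = (\<Sum>i\<in>I. elt (f i))"
  by (induction I rule: infinite_finite_induct) (auto simp: elt_simps star_polys_sum)

lemma graph_relations_star_polys: "r \<in> graph_relations G \<Longrightarrow> r \<in> star_polys"
  unfolding graph_relations_def by (elim UnE CollectE exE conjE) (simp_all add: star_polys_sum)

lemma elt_rel: "r \<in> R2 \<Longrightarrow> elt r = 0"
proof -
  assume r: "r \<in> R2"
  then have "norm (elt r) = 0"
    using elt_unary(3)[OF graph_relations_star_polys[OF r]] Q2.norm_rel[OF r] by simp
  then show ?thesis by simp
qed

lemma elt_dense:
  assumes "e > 0" shows "\<exists>p\<in>star_polys. norm (X - elt p) < e"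
proof -
  obtain x where x: "x \<in> cauchy_seqs R2" "X = cl x" by (rule q2_cases)
  obtain N where N: "\<forall>m\<ge>N. \<forall>n\<ge>N. univ_norm R2 (x m - x n) < e / 2"
    by (rule Q2.C_D[OF x(1) half_gt_zero[OF assms]])
  have sp: "x N \<in> star_polys" by (rule Q2.C_star_polys[OF x(1)])
  have "X - elt (x N) = cl (\<lambda>n. x n - x N)"
    using x sp by (simp add: elt_def cl_simps)
  moreover have "norm (cl (\<lambda>n. x n - x N)) \<le> e / 2"
    by (rule LIMSEQ_le_const2[OF norm_cl_tendsto[OF Q2.C_diff[OF x(1) Q2.C_const[OF sp]]]])
      (use N in \<open>auto intro!: exI[of _ N] less_imp_le\<close>)
  ultimately show ?thesis using sp assms by (intro bexI[of _ "x N"]) auto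
qed

section \<open>The gauge action\<close>

lemma gauge_word_1: "cmod c = 1 \<Longrightarrow> gauge_word c w * gauge_word (cnj c) w = 1"
proof -
  assume c: "cmod c = 1"
  have cc: "c * cnj c = 1" using c by (simp add: complex_norm_square[symmetric])
  have l: "gauge_letter c l * gauge_letter (cnj c) l = 1" for l :: "('a, 'b) graph_gen letter"
    using cc by (induction c l rule: gauge_letter.induct) (simp_all add: mult.commute)
  have "(\<Prod>l\<leftarrow>ls. gauge_letter c l) * (\<Prod>l\<leftarrow>ls. gauge_letter (cnj c) l) = 1"
    for ls :: "('a, 'b) graph_gen letter list"
  proof (induction ls)
    case (Cons a ls)
    have "(\<Prod>l\<leftarrow>a # ls. gauge_letter c l) * (\<Prod>l\<leftarrow>a # ls. gauge_letter (cnj c) l)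
      = (gauge_letter c a * gauge_letter (cnj c) a) * ((\<Prod>l\<leftarrow>ls. gauge_letter c l) * (\<Prod>l\<leftarrow>ls. gauge_letter (cnj c) l))"
      by (simp add: mult_ac)
    then show ?case by (simp add: Cons l)
  qed simp
  then show ?thesis by (simp add: gauge_word_def)
qed

lemma poly_gauge_inverse: "cmod c = 1 \<Longrightarrow> poly_gauge (cnj c) (poly_gauge c p) = p"
  by (rule poly_mapping_eqI)
    (simp add: poly_gauge.rep_eq gauge_word_1 mult.commute[of "gauge_word (cnj c) _"] flip: mult.assoc)

text \<open>Every relation is homogeneous: the gauge map fixes it or multiplies it by
  \<open>c\<close>, the latter for the partial isometry relations and for edges outside the
  graph.\<close>

lemma graph_relations_gauge:
  assumes c: "cmod c = 1" and r: "r \<in> graph_relations G" and cs: "cstar_seminorm \<nu>"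
    and rel: "\<And>r. r \<in> graph_relations G \<Longrightarrow> \<nu> r = 0"
  shows "\<nu> (poly_gauge c r) = 0"
proof -
  have cc: "c * cnj c = 1" using c by (simp add: complex_norm_square[symmetric])
  have ss: "poly_gauge c (poly_adj (genS e) * genS e) = poly_adj (genS e) * genS e"
    "poly_gauge c (genS e * poly_adj (genS e)) = genS e * poly_adj (genS e)" for e :: 'b
    using cc by (simp_all add: poly_gauge_mult poly_gauge_adj poly_gauge_genS poly_adj_scale
        poly_scale_mult_left poly_scale_mult_right poly_scale_scale mult.commute)
  have gs: "poly_gauge c (\<Sum>e\<in>I. genS e * poly_adj (genS e)) = (\<Sum>e\<in>I. genS e * poly_adj (genS e))" for I :: "'b set"
    by (induction I rule: infinite_finite_induct) (simp_all add: poly_gauge_add ss)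
  have sss: "poly_gauge c (genS e * poly_adj (genS e) * genS e) = poly_scale c (genS e * poly_adj (genS e) * genS e)" for e :: 'b
    unfolding poly_gauge_mult[of c "_ * _"] ss poly_gauge_genS by (simp add: poly_scale_mult_right)
  have "poly_gauge c r = r \<or> poly_gauge c r = poly_scale c r"
    using r unfolding graph_relations_def
    by (elim UnE CollectE exE conjE)
      (simp_all add: poly_gauge_diff poly_gauge_adj poly_gauge_genP poly_gauge_mult[of c "genP _"] ss sss gs
        poly_gauge_genS poly_scale_diff)
  then show ?thesis
    using rel[OF r] cstar_seminormD(3)[OF cs graph_relations_star_polys[OF r], of c] by auto
qed

text \<open>Composition with a gauge map carries admissible seminorms to admissible ones, hence one
  inequality. The conjugate scalar gives the inverse map and thereby the other.\<close>

lemma univ_norm_gauge: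
  assumes c: "cmod c = 1" and p: "p \<in> star_polys"
  shows "univ_norm (graph_relations G) (poly_gauge c p) = univ_norm (graph_relations G) p"
proof -
  interpret bounded_relations "graph_relations G" by (rule bounded_graph_relations)
  have le: "univ_norm (graph_relations G) (poly_gauge c p) \<le> univ_norm (graph_relations G) p"
    if c: "cmod c = 1" and p: "p \<in> star_polys" for c p
  proof (rule norm_leI)
    fix \<nu> assume nu: "\<nu> \<in> rel_seminorms (graph_relations G)"
    then have cs: "cstar_seminorm \<nu>" and rel: "\<And>r. r \<in> graph_relations G \<Longrightarrow> \<nu> r = 0"
      by (auto simp: rel_seminorms_def)
    have "(\<lambda>q. \<nu> (poly_gauge c q)) \<in> rel_seminorms (graph_relations G)"
      unfolding rel_seminorms_def cstar_seminorm_def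
      using cstar_seminormD[OF cs] graph_relations_gauge[OF c _ cs rel]
      by (auto simp: poly_gauge_add poly_gauge_scale poly_gauge_mult poly_gauge_adj)
    then show "\<nu> (poly_gauge c p) \<le> univ_norm (graph_relations G) p"
      using seminorm_le[OF p] by fastforce
  qed
  show ?thesis
    using le[OF c p] le[of "cnj c" "poly_gauge c p"] c p by (simp add: poly_gauge_inverse)
qed

definition gauge_map :: "complex \<Rightarrow> q2alg \<Rightarrow> q2alg" where
  "gauge_map c X = Abs_q2 (gauge Q2 c (Rep_q2 X))"

lemma gauge_lipschitz:
  assumes "cmod c = 1" "p \<in> star_polys" "q \<in> star_polys"
  shows "univ_norm R2 (poly_gauge c p - poly_gauge c q) \<le> 1 * univ_norm R2 (p - q)"
  using univ_norm_gauge[OF assms(1), of "p - q" Q2] assms by (simp add: poly_gauge_diff)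

lemma C_gauge: "cmod c = 1 \<Longrightarrow> x \<in> cauchy_seqs R2 \<Longrightarrow> (\<lambda>n. poly_gauge c (x n)) \<in> cauchy_seqs R2"
  by (rule Q2.C_lipschitz[where T = "poly_gauge c", OF _ star_polys_gauge gauge_lipschitz])

lemma gauge_class:
  assumes c: "cmod c = 1" and x: "x \<in> cauchy_seqs R2"
  shows "gauge Q2 c (univ_class R2 x) = univ_class R2 (\<lambda>n. poly_gauge c (x n))"
  unfolding gauge_def
proof (rule Q2.UN_cls[OF x])
  fix x' assume x': "(x, x') \<in> null_rel R2"
  show "univ_class R2 (\<lambda>n. poly_gauge c (x' n)) = univ_class R2 (\<lambda>n. poly_gauge c (x n))"
    by (rule Q2.cls_lipschitz[where T = "poly_gauge c", OF x x' star_polys_gauge gauge_lipschitz[OF c]])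
qed

lemma gauge_cl: "cmod c = 1 \<Longrightarrow> x \<in> cauchy_seqs R2 \<Longrightarrow> gauge_map c (cl x) = cl (\<lambda>n. poly_gauge c (x n))"
  by (simp add: gauge_map_def Rep_cl gauge_class) (simp add: cl_def)

lemma Rep_gauge: "cmod c = 1 \<Longrightarrow> Rep_q2 (gauge_map c X) = gauge Q2 c (Rep_q2 X)"
proof -
  assume c: "cmod c = 1"
  obtain x where x: "x \<in> cauchy_seqs R2" "X = cl x" by (rule q2_cases)
  show ?thesis by (simp add: x gauge_cl[OF c x(1)] Rep_cl C_gauge[OF c x(1)] gauge_class[OF c x(1)])
qed

lemma gauge_simps:
  assumes c: "cmod c = 1"
  shows "gauge_map c (X + Y) = gauge_map c X + gauge_map c Y"
    "gauge_map c (X * Y) = gauge_map c X * gauge_map c Y"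
    "gauge_map c (X\<^sup>\<star>) = (gauge_map c X)\<^sup>\<star>" "gauge_map c (d *\<^sub>C X) = d *\<^sub>C gauge_map c X"
    "norm (gauge_map c X) = norm X"
proof -
  obtain x where x: "x \<in> cauchy_seqs R2" "X = cl x" by (rule q2_cases)
  obtain y where y: "y \<in> cauchy_seqs R2" "Y = cl y" by (rule q2_cases)
  note [simp] = Q2.C_star_polys[OF x(1)] C_gauge[OF c x(1)] C_gauge[OF c y(1)]
  note defs = x y cl_simps star_cl cscale_cl gauge_cl[OF c]
  show "gauge_map c (X + Y) = gauge_map c X + gauge_map c Y"
    "gauge_map c (X * Y) = gauge_map c X * gauge_map c Y"
    "gauge_map c (X\<^sup>\<star>) = (gauge_map c X)\<^sup>\<star>" "gauge_map c (d *\<^sub>C X) = d *\<^sub>C gauge_map c X"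
    by (simp_all add: defs poly_gauge_add poly_gauge_mult poly_gauge_adj poly_gauge_scale)
  show "norm (gauge_map c X) = norm X"
    unfolding x gauge_cl[OF c x(1)]
    using LIMSEQ_unique[OF norm_cl_tendsto[OF C_gauge[OF c x(1)]], of "norm (cl x)"] norm_cl_tendsto[OF x(1)]
    by (simp add: univ_norm_gauge[OF c])
qed

lemma gauge_elt: "cmod c = 1 \<Longrightarrow> p \<in> star_polys \<Longrightarrow> gauge_map c (elt p) = elt (poly_gauge c p)"
  by (simp add: elt_def gauge_cl)

lemma gauge_0 [simp]: "cmod c = 1 \<Longrightarrow> gauge_map c 0 = 0"
  using gauge_elt[of c 0] by simp

lemma gauge_diff: "cmod c = 1 \<Longrightarrow> gauge_map c (X - Y) = gauge_map c X - gauge_map c Y"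
  using gauge_simps(1)[of c "X - Y" Y] by (simp add: eq_diff_eq)

lemma gauge_sum: "cmod c = 1 \<Longrightarrow> gauge_map c (\<Sum>i\<in>I. f i) = (\<Sum>i\<in>I. gauge_map c (f i))"
  by (induction I rule: infinite_finite_induct) (simp_all add: gauge_simps)

definition core :: "q2alg set" where
  "core = {X. \<forall>c. cmod c = 1 \<longrightarrow> gauge_map c X = X}"

lemma subalgebra_core: "subalgebra core"
  by (auto simp: subalgebra_def core_def gauge_simps)

text \<open>Gauge maps are isometric, hence continuous, and their fixed points form closed
  sets.\<close>

lemma closed_core: "closed core"
  unfolding closed_sequential_limits
proof (intro allI impI)
  fix x l assume x: "(\<forall>n. x n \<in> core) \<and> x \<longlonglongrightarrow> l"
  have "gauge_map c l = l" if c: "cmod c = 1" for c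
  proof -
    have "norm (gauge_map c l - x n) = norm (l - x n)" for n
      using gauge_simps(5)[OF c, of "l - x n"] gauge_diff[OF c, of l "x n"] x c by (simp add: core_def)
    moreover have "(\<lambda>n. norm (l - x n)) \<longlonglongrightarrow> 0"
      using tendsto_norm[OF tendsto_diff[OF tendsto_const conjunct2[OF x]], of l] by simp
    ultimately have "(\<lambda>n. norm (gauge_map c l - x n)) \<longlonglongrightarrow> 0" by simp
    then have "(\<lambda>n. gauge_map c l - x n) \<longlonglongrightarrow> 0" by (rule tendsto_norm_zero_cancel)
    from tendsto_diff[OF tendsto_const this, of "gauge_map c l"] have "x \<longlonglongrightarrow> gauge_map c l" by simp
    then show ?thesis using x LIMSEQ_unique by blast
  qed
  then show "l \<in> core" by (simp add: core_def)
qed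

lemma complete_core: "complete core"
  using closed_core by (simp add: complete_eq_closed)

section \<open>Generators and relations\<close>

definition Pa :: q2alg where "Pa = elt (genP V00)"
definition Pb :: q2alg where "Pb = elt (genP V01)"
definition Pc :: q2alg where "Pc = elt (genP V11)"
definition Se :: q2alg where "Se = elt (genS Loop00)"
definition Sf :: q2alg where "Sf = elt (genS E00_01)"
definition Sg :: q2alg where "Sg = elt (genS E00_11)"
definition Sh :: q2alg where "Sh = elt (genS Loop01)"

lemmas gen_defs = Pa_def Pb_def Pc_def Se_def Sf_def Sg_def Sh_def

lemma out_arcs_Q2:
  "out_arcs Q2 V00 = {Loop00, E00_01, E00_11}" "out_arcs Q2 V01 = {Loop01}" "out_arcs Q2 V11 = {}"
  by (auto simp: out_arcs_def Q2_def split: Q2_edge.splits) (metis Q2_edge.exhaust)+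

lemma Q2_verts: "v \<in> verts Q2" by (cases v) (auto simp: Q2_def)

lemma Q2_arcs: "e \<in> arcs Q2" by (cases e) (auto simp: Q2_def)

lemma is_proj_vertex: "is_proj (elt (genP v))"
proof -
  have "elt (poly_adj (genP v) - genP v) = 0" "elt (genP v * genP v - genP v) = 0"
    using Q2_verts by (auto intro!: elt_rel simp: graph_relations_def)
  then show ?thesis by (simp add: elt_simps is_proj_def)
qed

lemma vertex_orth: "v \<noteq> w \<Longrightarrow> elt (genP v) * elt (genP w) = 0"
proof -
  assume "v \<noteq> w"
  then have "genP v * genP w \<in> R2" using Q2_verts unfolding graph_relations_def by blast
  then show ?thesis using elt_rel[of "genP v * genP w"] by (simp add: elt_simps)
qed

lemma edge_range: "(elt (genS e))\<^sup>\<star> * elt (genS e) = elt (genP (head Q2 e))"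
proof -
  have "elt (poly_adj (genS e) * genS e - genP (head Q2 e)) = 0"
    using Q2_arcs by (intro elt_rel) (auto simp: graph_relations_def)
  then show ?thesis by (simp add: elt_simps)
qed

lemma edge_partial_isometry: "elt (genS e) * elt (genP (head Q2 e)) = elt (genS e)"
proof -
  have "elt (genS e * poly_adj (genS e) * genS e - genS e) = 0"
    using Q2_arcs by (intro elt_rel) (auto simp: graph_relations_def)
  then show ?thesis by (simp add: elt_simps mult.assoc edge_range)
qed

lemma is_proj_range: "is_proj (elt (genS e) * (elt (genS e))\<^sup>\<star>)"
proof -
  let ?s = "elt (genS e)"
  have "?s * ?s\<^sup>\<star> * (?s * ?s\<^sup>\<star>) = ?s * (?s\<^sup>\<star> * ?s) * ?s\<^sup>\<star>" by (simp only: mult.assoc)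
  then show ?thesis
    by (simp add: is_proj_def star_mult edge_range edge_partial_isometry)
qed

lemma ck_relations: "Se * Se\<^sup>\<star> + Sf * Sf\<^sup>\<star> + Sg * Sg\<^sup>\<star> = Pa" "Sh * Sh\<^sup>\<star> = Pb"
proof -
  have "elt ((\<Sum>e\<in>out_arcs Q2 v. genS e * poly_adj (genS e)) - genP v) = 0" if "out_arcs Q2 v \<noteq> {}" for v
  proof (rule elt_rel)
    show "(\<Sum>e\<in>out_arcs Q2 v. genS e * poly_adj (genS e)) - genP v \<in> R2"
      using that Q2_verts[of v] unfolding graph_relations_def Un_iff mem_Collect_eq by fast
  qed
  from this[of V00] this[of V01] show "Se * Se\<^sup>\<star> + Sf * Sf\<^sup>\<star> + Sg * Sg\<^sup>\<star> = Pa" "Sh * Sh\<^sup>\<star> = Pb"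
    by (simp_all add: out_arcs_Q2 elt_simps gen_defs add.assoc)
qed

lemma proj_P: "is_proj Pa" "is_proj Pb" "is_proj Pc"
  by (simp_all add: gen_defs is_proj_vertex)

lemma star_P [simp]: "Pa\<^sup>\<star> = Pa" "Pb\<^sup>\<star> = Pb" "Pc\<^sup>\<star> = Pc"
  using proj_P by (auto simp: is_proj_def)

lemma P_mult: "Pa * Pa = Pa" "Pb * Pb = Pb" "Pc * Pc = Pc" "Pa * Pb = 0" "Pb * Pa = 0"
  "Pa * Pc = 0" "Pc * Pa = 0" "Pb * Pc = 0" "Pc * Pb = 0"
  using proj_P by (auto simp: is_proj_def gen_defs vertex_orth)

lemma star_S_mult: "Se\<^sup>\<star> * Se = Pa" "Sf\<^sup>\<star> * Sf = Pb" "Sg\<^sup>\<star> * Sg = Pc" "Sh\<^sup>\<star> * Sh = Pb"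
  using edge_range[of Loop00] edge_range[of E00_01] edge_range[of E00_11] edge_range[of Loop01]
  by (simp_all add: gen_defs Q2_def)

lemma S_P: "Se * Pa = Se" "Sf * Pb = Sf" "Sg * Pc = Sg" "Sh * Pb = Sh"
  using edge_partial_isometry[of Loop00] edge_partial_isometry[of E00_01]
    edge_partial_isometry[of E00_11] edge_partial_isometry[of Loop01]
  by (simp_all add: gen_defs Q2_def)

text \<open>The range projections add up to the projection \<open>Pa\<close>, so
  \<open>proj_sum_orthogonal\<close> applies to every arrangement of the three.\<close>

lemma star_S_orth: "Se\<^sup>\<star> * Sf = 0" "Se\<^sup>\<star> * Sg = 0" "Sf\<^sup>\<star> * Sg = 0"
  "Sf\<^sup>\<star> * Se = 0" "Sg\<^sup>\<star> * Se = 0" "Sg\<^sup>\<star> * Sf = 0"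
proof -
  have proj: "is_proj (Se * Se\<^sup>\<star>)" "is_proj (Sf * Sf\<^sup>\<star>)" "is_proj (Sg * Sg\<^sup>\<star>)"
    by (simp_all add: gen_defs is_proj_range)
  \<comment> \<open>Writing \<open>v\<close> as \<open>v * (v\<^sup>\<star> * v)\<close>, and
    \<open>w\<close> likewise, brings the product of the range projections into the middle.\<close>
  have orth: "v\<^sup>\<star> * w = 0"
    if "v * v\<^sup>\<star> * (w * w\<^sup>\<star>) = 0" "v * (v\<^sup>\<star> * v) = v" "w * (w\<^sup>\<star> * w) = w" for v w :: q2alg
  proof -
    have "v\<^sup>\<star> * w = (v * (v\<^sup>\<star> * v))\<^sup>\<star> * (w * (w\<^sup>\<star> * w))" using that by simp
    also have "\<dots> = v\<^sup>\<star> * (v * v\<^sup>\<star> * (w * w\<^sup>\<star>)) * w" by (simp add: star_mult mult.assoc)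
    finally show ?thesis using that by simp
  qed
  have "Sf * Sf\<^sup>\<star> * (Se * Se\<^sup>\<star>) = 0" "Sg * Sg\<^sup>\<star> * (Se * Se\<^sup>\<star>) = 0" "Sg * Sg\<^sup>\<star> * (Sf * Sf\<^sup>\<star>) = 0"
    using ck_relations(1)
    by (auto intro!: proj_sum_orthogonal[OF proj(1,2,3) proj_P(1)] proj_sum_orthogonal[OF proj(1,3,2) proj_P(1)]
        proj_sum_orthogonal[OF proj(2,3,1) proj_P(1)] simp: add_ac)
  then show 1: "Sf\<^sup>\<star> * Se = 0" "Sg\<^sup>\<star> * Se = 0" "Sg\<^sup>\<star> * Sf = 0"
    by (auto intro!: orth simp: star_S_mult S_P)
  show "Se\<^sup>\<star> * Sf = 0" "Se\<^sup>\<star> * Sg = 0" "Sf\<^sup>\<star> * Sg = 0"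
    using 1 by (metis star_0 star_mult star_star)+
qed

lemma P_S: "Pa * Se = Se" "Pa * Sf = Sf" "Pa * Sg = Sg" "Pb * Sh = Sh"
  unfolding ck_relations[symmetric]
  by (simp_all add: distrib_right mult.assoc star_S_mult star_S_orth S_P)

lemma star_S_P: "Se\<^sup>\<star> * Pa = Se\<^sup>\<star>" "Sf\<^sup>\<star> * Pa = Sf\<^sup>\<star>" "Sg\<^sup>\<star> * Pa = Sg\<^sup>\<star>" "Sh\<^sup>\<star> * Pb = Sh\<^sup>\<star>"
  "Pa * Se\<^sup>\<star> = Se\<^sup>\<star>" "Pb * Sf\<^sup>\<star> = Sf\<^sup>\<star>" "Pc * Sg\<^sup>\<star> = Sg\<^sup>\<star>" "Pb * Sh\<^sup>\<star> = Sh\<^sup>\<star>"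
  using P_S S_P by (metis star_mult star_P)+

lemma letter_zero: "x * P = x \<Longrightarrow> P * Q = 0 \<Longrightarrow> x * Q = 0" "Q * x = x \<Longrightarrow> P * Q = 0 \<Longrightarrow> P * x = 0"
  for x P Q :: q2alg
  by (metis mult.assoc mult_zero_right, metis mult.assoc mult_zero_left)

lemma S_zero:
  "Se * Pb = 0" "Se * Pc = 0" "Sf * Pa = 0" "Sf * Pc = 0" "Sg * Pa = 0" "Sg * Pb = 0" "Sh * Pa = 0" "Sh * Pc = 0"
  "Se\<^sup>\<star> * Pb = 0" "Se\<^sup>\<star> * Pc = 0" "Sf\<^sup>\<star> * Pb = 0" "Sf\<^sup>\<star> * Pc = 0" "Sg\<^sup>\<star> * Pb = 0" "Sg\<^sup>\<star> * Pc = 0"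
  "Sh\<^sup>\<star> * Pa = 0" "Sh\<^sup>\<star> * Pc = 0"
  "Pb * Se = 0" "Pc * Se = 0" "Pb * Sf = 0" "Pc * Sf = 0" "Pb * Sg = 0" "Pc * Sg = 0" "Pa * Sh = 0" "Pc * Sh = 0"
  by (rule letter_zero(1)[OF S_P(1) P_mult(4)] letter_zero(1)[OF S_P(1) P_mult(6)]
      letter_zero(1)[OF S_P(2) P_mult(5)] letter_zero(1)[OF S_P(2) P_mult(8)]
      letter_zero(1)[OF S_P(3) P_mult(7)] letter_zero(1)[OF S_P(3) P_mult(9)]
      letter_zero(1)[OF S_P(4) P_mult(5)] letter_zero(1)[OF S_P(4) P_mult(8)]
      letter_zero(1)[OF star_S_P(1) P_mult(4)] letter_zero(1)[OF star_S_P(1) P_mult(6)]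
      letter_zero(1)[OF star_S_P(2) P_mult(4)] letter_zero(1)[OF star_S_P(2) P_mult(6)]
      letter_zero(1)[OF star_S_P(3) P_mult(4)] letter_zero(1)[OF star_S_P(3) P_mult(6)]
      letter_zero(1)[OF star_S_P(4) P_mult(5)] letter_zero(1)[OF star_S_P(4) P_mult(8)]
      letter_zero(2)[OF P_S(1) P_mult(5)] letter_zero(2)[OF P_S(1) P_mult(7)]
      letter_zero(2)[OF P_S(2) P_mult(5)] letter_zero(2)[OF P_S(2) P_mult(7)]
      letter_zero(2)[OF P_S(3) P_mult(5)] letter_zero(2)[OF P_S(3) P_mult(7)]
      letter_zero(2)[OF P_S(4) P_mult(4)] letter_zero(2)[OF P_S(4) P_mult(9)])+

text \<open>For rewriting right-nested products.\<close>

lemma mult_assoc_eq: "x * y = w \<Longrightarrow> x * (y * z) = w * z" for x y z w :: q2alg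
  by (simp flip: mult.assoc)

lemmas gen_mult = P_mult star_S_mult ck_relations(2) star_S_orth P_S S_P star_S_P S_zero
lemmas gen_mult' = gen_mult gen_mult[THEN mult_assoc_eq]

section \<open>Normal forms of words\<close>

text \<open>The paths \<open>e\<^sup>k\<close>; the paths to \<open>V01\<close>, multiplied by a power of the unitary \<open>h\<^sup>*\<close> of its
  corner so as to have degree \<open>0\<close>; the paths to \<open>V11\<close>.\<close>

fun epow :: "nat \<Rightarrow> q2alg" where
  "epow 0 = Pa"
| "epow (Suc k) = Se * epow k"

fun hpow :: "nat \<Rightarrow> q2alg" where
  "hpow 0 = Pb"
| "hpow (Suc k) = Sh * hpow k"

text \<open>\<open>Sh\<close> is unitary in the corner of \<open>Pb\<close>, so its adjoint supplies
  the negative powers, and left multiplication by \<open>Sh\<close> or its adjoint moves the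
  exponent by one in either direction.\<close>

definition hpowi :: "int \<Rightarrow> q2alg" where
  "hpowi n = (if n \<ge> 0 then hpow (nat n) else (hpow (nat (- n)))\<^sup>\<star>)"

fun yb :: "nat \<Rightarrow> q2alg" where
  "yb 0 = Pb"
| "yb (Suc 0) = Sf * Sh\<^sup>\<star>"
| "yb (Suc (Suc i)) = Se * yb (Suc i) * Sh\<^sup>\<star>"

fun zc :: "nat \<Rightarrow> q2alg" where
  "zc 0 = Pc"
| "zc (Suc 0) = Sg"
| "zc (Suc (Suc i)) = Se * zc (Suc i)"

lemma epow_P: "Pa * epow k = epow k" "epow k * Pa = epow k"
  by (induction k) (simp_all add: gen_mult' mult.assoc)

lemma epow_comm: "epow k * Se = Se * epow k"
  by (induction k) (simp_all add: gen_mult' mult.assoc)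

lemma hpow_P: "Pb * hpow k = hpow k" "hpow k * Pb = hpow k"
  by (induction k) (simp_all add: gen_mult' mult.assoc)

lemma hpow_comm: "hpow k * Sh = Sh * hpow k"
  by (induction k) (simp_all add: gen_mult' mult.assoc)

lemma star_hpow_Suc: "(hpow (Suc k))\<^sup>\<star> = Sh\<^sup>\<star> * (hpow k)\<^sup>\<star>"
  by (simp add: hpow_comm[symmetric] star_mult)

lemma star_hpow_P: "Pb * (hpow k)\<^sup>\<star> = (hpow k)\<^sup>\<star>"
  using hpow_P(2)[of k] by (metis star_P(2) star_mult)

lemma yb_Suc_P: "Pa * yb (Suc i) = yb (Suc i)"
  by (cases i) (simp_all add: gen_mult' mult.assoc)

lemma yb_P: "yb i * Pb = yb i"
  by (induction i rule: yb.induct) (simp_all add: gen_mult' mult.assoc)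

lemma zc_Suc_P: "Pa * zc (Suc i) = zc (Suc i)"
  by (cases i) (simp_all add: gen_mult' mult.assoc)

lemma zc_P: "zc i * Pc = zc i"
  by (induction i rule: zc.induct) (simp_all add: gen_mult' mult.assoc)

lemma hpowi_0 [simp]: "hpowi 0 = Pb"
  by (simp add: hpowi_def)

lemma hpowi_P: "Pb * hpowi n = hpowi n"
  by (simp add: hpowi_def hpow_P star_hpow_P)

lemma Sh_U: "Sh * hpowi n = hpowi (n + 1)"
proof (cases "n \<ge> 0")
  case True
  then have "nat (n + 1) = Suc (nat n)" by simp
  then show ?thesis using True by (simp add: hpowi_def)
next
  case False
  then obtain k where k: "n = - int (Suc k)" by (metis int_cases of_nat_0_le_iff)
  then have "nat (- n) = Suc k" "\<not> n \<ge> 0" by simp_all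
  then have Un: "hpowi n = (hpow (Suc k))\<^sup>\<star>" by (simp only: hpowi_def if_False)
  have "Sh * hpowi n = Sh * (Sh\<^sup>\<star> * (hpow k)\<^sup>\<star>)" by (simp only: Un star_hpow_Suc)
  also have "\<dots> = (hpow k)\<^sup>\<star>" by (simp only: gen_mult' star_hpow_P)
  finally have "Sh * hpowi n = (hpow k)\<^sup>\<star>" .
  moreover have "hpowi (- int k) = (hpow k)\<^sup>\<star>" by (cases "k = 0") (simp_all add: hpowi_def)
  moreover have "n + 1 = - int k" using k by simp
  ultimately show ?thesis by simp
qed

lemma star_Sh_U: "Sh\<^sup>\<star> * hpowi n = hpowi (n - 1)"
proof -
  have "hpowi n = Sh * hpowi (n - 1)" by (simp add: Sh_U)
  then show ?thesis by (simp add: gen_mult' hpowi_P)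
qed

lemma yb_hpow: "yb (Suc l) * hpow (Suc l) = epow l * Sf"
proof (induction l)
  case (Suc l)
  have "yb (Suc (Suc l)) * hpow (Suc (Suc l)) = Se * yb (Suc l) * (Sh\<^sup>\<star> * (Sh * hpow (Suc l)))"
    by (simp only: yb.simps hpow.simps mult.assoc)
  also have "Sh\<^sup>\<star> * (Sh * hpow (Suc l)) = hpow (Suc l)"
    by (simp only: gen_mult' hpow_P)
  finally show ?case using Suc by (simp only: mult.assoc epow.simps)
qed (simp add: gen_mult' mult.assoc)

lemma zc_Suc: "zc (Suc l) = epow l * Sg"
  by (induction l) (simp_all add: gen_mult' mult.assoc)

text \<open>In the first and third family the degree fixes the difference of the lengths. In the
  second it sits in the power of \<open>Sh\<close>, and \<open>i\<close>, \<open>j\<close> are free: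
  degree 0 leaves a full system of matrix units there, and only diagonal elements in the other
  two.\<close>

definition NF :: "int \<Rightarrow> q2alg \<Rightarrow> bool" where
  "NF d X \<longleftrightarrow> X = 0 \<or> (\<exists>k l. d = int k - int l \<and> X = epow k * (epow l)\<^sup>\<star>)
     \<or> (\<exists>i j. X = yb i * (hpowi d * (yb j)\<^sup>\<star>)) \<or> (\<exists>i j. d = int i - int j \<and> X = zc i * (zc j)\<^sup>\<star>)"

lemma NF_0: "NF d 0"
  by (simp add: NF_def)

lemma NF_a: "d = int k - int l \<Longrightarrow> NF d (epow k * (epow l)\<^sup>\<star>)"
  and NF_b: "NF d (yb i * (hpowi d * (yb j)\<^sup>\<star>))"
  and NF_c: "d = int i - int j \<Longrightarrow> NF d (zc i * (zc j)\<^sup>\<star>)"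
  unfolding NF_def by blast+

fun letter_val :: "(Q2_vertex, Q2_edge) graph_gen letter \<Rightarrow> q2alg" where
  "letter_val (Gen x) = elt (gen x)"
| "letter_val (Adj x) = (elt (gen x))\<^sup>\<star>"

fun letter_deg :: "('v, 'e) graph_gen letter \<Rightarrow> int" where
  "letter_deg (Gen (Vertex v)) = 0"
| "letter_deg (Adj (Vertex v)) = 0"
| "letter_deg (Gen (Edge e)) = 1"
| "letter_deg (Adj (Edge e)) = - 1"

lemma letter_cases:
  "(letter_val l, letter_deg l) \<in> {(Pa, 0), (Pb, 0), (Pc, 0), (Se, 1), (Sf, 1), (Sg, 1), (Sh, 1),
     (Se\<^sup>\<star>, - 1), (Sf\<^sup>\<star>, - 1), (Sg\<^sup>\<star>, - 1), (Sh\<^sup>\<star>, - 1)}"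
proof -
  have v: "elt (genP v) \<in> {Pa, Pb, Pc}" for v by (cases v) (auto simp: gen_defs)
  have e: "elt (genS e) \<in> {Se, Sf, Sg, Sh}" for e by (cases e) (auto simp: gen_defs)
  have v': "(elt (genP v))\<^sup>\<star> \<in> {Pa, Pb, Pc}" for v using v[of v] by auto
  have e': "(elt (genS e))\<^sup>\<star> \<in> {Se\<^sup>\<star>, Sf\<^sup>\<star>, Sg\<^sup>\<star>, Sh\<^sup>\<star>}" for e using e[of e] by auto
  show ?thesis
  proof (cases l)
    case (Gen x) then show ?thesis using v e by (cases x) auto
  next
    case (Adj x) then show ?thesis using v' e' by (cases x) auto
  qed
qed

lemma letter_epow:
  assumes l: "(x, \<delta>) \<in> {(Pa, 0), (Pb, 0), (Pc, 0), (Se, 1), (Sf, 1), (Sg, 1), (Sh, 1),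
     (Se\<^sup>\<star>, - 1), (Sf\<^sup>\<star>, - 1), (Sg\<^sup>\<star>, - 1), (Sh\<^sup>\<star>, - 1)}"
  shows "NF (\<delta> + (int k - int l)) (x * (epow k * (epow l)\<^sup>\<star>))"
proof -
  have P: "Pa * (epow l)\<^sup>\<star> = (epow l)\<^sup>\<star>" using epow_P(2)[of l] by (metis star_P(1) star_mult)
  have zero: "x * (epow k * z) = 0" if "x * Pa = 0" for z
    using that epow_P(1)[of k] by (metis mult.assoc mult_zero_left)
  have e: "Se\<^sup>\<star> * (epow l)\<^sup>\<star> = Pa * (epow (Suc l))\<^sup>\<star>"
    using epow_P(2)[of "Suc l"] epow_comm[of l] by (metis epow.simps(2) star_P(1) star_mult)
  \<comment> \<open>By \<open>yb_hpow\<close> the path \<open>epow l * Sf\<close> is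
    \<open>yb (Suc l)\<close> times a power of \<open>Sh\<close>. Here the first family passes into
    the second; by \<open>zc_Suc\<close> it passes likewise into the third.\<close>
  have "Sf\<^sup>\<star> * (epow l)\<^sup>\<star> = (hpow (Suc l))\<^sup>\<star> * (yb (Suc l))\<^sup>\<star>"
    using yb_hpow[of l] by (metis star_mult)
  also have "(hpow (Suc l))\<^sup>\<star> = yb 0 * hpowi (- 1 + - int l)"
    using star_hpow_P[of "Suc l"] by (simp add: hpowi_def nat_add_distrib del: hpow.simps)
  finally have f: "Sf\<^sup>\<star> * (epow l)\<^sup>\<star> = yb 0 * (hpowi (- 1 + - int l) * (yb (Suc l))\<^sup>\<star>)" by (simp add: mult.assoc)
  have "Sg\<^sup>\<star> * (epow l)\<^sup>\<star> = (zc (Suc l))\<^sup>\<star>" using zc_Suc[of l] by (metis star_mult)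
  then have g: "Sg\<^sup>\<star> * (epow l)\<^sup>\<star> = zc 0 * (zc (Suc l))\<^sup>\<star>"
    using zc_P[of "Suc l"] by (metis star_P(3) star_mult zc.simps(1))
  from l consider "x = Pa" "\<delta> = 0" | "x = Se" "\<delta> = 1" | "x = Se\<^sup>\<star>" "\<delta> = - 1" | "x = Sf\<^sup>\<star>" "\<delta> = - 1"
    | "x = Sg\<^sup>\<star>" "\<delta> = - 1" | "x * Pa = 0"
    using gen_mult by auto
  then show ?thesis
  proof cases
    case 1
    have "x * (epow k * (epow l)\<^sup>\<star>) = epow k * (epow l)\<^sup>\<star>" using 1 epow_P(1)[of k] by (simp flip: mult.assoc)
    then show ?thesis using 1 by (simp add: NF_a)
  next
    case 2
    have "x * (epow k * (epow l)\<^sup>\<star>) = epow (Suc k) * (epow l)\<^sup>\<star>" using 2 by (simp add: mult.assoc)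
    then show ?thesis using 2 by (metis NF_a add_diff_eq int_Suc add.commute)
  next
    case 3
    show ?thesis
    proof (cases k)
      case 0
      have "x * (epow k * (epow l)\<^sup>\<star>) = epow 0 * (epow (Suc l))\<^sup>\<star>" using 0 3 P e by (simp del: epow.simps(2))
      then show ?thesis using 0 3 NF_a[of "- 1 - int l" 0 "Suc l"] by simp
    next
      case (Suc k')
      have "x * (epow k * (epow l)\<^sup>\<star>) = epow k' * (epow l)\<^sup>\<star>"
        using 3 Suc epow_P(1)[of k'] by (simp add: mult.assoc gen_mult') (simp flip: mult.assoc)
      then show ?thesis using Suc 3 NF_a[of "int k' - int l" k' l] by simp
    qed
  next
    case 4
    show ?thesis
    proof (cases k)
      case 0
      then show ?thesis using 4 P f NF_b[of "- 1 + - int l" 0 "Suc l"] by simp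
    next
      case (Suc k')
      then have "x * (epow k * (epow l)\<^sup>\<star>) = 0" using 4 by (simp add: mult.assoc gen_mult')
      then show ?thesis by (simp add: NF_0)
    qed
  next
    case 5
    show ?thesis
    proof (cases k)
      case 0
      then show ?thesis using 5 P g NF_c[of "- 1 + - int l" 0 "Suc l"] by simp
    next
      case (Suc k')
      then have "x * (epow k * (epow l)\<^sup>\<star>) = 0" using 5 by (simp add: mult.assoc gen_mult')
      then show ?thesis by (simp add: NF_0)
    qed
  next
    case 6
    then show ?thesis using zero by (simp add: NF_0)
  qed
qed

lemma letter_yb:
  assumes l: "(x, \<delta>) \<in> {(Pa, 0), (Pb, 0), (Pc, 0), (Se, 1), (Sf, 1), (Sg, 1), (Sh, 1),
     (Se\<^sup>\<star>, - 1), (Sf\<^sup>\<star>, - 1), (Sg\<^sup>\<star>, - 1), (Sh\<^sup>\<star>, - 1)}"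
  shows "NF (\<delta> + d) (x * (yb i * (hpowi d * (yb j)\<^sup>\<star>)))"
proof (cases i)
  case 0
  have PU: "Pb * (hpowi d * z) = hpowi d * z" for d z by (simp add: hpowi_P flip: mult.assoc)
  have ShU: "Sh * (hpowi d * z) = hpowi (1 + d) * z" "Sh\<^sup>\<star> * (hpowi d * z) = hpowi (- 1 + d) * z" for d z
    using Sh_U[of d] star_Sh_U[of d] by (simp_all add: add.commute flip: mult.assoc)
  from l consider "x = Pb" "\<delta> = 0" | "x = Sf" "\<delta> = 1" | "x = Sh" "\<delta> = 1" | "x = Sh\<^sup>\<star>" "\<delta> = - 1" | "x * Pb = 0"
    using gen_mult by auto
  then show ?thesis
  proof cases
    case 1 then show ?thesis using NF_b[of d 0 j] 0 by (simp add: gen_mult' PU)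
  next
    case 2
    \<comment> \<open>Inserting \<open>Sh\<^sup>\<star> * Sh = Pb\<close> behind \<open>Sf\<close>
      creates \<open>yb (Suc 0)\<close> and raises the exponent by one.\<close>
    have "Sf * (hpowi d * z) = yb (Suc 0) * (hpowi (1 + d) * z)" for z
      by (simp add: mult.assoc gen_mult' PU flip: ShU(1))
    then show ?thesis using NF_b[of "1 + d" "Suc 0" j] 0 2 by (simp add: gen_mult' PU del: yb.simps(2))
  next
    case 3 then show ?thesis using NF_b[of "1 + d" 0 j] 0 by (simp add: gen_mult' PU ShU)
  next
    case 4 then show ?thesis using NF_b[of "- 1 + d" 0 j] 0 by (simp add: gen_mult' PU ShU)
  next
    case 5
    then have "x * (yb i * z) = 0" for z using 0 by (simp flip: mult.assoc)
    then show ?thesis by (simp add: NF_0)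
  qed
next
  case (Suc m)
  have PU: "Pb * (hpowi d * z) = hpowi d * z" for d z by (simp add: hpowi_P flip: mult.assoc)
  have ShU: "Sh\<^sup>\<star> * (hpowi d * z) = hpowi (- 1 + d) * z" for d z
    using star_Sh_U[of d] by (simp add: add.commute flip: mult.assoc)
  from l consider "x = Pa" "\<delta> = 0" | "x = Se" "\<delta> = 1" | "x = Se\<^sup>\<star>" "\<delta> = - 1" | "x = Sf\<^sup>\<star>" "\<delta> = - 1"
    | "x = Sg\<^sup>\<star>" "\<delta> = - 1" | "x * Pa = 0"
    using gen_mult by auto
  then show ?thesis
  proof cases
    case 1
    have "x * (yb i * z) = yb i * z" for z using 1 Suc yb_Suc_P[of m] by (simp flip: mult.assoc)
    then show ?thesis using 1 by (simp add: NF_b)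
  next
    case 2
    have "Se * (yb (Suc m) * (hpowi d * z)) = yb (Suc (Suc m)) * (hpowi (1 + d) * z)" for z
      using ShU[of "1 + d" z] by (simp add: mult.assoc del: yb.simps(2))
    then show ?thesis using NF_b[of "1 + d" "Suc (Suc m)" j] Suc 2 by (simp del: yb.simps)
  next
    case 3
    show ?thesis
    proof (cases m)
      case 0
      then have "x * (yb i * z) = 0" for z using 3 Suc by (simp add: mult.assoc gen_mult')
      then show ?thesis by (simp add: NF_0)
    next
      case (Suc m')
      have "Se\<^sup>\<star> * (Se * (yb (Suc m') * z)) = yb (Suc m') * z" for z
        using yb_Suc_P[of m'] by (simp add: gen_mult' del: yb.simps) (simp flip: mult.assoc del: yb.simps)
      then have "x * (yb i * (hpowi d * z)) = yb (Suc m') * (hpowi (- 1 + d) * z)" for z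
        using 3 Suc \<open>i = Suc m\<close> by (simp add: mult.assoc ShU del: yb.simps(2))
      then show ?thesis using NF_b[of "- 1 + d" "Suc m'" j] 3 by (simp del: yb.simps)
    qed
  next
    case 4
    show ?thesis
    proof (cases m)
      case 0
      then have "x * (yb i * (hpowi d * z)) = yb 0 * (hpowi (- 1 + d) * z)" for z
        using 4 Suc by (simp add: mult.assoc gen_mult' ShU PU)
      then show ?thesis using NF_b[of "- 1 + d" 0 j] 4 by (simp del: yb.simps)
    next
      case (Suc m')
      then have "x * (yb i * z) = 0" for z using 4 \<open>i = Suc m\<close> by (simp add: mult.assoc gen_mult')
      then show ?thesis by (simp add: NF_0)
    qed
  next
    case 5
    then have "x * (yb i * z) = 0" for z using Suc by (cases m) (simp_all add: mult.assoc gen_mult')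
    then show ?thesis by (simp add: NF_0)
  next
    case 6
    then have "x * (yb i * z) = 0" for z
      using Suc yb_Suc_P[of m] by (metis mult.assoc mult_zero_left)
    then show ?thesis by (simp add: NF_0)
  qed
qed

lemma letter_zc:
  assumes l: "(x, \<delta>) \<in> {(Pa, 0), (Pb, 0), (Pc, 0), (Se, 1), (Sf, 1), (Sg, 1), (Sh, 1),
     (Se\<^sup>\<star>, - 1), (Sf\<^sup>\<star>, - 1), (Sg\<^sup>\<star>, - 1), (Sh\<^sup>\<star>, - 1)}"
  shows "NF (\<delta> + (int i - int j)) (x * (zc i * (zc j)\<^sup>\<star>))"
proof (cases i)
  case 0
  from l consider "x = Pc" "\<delta> = 0" | "x = Sg" "\<delta> = 1" | "x * Pc = 0"
    using gen_mult by auto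
  then show ?thesis
  proof cases
    case 1 then show ?thesis using NF_c[of "- int j" 0 j] 0 by (simp add: gen_mult')
  next
    case 2 then show ?thesis using NF_c[of "1 - int j" "Suc 0" j] 0 by (simp add: gen_mult')
  next
    case 3
    then have "x * (zc i * z) = 0" for z using 0 by (simp flip: mult.assoc)
    then show ?thesis by (simp add: NF_0)
  qed
next
  case (Suc m)
  from l consider "x = Pa" "\<delta> = 0" | "x = Se" "\<delta> = 1" | "x = Se\<^sup>\<star>" "\<delta> = - 1" | "x = Sf\<^sup>\<star>" "\<delta> = - 1"
    | "x = Sg\<^sup>\<star>" "\<delta> = - 1" | "x * Pa = 0"
    using gen_mult by auto
  then show ?thesis
  proof cases
    case 1
    have "x * (zc i * z) = zc i * z" for z using 1 Suc zc_Suc_P[of m] by (simp flip: mult.assoc)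
    then show ?thesis using 1 by (simp add: NF_c)
  next
    case 2
    then have "x * (zc i * (zc j)\<^sup>\<star>) = zc (Suc (Suc m)) * (zc j)\<^sup>\<star>" using Suc by (simp add: mult.assoc)
    then show ?thesis using 2 Suc NF_c[of "1 + (int i - int j)" "Suc (Suc m)" j] by (simp del: zc.simps)
  next
    case 3
    show ?thesis
    proof (cases m)
      case 0
      then have "x * (zc i * z) = 0" for z using 3 Suc by (simp add: mult.assoc gen_mult')
      then show ?thesis by (simp add: NF_0)
    next
      case (Suc m')
      have "Se\<^sup>\<star> * (Se * (zc (Suc m') * z)) = zc (Suc m') * z" for z
        using zc_Suc_P[of m'] by (simp add: gen_mult' del: zc.simps) (simp flip: mult.assoc del: zc.simps)
      then have "x * (zc i * (zc j)\<^sup>\<star>) = zc (Suc m') * (zc j)\<^sup>\<star>"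
        using 3 Suc \<open>i = Suc m\<close> by (simp add: mult.assoc del: zc.simps(2))
      then show ?thesis using 3 Suc \<open>i = Suc m\<close> NF_c[of "- 1 + (int i - int j)" "Suc m'" j] by (simp del: zc.simps)
    qed
  next
    case 4
    then have "x * (zc i * z) = 0" for z using Suc by (cases m) (simp_all add: mult.assoc gen_mult')
    then show ?thesis by (simp add: NF_0)
  next
    case 5
    show ?thesis
    proof (cases m)
      case 0
      then have "x * (zc i * (zc j)\<^sup>\<star>) = zc 0 * (zc j)\<^sup>\<star>" using 5 Suc by (simp add: mult.assoc gen_mult')
      then show ?thesis using 5 0 Suc NF_c[of "- int j" 0 j] by (simp del: zc.simps)
    next
      case (Suc m')
      then have "x * (zc i * z) = 0" for z using 5 \<open>i = Suc m\<close> by (simp add: mult.assoc gen_mult')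
      then show ?thesis by (simp add: NF_0)
    qed
  next
    case 6
    then have "x * (zc i * z) = 0" for z
      using Suc zc_Suc_P[of m] by (metis mult.assoc mult_zero_left)
    then show ?thesis by (simp add: NF_0)
  qed
qed

lemma NF_letter: "NF d X \<Longrightarrow> NF (letter_deg l + d) (letter_val l * X)"
  using letter_epow[OF letter_cases[of l]] letter_yb[OF letter_cases[of l]] letter_zc[OF letter_cases[of l]]
  unfolding NF_def[of d X] by (auto simp: NF_0)

text \<open>The value at the empty word is a dummy: that word has coefficient 0 in every element of
  \<open>star_polys\<close>.\<close>

fun word_val :: "(Q2_vertex, Q2_edge) graph_gen letter list \<Rightarrow> q2alg" where
  "word_val [] = 0"
| "word_val [l] = letter_val l"
| "word_val (l # ls) = letter_val l * word_val ls"

definition word_deg :: "('v, 'e) graph_gen letter list \<Rightarrow> int" where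
  "word_deg ls = sum_list (map letter_deg ls)"

lemma NF_word: "ls \<noteq> [] \<Longrightarrow> NF (word_deg ls) (word_val ls)"
proof (induction ls rule: list_nonempty_induct)
  case (single l)
  \<comment> \<open>Every letter absorbs a vertex projection on the right, and the vertex
    projections are normal forms of degree 0.\<close>
  have "NF (letter_deg l + 0) (letter_val l * P)" if "P \<in> {Pa, Pb, Pc}" for P
  proof (rule NF_letter)
    show "NF 0 P"
      using that NF_a[of 0 0 0] NF_b[of 0 0 0] NF_c[of 0 0 0] by (auto simp: P_mult)
  qed
  moreover have "letter_val l * Pa = letter_val l \<or> letter_val l * Pb = letter_val l \<or> letter_val l * Pc = letter_val l"
    using letter_cases[of l] gen_mult by auto
  ultimately show ?case by (auto simp: word_deg_def) (metis insertI1 insertI2)+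
next
  case (cons l ls)
  then have "word_val (l # ls) = letter_val l * word_val ls" by (cases ls) auto
  then show ?case using NF_letter[OF cons.IH, of l] by (simp add: word_deg_def)
qed

lemma elt_word: "ls \<noteq> [] \<Longrightarrow> elt (Poly_Mapping.single (Word ls) 1) = word_val ls"
proof (induction ls rule: list_nonempty_induct)
  case (single l)
  show ?case
  proof (cases l)
    case (Gen x) then show ?thesis by (simp add: gen_def)
  next
    case (Adj x)
    have "Poly_Mapping.single (Word [l]) 1 = poly_adj (gen x)"
      by (simp add: gen_def poly_adj_single word_adj_def Adj)
    then show ?thesis using elt_unary(1)[of "gen x"] Adj by simp
  qed
next
  case (cons l ls)
  have l: "elt (Poly_Mapping.single (Word [l]) 1) = letter_val l"
  proof (cases l)
    case (Gen x) then show ?thesis by (simp add: gen_def)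
  next
    case (Adj x)
    have "Poly_Mapping.single (Word [l]) 1 = poly_adj (gen x)"
      by (simp add: gen_def poly_adj_single word_adj_def Adj)
    then show ?thesis using elt_unary(1)[of "gen x"] Adj by simp
  qed
  have eq: "Poly_Mapping.single (Word (l # ls)) 1
      = Poly_Mapping.single (Word [l]) 1 * Poly_Mapping.single (Word ls) (1::complex)"
    by (simp add: mult_single plus_star_word_def)
  have sp: "Poly_Mapping.single (Word [l]) (1::complex) \<in> star_polys" "Poly_Mapping.single (Word ls) (1::complex) \<in> star_polys"
    using cons.hyps by (auto simp: star_polys_single_iff zero_star_word_def)
  show ?case unfolding eq elt_binary(2)[OF sp] l cons.IH using cons.hyps by (cases ls) auto
qed

section \<open>The finite-dimensional subalgebras of the core\<close>

definition aa :: "nat \<Rightarrow> q2alg" where "aa k = epow k * (epow k)\<^sup>\<star>"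
definition ee :: "nat \<Rightarrow> nat \<Rightarrow> q2alg" where "ee i j = yb i * (yb j)\<^sup>\<star>"
definition cc :: "nat \<Rightarrow> q2alg" where "cc i = zc i * (zc i)\<^sup>\<star>"

lemma NF_degree_0: "NF 0 X \<Longrightarrow> X = 0 \<or> (\<exists>k. X = aa k) \<or> (\<exists>i j. X = ee i j) \<or> (\<exists>i. X = cc i)"
proof -
  have "yb i * (Pb * z) = yb i * z" for i z using yb_P[of i] by (simp flip: mult.assoc)
  then show "NF 0 X \<Longrightarrow> ?thesis"
    by (auto simp: NF_def aa_def ee_def cc_def)
qed

text \<open>The Cuntz-Krieger relation at \<open>V00\<close>, inserted between \<open>epow k\<close>
  and its adjoint. In the term for the edge to \<open>V01\<close> the powers of \<open>Sh\<close>
  cancel.\<close>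

lemma aa_Suc: "aa k = aa (Suc k) + ee (Suc k) (Suc k) + cc (Suc k)"
proof -
  have "hpow (Suc k) * (hpow (Suc k))\<^sup>\<star> = Pb" for k
  proof -
    have "hpow k * (hpow k)\<^sup>\<star> = Pb" for k
    proof (induction k)
      case (Suc k)
      have "hpow (Suc k) * (hpow (Suc k))\<^sup>\<star> = Sh * (hpow k * (hpow k)\<^sup>\<star>) * Sh\<^sup>\<star>"
        by (simp add: star_mult mult.assoc)
      then show ?case using Suc by (simp add: gen_mult)
    qed (simp add: P_mult)
    then show ?thesis .
  qed
  moreover have "(epow k * Sf) * (epow k * Sf)\<^sup>\<star> = yb (Suc k) * (hpow (Suc k) * (hpow (Suc k))\<^sup>\<star>) * (yb (Suc k))\<^sup>\<star>"
    unfolding yb_hpow[symmetric] by (simp only: star_mult mult.assoc)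
  ultimately have f: "(epow k * Sf) * (epow k * Sf)\<^sup>\<star> = ee (Suc k) (Suc k)"
    by (simp only: yb_P ee_def)
  have g: "(epow k * Sg) * (epow k * Sg)\<^sup>\<star> = cc (Suc k)" by (simp only: zc_Suc[symmetric] cc_def)
  have e: "(epow k * Se) * (epow k * Se)\<^sup>\<star> = aa (Suc k)" by (simp only: epow_comm aa_def epow.simps)
  have "aa k = epow k * Pa * (epow k)\<^sup>\<star>" by (simp add: aa_def epow_P)
  also have "\<dots> = (epow k * Se) * (epow k * Se)\<^sup>\<star> + (epow k * Sf) * (epow k * Sf)\<^sup>\<star> + (epow k * Sg) * (epow k * Sg)\<^sup>\<star>"
    by (simp add: ck_relations(1)[symmetric] distrib_left distrib_right star_mult mult.assoc)
  finally show ?thesis by (simp only: e f g)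
qed

text \<open>Partial isometries with common initial projection \<open>Pb\<close> and orthogonal
  ranges: the reason why the \<open>ee i j\<close> are matrix units.\<close>

lemma star_yb_yb: "(yb i)\<^sup>\<star> * yb j = (if i = j then Pb else 0)"
proof (induction i arbitrary: j rule: yb.induct)
  case 1
  show ?case by (cases j rule: yb.cases) (simp_all add: gen_mult' mult.assoc)
next
  case 2
  show ?case by (cases j rule: yb.cases) (simp_all add: gen_mult' mult.assoc star_mult)
next
  case (3 i)
  show ?case
  proof (cases j rule: yb.cases)
    case (3 j')
    have "Pa * (yb (Suc j') * z) = yb (Suc j') * z" for z using yb_Suc_P[of j'] by (simp flip: mult.assoc)
    then have "(yb (Suc (Suc i)))\<^sup>\<star> * yb j = Sh * ((yb (Suc i))\<^sup>\<star> * yb (Suc j')) * Sh\<^sup>\<star>"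
      using 3 by (simp add: gen_mult' mult.assoc star_mult del: yb.simps(2))
    then show ?thesis using "3.IH"[of "Suc j'"] 3 by (simp add: gen_mult del: yb.simps)
  qed (simp_all add: gen_mult' mult.assoc star_mult)
qed

lemma star_zc_zc: "(zc i)\<^sup>\<star> * zc j = (if i = j then Pc else 0)"
proof (induction i arbitrary: j rule: zc.induct)
  case 1
  show ?case by (cases j rule: zc.cases) (simp_all add: gen_mult' mult.assoc)
next
  case 2
  show ?case by (cases j rule: zc.cases) (simp_all add: gen_mult' mult.assoc star_mult)
next
  case (3 i)
  show ?case
  proof (cases j rule: zc.cases)
    case (3 j')
    have "(zc (Suc (Suc i)))\<^sup>\<star> * zc j = (zc (Suc i))\<^sup>\<star> * zc (Suc j')"
      using 3 zc_Suc_P[of j'] by (simp add: gen_mult' mult.assoc star_mult del: zc.simps(2))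
    then show ?thesis using "3.IH"[of "Suc j'"] 3 by (simp del: zc.simps)
  qed (simp_all add: gen_mult' mult.assoc star_mult)
qed

lemma star_yb_zc: "(yb i)\<^sup>\<star> * zc j = 0"
proof (induction i arbitrary: j rule: yb.induct)
  case 1
  show ?case by (cases j rule: zc.cases) (simp_all add: gen_mult' mult.assoc)
next
  case 2
  show ?case by (cases j rule: zc.cases) (simp_all add: gen_mult' mult.assoc star_mult)
next
  case (3 i)
  show ?case
  proof (cases j rule: zc.cases)
    case (3 j')
    have "(yb (Suc (Suc i)))\<^sup>\<star> * zc j = Sh * ((yb (Suc i))\<^sup>\<star> * zc (Suc j'))"
      using 3 zc_Suc_P[of j'] by (simp add: gen_mult' mult.assoc star_mult del: zc.simps(2) yb.simps(2))
    then show ?thesis using "3.IH"[of "Suc j'"] by (simp del: zc.simps yb.simps)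
  qed (simp_all add: gen_mult' mult.assoc star_mult)
qed

text \<open>After \<open>n\<close> turns of the loop at \<open>V00\<close> one is still there, which
  no path into \<open>V01\<close> of length at most \<open>n\<close> allows.\<close>

lemma star_epow_yb: "i \<le> n \<Longrightarrow> (epow n)\<^sup>\<star> * yb i = 0"
proof (induction n arbitrary: i)
  case 0 then show ?case by (simp add: P_mult)
next
  case (Suc n)
  show ?case
  proof (cases i rule: yb.cases)
    case (3 j)
    have "Pa * (yb (Suc j) * z) = yb (Suc j) * z" for z using yb_Suc_P[of j] by (simp flip: mult.assoc)
    then have "(epow (Suc n))\<^sup>\<star> * yb i = (epow n)\<^sup>\<star> * yb (Suc j) * Sh\<^sup>\<star>"
      using 3 by (simp add: gen_mult' mult.assoc star_mult del: yb.simps(2))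
    then show ?thesis using Suc 3 by (simp del: yb.simps)
  qed (simp_all add: gen_mult' mult.assoc star_mult)
qed

lemma star_epow_zc: "i \<le> n \<Longrightarrow> (epow n)\<^sup>\<star> * zc i = 0"
proof (induction n arbitrary: i)
  case 0 then show ?case by (simp add: P_mult)
next
  case (Suc n)
  show ?case
  proof (cases i rule: zc.cases)
    case (3 j)
    then have "(epow (Suc n))\<^sup>\<star> * zc i = (epow n)\<^sup>\<star> * zc (Suc j)"
      using zc_Suc_P[of j] by (simp add: gen_mult' mult.assoc star_mult del: zc.simps(2))
    then show ?thesis using Suc 3 by (simp del: zc.simps)
  qed (simp_all add: gen_mult' mult.assoc star_mult)
qed

lemma star_epow_epow: "(epow n)\<^sup>\<star> * epow n = Pa"
proof (induction n)
  case (Suc n)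
  have "(epow (Suc n))\<^sup>\<star> * epow (Suc n) = (epow n)\<^sup>\<star> * epow n"
    by (simp add: star_mult gen_mult' mult.assoc epow_P)
  then show ?case using Suc by simp
qed (simp add: P_mult)

lemma star_core_gens [simp]: "(aa n)\<^sup>\<star> = aa n" "(ee i j)\<^sup>\<star> = ee j i" "(cc i)\<^sup>\<star> = cc i"
  by (simp_all add: aa_def ee_def cc_def star_mult)

text \<open>The bounds in the last four clauses matter: for \<open>i > n\<close> the projections
  \<open>ee i i\<close> and \<open>cc i\<close> lie below \<open>aa n\<close>.\<close>

lemma core_gens_mult:
  "aa n * aa n = aa n" "ee i j * ee k l = (if j = k then ee i l else 0)" "cc i * cc j = (if i = j then cc i else 0)"
  "ee i j * cc k = 0" "cc k * ee i j = 0"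
  "i \<le> n \<Longrightarrow> aa n * ee i j = 0" "j \<le> n \<Longrightarrow> ee i j * aa n = 0"
  "i \<le> n \<Longrightarrow> aa n * cc i = 0" "i \<le> n \<Longrightarrow> cc i * aa n = 0"
proof -
  have mid: "x * y\<^sup>\<star> * (z * w\<^sup>\<star>) = x * (y\<^sup>\<star> * z) * w\<^sup>\<star>" for x y z w :: q2alg
    by (simp add: mult.assoc)
  show 1: "aa n * aa n = aa n" "ee i j * ee k l = (if j = k then ee i l else 0)" "cc i * cc j = (if i = j then cc i else 0)"
    "ee i j * cc k = 0" "i \<le> n \<Longrightarrow> aa n * ee i j = 0" "i \<le> n \<Longrightarrow> aa n * cc i = 0" for i j k l n
    by (simp_all add: aa_def ee_def cc_def mid star_yb_yb star_zc_zc star_yb_zc star_epow_yb star_epow_zc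
        star_epow_epow epow_P yb_P zc_P)
  show "cc k * ee i j = 0" using 1(4)[of j i k] by (metis star_0 star_core_gens(2,3) star_mult)
  show "j \<le> n \<Longrightarrow> ee i j * aa n = 0" using 1(5)[of j n i] by (metis star_0 star_core_gens(1,2) star_mult)
  show "i \<le> n \<Longrightarrow> cc i * aa n = 0" using 1(6)[of i n] by (metis star_0 star_core_gens(1,3) star_mult)
qed

text \<open>Coordinates on stage \<open>n\<close>: a scalar, a matrix of size \<open>n + 1\<close>
  and \<open>n + 1\<close> further scalars. \<open>T\<close> and \<open>m\<close> are total
  functions that are read at indices up to \<open>n\<close>.\<close>

definition phi :: "nat \<Rightarrow> complex \<Rightarrow> (nat \<Rightarrow> nat \<Rightarrow> complex) \<Rightarrow> (nat \<Rightarrow> complex) \<Rightarrow> q2alg" where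
  "phi n l T m = l *\<^sub>C aa n + (\<Sum>i\<le>n. \<Sum>j\<le>n. T i j *\<^sub>C ee i j) + (\<Sum>i\<le>n. m i *\<^sub>C cc i)"

definition Fn :: "nat \<Rightarrow> q2alg set" where "Fn n = {phi n l T m | l T m. True}"

lemma phi_in_Fn: "phi n l T m \<in> Fn n"
  by (auto simp: Fn_def)

lemma phi_add: "phi n l T m + phi n l' T' m' = phi n (l + l') (\<lambda>i j. T i j + T' i j) (\<lambda>i. m i + m' i)"
  by (simp add: phi_def cscale_add_left sum.distrib algebra_simps)

lemma phi_cscale: "c *\<^sub>C phi n l T m = phi n (c * l) (\<lambda>i j. c * T i j) (\<lambda>i. c * m i)"
  by (simp add: phi_def cscale_add_right cscale_sum_right)

lemma phi_star: "(phi n l T m)\<^sup>\<star> = phi n (cnj l) (\<lambda>i j. cnj (T j i)) (\<lambda>i. cnj (m i))"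
  unfolding phi_def star_add star_sum star_cscale star_core_gens
  by (subst sum.swap) simp

lemma phi_mult: "phi n l T m * phi n l' T' m'
    = phi n (l * l') (\<lambda>i j. \<Sum>k\<le>n. T i k * T' k j) (\<lambda>i. m i * m' i)"
proof -
  have a: "aa n * phi n l' T' m' = l' *\<^sub>C aa n"
    by (simp add: phi_def distrib_left sum_distrib_left core_gens_mult)
  have e: "ee i k * phi n l' T' m' = (\<Sum>j\<le>n. T' k j *\<^sub>C ee i j)" if "k \<le> n" for i k
  proof -
    have inner: "(\<Sum>j\<le>n. T' i' j *\<^sub>C (ee i k * ee i' j)) = (if i' = k then \<Sum>j\<le>n. T' k j *\<^sub>C ee i j else 0)" for i'
      by (cases "i' = k") (simp_all add: core_gens_mult(2))
    have "ee i k * phi n l' T' m' = l' *\<^sub>C (ee i k * aa n) + (\<Sum>i'\<le>n. \<Sum>j\<le>n. T' i' j *\<^sub>C (ee i k * ee i' j))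
        + (\<Sum>i'\<le>n. m' i' *\<^sub>C (ee i k * cc i'))"
      by (simp add: phi_def distrib_left sum_distrib_left)
    then show ?thesis unfolding inner using that by (simp add: core_gens_mult(4,7))
  qed
  have c: "cc i * phi n l' T' m' = m' i *\<^sub>C cc i" if "i \<le> n" for i
  proof -
    have "cc i * phi n l' T' m' = l' *\<^sub>C (cc i * aa n) + (\<Sum>i'\<le>n. \<Sum>j\<le>n. T' i' j *\<^sub>C (cc i * ee i' j))
        + (\<Sum>i'\<le>n. m' i' *\<^sub>C (cc i * cc i'))"
      by (simp add: phi_def distrib_left sum_distrib_left)
    also have "(\<Sum>i'\<le>n. m' i' *\<^sub>C (cc i * cc i')) = (\<Sum>i'\<le>n. if i' = i then m' i *\<^sub>C cc i else 0)"
      by (intro sum.cong) (auto simp: core_gens_mult(3))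
    finally show ?thesis using that by (simp add: core_gens_mult(5,9))
  qed
  have "phi n l T m * phi n l' T' m' = (l * l') *\<^sub>C aa n
      + (\<Sum>i\<le>n. \<Sum>k\<le>n. T i k *\<^sub>C (\<Sum>j\<le>n. T' k j *\<^sub>C ee i j)) + (\<Sum>i\<le>n. (m i * m' i) *\<^sub>C cc i)"
    unfolding phi_def[of n l T m] distrib_right sum_distrib_right mult_cscale_left a
    by (simp add: e c)
  also have "(\<Sum>i\<le>n. \<Sum>k\<le>n. T i k *\<^sub>C (\<Sum>j\<le>n. T' k j *\<^sub>C ee i j))
      = (\<Sum>i\<le>n. \<Sum>j\<le>n. (\<Sum>k\<le>n. T i k * T' k j) *\<^sub>C ee i j)"
    unfolding cscale_sum_right cscale_sum_left cscale_cscale by (intro sum.cong refl sum.swap)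
  finally show ?thesis by (simp add: phi_def)
qed

lemma subalgebra_Fn: "subalgebra (Fn n)"
proof -
  have "phi n 0 (\<lambda>_ _. 0) (\<lambda>_. 0) = 0" by (simp add: phi_def)
  then have "0 \<in> Fn n" using phi_in_Fn by metis
  then show ?thesis
    unfolding subalgebra_def by (auto simp: Fn_def phi_add phi_mult phi_star phi_cscale) blast+
qed

lemma core_gens_in_Fn: "aa n \<in> Fn n" "i \<le> n \<Longrightarrow> j \<le> n \<Longrightarrow> ee i j \<in> Fn n" "i \<le> n \<Longrightarrow> cc i \<in> Fn n"
proof -
  have "phi n 1 (\<lambda>_ _. 0) (\<lambda>_. 0) = aa n" by (simp add: phi_def)
  then show "aa n \<in> Fn n" using phi_in_Fn by metis
  have "phi n 0 (\<lambda>i' j'. if i' = i \<and> j' = j then 1 else 0) (\<lambda>_. 0) = ee i j" if "i \<le> n" "j \<le> n"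
  proof -
    have "(\<Sum>j'\<le>n. (if i' = i \<and> j' = j then 1 else 0) *\<^sub>C ee i' j') = (if i' = i then ee i j else 0)" for i'
      using that by (cases "i' = i") (simp_all add: if_distrib[of "\<lambda>x. x *\<^sub>C _"] sum.delta cong: if_cong)
    then show ?thesis using that by (simp add: phi_def)
  qed
  then show "i \<le> n \<Longrightarrow> j \<le> n \<Longrightarrow> ee i j \<in> Fn n" using phi_in_Fn by metis
  have "phi n 0 (\<lambda>_ _. 0) (\<lambda>i'. if i' = i then 1 else 0) = cc i" if "i \<le> n"
    using that by (simp add: phi_def if_distrib[of "\<lambda>x. x *\<^sub>C _"] sum.delta cong: if_cong)
  then show "i \<le> n \<Longrightarrow> cc i \<in> Fn n" using phi_in_Fn by metis
qed

text \<open>Of the generators of stage \<open>n\<close>, only \<open>aa n\<close> is not a generator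
  of the next stage; \<open>aa_Suc\<close> expresses it there.\<close>

lemma Fn_Suc: "Fn n \<subseteq> Fn (Suc n)"
proof
  fix x assume "x \<in> Fn n"
  then obtain l T m where x: "x = phi n l T m" by (auto simp: Fn_def)
  have "aa n \<in> Fn (Suc n)"
    unfolding aa_Suc[of n] by (intro subalgebraD[OF subalgebra_Fn] core_gens_in_Fn) auto
  then show "x \<in> Fn (Suc n)"
    unfolding x phi_def
    by (intro subalgebraD[OF subalgebra_Fn] subalgebra_sum[OF subalgebra_Fn] core_gens_in_Fn) auto
qed

lemma Fn_mono: "n \<le> m \<Longrightarrow> Fn n \<subseteq> Fn m"
  by (rule lift_Suc_mono_le[of Fn]) (rule Fn_Suc)

lemma NF_0_in_Fn: "NF 0 X \<Longrightarrow> \<exists>n. X \<in> Fn n"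
proof -
  assume "NF 0 X"
  then consider "X = 0" | k where "X = aa k" | i j where "X = ee i j" | i where "X = cc i"
    using NF_degree_0 by blast
  then show ?thesis
  proof cases
    case 3
    then have "X \<in> Fn (max i j)" by (auto intro: core_gens_in_Fn)
    then show ?thesis by blast
  qed (use core_gens_in_Fn subalgebraD(1)[OF subalgebra_Fn] in blast)+
qed

section \<open>Density in the core\<close>

lemma gauge_word_powi: "cmod c = 1 \<Longrightarrow> gauge_word c (Word ls) = c powi word_deg ls"
proof -
  assume c: "cmod c = 1"
  then have c0: "c \<noteq> 0" by auto
  have "c * cnj c = 1" using c by (simp add: complex_norm_square[symmetric])
  then have inv: "cnj c = inverse c" using c0 by (simp add: field_simps)
  have "gauge_letter c l = c powi letter_deg l" for l :: "('a, 'b) graph_gen letter"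
    by (induction l rule: letter_deg.induct) (simp_all add: inv power_int_minus)
  then have "(\<Prod>l\<leftarrow>ls. gauge_letter c l) = c powi word_deg ls"
    using c0 by (induction ls) (simp_all add: word_deg_def power_int_add)
  then show ?thesis by (simp add: gauge_word_def)
qed

text \<open>Averages over roots of unity take the place of the integral over the circle; with
  \<open>N\<close> above all degrees in question they isolate degree 0.\<close>

lemma sum_roots_of_unity:
  fixes d :: int
  assumes "N > 0" "\<bar>d\<bar> < int N"
  shows "(\<Sum>j<N. (cis (2 * pi / real N) ^ j) powi d) = (if d = 0 then of_nat N else 0)"
proof (cases "d = 0")
  case False
  define w where "w = cis (2 * pi / real N) powi d"
  have w: "w = cis (2 * pi * d / real N)"
    by (simp add: w_def cis_power_int mult.commute)
  have "(cis (2 * pi / real N) ^ j) powi d = w ^ j" for j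
    unfolding w_def by (metis power_int_mult power_int_of_nat mult.commute)
  then have "(\<Sum>j<N. (cis (2 * pi / real N) ^ j) powi d) = (\<Sum>j<N. w ^ j)" by simp
  moreover have "w ^ N = 1"
    using assms(1) by (simp add: w DeMoivre cis_multiple_2pi)
  moreover have "w \<noteq> 1"
  proof
    assume "w = 1"
    then have "cos (2 * pi * d / real N) = 1" unfolding w by (metis cis.sel(1) one_complex.sel(1))
    then obtain k :: int where "2 * pi * d / real N = real_of_int k * (2 * pi)"
      using cos_one_2pi_int by auto
    then have "real_of_int d = real_of_int (k * int N)" using assms(1) by (simp add: field_simps)
    then have "d = k * int N" by (simp only: of_int_eq_iff)
    then show False using assms(2) False by (simp add: abs_mult)
  qed
  ultimately show ?thesis using geometric_sum[of w N] False by simp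
qed (use assms in simp)

text \<open>Averaging over the gauge action fixes \<open>X\<close>, does not increase norms, and
  maps a nearby polynomial to its part of degree 0, which lies in some stage.\<close>

lemma Fn_dense:
  assumes X: "X \<in> core" and e: "e > 0"
  shows "\<exists>n. \<exists>Y\<in>Fn n. norm (X - Y) < e"
proof -
  obtain p where p: "p \<in> star_polys" "norm (X - elt p) < e" using elt_dense[OF e] by blast
  define K where "K = Poly_Mapping.keys p"
  define v where "v w = word_val (letters w)" for w
  define d where "d w = word_deg (letters w)" for w :: "(Q2_vertex, Q2_edge) graph_gen star_word"
  define a where "a w = Poly_Mapping.lookup p w" for w
  have fin: "finite K" by (simp add: K_def)
  have ne: "letters w \<noteq> []" if "w \<in> K" for w
    using p(1) that by (cases w) (auto simp: K_def star_polys_def in_keys_iff zero_star_word_def)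
  have v: "elt (Poly_Mapping.single w c) = c *\<^sub>C v w" if "w \<in> K" for w c
  proof -
    have "Poly_Mapping.single w c = poly_scale c (Poly_Mapping.single w 1)" by (simp add: poly_scale_single)
    moreover have "Poly_Mapping.single w (1::complex) \<in> star_polys"
      using ne[OF that] by (cases w) (auto simp: star_polys_single_iff zero_star_word_def)
    ultimately have "elt (Poly_Mapping.single w c) = c *\<^sub>C elt (Poly_Mapping.single w 1)"
      by (simp add: elt_simps)
    then show ?thesis using elt_word[OF ne[OF that]] by (simp add: v_def)
  qed
  have single_sp: "Poly_Mapping.single w c \<in> star_polys" if "w \<in> K" for w c
    using ne[OF that] by (cases w) (auto simp: star_polys_single_iff zero_star_word_def)
  have expand: "elt p = (\<Sum>w\<in>K. a w *\<^sub>C v w)"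
  proof -
    have "elt p = elt (\<Sum>w\<in>K. Poly_Mapping.single w (a w))"
      unfolding K_def a_def by (simp flip: star_poly_expansion)
    then show ?thesis using single_sp v by (simp add: elt_sum)
  qed
  have gauge_v: "gauge_map c (v w) = (c powi d w) *\<^sub>C v w" if "cmod c = 1" "w \<in> K" for c w
  proof -
    have "gauge_map c (elt (Poly_Mapping.single w 1)) = elt (Poly_Mapping.single w (gauge_word c w))"
      using gauge_elt[OF that(1) single_sp[OF that(2)]] by (simp add: poly_gauge_single)
    then show ?thesis
      using v[OF that(2)] gauge_word_powi[OF that(1), of "letters w"] by (simp add: d_def)
  qed
  \<comment> \<open>Positive and larger than the absolute value of every degree that occurs in
    \<open>p\<close>.\<close>
  define N where "N = Suc (nat (\<Sum>w\<in>K. \<bar>d w\<bar>))"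
  have dN: "\<bar>d w\<bar> < int N" if "w \<in> K" for w
  proof -
    have "\<bar>d w\<bar> \<le> (\<Sum>w\<in>K. \<bar>d w\<bar>)" using fin that by (intro member_le_sum) auto
    then show ?thesis by (simp add: N_def)
  qed
  have N: "N > 0" by (simp add: N_def)
  define z where "z j = cis (2 * pi / real N) ^ j" for j
  have z: "cmod (z j) = 1" for j by (simp add: z_def norm_power)
  define Y where "Y = (\<Sum>w | w \<in> K \<and> d w = 0. a w *\<^sub>C v w)"
  have avg: "(\<Sum>j<N. gauge_map (z j) (elt p)) = of_nat N *\<^sub>C Y"
  proof -
    have "(\<Sum>j<N. gauge_map (z j) (elt p)) = (\<Sum>j<N. \<Sum>w\<in>K. (a w * (z j powi d w)) *\<^sub>C v w)"
      using z gauge_v by (simp add: expand gauge_sum gauge_simps)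
    also have "\<dots> = (\<Sum>w\<in>K. \<Sum>j<N. (a w * (z j powi d w)) *\<^sub>C v w)" by (rule sum.swap)
    also have "\<dots> = (\<Sum>w\<in>K. (a w * (\<Sum>j<N. z j powi d w)) *\<^sub>C v w)"
      by (simp add: sum_distrib_left cscale_sum_left)
    also have "\<dots> = (\<Sum>w\<in>K. if d w = 0 then (of_nat N * a w) *\<^sub>C v w else 0)"
      unfolding z_def by (intro sum.cong refl) (simp only: sum_roots_of_unity[OF N dN], simp add: mult.commute)
    also have "\<dots> = of_nat N *\<^sub>C Y"
      unfolding Y_def cscale_sum_right using fin by (simp add: sum.inter_filter)
    finally show ?thesis .
  qed
  have "(\<Sum>j<N. gauge_map (z j) (X - elt p)) = (\<Sum>j<N. X - gauge_map (z j) (elt p))"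
    using X z by (intro sum.cong refl) (simp add: gauge_diff core_def)
  also have "\<dots> = of_nat N *\<^sub>C (X - Y)"
    using avg by (simp add: sum_subtractf cscale_diff_right) (metis cscale_of_real of_real_of_nat_eq sum_constant_scaleR card_lessThan)
  finally have "real N * norm (X - Y) = norm (\<Sum>j<N. gauge_map (z j) (X - elt p))"
    by simp
  also have "\<dots> \<le> (\<Sum>j<N. norm (gauge_map (z j) (X - elt p)))" by (rule norm_sum)
  also have "\<dots> = real N * norm (X - elt p)" using z by (simp add: gauge_simps)
  finally have "norm (X - Y) < e" using N p(2) by simp
  moreover have "\<exists>n. Y \<in> Fn n"
  proof -
    have "\<exists>n. v w \<in> Fn n" if "w \<in> K" "d w = 0" for w
      using NF_word[OF ne[OF that(1)]] that(2) NF_0_in_Fn unfolding v_def d_def by metis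
    then obtain n where n: "\<And>w. w \<in> K \<Longrightarrow> d w = 0 \<Longrightarrow> v w \<in> Fn (n w)" by metis
    have "v w \<in> Fn (\<Sum>w\<in>K. n w)" if "w \<in> K" "d w = 0" for w
      using n[OF that] Fn_mono[of "n w" "\<Sum>w\<in>K. n w"] fin that(1) member_le_sum[of w K n] by auto
    then have "Y \<in> Fn (\<Sum>w\<in>K. n w)"
      unfolding Y_def by (intro subalgebra_sum[OF subalgebra_Fn] subalgebraD(5)[OF subalgebra_Fn]) auto
    then show ?thesis by blast
  qed
  ultimately show ?thesis by blast
qed

lemma gauge_gens:
  assumes "cmod c = 1"
  shows "gauge_map c Pa = Pa" "gauge_map c Pb = Pb" "gauge_map c Pc = Pc"
    "gauge_map c Se = c *\<^sub>C Se" "gauge_map c Sf = c *\<^sub>C Sf" "gauge_map c Sg = c *\<^sub>C Sg" "gauge_map c Sh = c *\<^sub>C Sh"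
  using assms by (simp_all add: gen_defs gauge_elt poly_gauge_genP poly_gauge_genS elt_simps)

lemma core_gens_in_core: "aa k \<in> core" "ee i j \<in> core" "cc i \<in> core"
proof -
  have cc1: "c * cnj c = 1" if "cmod c = 1" for c using that by (simp add: complex_norm_square[symmetric])
  have yb: "gauge_map c (yb i) = yb i" if "cmod c = 1" for c i
    using cc1[OF that]
    by (induction i rule: yb.induct) (simp_all add: gauge_simps[OF that] gauge_gens[OF that] star_cscale mult.commute)
  have ep: "gauge_map c (epow k) = c ^ k *\<^sub>C epow k" if "cmod c = 1" for c k
    by (induction k) (simp_all add: gauge_simps[OF that] gauge_gens[OF that] mult.commute)
  have zc: "gauge_map c (zc i) = c ^ i *\<^sub>C zc i" if "cmod c = 1" for c i
    by (induction i rule: zc.induct) (simp_all add: gauge_simps[OF that] gauge_gens[OF that] mult.commute)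
  have pow: "cnj c ^ k * c ^ k = 1" if "cmod c = 1" for c k
    using cc1[OF that] by (simp add: mult.commute flip: power_mult_distrib)
  show "aa k \<in> core" "ee i j \<in> core" "cc i \<in> core"
    by (simp_all add: core_def aa_def ee_def cc_def gauge_simps yb ep zc star_cscale pow)
qed

lemma Fn_subset_core: "Fn n \<subseteq> core"
  by (auto simp: Fn_def phi_def intro!: subalgebraD[OF subalgebra_core] subalgebra_sum[OF subalgebra_core] core_gens_in_core)

section \<open>A representation on a pre-Hilbert space\<close>

text \<open>The basis vectors \<open>B i\<close> and \<open>C i\<close> stand for the paths of length \<open>i\<close> that enter \<open>V01\<close>
  (continued by the loop \<open>h\<close> for ever) and \<open>V11\<close>, respectively.\<close>

datatype basis = B nat | C nat

text \<open>Letters send basis vectors to basis vectors or to 0 and so preserve finite support. With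
  explicit adjoints, the operator norm on this pre-Hilbert space is a C*-seminorm.\<close>

typedef hvec = "{\<xi> :: basis \<Rightarrow> complex. finite {a. \<xi> a \<noteq> 0}}" morphisms hv Hvec
  by (intro exI[of _ "\<lambda>_. 0"]) simp

setup_lifting type_definition_hvec

lemma finite_hv [simp]: "finite {a. hv \<xi> a \<noteq> 0}"
  using hv[of \<xi>] by simp

lemma hvec_eqI: "(\<And>a. hv \<xi> a = hv \<eta> a) \<Longrightarrow> \<xi> = \<eta>"
  by (simp add: hv_inject[symmetric] fun_eq_iff)

instantiation hvec :: real_vector
begin

lift_definition zero_hvec :: hvec is "\<lambda>_. 0" by simp
lift_definition plus_hvec :: "hvec \<Rightarrow> hvec \<Rightarrow> hvec" is "\<lambda>\<xi> \<eta> a. \<xi> a + \<eta> a"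
proof -
  fix \<xi> \<eta> :: "basis \<Rightarrow> complex" assume "finite {a. \<xi> a \<noteq> 0}" "finite {a. \<eta> a \<noteq> 0}"
  then have "finite ({a. \<xi> a \<noteq> 0} \<union> {a. \<eta> a \<noteq> 0})" by simp
  then show "finite {a. \<xi> a + \<eta> a \<noteq> 0}" by (rule rev_finite_subset) auto
qed
lift_definition minus_hvec :: "hvec \<Rightarrow> hvec \<Rightarrow> hvec" is "\<lambda>\<xi> \<eta> a. \<xi> a - \<eta> a"
proof -
  fix \<xi> \<eta> :: "basis \<Rightarrow> complex" assume "finite {a. \<xi> a \<noteq> 0}" "finite {a. \<eta> a \<noteq> 0}"
  then have "finite ({a. \<xi> a \<noteq> 0} \<union> {a. \<eta> a \<noteq> 0})" by simp
  then show "finite {a. \<xi> a - \<eta> a \<noteq> 0}" by (rule rev_finite_subset) auto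
qed
lift_definition uminus_hvec :: "hvec \<Rightarrow> hvec" is "\<lambda>\<xi> a. - \<xi> a" by simp
lift_definition scaleR_hvec :: "real \<Rightarrow> hvec \<Rightarrow> hvec" is "\<lambda>r \<xi> a. r *\<^sub>R \<xi> a"
  by (erule rev_finite_subset) auto

instance
  by standard (transfer; simp add: algebra_simps fun_eq_iff)+

end

lemma hv_simps [simp]: "hv 0 a = 0" "hv (\<xi> + \<eta>) a = hv \<xi> a + hv \<eta> a" "hv (\<xi> - \<eta>) a = hv \<xi> a - hv \<eta> a"
  "hv (- \<xi>) a = - hv \<xi> a" "hv (r *\<^sub>R \<xi>) a = r *\<^sub>R hv \<xi> a"
  by (simp_all add: zero_hvec.rep_eq plus_hvec.rep_eq minus_hvec.rep_eq uminus_hvec.rep_eq scaleR_hvec.rep_eq)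

instantiation hvec :: real_inner
begin

text \<open>The real part of the usual complex inner product, as \<open>real_inner\<close> demands.
  Complex scalars act through \<open>hscale\<close>, and \<open>inner_hscale\<close> replaces
  sesquilinearity.\<close>

definition inner_hvec :: "hvec \<Rightarrow> hvec \<Rightarrow> real" where
  "inner_hvec \<xi> \<eta> = (\<Sum>a | hv \<xi> a \<noteq> 0. inner (hv \<xi> a) (hv \<eta> a))"
definition norm_hvec :: "hvec \<Rightarrow> real" where "norm_hvec \<xi> = sqrt (inner \<xi> \<xi>)"
definition sgn_hvec :: "hvec \<Rightarrow> hvec" where "sgn_hvec \<xi> = inverse (norm \<xi>) *\<^sub>R \<xi>"
definition dist_hvec :: "hvec \<Rightarrow> hvec \<Rightarrow> real" where "dist_hvec \<xi> \<eta> = norm (\<xi> - \<eta>)"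
definition uniformity_hvec :: "(hvec \<times> hvec) filter" where
  "uniformity_hvec = (INF e\<in>{0 <..}. principal {(\<xi>, \<eta>). dist \<xi> \<eta> < e})"
definition open_hvec :: "hvec set \<Rightarrow> bool" where
  "open_hvec U \<longleftrightarrow> (\<forall>x\<in>U. eventually (\<lambda>(x', y). x' = x \<longrightarrow> y \<in> U) uniformity)"

lemma inner_hvec_eq_aux:
  assumes "finite A" "{a. hv \<xi> a \<noteq> 0} \<subseteq> A \<or> {a. hv \<eta> a \<noteq> 0} \<subseteq> A"
  shows "inner \<xi> \<eta> = (\<Sum>a\<in>A. inner (hv \<xi> a) (hv \<eta> a))"
proof -
  have out: "inner (hv \<xi> a) (hv \<eta> a) = 0" if "a \<notin> A" for a
    using assms(2) that by (cases "hv \<xi> a = 0"; cases "hv \<eta> a = 0") auto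
  have "inner \<xi> \<eta> = (\<Sum>a\<in>{a. hv \<xi> a \<noteq> 0} \<union> A. inner (hv \<xi> a) (hv \<eta> a))"
    unfolding inner_hvec_def using assms(1) by (intro sum.mono_neutral_left) auto
  also have "\<dots> = (\<Sum>a\<in>A. inner (hv \<xi> a) (hv \<eta> a))"
    using assms(1) out by (intro sum.mono_neutral_right) auto
  finally show ?thesis .
qed

instance
proof
  fix x y z :: hvec and r :: real
  let ?A = "{a. hv x a \<noteq> 0} \<union> {a. hv y a \<noteq> 0} \<union> {a. hv z a \<noteq> 0}"
  have A: "finite ?A" by simp
  note eq = inner_hvec_eq_aux[OF A]
  show "dist x y = norm (x - y)" "sgn x = inverse (norm x) *\<^sub>R x"
    "uniformity = (INF e\<in>{0 <..}. principal {(\<xi>, \<eta> :: hvec). dist \<xi> \<eta> < e})"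
    "open U \<longleftrightarrow> (\<forall>x\<in>U. eventually (\<lambda>(x', y). x' = x \<longrightarrow> y \<in> U) uniformity)" "norm x = sqrt (inner x x)" for U :: "hvec set"
    by (simp_all add: dist_hvec_def sgn_hvec_def uniformity_hvec_def open_hvec_def norm_hvec_def)
  show "inner x y = inner y x"
    by (subst (1 2) eq) (auto simp: inner_commute)
  show "inner (x + y) z = inner x z + inner y z"
    by (subst (1 2 3) eq) (auto simp: inner_add_left sum.distrib)
  show "inner (r *\<^sub>R x) y = r * inner x y"
    by (subst (1 2) eq) (auto simp: sum_distrib_left)
  show "0 \<le> inner x x" unfolding inner_hvec_def by (intro sum_nonneg) simp
  show "inner x x = 0 \<longleftrightarrow> x = 0"
  proof
    assume "inner x x = 0"
    then have "\<forall>a\<in>{a. hv x a \<noteq> 0}. inner (hv x a) (hv x a) = 0"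
      unfolding inner_hvec_def by (subst (asm) sum_nonneg_eq_0_iff) auto
    then show "x = 0" by (intro hvec_eqI) auto
  qed (simp add: inner_hvec_def)
qed

end

lemmas inner_hvec_eq = inner_hvec_eq_aux

lemma norm_hvec_sq: "(norm \<xi>)\<^sup>2 = (\<Sum>a | hv \<xi> a \<noteq> 0. (cmod (hv \<xi> a))\<^sup>2)" for \<xi> :: hvec
  by (simp add: power2_norm_eq_inner inner_hvec_def)

lift_definition hscale :: "complex \<Rightarrow> hvec \<Rightarrow> hvec" is "\<lambda>c \<xi> a. c * \<xi> a"
  by (erule rev_finite_subset) auto

lemma hv_hscale [simp]: "hv (hscale c \<xi>) a = c * hv \<xi> a"
  by (simp add: hscale.rep_eq)

lemma inner_hscale: "inner (hscale c \<xi>) \<eta> = inner \<xi> (hscale (cnj c) \<eta>)"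
proof -
  let ?A = "{a. hv \<xi> a \<noteq> 0} \<union> {a. hv \<eta> a \<noteq> 0}"
  have "inner (c * x) y = inner x (cnj c * y)" for x y :: complex
    by (simp add: inner_complex_def algebra_simps)
  then show ?thesis
    by (subst (1 2) inner_hvec_eq[of ?A]) (auto intro: sum.cong)
qed

lemma norm_hscale: "norm (hscale c \<xi>) = cmod c * norm \<xi>"
proof -
  have "hscale (cnj c) (hscale c \<xi>) = (cmod c)\<^sup>2 *\<^sub>R \<xi>"
    by (rule hvec_eqI) (simp add: complex_norm_square scaleR_conv_of_real mult_ac flip: of_real_power)
  then have "(norm (hscale c \<xi>))\<^sup>2 = (cmod c * norm \<xi>)\<^sup>2"
    by (simp add: power2_norm_eq_inner inner_hscale power_mult_distrib)
  then show ?thesis by (rule power2_eq_imp_eq) auto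
qed

section \<open>Letters as partial injections of the basis\<close>

fun vert :: "basis \<Rightarrow> Q2_vertex" where
  "vert (B 0) = V01" | "vert (C 0) = V11" | "vert _ = V00"

text \<open>\<open>edge_pre e a = Some b\<close> says that the path \<open>a\<close> is
  \<open>b\<close> preceded by \<open>e\<close>, and \<open>edge_post\<close> is the inverse. The
  infinite path behind \<open>B 0\<close> is fixed by the loop at \<open>V01\<close>.\<close>

fun edge_pre :: "Q2_edge \<Rightarrow> basis \<Rightarrow> basis option" where
  "edge_pre Loop00 (B (Suc (Suc i))) = Some (B (Suc i))"
| "edge_pre Loop00 (C (Suc (Suc i))) = Some (C (Suc i))"
| "edge_pre E00_01 (B (Suc 0)) = Some (B 0)"
| "edge_pre E00_11 (C (Suc 0)) = Some (C 0)"
| "edge_pre Loop01 (B 0) = Some (B 0)"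
| "edge_pre _ _ = None"

fun edge_post :: "Q2_edge \<Rightarrow> basis \<Rightarrow> basis option" where
  "edge_post Loop00 (B (Suc i)) = Some (B (Suc (Suc i)))"
| "edge_post Loop00 (C (Suc i)) = Some (C (Suc (Suc i)))"
| "edge_post E00_01 (B 0) = Some (B (Suc 0))"
| "edge_post E00_11 (C 0) = Some (C (Suc 0))"
| "edge_post Loop01 (B 0) = Some (B 0)"
| "edge_post _ _ = None"

fun pre :: "(Q2_vertex, Q2_edge) graph_gen letter \<Rightarrow> basis \<Rightarrow> basis option" where
  "pre (Gen (Vertex v)) a = (if vert a = v then Some a else None)"
| "pre (Adj (Vertex v)) a = (if vert a = v then Some a else None)"
| "pre (Gen (Edge e)) a = edge_pre e a"
| "pre (Adj (Edge e)) a = edge_post e a"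

lemma edge_pre_post: "edge_pre e a = Some b \<longleftrightarrow> edge_post e b = Some a"
  by (cases "(e, a)" rule: edge_pre.cases; cases "(e, b)" rule: edge_post.cases) auto

text \<open>The adjoint letter belongs to the inverse partial injection. Finite support,
  contractivity and the adjoint of \<open>act\<close> all rest on this.\<close>

lemma pre_adj: "pre (letter_adj l) b = Some a \<longleftrightarrow> pre l a = Some b"
  by (cases l; rename_tac x; case_tac x) (auto simp: edge_pre_post split: if_splits)

lemma pre_inj: "pre l a = Some b \<Longrightarrow> pre l a' = Some b \<Longrightarrow> a = a'"
  using pre_adj by (metis option.inject)

lift_definition act :: "(Q2_vertex, Q2_edge) graph_gen letter \<Rightarrow> hvec \<Rightarrow> hvec"
  is "\<lambda>l \<xi> a. case pre l a of None \<Rightarrow> 0 | Some b \<Rightarrow> \<xi> b"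
proof -
  fix l and \<xi> :: "basis \<Rightarrow> complex" assume fin: "finite {a. \<xi> a \<noteq> 0}"
  have "{a. (case pre l a of None \<Rightarrow> 0 | Some b \<Rightarrow> \<xi> b) \<noteq> 0} \<subseteq> (\<lambda>b. the (pre (letter_adj l) b)) ` {b. \<xi> b \<noteq> 0}"
  proof
    fix a assume "a \<in> {a. (case pre l a of None \<Rightarrow> 0 | Some b \<Rightarrow> \<xi> b) \<noteq> 0}"
    then obtain b where b: "pre l a = Some b" "\<xi> b \<noteq> 0" by (auto split: option.splits)
    then have "pre (letter_adj l) b = Some a" by (simp add: pre_adj)
    then show "a \<in> (\<lambda>b. the (pre (letter_adj l) b)) ` {b. \<xi> b \<noteq> 0}" using b by (intro image_eqI[of _ _ b]) auto
  qed
  then show "finite {a. (case pre l a of None \<Rightarrow> 0 | Some b \<Rightarrow> \<xi> b) \<noteq> 0}"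
    using fin finite_surj by blast
qed

lemma hv_act: "hv (act l \<xi>) a = (case pre l a of None \<Rightarrow> 0 | Some b \<Rightarrow> hv \<xi> b)"
  by (simp add: act.rep_eq)

lemma act_linear: "act l (\<xi> + \<eta>) = act l \<xi> + act l \<eta>" "act l (r *\<^sub>R \<xi>) = r *\<^sub>R act l \<xi>"
  "act l (hscale c \<xi>) = hscale c (act l \<xi>)"
  by (auto intro!: hvec_eqI simp: hv_act split: option.splits)

lemma inner_act: "inner (act l \<xi>) \<eta> = inner \<xi> (act (letter_adj l) \<eta>)"
proof -
  let ?X = "{a. hv \<xi> a \<noteq> 0}" and ?Y = "{a. hv \<eta> a \<noteq> 0}"
  have 1: "inner (hv (act l \<xi>) a) (hv \<eta> a) = (\<Sum>b\<in>?X. if pre l a = Some b then inner (hv \<xi> b) (hv \<eta> a) else 0)" for a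
    by (cases "pre l a") (auto simp: hv_act)
  have 2: "inner (hv \<xi> b) (hv (act (letter_adj l) \<eta>) b) = (\<Sum>a\<in>?Y. if pre l a = Some b then inner (hv \<xi> b) (hv \<eta> a) else 0)" for b
  proof -
    have pa: "pre l a = Some b \<longleftrightarrow> pre (letter_adj l) b = Some a" for a by (rule pre_adj[symmetric])
    show ?thesis unfolding pa by (cases "pre (letter_adj l) b") (auto simp: hv_act)
  qed
  have "inner (act l \<xi>) \<eta> = (\<Sum>a\<in>?Y. inner (hv (act l \<xi>) a) (hv \<eta> a))"
    by (rule inner_hvec_eq) auto
  also have "\<dots> = (\<Sum>b\<in>?X. inner (hv \<xi> b) (hv (act (letter_adj l) \<eta>) b))"
    unfolding 1 2 by (rule sum.swap)
  also have "\<dots> = inner \<xi> (act (letter_adj l) \<eta>)"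
    by (rule inner_hvec_eq[symmetric]) auto
  finally show ?thesis .
qed

lemma norm_act_le: "norm (act l \<xi>) \<le> norm \<xi>"
proof -
  define A where "A = {a. hv (act l \<xi>) a \<noteq> 0}"
  have A: "\<exists>b. pre l a = Some b \<and> hv \<xi> b \<noteq> 0" if "a \<in> A" for a
    using that by (auto simp: A_def hv_act split: option.splits)
  have inj: "inj_on (\<lambda>a. the (pre l a)) A"
    using A pre_inj by (intro inj_onI) (metis option.sel)
  have "(norm (act l \<xi>))\<^sup>2 = (\<Sum>a\<in>A. (cmod (hv \<xi> (the (pre l a))))\<^sup>2)"
    unfolding norm_hvec_sq A_def[symmetric] using A by (intro sum.cong) (force simp: hv_act)+
  also have "\<dots> = (\<Sum>b\<in>(\<lambda>a. the (pre l a)) ` A. (cmod (hv \<xi> b))\<^sup>2)"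
    using inj by (simp add: sum.reindex)
  also have "\<dots> \<le> (norm \<xi>)\<^sup>2"
    unfolding norm_hvec_sq using A by (intro sum_mono2) force+
  finally show ?thesis by (rule power2_le_imp_le) simp
qed

definition actw :: "(Q2_vertex, Q2_edge) graph_gen star_word \<Rightarrow> hvec \<Rightarrow> hvec" where
  "actw w \<xi> = foldr act (letters w) \<xi>"

lemma actw_linear: "actw w (\<xi> + \<eta>) = actw w \<xi> + actw w \<eta>" "actw w (r *\<^sub>R \<xi>) = r *\<^sub>R actw w \<xi>"
  "actw w (hscale c \<xi>) = hscale c (actw w \<xi>)"
proof -
  have "foldr act ls (\<xi> + \<eta>) = foldr act ls \<xi> + foldr act ls \<eta>" "foldr act ls (r *\<^sub>R \<xi>) = r *\<^sub>R foldr act ls \<xi>"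
    "foldr act ls (hscale c \<xi>) = hscale c (foldr act ls \<xi>)" for ls
    by (induction ls) (simp_all add: act_linear)
  then show "actw w (\<xi> + \<eta>) = actw w \<xi> + actw w \<eta>" "actw w (r *\<^sub>R \<xi>) = r *\<^sub>R actw w \<xi>"
    "actw w (hscale c \<xi>) = hscale c (actw w \<xi>)" by (simp_all add: actw_def)
qed

lemma actw_plus: "actw (v + w) \<xi> = actw v (actw w \<xi>)"
  by (simp add: actw_def plus_star_word_def)

lemma norm_actw_le: "norm (actw w \<xi>) \<le> norm \<xi>"
proof -
  have "norm (foldr act ls \<xi>) \<le> norm \<xi>" for ls
    by (induction ls) (auto intro: order_trans[OF norm_act_le])
  then show ?thesis by (simp add: actw_def)
qed

lemma inner_actw: "inner (actw w \<xi>) \<eta> = inner \<xi> (actw (word_adj w) \<eta>)"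
proof -
  have "inner (foldr act ls \<xi>) \<eta> = inner \<xi> (foldr act (rev (map letter_adj ls)) \<eta>)" for ls
    by (induction ls arbitrary: \<eta>) (simp_all add: inner_act)
  then show ?thesis by (simp add: actw_def word_adj_def)
qed

section \<open>The representation of polynomials and its operator norm\<close>

definition rep :: "q2_poly \<Rightarrow> hvec \<Rightarrow> hvec" where
  "rep p \<xi> = (\<Sum>w\<in>Poly_Mapping.keys p. hscale (Poly_Mapping.lookup p w) (actw w \<xi>))"

lemma hscale_add_left: "hscale (c + d) \<xi> = hscale c \<xi> + hscale d \<xi>"
  and hscale_0_left: "hscale 0 \<xi> = 0"
  and hscale_add_right: "hscale c (\<xi> + \<eta>) = hscale c \<xi> + hscale c \<eta>"
  and hscale_scaleR: "hscale c (r *\<^sub>R \<xi>) = r *\<^sub>R hscale c \<xi>"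
  and hscale_hscale: "hscale c (hscale d \<xi>) = hscale (c * d) \<xi>"
  by (auto intro!: hvec_eqI simp: algebra_simps)

lemma rep_eq: "finite A \<Longrightarrow> Poly_Mapping.keys p \<subseteq> A \<Longrightarrow>
    rep p \<xi> = (\<Sum>w\<in>A. hscale (Poly_Mapping.lookup p w) (actw w \<xi>))"
  unfolding rep_def by (intro sum.mono_neutral_left) (auto simp: in_keys_iff hscale_0_left)

lemma rep_add: "rep (p + q) \<xi> = rep p \<xi> + rep q \<xi>"
proof -
  let ?A = "Poly_Mapping.keys p \<union> Poly_Mapping.keys q"
  have "Poly_Mapping.keys (p + q) \<subseteq> ?A" by (rule Poly_Mapping.keys_add)
  then show ?thesis
    by (simp add: rep_eq[of ?A] lookup_add hscale_add_left sum.distrib)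
qed

lemma rep_single: "rep (Poly_Mapping.single w c) \<xi> = hscale c (actw w \<xi>)"
  by (subst rep_eq[of "{w}"]) (auto simp: lookup_single)

lemma rep_linear: "rep p (\<xi> + \<eta>) = rep p \<xi> + rep p \<eta>" "rep p (r *\<^sub>R \<xi>) = r *\<^sub>R rep p \<xi>"
  "rep p (hscale c \<xi>) = hscale c (rep p \<xi>)"
proof (induction p rule: star_poly_induct)
  case (single w a)
  show "rep (Poly_Mapping.single w a) (\<xi> + \<eta>) = rep (Poly_Mapping.single w a) \<xi> + rep (Poly_Mapping.single w a) \<eta>"
    "rep (Poly_Mapping.single w a) (r *\<^sub>R \<xi>) = r *\<^sub>R rep (Poly_Mapping.single w a) \<xi>"
    "rep (Poly_Mapping.single w a) (hscale c \<xi>) = hscale c (rep (Poly_Mapping.single w a) \<xi>)"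
    by (simp_all add: rep_single actw_linear hscale_add_right hscale_scaleR hscale_hscale mult.commute)
next
  case (add p q)
  then show "rep (p + q) (\<xi> + \<eta>) = rep (p + q) \<xi> + rep (p + q) \<eta>"
    "rep (p + q) (r *\<^sub>R \<xi>) = r *\<^sub>R rep (p + q) \<xi>" "rep (p + q) (hscale c \<xi>) = hscale c (rep (p + q) \<xi>)"
    by (simp_all add: rep_add scaleR_add_right hscale_add_right)
qed

lemma rep_mult: "rep (p * q) \<xi> = rep p (rep q \<xi>)"
proof (induction p rule: star_poly_induct)
  case (single v a)
  show ?case
    by (induction q rule: star_poly_induct)
      (simp_all add: mult_single rep_single actw_plus actw_linear hscale_hscale rep_add distrib_left hscale_add_right)
qed (simp add: rep_add distrib_right)

lemma rep_scale: "rep (poly_scale c p) \<xi> = hscale c (rep p \<xi>)"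
  by (induction p rule: star_poly_induct)
    (simp_all add: poly_scale_single rep_single hscale_hscale poly_scale_add rep_add hscale_add_right)

lemma rep_minus: "rep (p - q) \<xi> = rep p \<xi> - rep q \<xi>"
  using rep_add[of "p - q" q \<xi>] by (simp add: eq_diff_eq)

lemma inner_rep: "inner (rep p \<xi>) \<eta> = inner \<xi> (rep (poly_adj p) \<eta>)"
  by (induction p rule: star_poly_induct)
    (simp_all add: poly_adj_single rep_single inner_hscale inner_actw actw_linear poly_adj_add rep_add
      inner_add_left inner_add_right)

lemma bounded_linear_rep: "bounded_linear (rep p)"
proof (rule bounded_linear_intro)
  fix \<xi> :: hvec
  have "norm (rep p \<xi>) \<le> (\<Sum>w\<in>Poly_Mapping.keys p. cmod (Poly_Mapping.lookup p w) * norm \<xi>)"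
    unfolding rep_def by (intro sum_norm_le) (simp add: norm_hscale mult_left_mono norm_actw_le)
  then show "norm (rep p \<xi>) \<le> norm \<xi> * (\<Sum>w\<in>Poly_Mapping.keys p. cmod (Poly_Mapping.lookup p w))"
    by (simp add: sum_distrib_left mult.commute)
qed (simp_all add: rep_linear)

definition op_norm :: "q2_poly \<Rightarrow> real" where "op_norm p = onorm (rep p)"

lemma op_norm_ge: "norm (rep p \<xi>) \<le> op_norm p * norm \<xi>"
  unfolding op_norm_def by (rule onorm[OF bounded_linear_rep])

lemma op_norm_le: "0 \<le> K \<Longrightarrow> (\<And>\<xi>. norm (rep p \<xi>) \<le> K * norm \<xi>) \<Longrightarrow> op_norm p \<le> K"
  unfolding op_norm_def by (rule onorm_bound)

lemma op_norm_nonneg: "0 \<le> op_norm p"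
  unfolding op_norm_def by (rule onorm_pos_le[OF bounded_linear_rep])

text \<open>The adjoints provided by \<open>inner_rep\<close> and the Cauchy-Schwarz inequality
  yield both the bound for the adjoint and the C*-identity.\<close>

lemma cstar_seminorm_op_norm: "cstar_seminorm op_norm"
  unfolding cstar_seminorm_def
proof (intro conjI ballI allI)
  fix p q :: q2_poly and c
  show "0 \<le> op_norm p" by (rule op_norm_nonneg)
  show "op_norm (p + q) \<le> op_norm p + op_norm q"
  proof (rule op_norm_le)
    fix \<xi>
    have "norm (rep (p + q) \<xi>) \<le> norm (rep p \<xi>) + norm (rep q \<xi>)" unfolding rep_add by (rule norm_triangle_ineq)
    then show "norm (rep (p + q) \<xi>) \<le> (op_norm p + op_norm q) * norm \<xi>"
      using op_norm_ge[of p \<xi>] op_norm_ge[of q \<xi>] by (simp add: distrib_right)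
  qed (simp add: op_norm_nonneg)
  have sc: "op_norm (poly_scale c p) \<le> cmod c * op_norm p" for c p
    by (rule op_norm_le) (simp_all add: rep_scale norm_hscale op_norm_nonneg op_norm_ge mult.assoc mult_left_mono)
  show "op_norm (poly_scale c p) = cmod c * op_norm p"
  proof (cases "c = 0")
    case True then show ?thesis using sc[of 0 p] op_norm_nonneg[of 0] by simp
  next
    case False
    have "op_norm p \<le> cmod (inverse c) * op_norm (poly_scale c p)"
      using sc[of "inverse c" "poly_scale c p"] False by (simp add: poly_scale_scale)
    then have "cmod c * op_norm p \<le> cmod c * (cmod (inverse c) * op_norm (poly_scale c p))"
      by (rule mult_left_mono) simp
    also have "\<dots> = cmod (c * inverse c) * op_norm (poly_scale c p)" by (simp only: Real_Vector_Spaces.norm_mult mult.assoc)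
    finally show ?thesis using sc[of c p] False by simp
  qed
  have mult: "op_norm (p * q) \<le> op_norm p * op_norm q" for p q
  proof (rule op_norm_le)
    fix \<xi>
    have "norm (rep (p * q) \<xi>) \<le> op_norm p * norm (rep q \<xi>)" unfolding rep_mult by (rule op_norm_ge)
    also have "\<dots> \<le> op_norm p * (op_norm q * norm \<xi>)"
      by (intro mult_left_mono op_norm_ge op_norm_nonneg)
    finally show "norm (rep (p * q) \<xi>) \<le> op_norm p * op_norm q * norm \<xi>" by (simp add: mult.assoc)
  qed (simp add: op_norm_nonneg)
  then show "op_norm (p * q) \<le> op_norm p * op_norm q" .
  have adj: "op_norm (poly_adj p) \<le> op_norm p" for p
  proof (rule op_norm_le)
    fix \<xi>
    have "norm (rep (poly_adj p) \<xi>) * norm (rep (poly_adj p) \<xi>) = inner \<xi> (rep p (rep (poly_adj p) \<xi>))"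
      using inner_rep[of "poly_adj p" \<xi> "rep (poly_adj p) \<xi>"] by (simp flip: power2_eq_square add: power2_norm_eq_inner)
    also have "\<dots> \<le> norm \<xi> * norm (rep p (rep (poly_adj p) \<xi>))" by (rule norm_cauchy_schwarz)
    also have "\<dots> \<le> norm \<xi> * (op_norm p * norm (rep (poly_adj p) \<xi>))"
      by (intro mult_left_mono op_norm_ge) simp
    finally have "norm (rep (poly_adj p) \<xi>) * norm (rep (poly_adj p) \<xi>) \<le> (op_norm p * norm \<xi>) * norm (rep (poly_adj p) \<xi>)"
      by (simp add: mult_ac)
    then show "norm (rep (poly_adj p) \<xi>) \<le> op_norm p * norm \<xi>"
      by (cases "norm (rep (poly_adj p) \<xi>) = 0") (auto simp: mult_le_cancel_right op_norm_nonneg)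
  qed (rule op_norm_nonneg)
  show "op_norm (poly_adj p * p) = (op_norm p)\<^sup>2"
  proof (rule antisym)
    have "op_norm (poly_adj p * p) \<le> op_norm (poly_adj p) * op_norm p" by (rule mult)
    also have "\<dots> \<le> op_norm p * op_norm p" by (intro mult_right_mono adj op_norm_nonneg)
    finally show "op_norm (poly_adj p * p) \<le> (op_norm p)\<^sup>2" by (simp add: power2_eq_square)
    have "op_norm p \<le> sqrt (op_norm (poly_adj p * p))"
    proof (rule op_norm_le)
      fix \<xi>
      have "(norm (rep p \<xi>))\<^sup>2 = inner \<xi> (rep (poly_adj p * p) \<xi>)"
        by (simp add: power2_norm_eq_inner inner_rep rep_mult)
      also have "\<dots> \<le> norm \<xi> * norm (rep (poly_adj p * p) \<xi>)" by (rule norm_cauchy_schwarz)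
      also have "\<dots> \<le> norm \<xi> * (op_norm (poly_adj p * p) * norm \<xi>)"
        by (intro mult_left_mono op_norm_ge) simp
      also have "\<dots> = (sqrt (op_norm (poly_adj p * p)) * norm \<xi>)\<^sup>2"
        by (simp add: power_mult_distrib op_norm_nonneg) (simp add: power2_eq_square)
      finally show "norm (rep p \<xi>) \<le> sqrt (op_norm (poly_adj p * p)) * norm \<xi>"
        by (rule power2_le_imp_le) (simp add: op_norm_nonneg)
    qed (simp add: op_norm_nonneg)
    then have "(op_norm p)\<^sup>2 \<le> (sqrt (op_norm (poly_adj p * p)))\<^sup>2"
      by (intro power_mono op_norm_nonneg)
    then show "(op_norm p)\<^sup>2 \<le> op_norm (poly_adj p * p)" by (simp add: op_norm_nonneg)
  qed
qed

lemma rep_gen: "rep (gen x) \<xi> = act (Gen x) \<xi>" "rep (poly_adj (gen x)) \<xi> = act (Adj x) \<xi>"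
  by (auto intro!: hvec_eqI simp: gen_def poly_adj_single rep_single actw_def word_adj_def)

lemma rep_relations: assumes "r \<in> R2" shows "rep r \<xi> = 0"
proof -
  have P: "act (Adj (Vertex v)) \<xi> = act (Gen (Vertex v)) \<xi>"
    "act (Gen (Vertex v)) (act (Gen (Vertex v)) \<xi>) = act (Gen (Vertex v)) \<xi>"
    "v \<noteq> w \<Longrightarrow> act (Gen (Vertex v)) (act (Gen (Vertex w)) \<xi>) = 0" for v w \<xi>
    by (auto intro!: hvec_eqI simp: hv_act)
  have range: "act (Adj (Edge e)) (act (Gen (Edge e)) \<xi>) = act (Gen (Vertex (head Q2 e))) \<xi>" for e \<xi>
  proof (rule hvec_eqI)
    fix a
    show "hv (act (Adj (Edge e)) (act (Gen (Edge e)) \<xi>)) a = hv (act (Gen (Vertex (head Q2 e))) \<xi>) a"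
      by (cases e; cases a rule: vert.cases) (simp_all add: hv_act Q2_def)
  qed
  have SP: "act (Gen (Edge e)) (act (Gen (Vertex (head Q2 e))) \<xi>) = act (Gen (Edge e)) \<xi>" for e \<xi>
  proof (rule hvec_eqI)
    fix a
    show "hv (act (Gen (Edge e)) (act (Gen (Vertex (head Q2 e))) \<xi>)) a = hv (act (Gen (Edge e)) \<xi>) a"
      by (cases "(e, a)" rule: edge_pre.cases) (simp_all add: hv_act Q2_def)
  qed
  have rep_sum: "rep (\<Sum>i\<in>I. f i) \<xi> = (\<Sum>i\<in>I. rep (f i) \<xi>)" for f :: "Q2_edge \<Rightarrow> q2_poly" and I
  proof (induction I rule: infinite_finite_induct)
    case empty then show ?case by (simp add: rep_def)
  next
    case (infinite I) then show ?case by (simp add: rep_def)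
  qed (simp add: rep_add)
  have ck: "(\<Sum>e\<in>out_arcs Q2 v. act (Gen (Edge e)) (act (Adj (Edge e)) \<xi>)) = act (Gen (Vertex v)) \<xi>"
    if "out_arcs Q2 v \<noteq> {}" for v
  proof (rule hvec_eqI)
    fix a
    from that have "v = V00 \<or> v = V01" by (cases v) (auto simp: out_arcs_Q2)
    then show "hv (\<Sum>e\<in>out_arcs Q2 v. act (Gen (Edge e)) (act (Adj (Edge e)) \<xi>)) a = hv (act (Gen (Vertex v)) \<xi>) a"
      by (elim disjE; cases "(Loop00, a)" rule: edge_pre.cases) (auto simp: out_arcs_Q2 hv_act)
  qed
  show ?thesis
    using assms unfolding graph_relations_def
    by (elim UnE CollectE exE conjE)
      (simp_all add: Q2_verts Q2_arcs rep_minus rep_sum rep_mult rep_gen P range SP ck)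
qed

text \<open>The universal norm dominates every admissible seminorm, so the representation bounds it
  from below; this makes matrix coefficients continuous.\<close>

lemma op_norm_le_univ_norm: "p \<in> star_polys \<Longrightarrow> op_norm p \<le> univ_norm R2 p"
proof (rule Q2.seminorm_le)
  have "op_norm r = 0" if "r \<in> R2" for r
  proof (rule antisym)
    show "op_norm r \<le> 0" by (rule op_norm_le) (simp_all add: rep_relations[OF that])
  qed (rule op_norm_nonneg)
  then show "op_norm \<in> rel_seminorms R2" by (simp add: rel_seminorms_def cstar_seminorm_op_norm)
qed

section \<open>Matrix coefficients\<close>

lift_definition delta :: "basis \<Rightarrow> hvec" is "\<lambda>b a. if a = b then 1 else 0"
  by simp

lemma hv_delta [simp]: "hv (delta b) a = (if a = b then 1 else 0)"
  by (simp add: delta.rep_eq)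

lemma norm_delta [simp]: "norm (delta b) = 1"
proof -
  have "(norm (delta b))\<^sup>2 = 1\<^sup>2" unfolding norm_hvec_sq by simp
  then show ?thesis by (rule power2_eq_imp_eq) auto
qed

lemma inner_delta: "inner \<xi> (delta a) = Re (hv \<xi> a)"
  by (subst inner_hvec_eq[of "{a}"]) (auto simp: inner_complex_def)

lemma cmod_hv_le: "cmod (hv \<xi> a) \<le> norm \<xi>"
proof (cases "hv \<xi> a = 0")
  case False
  have "(cmod (hv \<xi> a))\<^sup>2 \<le> (norm \<xi>)\<^sup>2"
    unfolding norm_hvec_sq using False by (intro member_le_sum) auto
  then show ?thesis by (rule power2_le_imp_le) simp
qed simp

definition pcoef :: "basis \<Rightarrow> basis \<Rightarrow> q2_poly \<Rightarrow> complex" where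
  "pcoef a b p = hv (rep p (delta b)) a"

lemma pcoef_simps: "pcoef a b (p + q) = pcoef a b p + pcoef a b q" "pcoef a b (p - q) = pcoef a b p - pcoef a b q"
  "pcoef a b (poly_scale c p) = c * pcoef a b p"
  by (simp_all add: pcoef_def rep_add rep_minus rep_scale)

lemma pcoef_le: "p \<in> star_polys \<Longrightarrow> cmod (pcoef a b p) \<le> univ_norm R2 p"
  unfolding pcoef_def using cmod_hv_le[of "rep p (delta b)" a] op_norm_ge[of p "delta b"] op_norm_le_univ_norm[of p]
  by simp

text \<open>The inner product shows real parts only. The identity for real parts, applied to the
  multiple of \<open>p\<close> by \<open>\<i>\<close>, gives the imaginary parts.\<close>

lemma pcoef_adj: "pcoef a b (poly_adj p) = cnj (pcoef b a p)"
proof -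
  have re: "Re (pcoef a b (poly_adj p)) = Re (pcoef b a p)" for p
    using inner_rep[of p "delta a" "delta b"] inner_delta[of "rep p (delta a)" b]
      inner_delta[of "rep (poly_adj p) (delta b)" a] by (simp add: pcoef_def inner_commute)
  have "Im (pcoef a b (poly_adj p)) = - Im (pcoef b a p)"
    using re[of "poly_scale \<i> p"] by (simp add: poly_adj_scale pcoef_simps)
  then show ?thesis using re by (simp add: complex_eq_iff)
qed

lemma pcoef_gen_mult: "pcoef a b (gen x * p) = (case pre (Gen x) a of None \<Rightarrow> 0 | Some a' \<Rightarrow> pcoef a' b p)"
  "pcoef a b (poly_adj (gen x) * p) = (case pre (Adj x) a of None \<Rightarrow> 0 | Some a' \<Rightarrow> pcoef a' b p)"
  by (simp_all add: pcoef_def rep_mult rep_gen hv_act split: option.split)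

text \<open>The limit along an arbitrary representing sequence; by \<open>pcoef_le\<close> it exists
  and does not depend on the choice.\<close>

definition coef :: "basis \<Rightarrow> basis \<Rightarrow> q2alg \<Rightarrow> complex" where
  "coef a b X = lim (\<lambda>n. pcoef a b ((SOME x. x \<in> cauchy_seqs R2 \<and> X = cl x) n))"

lemma coef_tendsto:
  assumes x: "x \<in> cauchy_seqs R2"
  shows "(\<lambda>n. pcoef a b (x n)) \<longlonglongrightarrow> coef a b (cl x)"
proof -
  define y where "y = (SOME y. y \<in> cauchy_seqs R2 \<and> cl x = cl y)"
  have y: "y \<in> cauchy_seqs R2" "cl x = cl y"
    using someI[of "\<lambda>y. y \<in> cauchy_seqs R2 \<and> cl x = cl y" x] x by (auto simp: y_def)
  note sp = Q2.C_star_polys[OF x] Q2.C_star_polys[OF y(1)]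
  have "Cauchy (\<lambda>n. pcoef a b (y n))"
  proof (rule metric_CauchyI)
    fix e :: real assume e: "e > 0"
    obtain N where N: "\<forall>m\<ge>N. \<forall>n\<ge>N. univ_norm R2 (y m - y n) < e" by (rule Q2.C_D[OF y(1) e])
    have "dist (pcoef a b (y m)) (pcoef a b (y n)) \<le> univ_norm R2 (y m - y n)" for m n
      using pcoef_le[of "y m - y n" a b] sp by (simp add: dist_norm pcoef_simps)
    then show "\<exists>M. \<forall>m\<ge>M. \<forall>n\<ge>M. dist (pcoef a b (y m)) (pcoef a b (y n)) < e"
      using N order_le_less_trans by blast
  qed
  then have "convergent (\<lambda>n. pcoef a b (y n))" by (simp add: Cauchy_convergent_iff)
  then have lim: "(\<lambda>n. pcoef a b (y n)) \<longlonglongrightarrow> coef a b (cl x)"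
    by (simp add: coef_def y_def convergent_LIMSEQ_iff)
  have null: "(\<lambda>n. univ_norm R2 (x n - y n)) \<longlonglongrightarrow> 0" using cl_eq_iff[OF x y(1)] y(2) by simp
  have "(\<lambda>n. pcoef a b (x n) - pcoef a b (y n)) \<longlonglongrightarrow> 0"
  proof (rule tendsto_0_le[OF null])
    have "norm (pcoef a b (x n) - pcoef a b (y n)) \<le> norm (univ_norm R2 (x n - y n)) * 1" for n
      using pcoef_le[of "x n - y n" a b] sp by (simp add: pcoef_simps)
    then show "\<forall>\<^sub>F n in sequentially. norm (pcoef a b (x n) - pcoef a b (y n)) \<le> norm (univ_norm R2 (x n - y n)) * 1"
      by simp
  qed
  from tendsto_add[OF this lim] show ?thesis by simp
qed

lemma coef_simps: "coef a b (X + Y) = coef a b X + coef a b Y" "coef a b (c *\<^sub>C X) = c * coef a b X"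
  "coef a b (X\<^sup>\<star>) = cnj (coef b a X)" "cmod (coef a b X) \<le> norm X"
proof -
  obtain x where x: "x \<in> cauchy_seqs R2" "X = cl x" by (rule q2_cases)
  obtain y where y: "y \<in> cauchy_seqs R2" "Y = cl y" by (rule q2_cases)
  note lim = coef_tendsto[OF x(1)] coef_tendsto[OF y(1)]
  show "coef a b (X + Y) = coef a b X + coef a b Y"
    using LIMSEQ_unique[OF coef_tendsto[OF Q2.C_add[OF x(1) y(1)]]] tendsto_add[OF lim(1) lim(2)]
    by (simp add: x y cl_simps pcoef_simps)
  show "coef a b (c *\<^sub>C X) = c * coef a b X"
    using LIMSEQ_unique[OF coef_tendsto[OF Q2.C_scale[OF x(1)]]] tendsto_mult[OF tendsto_const lim(1)]
    by (simp add: x cscale_cl pcoef_simps)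
  show "coef a b (X\<^sup>\<star>) = cnj (coef b a X)"
    using LIMSEQ_unique[OF coef_tendsto[OF Q2.C_adj[OF x(1)]]] tendsto_cnj[OF lim(1)]
    by (simp add: x star_cl pcoef_adj)
  show "cmod (coef a b X) \<le> norm X"
    unfolding x by (rule LIMSEQ_le[OF tendsto_norm[OF lim(1)] norm_cl_tendsto[OF x(1)]])
      (use pcoef_le Q2.C_star_polys[OF x(1)] in auto)
qed

lemma coef_0 [simp]: "coef a b 0 = 0"
  using coef_simps(2)[of a b 0 0] by simp

lemma coef_diff: "coef a b (X - Y) = coef a b X - coef a b Y"
  using coef_simps(1)[of a b "X - Y" Y] by (simp add: eq_diff_eq)

lemma coef_sum: "coef a b (\<Sum>i\<in>I. f i) = (\<Sum>i\<in>I. coef a b (f i))"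
  by (induction I rule: infinite_finite_induct) (simp_all add: coef_simps)

lemma tendsto_coef:
  assumes "X \<longlonglongrightarrow> L" shows "(\<lambda>n. coef a b (X n)) \<longlonglongrightarrow> coef a b L"
proof (rule LIM_zero_cancel, rule tendsto_0_le)
  show "(\<lambda>n. X n - L) \<longlonglongrightarrow> 0" using assms by (simp add: LIM_zero)
  show "\<forall>\<^sub>F n in sequentially. norm (coef a b (X n) - coef a b L) \<le> norm (X n - L) * 1"
    using coef_simps(4) by (simp flip: coef_diff)
qed

lemma coef_letter_mult: "coef a b (letter_val l * X) = (case pre l a of None \<Rightarrow> 0 | Some a' \<Rightarrow> coef a' b X)"
proof -
  obtain x where x: "x \<in> cauchy_seqs R2" "X = cl x" by (rule q2_cases)
  define p where "p = (case l of Gen y \<Rightarrow> gen y | Adj y \<Rightarrow> poly_adj (gen y))"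
  have p: "p \<in> star_polys" by (simp add: p_def split: letter.splits)
  have l: "letter_val l = cl (\<lambda>_. p)"
    by (cases l) (simp_all add: p_def elt_def star_cl)
  have "(\<lambda>n. pcoef a b (p * x n)) \<longlonglongrightarrow> coef a b (letter_val l * X)"
    using coef_tendsto[OF Q2.C_mult[OF Q2.C_const[OF p] x(1)]] by (simp add: l x cl_simps p)
  moreover have "pcoef a b (p * x n) = (case pre l a of None \<Rightarrow> 0 | Some a' \<Rightarrow> pcoef a' b (x n))" for n
    unfolding p_def by (cases l) (simp_all only: letter.case pcoef_gen_mult)
  moreover have "(\<lambda>n. case pre l a of None \<Rightarrow> 0 | Some a' \<Rightarrow> pcoef a' b (x n))
      \<longlonglongrightarrow> (case pre l a of None \<Rightarrow> 0 | Some a' \<Rightarrow> coef a' b X)"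
    using coef_tendsto[OF x(1)] by (cases "pre l a") (simp_all add: x)
  ultimately show ?thesis using LIMSEQ_unique by simp
qed

lemma coef_gen_mult:
  "coef a b (Pa * X) = (if vert a = V00 then coef a b X else 0)"
  "coef a b (Pb * X) = (if vert a = V01 then coef a b X else 0)"
  "coef a b (Pc * X) = (if vert a = V11 then coef a b X else 0)"
  "coef a b (Se * X) = (case edge_pre Loop00 a of None \<Rightarrow> 0 | Some a' \<Rightarrow> coef a' b X)"
  "coef a b (Sf * X) = (case edge_pre E00_01 a of None \<Rightarrow> 0 | Some a' \<Rightarrow> coef a' b X)"
  "coef a b (Sg * X) = (case edge_pre E00_11 a of None \<Rightarrow> 0 | Some a' \<Rightarrow> coef a' b X)"
  "coef a b (Sh\<^sup>\<star> * X) = (case edge_post Loop01 a of None \<Rightarrow> 0 | Some a' \<Rightarrow> coef a' b X)"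
  using coef_letter_mult[of a b "Gen (Vertex V00)" X] coef_letter_mult[of a b "Gen (Vertex V01)" X]
    coef_letter_mult[of a b "Gen (Vertex V11)" X] coef_letter_mult[of a b "Gen (Edge Loop00)" X]
    coef_letter_mult[of a b "Gen (Edge E00_01)" X] coef_letter_mult[of a b "Gen (Edge E00_11)" X]
    coef_letter_mult[of a b "Adj (Edge Loop01)" X]
  by (simp_all add: gen_defs)

lemma coef_P:
  "coef a b Pa = (if a = b \<and> vert a = V00 then 1 else 0)"
  "coef a b Pb = (if a = b \<and> vert a = V01 then 1 else 0)"
  "coef a b Pc = (if a = b \<and> vert a = V11 then 1 else 0)"
proof -
  have "coef a b (elt (genP v)) = (if a = b \<and> vert a = v then 1 else 0)" for v
  proof -
    have "pcoef a b (genP v) = (if a = b \<and> vert a = v then 1 else 0)"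
      by (simp add: pcoef_def rep_gen hv_act)
    then show ?thesis
      using coef_tendsto[of "\<lambda>_. genP v" a b] by (simp add: elt_def LIMSEQ_const_iff)
  qed
  then show "coef a b Pa = (if a = b \<and> vert a = V00 then 1 else 0)"
    "coef a b Pb = (if a = b \<and> vert a = V01 then 1 else 0)"
    "coef a b Pc = (if a = b \<and> vert a = V11 then 1 else 0)" by (simp_all add: gen_defs)
qed

text \<open>In the representation \<open>yb i\<close> moves the vector of \<open>B 0\<close> to that
  of \<open>B i\<close> and kills the other basis vectors.\<close>

lemma coef_yb_mult: "coef a b (yb i * X) = (if a = B i then coef (B 0) b X else 0)"
proof (induction i arbitrary: a X rule: yb.induct)
  case 1 show ?case by (cases a rule: vert.cases) (simp_all add: coef_gen_mult)
next
  case 2 show ?case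
    by (cases "(E00_01, a)" rule: edge_pre.cases) (simp_all add: coef_gen_mult mult.assoc)
next
  case (3 i)
  show ?case
    by (cases "(Loop00, a)" rule: edge_pre.cases) (simp_all add: coef_gen_mult mult.assoc 3 del: yb.simps(2))
qed

lemma coef_zc_mult: "coef a b (zc i * X) = (if a = C i then coef (C 0) b X else 0)"
proof (induction i arbitrary: a X rule: zc.induct)
  case 1 show ?case by (cases a rule: vert.cases) (simp_all add: coef_gen_mult)
next
  case 2 show ?case
    by (cases "(E00_11, a)" rule: edge_pre.cases) (simp_all add: coef_gen_mult)
next
  case (3 i)
  show ?case
    by (cases "(Loop00, a)" rule: edge_pre.cases) (simp_all add: coef_gen_mult mult.assoc 3 del: zc.simps(2))
qed

text \<open>Removal of \<open>n\<close> turns of the loop at \<open>V00\<close>. A path of length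
  \<open>j > 0\<close> starts with \<open>j - 1\<close> of them, followed by its edge out of
  \<open>V00\<close>; hence the strict inequality.\<close>

fun lower :: "nat \<Rightarrow> basis \<Rightarrow> basis option" where
  "lower n (B j) = (if n < j then Some (B (j - n)) else None)"
| "lower n (C j) = (if n < j then Some (C (j - n)) else None)"

lemma coef_epow_mult: "coef a b (epow n * X) = (case lower n a of None \<Rightarrow> 0 | Some a' \<Rightarrow> coef a' b X)"
proof (induction n arbitrary: a)
  case 0 show ?case by (cases a rule: vert.cases) (simp_all add: coef_gen_mult)
next
  case (Suc n)
  show ?case
    by (cases "(Loop00, a)" rule: edge_pre.cases) (auto simp: coef_gen_mult mult.assoc Suc)
qed

lemma coef_ee: "coef a b (ee i j) = (if a = B i \<and> b = B j then 1 else 0)"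
proof -
  have "coef b (B 0) (yb j) = (if b = B j then 1 else 0)" for b
    using coef_yb_mult[of b "B 0" j Pb] by (simp add: yb_P coef_P)
  then show ?thesis by (simp add: ee_def coef_yb_mult coef_simps)
qed

lemma coef_cc: "coef a b (cc i) = (if a = C i \<and> b = C i then 1 else 0)"
proof -
  have "coef b (C 0) (zc i) = (if b = C i then 1 else 0)" for b
    using coef_zc_mult[of b "C 0" i Pc] by (simp add: zc_P coef_P)
  then show ?thesis by (simp add: cc_def coef_zc_mult coef_simps)
qed

lemma coef_aa: "coef a b (aa n) = (if a = b \<and> lower n a \<noteq> None then 1 else 0)"
proof -
  have "coef b a' (epow n) = (case lower n b of None \<Rightarrow> 0 | Some b' \<Rightarrow> if b' = a' \<and> vert a' = V00 then 1 else 0)" for a' b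
    using coef_epow_mult[of b a' n Pa] by (simp add: epow_P coef_P split: option.splits)
  moreover have "vert (B m) = V00 \<and> vert (C m) = V00" if "m > 0" for m
    using that by (cases m) auto
  then have "lower n a = Some a' \<Longrightarrow> vert a' = V00" for a'
    by (cases a) (auto split: if_splits)
  moreover have "lower n a = Some a' \<Longrightarrow> lower n b = Some a' \<Longrightarrow> a = b" for a'
    by (cases a; cases b) (auto split: if_splits)
  ultimately show ?thesis
    by (auto simp: aa_def coef_epow_mult coef_simps split: option.splits)
qed

text \<open>The path behind \<open>C (Suc n)\<close> lies below \<open>aa n\<close> and is not
  reached by the other generators of \<open>Fn n\<close>, so its coefficient isolates
  \<open>l\<close>.\<close>

lemma coef_phi:
  "coef (C (Suc n)) (C (Suc n)) (phi n l T m) = l"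
  "i \<le> n \<Longrightarrow> j \<le> n \<Longrightarrow> coef (B i) (B j) (phi n l T m) = T i j"
  "i \<le> n \<Longrightarrow> coef (C i) (C i) (phi n l T m) = m i"
proof -
  have T: "(\<Sum>i'\<le>n. \<Sum>j'\<le>n. T i' j' * (if i = i' \<and> j = j' then 1 else 0)) = T i j" if "i \<le> n" "j \<le> n" for i j
  proof -
    have "(\<Sum>j'\<le>n. T i' j' * (if i = i' \<and> j = j' then 1 else 0)) = (if i' = i then T i j else 0)" for i'
      using that by (cases "i = i'") (auto simp: if_distrib[of "\<lambda>x. _ * x"] cong: if_cong)
    then show ?thesis using that by simp
  qed
  show "coef (C (Suc n)) (C (Suc n)) (phi n l T m) = l"
    by (simp add: phi_def coef_simps coef_sum coef_aa coef_ee coef_cc)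
  show "i \<le> n \<Longrightarrow> j \<le> n \<Longrightarrow> coef (B i) (B j) (phi n l T m) = T i j"
    using T by (simp add: phi_def coef_simps coef_sum coef_aa coef_ee coef_cc)
  show "i \<le> n \<Longrightarrow> coef (C i) (C i) (phi n l T m) = m i"
    by (simp add: phi_def coef_simps coef_sum coef_aa coef_ee coef_cc if_distrib[of "\<lambda>x. _ * x"] cong: if_cong)
qed

lemma phi_cong: "l = l' \<Longrightarrow> (\<And>i j. i \<le> n \<Longrightarrow> j \<le> n \<Longrightarrow> T i j = T' i j) \<Longrightarrow> (\<And>i. i \<le> n \<Longrightarrow> m i = m' i) \<Longrightarrow>
    phi n l T m = phi n l' T' m'"
  by (simp add: phi_def)

text \<open>Membership becomes a fixed-point equation for a continuous map, which is how
  \<open>Fn n\<close> is seen to be closed.\<close>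

lemma Fn_iff: "X \<in> Fn n \<longleftrightarrow>
  X = phi n (coef (C (Suc n)) (C (Suc n)) X) (\<lambda>i j. coef (B i) (B j) X) (\<lambda>i. coef (C i) (C i) X)"
proof
  assume "X \<in> Fn n"
  then obtain l T m where X: "X = phi n l T m" by (auto simp: Fn_def)
  show "X = phi n (coef (C (Suc n)) (C (Suc n)) X) (\<lambda>i j. coef (B i) (B j) X) (\<lambda>i. coef (C i) (C i) X)"
    unfolding X by (rule phi_cong) (simp_all add: coef_phi)
next
  assume eq: "X = phi n (coef (C (Suc n)) (C (Suc n)) X) (\<lambda>i j. coef (B i) (B j) X) (\<lambda>i. coef (C i) (C i) X)"
  show "X \<in> Fn n" by (subst eq) (rule phi_in_Fn)
qed

lemma complete_Fn: "complete (Fn n)"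
proof -
  have "closed (Fn n)"
    unfolding closed_sequential_limits
  proof (intro allI impI)
    fix x L assume x: "(\<forall>k. x k \<in> Fn n) \<and> x \<longlonglongrightarrow> L"
    let ?e = "\<lambda>X. phi n (coef (C (Suc n)) (C (Suc n)) X) (\<lambda>i j. coef (B i) (B j) X) (\<lambda>i. coef (C i) (C i) X)"
    have cs: "(\<lambda>k. c k *\<^sub>C Y) \<longlonglongrightarrow> c' *\<^sub>C Y" if "c \<longlonglongrightarrow> c'" for c c' and Y :: q2alg
    proof (rule LIM_zero_cancel, rule tendsto_0_le)
      show "(\<lambda>k. c k - c') \<longlonglongrightarrow> 0" using that by (simp add: LIM_zero)
      show "\<forall>\<^sub>F k in sequentially. norm (c k *\<^sub>C Y - c' *\<^sub>C Y) \<le> norm (c k - c') * norm Y"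
        by (simp flip: cscale_diff_left)
    qed
    have "(\<lambda>k. ?e (x k)) \<longlonglongrightarrow> ?e L"
      unfolding phi_def by (intro tendsto_add tendsto_sum cs tendsto_coef) (use x in auto)
    moreover have "?e (x k) = x k" for k by (rule Fn_iff[THEN iffD1, symmetric]) (use x in simp)
    ultimately have "x \<longlonglongrightarrow> ?e L" by simp
    with conjunct2[OF x] have "L = ?e L" by (rule LIMSEQ_unique)
    then show "L \<in> Fn n" by (rule Fn_iff[THEN iffD2])
  qed
  then show ?thesis by (simp add: complete_eq_closed)
qed

section \<open>Projections over the core are equivalent to projections over a finite stage\<close>

lemma mats_approx:
  assumes M: "M \<in> mats k core" and e: "e > 0"
  shows "\<exists>n\<ge>N. \<exists>Y\<in>mats k (Fn n). norm (M - Y) < e"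
proof -
  \<comment> \<open>There are \<open>k * k\<close> entries; the summand 1 covers
    \<open>k = 0\<close> and makes the final estimate strict.\<close>
  define e' where "e' = e / (real (k * k) + 1)"
  have e': "e' > 0" using e by (simp add: e'_def add_nonneg_pos)
  have "\<exists>n Y. Y \<in> Fn n \<and> norm (ent M i j - Y) < e'" for i j
    using Fn_dense[OF _ e', of "ent M i j"] M by (auto simp: mats_def)
  then obtain n Y where Y: "\<And>i j. Y i j \<in> Fn (n i j)" "\<And>i j. norm (ent M i j - Y i j) < e'" by metis
  define m where "m = N + (\<Sum>i<k. \<Sum>j<k. n i j)"
  have "n i j \<le> m" if "i < k" "j < k" for i j
  proof -
    have "n i j \<le> (\<Sum>j<k. n i j)" using that by (intro member_le_sum) auto
    also have "\<dots> \<le> (\<Sum>i<k. \<Sum>j<k. n i j)" using that by (intro member_le_sum[of i _ "\<lambda>i. \<Sum>j<k. n i j"]) auto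
    finally show ?thesis by (simp add: m_def)
  qed
  then have Ym: "Y i j \<in> Fn m" if "i < k" "j < k" for i j
    using Y(1)[of i j] Fn_mono[of "n i j" m] that by blast
  define Z where "Z = Fmat (\<lambda>i j. if i < k \<and> j < k then Y i j else 0)"
  have entZ: "ent Z i j = (if i < k \<and> j < k then Y i j else 0)" for i j
    unfolding Z_def by (subst Fmat_inverse) auto
  have Z: "Z \<in> mats k (Fn m)"
    using Ym subalgebraD(1)[OF subalgebra_Fn] by (auto simp: mats_def entZ supp_def)
  have supp: "supp k (M - Z)" using M by (auto simp: mats_def supp_def entZ)
  have "norm (M - Z) = (\<Sum>i<k. \<Sum>j<k. norm (ent M i j - Y i j))"
    unfolding norm_fmat_eq[OF supp] by (intro sum.cong) (auto simp: entZ)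
  also have "\<dots> \<le> (\<Sum>i<k. \<Sum>j<k. e')" using Y(2) by (intro sum_mono less_imp_le)
  also have "\<dots> = real (k * k) * e'" by simp
  also have "\<dots> < (real (k * k) + 1) * e'" using e' by (simp add: distrib_right)
  also have "\<dots> = e" by (simp add: e'_def add_nonneg_pos less_imp_neq[symmetric])
  finally show ?thesis using Z by (intro exI[of _ m]) (auto simp: m_def)
qed

lemma mats_Fn: "subalgebra (mats k (Fn n))" "complete (mats k (Fn n))"
  by (intro subalgebra_mats complete_mats subalgebra_Fn complete_Fn)+

lemma mats_core: "subalgebra (mats k core)" "complete (mats k core)"
  by (intro subalgebra_mats complete_mats subalgebra_core complete_core)+

lemma mats_mono: "S \<subseteq> T \<Longrightarrow> mats k S \<subseteq> mats k T"
  by (auto simp: mats_def)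

abbreviation "CF \<equiv> fmats core"

lemma CF: "subalgebra CF"
  by (rule subalgebra_fmats[OF subalgebra_core])

text \<open>\<open>q * p\<close> is nearly a partial isometry from \<open>p\<close> to
  \<open>q\<close>: its defects are \<open>p * (p - q) * p\<close> and
  \<open>q * (q - p) * q\<close>. Projections may have norm above 1 in \<open>fmat\<close>, whence
  the factor in front of \<open>norm (q - p)\<close>.\<close>

lemma proj_close_mvn:
  fixes p q :: "'a::star_normed_algebra"
  assumes S: "subalgebra S" "complete S" and p: "is_proj p" "p \<in> S" and q: "is_proj q" "q \<in> S"
    and le: "(norm p + 1)\<^sup>2 * norm (q - p) \<le> 1/2" "norm q \<le> norm p + 1"
  shows "mvn S p q"
proof -
  note ps = is_projD[OF p(1)] and qs = is_projD[OF q(1)]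
  have b: "norm (x * y * x) \<le> (norm p + 1)\<^sup>2 * norm y" if "norm x \<le> norm p + 1" for x y :: 'a
  proof -
    have "norm (x * y * x) \<le> norm x * norm y * norm x"
      by (rule order_trans[OF norm_mult_ineq mult_right_mono[OF norm_mult_ineq norm_ge_zero]])
    also have "\<dots> = (norm x)\<^sup>2 * norm y" by (simp add: power2_eq_square)
    also have "\<dots> \<le> (norm p + 1)\<^sup>2 * norm y" using that by (intro mult_right_mono power_mono) auto
    finally show ?thesis .
  qed
  have pp: "p * (p * z) = p * z" "q * (q * z) = q * z" for z using ps(2) qs(2) by (simp_all flip: mult.assoc)
  have "\<exists>w\<in>S. w\<^sup>\<star> * w = p \<and> w * w\<^sup>\<star> = q"
  proof (rule polar_limit[OF S _ p(1) _ q(1)])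
    show "q * p \<in> S" by (intro subalgebraD[OF S(1)] p q)
    show "q * p * p = q * p" "q * (q * p) = q * p" using ps qs pp by (simp_all add: mult.assoc)
    have "p - (q * p)\<^sup>\<star> * (q * p) = p * (p - q) * p"
      using ps qs pp by (simp add: star_mult mult.assoc right_diff_distrib left_diff_distrib)
    then show "norm (p - (q * p)\<^sup>\<star> * (q * p)) \<le> 1/2"
      using b[of p "p - q"] le(1) by (simp add: norm_minus_commute)
    have "q - (q * p) * (q * p)\<^sup>\<star> = q * (q - p) * q"
      using ps qs pp by (simp add: star_mult mult.assoc right_diff_distrib left_diff_distrib)
    then show "norm (q - (q * p) * (q * p)\<^sup>\<star>) \<le> 1/2"
      using b[of q "q - p"] le by simp
  qed
  then show ?thesis using p q by (auto simp: mvn_def)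
qed

lemma proj_finite_stage:
  assumes p: "is_proj p" "p \<in> mats k core"
  shows "\<exists>n. \<exists>q\<in>mats k (Fn n). is_proj q \<and> mvn CF p q"
proof -
  define R where "R = norm p"
  \<comment> \<open>Chosen backwards: \<open>\<epsilon>\<close> so that distance
    \<open>2 * \<epsilon>\<close> meets the hypothesis of \<open>proj_close_mvn\<close>;
    \<open>\<delta>\<close> so that \<open>newton_projection\<close> moves by at most
    \<open>\<epsilon>\<close> when \<open>norm x \<le> R + 1\<close>; \<open>\<eta>\<close> so that
    an \<open>x\<close> within \<open>\<eta>\<close> of \<open>p\<close> has defect at most
    \<open>(2 * R + 2) * \<eta> \<le> \<delta>\<close>.\<close>
  define \<epsilon> where "\<epsilon> = 1 / (4 * (R + 1)\<^sup>2)"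
  define \<delta> where "\<delta> = min (1/8) (\<epsilon> / (2 * (5 + 2 * R)))"
  define \<eta> where "\<eta> = min \<epsilon> (\<delta> / (2 * R + 2))"
  have R: "R \<ge> 0" by (simp add: R_def)
  have R1: "(R + 1)\<^sup>2 \<ge> 1" using R by (simp add: one_le_power)
  have Rn: "R + 1 \<noteq> 0" using R by linarith
  then have e0: "\<epsilon> > 0" by (simp add: \<epsilon>_def)
  have e1: "\<epsilon> \<le> 1/4" using R1 by (simp add: \<epsilon>_def divide_simps)
  have d0: "\<delta> > 0" using e0 R by (simp add: \<delta>_def)
  have h0: "\<eta> > 0" using e0 d0 R by (simp add: \<eta>_def)
  obtain n Y where Y: "Y \<in> mats k (Fn n)" "norm (p - Y) < \<eta>" using mats_approx[OF p(2) h0, of 0] by auto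
  \<comment> \<open>The self-adjoint part of \<open>Y\<close> is as close to the self-adjoint
    \<open>p\<close> as the bound for \<open>Y\<close> and stays in the stage.\<close>
  define x where "x = (1/2) *\<^sub>R (Y + Y\<^sup>\<star>)"
  have xS: "x \<in> mats k (Fn n)" unfolding x_def by (intro subalgebraD[OF mats_Fn(1)] Y)
  have xs: "x\<^sup>\<star> = x" by (simp add: x_def star_scaleR star_add add.commute)
  have "p - x = (1/2) *\<^sub>R ((p - Y) + (p - Y)\<^sup>\<star>)"
    using is_projD(1)[OF p(1)] by (simp add: x_def star_diff algebra_simps flip: scaleR_2)
  then have "norm (p - x) \<le> (1/2) * (norm (p - Y) + norm ((p - Y)\<^sup>\<star>))"
    using norm_triangle_ineq[of "p - Y" "(p - Y)\<^sup>\<star>"] by simp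
  then have px: "norm (p - x) \<le> \<eta>" using Y(2) by simp
  then have xp: "norm (x - p) \<le> \<eta>" by (simp add: norm_minus_commute)
  have h1: "\<eta> \<le> 1" using e1 by (simp add: \<eta>_def)
  have nx: "norm x \<le> R + 1" using norm_triangle_ineq[of "x - p" p] xp h1 by (simp add: R_def)
  have "x * x - x = (x - p) * x + p * (x - p) - (x - p)"
    using is_projD(2)[OF p(1)] by (simp add: algebra_simps)
  then have "norm (x * x - x) \<le> norm ((x - p) * x + p * (x - p)) + norm (x - p)"
    by (simp only: norm_triangle_ineq4)
  also have "\<dots> \<le> norm ((x - p) * x) + norm (p * (x - p)) + norm (x - p)"
    by (intro add_right_mono norm_triangle_ineq)
  also have "norm ((x - p) * x) + norm (p * (x - p)) + norm (x - p) \<le> \<eta> * (R + 1) + R * \<eta> + \<eta>"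
    using xp nx R h0 by (intro add_mono order_trans[OF norm_mult_ineq] mult_mono) (auto simp: R_def)
  also have "\<dots> = \<eta> * (2 * R + 2)" by (simp add: algebra_simps)
  also have "\<dots> \<le> \<delta> / (2 * R + 2) * (2 * R + 2)" using R by (intro mult_right_mono) (auto simp: \<eta>_def)
  also have "\<dots> = \<delta>" using R by simp
  finally have xx: "norm (x * x - x) \<le> \<delta>" .
  have "2 * (1 + 2 * (norm x + 1)) * \<delta> \<le> 2 * (5 + 2 * R) * \<delta>"
    using nx d0 by (intro mult_right_mono) auto
  also have "\<dots> \<le> 2 * (5 + 2 * R) * (\<epsilon> / (2 * (5 + 2 * R)))"
    using R by (intro mult_left_mono) (auto simp: \<delta>_def)
  also have "\<dots> = \<epsilon>" using R by simp
  finally have le: "2 * (1 + 2 * (norm x + 1)) * \<delta> \<le> \<epsilon>" .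
  have d8: "\<delta> \<le> 1/8" unfolding \<delta>_def by (rule min.cobounded1)
  have e11: "\<epsilon> \<le> 1" using e1 by simp
  obtain q where q: "q \<in> mats k (Fn n)" "is_proj q" "norm (q - x) \<le> \<epsilon>"
    using newton_projection[OF mats_Fn xS xs xx d8 le e11] by blast
  have he: "\<eta> \<le> \<epsilon>" by (simp add: \<eta>_def)
  have qp: "norm (q - p) \<le> 2 * \<epsilon>" using norm_triangle_ineq[of "q - x" "x - p"] q(3) xp he by simp
  have "(norm p + 1)\<^sup>2 * norm (q - p) \<le> (R + 1)\<^sup>2 * (2 * \<epsilon>)"
    unfolding R_def using qp by (intro mult_left_mono) auto
  also have "\<dots> = 1/2" using Rn by (simp add: \<epsilon>_def)
  finally have "(norm p + 1)\<^sup>2 * norm (q - p) \<le> 1/2" .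
  moreover have "norm q \<le> norm p + 1" using norm_triangle_ineq[of "q - p" p] qp e1 by simp
  moreover have "q \<in> mats k core" using q(1) mats_mono[OF Fn_subset_core] by blast
  ultimately have "mvn (mats k core) p q" using p q by (intro proj_close_mvn[OF mats_core]) auto
  then show ?thesis using q mvn_mono[OF _ mats_subset_fmats] by blast
qed

section \<open>Decomposition into minimal projections\<close>

text \<open>Labels for generators of the semigroup of classes. All \<open>ee s s\<close> are
  equivalent and share \<open>LB\<close>; \<open>LU\<close> labels the unit, which later replaces
  the \<open>LA n\<close>.\<close>

datatype lab = LU | LA nat | LB | LC nat

definition One :: q2alg where "One = Pa + Pb + Pc"

fun labp :: "lab \<Rightarrow> q2alg" where
  "labp LU = One" | "labp (LA n) = aa n" | "labp LB = ee 0 0" | "labp (LC i) = cc i"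

lemma gens_0: "aa 0 = Pa" "ee 0 0 = Pb" "cc 0 = Pc"
  by (simp_all add: aa_def ee_def cc_def P_mult)

lemma is_proj_core_gens: "is_proj (aa n)" "is_proj (ee i i)" "is_proj (cc i)"
  by (simp_all add: is_proj_def core_gens_mult)

lemma is_proj_labp: "is_proj (labp x)"
proof (cases x)
  case LU
  have "is_proj (Pa + Pb + Pc)" by (intro is_proj_add proj_P) (simp_all add: P_mult distrib_right)
  then show ?thesis by (simp add: LU One_def)
qed (simp_all add: is_proj_core_gens)

lemma labp_in_core: "labp x \<in> core"
proof (cases x)
  case LU
  have "aa 0 + ee 0 0 + cc 0 \<in> core" by (intro subalgebraD(2)[OF subalgebra_core] core_gens_in_core)
  then show ?thesis by (simp add: LU One_def gens_0)
qed (simp_all add: core_gens_in_core)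

fun diag :: "lab list \<Rightarrow> q2alg fmat" where
  "diag [] = 0"
| "diag (x # xs) = emat 0 0 (labp x) + shift 1 (diag xs)"

lemma is_proj_emat: "is_proj a \<Longrightarrow> is_proj (emat i i a)"
  by (simp add: is_proj_def emat_star emat_mult)

lemma ent_diag: "ent (diag xs) i j = (if i = j \<and> i < length xs then labp (xs ! i) else 0)"
  by (induction xs arbitrary: i j) (auto simp: ent_shift nth_Cons split: nat.splits)

lemma supp_diag: "supp (length xs) (diag xs)"
  by (auto simp: supp_def ent_diag)

lemma diag_in_CF: "diag xs \<in> CF"
  using labp_in_core subalgebraD(1)[OF subalgebra_core] by (auto simp: fmats_def ent_diag)

lemma diag_append: "diag (xs @ ys) = diag xs + shift (length xs) (diag ys)"
  by (induction xs) (simp_all add: shift_zero_index shift_add shift_shift)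

lemma is_proj_diag: "is_proj (diag xs)"
proof (induction xs)
  case (Cons x xs)
  have "emat 0 0 (labp x) * shift 1 (diag xs) = 0" by (rule shift_orth) (simp add: supp_emat)
  then show ?case using Cons by (simp add: is_proj_add is_proj_emat is_proj_labp is_proj_shift)
qed simp

lemma diag_orth: "diag xs * shift (length xs) M = 0"
  by (rule shift_orth[OF supp_diag])

lemma orth_commute: "is_proj p \<Longrightarrow> is_proj q \<Longrightarrow> p * q = 0 \<Longrightarrow> q * p = 0"
  by (metis is_projD(1) star_0 star_mult)

definition dec :: "q2alg fmat \<Rightarrow> lab list \<Rightarrow> bool" where "dec p xs \<longleftrightarrow> mvn CF p (diag xs)"

lemma dec_0: "dec 0 []"
  unfolding dec_def by (simp add: mvn_refl diag_in_CF[of "[]", simplified])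

lemma dec_add:
  assumes "dec p xs" "dec q ys" "p * q = 0" shows "dec (p + q) (xs @ ys)"
proof -
  have "mvn CF q (shift (length xs) (diag ys))"
    using assms(2) mvn_trans[OF CF _ mvn_shift[OF subalgebra_core is_proj_diag diag_in_CF]]
    unfolding dec_def by blast
  then show ?thesis
    using assms unfolding dec_def diag_append by (intro mvn_add[OF CF]) (simp_all add: diag_orth)
qed

lemma mvn_emat:
  assumes "v \<in> core" "v\<^sup>\<star> * v = a" "v * v\<^sup>\<star> = b" "is_proj a" "is_proj b"
  shows "mvn CF (emat i i a) (emat 0 0 b)"
proof (rule mvnI)
  show "emat 0 i v \<in> CF" using assms by (intro emat_in_fmats subalgebra_core)
qed (use assms in \<open>simp_all add: is_proj_emat emat_star emat_mult\<close>)

lemma dec_single: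
  assumes "v \<in> core" "v\<^sup>\<star> * v = a" "v * v\<^sup>\<star> = labp x" "is_proj a"
  shows "dec (emat i i a) [x]"
  using mvn_emat[OF assms is_proj_labp] by (simp add: dec_def)

lemma dec_mvn: "mvn CF p q \<Longrightarrow> dec q xs \<Longrightarrow> dec p xs"
  unfolding dec_def by (rule mvn_trans[OF CF])

text \<open>Minimal projections of stage \<open>n\<close> with sum \<open>One\<close>; right
  multiplication by them picks out the columns of an element.\<close>

definition min_projs :: "nat \<Rightarrow> q2alg set" where
  "min_projs n = insert (aa n) ((\<lambda>s. ee s s) ` {..n} \<union> cc ` {..n})"

lemma min_projs_label:
  assumes "m \<in> min_projs n"
  shows "is_proj m" "m \<in> Fn n" "\<exists>x. \<forall>i. dec (emat i i m) [x]"
proof -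
  show "is_proj m" "m \<in> Fn n" using assms by (auto simp: min_projs_def is_proj_core_gens core_gens_in_Fn)
  from assms consider "m = aa n" | s where "m = ee s s" | s where "m = cc s" by (auto simp: min_projs_def)
  then show "\<exists>x. \<forall>i. dec (emat i i m) [x]"
  proof cases
    case 1
    then have "dec (emat i i m) [LA n]" for i
      by (intro dec_single[of "aa n"]) (simp_all add: core_gens_in_core core_gens_mult is_proj_core_gens)
    then show ?thesis by blast
  next
    case 2
    then have "dec (emat i i m) [LB]" for i
      by (intro dec_single[of "ee 0 s"]) (simp_all add: core_gens_in_core core_gens_mult is_proj_core_gens)
    then show ?thesis by blast
  next
    case 3
    then have "dec (emat i i m) [LC s]" for i
      by (intro dec_single[of "cc s"]) (simp_all add: core_gens_in_core core_gens_mult is_proj_core_gens)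
    then show ?thesis by blast
  qed
qed

lemma phi_mult_gens:
  "phi n l T m * aa n = l *\<^sub>C aa n"
  "t \<le> n \<Longrightarrow> phi n l T m * ee t t = (\<Sum>s\<le>n. T s t *\<^sub>C ee s t)"
  "t \<le> n \<Longrightarrow> phi n l T m * cc t = m t *\<^sub>C cc t"
proof -
  show "phi n l T m * aa n = l *\<^sub>C aa n"
    by (simp add: phi_def distrib_right sum_distrib_right core_gens_mult)
  show "phi n l T m * ee t t = (\<Sum>s\<le>n. T s t *\<^sub>C ee s t)" if "t \<le> n"
  proof -
    have "(\<Sum>j\<le>n. T i j *\<^sub>C (ee i j * ee t t)) = T i t *\<^sub>C ee i t" for i
    proof -
      have "(\<Sum>j\<le>n. T i j *\<^sub>C (ee i j * ee t t)) = (\<Sum>j\<le>n. if j = t then T i t *\<^sub>C ee i t else 0)"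
        by (intro sum.cong) (auto simp: core_gens_mult(2))
      then show ?thesis using that by simp
    qed
    moreover have "phi n l T m * ee t t = l *\<^sub>C (aa n * ee t t) + (\<Sum>i\<le>n. \<Sum>j\<le>n. T i j *\<^sub>C (ee i j * ee t t))
        + (\<Sum>i\<le>n. m i *\<^sub>C (cc i * ee t t))"
      by (simp add: phi_def distrib_right sum_distrib_right)
    ultimately show ?thesis using that by (simp add: core_gens_mult(5,6))
  qed
  show "phi n l T m * cc t = m t *\<^sub>C cc t" if "t \<le> n"
  proof -
    have "(\<Sum>i\<le>n. m i *\<^sub>C (cc i * cc t)) = (\<Sum>i\<le>n. if i = t then m t *\<^sub>C cc t else 0)"
      by (intro sum.cong) (auto simp: core_gens_mult(3))
    moreover have "phi n l T m * cc t = l *\<^sub>C (aa n * cc t) + (\<Sum>i\<le>n. \<Sum>j\<le>n. T i j *\<^sub>C (ee i j * cc t))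
        + (\<Sum>i\<le>n. m i *\<^sub>C (cc i * cc t))"
      by (simp add: phi_def distrib_right sum_distrib_right)
    ultimately show ?thesis using that by (simp add: core_gens_mult(4,8))
  qed
qed

lemma Fn_eq_0:
  assumes "y \<in> Fn n" "\<And>m. m \<in> min_projs n \<Longrightarrow> y * m = 0"
  shows "y = 0"
proof -
  obtain l T m where y: "y = phi n l T m" using assms(1) by (auto simp: Fn_def)
  have "y = y * aa n + (\<Sum>t\<le>n. y * ee t t) + (\<Sum>t\<le>n. y * cc t)"
  proof -
    have "(\<Sum>t\<le>n. y * ee t t) = (\<Sum>i\<le>n. \<Sum>j\<le>n. T i j *\<^sub>C ee i j)"
      unfolding y by (subst sum.swap) (simp add: phi_mult_gens)
    moreover have "(\<Sum>t\<le>n. y * cc t) = (\<Sum>i\<le>n. m i *\<^sub>C cc i)"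
      unfolding y by (simp add: phi_mult_gens)
    ultimately show ?thesis by (simp add: y phi_mult_gens(1)) (simp add: phi_def)
  qed
  then show ?thesis using assms(2) by (simp add: min_projs_def)
qed

text \<open>Compressing to a minimal projection leaves a scalar multiple of it. The scalar is an
  explicit squared modulus or a sum of such, so it vanishes only together with
  \<open>y * q\<close>.\<close>

lemma min_projs_compress:
  assumes "y \<in> Fn n" "q \<in> min_projs n"
  shows "\<exists>r\<ge>0. (y * q)\<^sup>\<star> * (y * q) = r *\<^sub>R q \<and> (r = 0 \<longrightarrow> y * q = 0)"
proof -
  obtain l T m where y: "y = phi n l T m" using assms(1) by (auto simp: Fn_def)
  have one: "(c *\<^sub>C q)\<^sup>\<star> * (c *\<^sub>C q) = (cmod c)\<^sup>2 *\<^sub>R q" if "is_proj q" for c and q :: q2alg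
    using is_projD[OF that]
    by (simp add: star_cscale complex_norm_square flip: cscale_of_real of_real_power)
  from assms(2) consider "q = aa n" | t where "t \<le> n" "q = ee t t" | t where "t \<le> n" "q = cc t"
    by (auto simp: min_projs_def)
  then show ?thesis
  proof cases
    case 1
    then show ?thesis using one[of q l] by (intro exI[of _ "(cmod l)\<^sup>2"]) (simp add: y phi_mult_gens is_proj_core_gens)
  next
    case 2
    have yq: "y * q = (\<Sum>s\<le>n. T s t *\<^sub>C ee s t)" using 2 by (simp add: y phi_mult_gens)
    then have "(y * q)\<^sup>\<star> = (\<Sum>s\<le>n. cnj (T s t) *\<^sub>C ee t s)" by (simp add: star_sum star_cscale)
    then have "(y * q)\<^sup>\<star> * (y * q) = (\<Sum>s\<le>n. cnj (T s t) *\<^sub>C ee t s) * (\<Sum>s\<le>n. T s t *\<^sub>C ee s t)"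
      by (simp only: yq)
    then have "(y * q)\<^sup>\<star> * (y * q) = (\<Sum>s\<le>n. \<Sum>s'\<le>n. (cnj (T s t) * T s' t) *\<^sub>C (ee t s * ee s' t))"
      by (simp add: sum_product mult.commute)
    also have "\<dots> = (\<Sum>s\<le>n. \<Sum>s'\<le>n. if s' = s then (cnj (T s t) * T s t) *\<^sub>C ee t t else 0)"
      by (intro sum.cong) (auto simp: core_gens_mult(2))
    also have "\<dots> = (\<Sum>s\<le>n. (cmod (T s t))\<^sup>2 *\<^sub>R ee t t)"
      by (simp add: mult.commute[of "cnj _"] flip: cscale_of_real complex_norm_square)
    finally have "(y * q)\<^sup>\<star> * (y * q) = (\<Sum>s\<le>n. (cmod (T s t))\<^sup>2) *\<^sub>R q"
      using 2 by (simp add: scaleR_sum_left)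
    moreover have "y * q = 0" if "(\<Sum>s\<le>n. (cmod (T s t))\<^sup>2) = 0"
      using that 2 by (simp add: y phi_mult_gens sum_nonneg_eq_0_iff)
    moreover have "(\<Sum>s\<le>n. (cmod (T s t))\<^sup>2) \<ge> 0" by (intro sum_nonneg) simp
    ultimately show ?thesis by blast
  next
    case 3
    then show ?thesis using one[of q "m t"] by (intro exI[of _ "(cmod (m t))\<^sup>2"]) (simp add: y phi_mult_gens is_proj_core_gens)
  qed
qed

text \<open>Since \<open>p\<close> is a projection, the corner is the sum over \<open>i\<close> of
  the compressions belonging to the entries \<open>ent p i j\<close>. A sum of nonnegative scalars
  vanishes only termwise.\<close>

lemma proj_column_compress:
  assumes p: "is_proj p" "p \<in> mats k (Fn n)" and q: "q \<in> min_projs n"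
  shows "\<exists>r\<ge>0. emat j j q * p * emat j j q = r *\<^sub>R emat j j q \<and> (r = 0 \<longrightarrow> p * emat j j q = 0)"
proof -
  have pF: "ent p i j \<in> Fn n" for i j using p(2) by (simp add: mats_def)
  have supp: "supp k p" using p(2) by (simp add: mats_def)
  obtain r where r: "\<And>i. r i \<ge> 0" "\<And>i. (ent p i j * q)\<^sup>\<star> * (ent p i j * q) = r i *\<^sub>R q"
    "\<And>i. r i = 0 \<Longrightarrow> ent p i j * q = 0"
    using min_projs_compress[OF pF q, of _ j] by metis
  have qp: "is_proj q" using min_projs_label(1)[OF q] .
  define E where "E = emat j j q"
  have Es: "E\<^sup>\<star> = E" by (simp add: E_def emat_star is_projD[OF qp])
  have "E * p * E = (p * E)\<^sup>\<star> * (p * E)"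
    using is_projD[OF p(1)] by (simp add: star_mult Es mult.assoc) (simp flip: mult.assoc)
  also have "\<dots> = (\<Sum>i<k. r i) *\<^sub>R E"
  proof (rule fmat_eqI)
    fix a b
    have "supp k ((p * E)\<^sup>\<star>)" if "j < k"
      using supp supp_emat[OF that that] by (intro supp_star supp_times) (auto simp: E_def)
    moreover have "p * E = 0" if "\<not> j < k"
      using that suppD(2)[OF supp] by (intro fmat_eqI) (simp add: E_def ent_mult_emat)
    moreover have "ent p i j = 0" if "\<not> j < k" for i using that suppD(2)[OF supp] by simp
    ultimately show "ent ((p * E)\<^sup>\<star> * (p * E)) a b = ent ((\<Sum>i<k. r i) *\<^sub>R E) a b"
    proof (cases "j < k")
      case True
      have s: "supp k ((p * E)\<^sup>\<star>)"
        using supp supp_emat[OF True True] by (intro supp_star supp_times) (auto simp: E_def)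
      show ?thesis
        unfolding ent_times[OF s] by (auto simp: E_def ent_mult_emat r(2) scaleR_sum_left)
    next
      case False
      then have z: "ent p i j = 0" for i using suppD(2)[OF supp] by simp
      then have rq: "r i *\<^sub>R q = 0" for i using r(2)[of i] by simp
      have "(\<Sum>i<k. r i) *\<^sub>R q = 0" unfolding scaleR_sum_left by (rule sum.neutral) (use rq in blast)
      moreover have "p * E = 0" using z by (intro fmat_eqI) (simp add: E_def ent_mult_emat)
      ultimately show ?thesis by (simp add: E_def)
    qed
  qed
  finally have "E * p * E = (\<Sum>i<k. r i) *\<^sub>R E" .
  moreover have "p * E = 0" if "(\<Sum>i<k. r i) = 0"
  proof (rule fmat_eqI)
    fix a b
    have "\<forall>i<k. r i = 0" using that r(1) by (simp add: sum_nonneg_eq_0_iff)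
    then have "ent p a j * q = 0" by (cases "a < k") (use r(3) suppD(1)[OF supp] in auto)
    then show "ent (p * E) a b = ent 0 a b" by (simp add: E_def ent_mult_emat)
  qed
  moreover have "(\<Sum>i<k. r i) \<ge> 0" using r(1) by (intro sum_nonneg)
  ultimately show ?thesis unfolding E_def by blast
qed

text \<open>Gaussian elimination: as long as some column \<open>p e\<close> is nonzero, the projection
  \<open>p e p / r\<close> with \<open>e p e = r e\<close> is split off.\<close>

lemma stage_proj_decomposes:
  assumes p: "is_proj p" "p \<in> mats k (Fn n)"
  shows "\<exists>xs. dec p xs"
proof -
  define J where "J = {..<k} \<times> min_projs n"
  have finJ: "finite J" by (simp add: J_def min_projs_def)
  define E :: "nat \<times> q2alg \<Rightarrow> q2alg fmat" where "E x = emat (fst x) (fst x) (snd x)" for x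
  \<comment> \<open>Induction on the set \<open>J'\<close> of columns that may still be nonzero; it
    is applied to all of \<open>J\<close> and bottoms out at the zero projection.\<close>
  have "\<exists>xs. dec p xs"
    if "is_proj p" "p \<in> mats k (Fn n)" "J' \<subseteq> J" "\<And>x. x \<in> J - J' \<Longrightarrow> p * E x = 0" for J' p
    using finite_subset[OF that(3) finJ] that
  proof (induction J' arbitrary: p rule: finite_induct)
    case empty
    have "ent p i j = 0" for i j
    proof (cases "j < k")
      case True
      show ?thesis
      proof (rule Fn_eq_0)
        show "ent p i j \<in> Fn n" using empty.prems(2) by (simp add: mats_def)
        fix m assume "m \<in> min_projs n"
        then have "p * E (j, m) = 0" using empty.prems(4) True by (auto simp: J_def)
        then have "ent (p * emat j j m) i j = 0" by (simp add: E_def)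
        then show "ent p i j * m = 0" by (simp add: ent_mult_emat)
      qed
    next
      case False
      then show ?thesis using empty.prems(2) by (auto simp: mats_def suppD(2))
    qed
    then have "p = 0" by (intro fmat_eqI) simp
    then show ?case using dec_0 by blast
  next
    case (insert x J')
    note p = insert.prems(1,2)
    show ?case
    proof (cases "p * E x = 0")
      case True
      then show ?thesis using insert by (intro insert.IH[OF p]) auto
    next
      case False
      obtain j m where x: "x = (j, m)" "j < k" "m \<in> min_projs n" using insert.prems(3) by (auto simp: J_def)
      define e where "e = E x"
      have e: "is_proj e" using min_projs_label(1)[OF x(3)] by (simp add: e_def E_def x is_proj_emat)
      have eS: "e \<in> mats k (Fn n)"
        using min_projs_label(2)[OF x(3)] x subalgebraD(1)[OF subalgebra_Fn]
        by (auto simp: mats_def e_def E_def supp_def)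
      obtain r where r: "r \<ge> 0" "e * p * e = r *\<^sub>R e" "r = 0 \<longrightarrow> p * e = 0"
        using proj_column_compress[OF p x(3), of j] by (auto simp: e_def E_def x)
      have r0: "r > 0" using r False by (auto simp: e_def less_eq_real_def)
      have epe: "e * (p * (e * z)) = r *\<^sub>R (e * z)" for z
        using r(2) by (simp flip: mult.assoc)
      have pp: "p * (p * z) = p * z" for z using is_projD(2)[OF p(1)] by (simp flip: mult.assoc)
      note ps = is_projD[OF p(1)] and es = is_projD[OF e]
      \<comment> \<open>The range projection of the column \<open>p * e\<close>, equivalent to
        \<open>e\<close> through the column divided by \<open>sqrt r\<close>.\<close>
      define g where "g = inverse r *\<^sub>R (p * e * p)"
      have gp: "g * p = g" "p * g = g" using ps pp by (simp_all add: g_def mult.assoc)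
      have g: "is_proj g"
        using ps es r0 by (simp add: is_proj_def g_def star_scaleR star_mult mult.assoc pp epe)
      have gS: "g \<in> mats k (Fn n)" unfolding g_def by (intro subalgebraD[OF mats_Fn(1)] p eS)
      define p' where "p' = p - g"
      have p': "is_proj p'"
        using ps is_projD[OF g] gp by (simp add: p'_def is_proj_def star_diff left_diff_distrib right_diff_distrib)
      have p'S: "p' \<in> mats k (Fn n)" unfolding p'_def by (intro subalgebraD[OF mats_Fn(1)] p gS)
      \<comment> \<open>Subtracting \<open>g\<close> kills column \<open>x\<close>; columns that
        vanished before still vanish, because \<open>g\<close> ends with the factor
        \<open>p\<close>.\<close>
      have "p' * E y = 0" if "y \<in> J - J'" for y
      proof (cases "y = x")
        case True
        have "p' * e = p * e - inverse r *\<^sub>R (p * (e * p * e))"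
          by (simp add: p'_def g_def left_diff_distrib mult.assoc)
        then show ?thesis using r0 r(2) True by (simp add: e_def)
      next
        case False
        then have "p * E y = 0" using insert.prems(4) that by auto
        then show ?thesis by (simp add: p'_def g_def left_diff_distrib mult.assoc)
      qed
      then obtain xs where xs: "dec p' xs" using insert.IH[OF p' p'S] insert.prems(3) by blast
      define w where "w = (1 / sqrt r) *\<^sub>R (p * e)"
      have sq: "(1 / sqrt r) * (1 / sqrt r) = inverse r" using r0 by (simp add: field_simps)
      have "mvn CF e g"
      proof (rule mvnI[OF e g])
        have "p * e \<in> mats k (Fn n)" by (intro subalgebraD[OF mats_Fn(1)] p eS)
        then have "w \<in> mats k (Fn n)" unfolding w_def by (rule subalgebraD(6)[OF mats_Fn(1)])
        then show "w \<in> CF" using Fn_subset_core by (auto simp: mats_def fmats_def)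
        have "w\<^sup>\<star> * w = ((1 / sqrt r) * (1 / sqrt r)) *\<^sub>R (e * p * e)"
          using ps es by (simp add: w_def star_scaleR star_mult mult.assoc pp)
        then show "w\<^sup>\<star> * w = e" unfolding sq r(2) using r0 by simp
        have ee: "e * (e * z) = e * z" for z using es by (simp flip: mult.assoc)
        have "w * w\<^sup>\<star> = ((1 / sqrt r) * (1 / sqrt r)) *\<^sub>R (p * e * p)"
          using ps es by (simp add: w_def star_scaleR star_mult mult.assoc ee)
        then show "w * w\<^sup>\<star> = g" unfolding sq g_def .
      qed
      then have "mvn CF g e" by (rule mvn_sym[OF CF])
      moreover obtain l where "dec e [l]" using min_projs_label(3)[OF x(3)] by (auto simp: e_def E_def x)
      ultimately have "dec g [l]" by (rule dec_mvn)
      moreover have "p' * g = 0" using gp is_projD[OF g] by (simp add: p'_def left_diff_distrib)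
      ultimately have "dec (p' + g) (xs @ [l])" using xs by (intro dec_add)
      then show ?thesis by (auto simp: p'_def)
    qed
  qed
  from this[of p J] show ?thesis using p by simp
qed

lemma proj_decomposes:
  assumes p: "is_proj p" "p \<in> CF"
  shows "\<exists>xs. dec p xs"
proof -
  obtain k where "supp k p" using supp_ex by blast
  then have "p \<in> mats k core" using p by (simp add: mats_def fmats_def)
  then obtain n q where "q \<in> mats k (Fn n)" "is_proj q" "mvn CF p q"
    using proj_finite_stage[OF p(1)] by blast
  then show ?thesis using stage_proj_decomposes[of q k n] dec_mvn by blast
qed

section \<open>Traces on the finite stages\<close>

text \<open>One trace for each simple summand of \<open>Fn n\<close>. The sum over the
  \<open>B i\<close> with \<open>i \<le> n\<close> is not tracial on later stages, which is why
  equivalences are first moved into a stage.\<close>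

lemma stage_traces:
  assumes "x \<in> Fn n" "y \<in> Fn n"
  shows "coef (C (Suc n)) (C (Suc n)) (x * y) = coef (C (Suc n)) (C (Suc n)) (y * x)"
    "(\<Sum>i\<le>n. coef (B i) (B i) (x * y)) = (\<Sum>i\<le>n. coef (B i) (B i) (y * x))"
    "i \<le> n \<Longrightarrow> coef (C i) (C i) (x * y) = coef (C i) (C i) (y * x)"
proof -
  obtain l T m where x: "x = phi n l T m" using assms(1) by (auto simp: Fn_def)
  obtain l' T' m' where y: "y = phi n l' T' m'" using assms(2) by (auto simp: Fn_def)
  show "coef (C (Suc n)) (C (Suc n)) (x * y) = coef (C (Suc n)) (C (Suc n)) (y * x)"
    "i \<le> n \<Longrightarrow> coef (C i) (C i) (x * y) = coef (C i) (C i) (y * x)"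
    by (simp_all add: x y phi_mult coef_phi)
  have "(\<Sum>i\<le>n. \<Sum>k\<le>n. T i k * T' k i) = (\<Sum>i\<le>n. \<Sum>k\<le>n. T' i k * T k i)"
    by (subst sum.swap) (simp add: mult.commute)
  then show "(\<Sum>i\<le>n. coef (B i) (B i) (x * y)) = (\<Sum>i\<le>n. coef (B i) (B i) (y * x))"
    by (simp add: x y phi_mult coef_phi)
qed

lemma matrix_trace:
  fixes \<tau> :: "q2alg \<Rightarrow> complex"
  assumes add: "\<And>x y. \<tau> (x + y) = \<tau> x + \<tau> y" and "\<tau> 0 = 0"
    and tr: "\<And>x y. x \<in> S \<Longrightarrow> y \<in> S \<Longrightarrow> \<tau> (x * y) = \<tau> (y * x)"
    and S: "subalgebra S" and w: "w \<in> mats k S"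
  shows "(\<Sum>i<k. \<tau> (ent (w\<^sup>\<star> * w) i i)) = (\<Sum>i<k. \<tau> (ent (w * w\<^sup>\<star>) i i))"
proof -
  have sum: "\<tau> (\<Sum>i\<in>I. f i) = (\<Sum>i\<in>I. \<tau> (f i))" for f :: "nat \<Rightarrow> q2alg" and I
    by (induction I rule: infinite_finite_induct) (simp_all add: add \<open>\<tau> 0 = 0\<close>)
  have k: "supp k w" and wS: "ent w i j \<in> S" for i j using w by (auto simp: mats_def)
  have "(\<Sum>i<k. \<tau> (ent (w\<^sup>\<star> * w) i i)) = (\<Sum>i<k. \<Sum>l<k. \<tau> ((ent w l i)\<^sup>\<star> * ent w l i))"
    by (simp add: ent_times[OF supp_star[OF k]] sum)
  also have "\<dots> = (\<Sum>i<k. \<Sum>l<k. \<tau> (ent w l i * (ent w l i)\<^sup>\<star>))"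
    using wS S by (intro sum.cong refl tr subalgebraD) auto
  also have "\<dots> = (\<Sum>l<k. \<Sum>i<k. \<tau> (ent w l i * (ent w l i)\<^sup>\<star>))" by (rule sum.swap)
  also have "\<dots> = (\<Sum>i<k. \<tau> (ent (w * w\<^sup>\<star>) i i))"
    by (simp add: ent_times[OF k] sum)
  finally show ?thesis .
qed

fun level :: "lab \<Rightarrow> nat" where
  "level (LA n) = n" | "level (LC i) = i" | "level _ = 0"

lemma labp_in_Fn: "level x \<le> n \<Longrightarrow> labp x \<in> Fn n"
proof -
  have "labp x \<in> Fn (level x)"
  proof (cases x)
    case LU
    have "aa 0 + ee 0 0 + cc 0 \<in> Fn 0" by (intro subalgebraD(2)[OF subalgebra_Fn] core_gens_in_Fn) auto
    then show ?thesis by (simp add: LU One_def gens_0)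
  qed (auto intro: core_gens_in_Fn)
  then show "level x \<le> n \<Longrightarrow> labp x \<in> Fn n" using Fn_mono by blast
qed

lemma diag_in_mats: "length xs \<le> k \<Longrightarrow> (\<And>x. x \<in> set xs \<Longrightarrow> level x \<le> n) \<Longrightarrow> diag xs \<in> mats k (Fn n)"
  using supp_mono[OF supp_diag[of xs]] labp_in_Fn subalgebraD(1)[OF subalgebra_Fn]
  by (auto simp: mats_def ent_diag)

text \<open>An approximation \<open>x\<close> of the witness is compressed to
  \<open>q * x * p\<close>, so the polar iteration ends at a witness for \<open>p\<close> and
  \<open>q\<close> themselves, which already lie in the stage.\<close>

lemma mvn_finite_stage:
  assumes pq: "mvn CF p q" and p: "p \<in> mats k0 (Fn N)" and q: "q \<in> mats k0 (Fn N)"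
  shows "\<exists>k\<ge>k0. \<exists>n\<ge>N. \<exists>w\<in>mats k (Fn n). w\<^sup>\<star> * w = p \<and> w * w\<^sup>\<star> = q"
proof -
  obtain v where v: "v \<in> CF" "v\<^sup>\<star> * v = p" "v * v\<^sup>\<star> = q" "v * p = v" "q * v = v"
    using mvn_normalize[OF CF pq] by auto
  have proj: "is_proj p" "is_proj q" using mvn_proj[OF pq] by auto
  obtain k1 where "supp k1 v" using supp_ex by blast
  define k where "k = k0 + k1"
  have vk: "v \<in> mats k core" using v(1) supp_mono[OF \<open>supp k1 v\<close>, of k] by (simp add: mats_def fmats_def k_def)
  have up: "M \<in> mats k (Fn n)" if "M \<in> mats k0 (Fn N)" "N \<le> n" for M n
    using that supp_mono[of k0 M k] Fn_mono[of N n] by (auto simp: mats_def k_def)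
  \<comment> \<open>Each of the two terms in \<open>bound\<close> is then at most
    \<open>(norm v + 1) * \<kappa> = 1/4\<close>; \<open>\<eta>\<close> allows for the factors
    \<open>q\<close> and \<open>p\<close> of the compression.\<close>
  define \<kappa> where "\<kappa> = 1 / (4 * (norm v + 1))"
  define \<eta> where "\<eta> = \<kappa> / (norm q * norm p + 1)"
  have k0: "\<kappa> > 0" by (simp add: \<kappa>_def add_nonneg_pos)
  have k1: "\<kappa> \<le> 1/4" unfolding \<kappa>_def by (intro divide_left_mono) (auto simp: add_nonneg_pos)
  have h0: "\<eta> > 0" using k0 by (simp add: \<eta>_def add_nonneg_pos)
  obtain n x where n: "n \<ge> N" and x: "x \<in> mats k (Fn n)" "norm (v - x) < \<eta>"
    using mats_approx[OF vk h0, of N] by auto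
  define y where "y = q * x * p"
  have yS: "y \<in> mats k (Fn n)" unfolding y_def using up[OF p n] up[OF q n] x by (intro subalgebraD[OF mats_Fn(1)])
  have "v - y = q * (v - x) * p" using v by (simp add: y_def right_diff_distrib left_diff_distrib)
  then have "norm (v - y) \<le> norm q * norm (v - x) * norm p"
    using order_trans[OF norm_mult_ineq mult_right_mono[OF norm_mult_ineq norm_ge_zero]] by simp
  also have "\<dots> \<le> norm q * \<eta> * norm p" using x(2) by (intro mult_right_mono mult_left_mono) auto
  also have "\<dots> = (norm q * norm p) * \<eta>" by simp
  also have "\<dots> \<le> (norm q * norm p + 1) * \<eta>" using h0 by (intro mult_right_mono) auto
  also have "\<dots> = \<kappa>"
  proof -
    have "norm q * norm p + 1 > 0" by (simp add: add_nonneg_pos)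
    then show ?thesis by (simp add: \<eta>_def)
  qed
  finally have vy: "norm (v - y) \<le> \<kappa>" .
  have ny: "norm y \<le> norm v + 1" using norm_triangle_ineq4[of v "v - y"] vy k1 by simp
  have bound: "norm (a * (b - c) + (a' - b') * c') \<le> 1/2"
    if "norm a \<le> norm v + 1" "norm c' \<le> norm v + 1" "norm (b - c) \<le> \<kappa>" "norm (a' - b') \<le> \<kappa>"
    for a b c a' b' c' :: "q2alg fmat"
  proof -
    have "norm (a * (b - c) + (a' - b') * c') \<le> norm a * norm (b - c) + norm (a' - b') * norm c'"
      by (intro order_trans[OF norm_triangle_ineq] add_mono norm_mult_ineq)
    also have "\<dots> \<le> (norm v + 1) * \<kappa> + \<kappa> * (norm v + 1)"
      using that k0 by (intro add_mono mult_mono) auto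
    also have "\<dots> = 1/2"
    proof -
      have quarter: "m * (1 / (4 * m)) = 1/4" if "m > 0" for m :: real using that by simp
      have "(norm v + 1) * \<kappa> = 1/4" unfolding \<kappa>_def by (rule quarter) (simp add: add_nonneg_pos)
      then show ?thesis by (simp add: mult.commute)
    qed
    finally show ?thesis .
  qed
  have sv: "norm (v\<^sup>\<star> - y\<^sup>\<star>) \<le> \<kappa>" using vy norm_star[of "v - y"] by (simp add: star_diff)
  have "\<exists>w\<in>mats k (Fn n). w\<^sup>\<star> * w = p \<and> w * w\<^sup>\<star> = q"
  proof (rule polar_limit[OF mats_Fn yS proj(1) _ proj(2)])
    show "y * p = y" "q * y = y" using is_projD(2)[OF proj(1)] is_projD(2)[OF proj(2)]
      by (simp_all add: y_def mult.assoc) (simp flip: mult.assoc)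
    have "p - y\<^sup>\<star> * y = v\<^sup>\<star> * (v - y) + (v\<^sup>\<star> - y\<^sup>\<star>) * y"
      using v(2) by (simp add: right_diff_distrib left_diff_distrib)
    then show "norm (p - y\<^sup>\<star> * y) \<le> 1/2" using bound[of "v\<^sup>\<star>" y v y "v\<^sup>\<star>" "y\<^sup>\<star>"] ny vy sv by simp
    have "q - y * y\<^sup>\<star> = v * (v\<^sup>\<star> - y\<^sup>\<star>) + (v - y) * y\<^sup>\<star>"
      using v(3) by (simp add: right_diff_distrib left_diff_distrib)
    then show "norm (q - y * y\<^sup>\<star>) \<le> 1/2" using bound[of v "y\<^sup>\<star>" "v\<^sup>\<star>" "y\<^sup>\<star>" v y] ny vy sv by simp
  qed
  then show ?thesis using n by (intro exI[of _ k]) (auto simp: k_def)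
qed

section \<open>The invariant\<close>

text \<open>The value at \<open>LA n\<close> comes from the relation
  \<open>1 = a\<^sub>n + \<Sum>\<^sub>i\<^sub>\<le>\<^sub>n e\<^sub>i\<^sub>i + \<Sum>\<^sub>i\<^sub>\<le>\<^sub>n c\<^sub>i\<close>, in which all \<open>e\<^sub>i\<^sub>i\<close> are equivalent.\<close>

fun val :: "lab \<Rightarrow> nat \<Rightarrow>\<^sub>0 int" where
  "val LU = Poly_Mapping.single 0 1"
| "val LB = Poly_Mapping.single 1 1"
| "val (LC i) = Poly_Mapping.single (i + 2) 1"
| "val (LA n) = Poly_Mapping.single 0 1 - Poly_Mapping.single 1 (int n + 1) - (\<Sum>i\<le>n. Poly_Mapping.single (i + 2) 1)"

definition vals :: "lab list \<Rightarrow> nat \<Rightarrow>\<^sub>0 int" where "vals xs = sum_list (map val xs)"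

lemma vals_simps [simp]: "vals [] = 0" "vals (x # xs) = val x + vals xs" "vals (xs @ ys) = vals xs + vals ys"
  by (simp_all add: vals_def)

lemma lookup_val_LA: "Poly_Mapping.lookup (val (LA n)) 0 = 1" "Poly_Mapping.lookup (val (LA n)) (Suc 0) = - int n - 1"
  "Poly_Mapping.lookup (val (LA n)) (Suc (Suc s)) = (if s \<le> n then - 1 else 0)"
proof -
  show "Poly_Mapping.lookup (val (LA n)) 0 = 1" "Poly_Mapping.lookup (val (LA n)) (Suc 0) = - int n - 1"
    by (simp_all add: lookup_minus lookup_sum lookup_single lookup_one when_def)
  have "(\<Sum>i\<le>n. (1::int) when i = s) = (if s \<le> n then 1 else 0)" by (simp add: when_def)
  then show "Poly_Mapping.lookup (val (LA n)) (Suc (Suc s)) = (if s \<le> n then - 1 else 0)"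
    by (simp add: lookup_minus lookup_sum lookup_single lookup_one)
qed

text \<open>For a class \<open>a [1] + b [e] + \<Sum> m_s [c_s]\<close> the traces are
  \<open>a\<close>, \<open>(n + 1) a + b\<close> and \<open>a + m_s\<close>, because the unit has
  trace \<open>n + 1\<close> in the matrix summand and 1 in the others.\<close>

lemma traces_labp:
  assumes "level x \<le> n"
  shows "coef (C (Suc n)) (C (Suc n)) (labp x) = of_int (Poly_Mapping.lookup (val x) 0)"
    "(\<Sum>i\<le>n. coef (B i) (B i) (labp x))
      = of_int (int (Suc n) * Poly_Mapping.lookup (val x) 0 + Poly_Mapping.lookup (val x) (Suc 0))"
    "s \<le> n \<Longrightarrow> coef (C s) (C s) (labp x)
      = of_int (Poly_Mapping.lookup (val x) 0 + Poly_Mapping.lookup (val x) (Suc (Suc s)))"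
proof -
  \<comment> \<open>In the matrix summand of stage \<open>n\<close>, the projection
    \<open>aa m\<close> occupies the indices from \<open>m + 1\<close> to \<open>n\<close>.\<close>
  have cnt: "(\<Sum>i\<le>n. if m < i then 1 else 0 :: complex) = of_nat n - of_nat m" if "m \<le> n" for m n
    using that by (induction n) (auto simp: le_Suc_eq)
  have One: "One = aa 0 + ee 0 0 + cc 0" by (simp add: One_def gens_0)
  have aa: "coef (B i) (B i) (aa m) = (if m < i then 1 else 0)" "coef (C i) (C i) (aa m) = (if m < i then 1 else 0)" for i m
    by (simp_all add: coef_aa)
  note cs = aa coef_ee coef_cc One coef_simps lookup_one
  show "coef (C (Suc n)) (C (Suc n)) (labp x) = of_int (Poly_Mapping.lookup (val x) 0)"
    using assms by (cases x) (auto simp: cs lookup_single lookup_val_LA simp del: val.simps(4))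
  show "(\<Sum>i\<le>n. coef (B i) (B i) (labp x))
      = of_int (int (Suc n) * Poly_Mapping.lookup (val x) 0 + Poly_Mapping.lookup (val x) (Suc 0))"
  proof (cases x)
    case LU
    have "(\<Sum>i\<le>n. (if 0 < i then 1 else 0) + (if i = 0 then 1 else 0)) = (\<Sum>i\<le>n. 1 :: complex)"
      by (intro sum.cong) auto
    then show ?thesis by (simp add: LU cs)
  next
    case (LA m)
    then show ?thesis using assms cnt[of m n] by (simp add: cs lookup_val_LA del: val.simps(4))
  qed (simp_all add: cs lookup_single)
  show "s \<le> n \<Longrightarrow> coef (C s) (C s) (labp x)
      = of_int (Poly_Mapping.lookup (val x) 0 + Poly_Mapping.lookup (val x) (Suc (Suc s)))"
    using assms by (cases x) (auto simp: cs lookup_single lookup_val_LA when_def simp del: val.simps(4))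
qed

lemma trace_diag:
  fixes \<tau> :: "q2alg \<Rightarrow> complex"
  assumes "\<tau> 0 = 0" "length xs \<le> k"
  shows "(\<Sum>i<k. \<tau> (ent (diag xs) i i)) = (\<Sum>x\<leftarrow>xs. \<tau> (labp x))"
proof -
  have "(\<Sum>i<k. \<tau> (ent (diag xs) i i)) = (\<Sum>i<length xs. \<tau> (labp (xs ! i)))"
    using assms by (intro sum.mono_neutral_cong_right) (auto simp: ent_diag)
  also have "\<dots> = (\<Sum>x\<leftarrow>xs. \<tau> (labp x))"
    by (simp add: sum_list_sum_nth atLeast0LessThan)
  finally show ?thesis .
qed

lemma lookup_vals: "Poly_Mapping.lookup (vals xs) i = (\<Sum>x\<leftarrow>xs. Poly_Mapping.lookup (val x) i)"
  by (induction xs) (simp_all add: lookup_add)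

text \<open>Equivalent diagonals have equal traces at a common stage, and the system in
  \<open>traces_labp\<close> is triangular, so the traces determine the coordinates.\<close>

lemma vals_eqI:
  assumes mvn: "mvn CF (diag xs) (diag ys)" shows "vals xs = vals ys"
proof -
  define N where "N = (\<Sum>x\<leftarrow>xs @ ys. level x)"
  define k0 where "k0 = length xs + length ys"
  have N: "level x \<le> N" if "x \<in> set (xs @ ys)" for x
    unfolding N_def using that by (intro member_le_sum_list) auto
  have mem: "diag xs \<in> mats k0 (Fn N)" "diag ys \<in> mats k0 (Fn N)"
    using N by (auto intro!: diag_in_mats simp: k0_def)
  obtain k n w where k: "k \<ge> k0" "n \<ge> N" and w: "w \<in> mats k (Fn n)" "w\<^sup>\<star> * w = diag xs" "w * w\<^sup>\<star> = diag ys"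
    using mvn_finite_stage[OF mvn mem] by blast
  have len: "length xs \<le> k" "length ys \<le> k" using k by (auto simp: k0_def)
  have lev: "level x \<le> n" if "x \<in> set (xs @ ys)" for x using N[OF that] k by simp
  have trace: "(\<Sum>x\<leftarrow>xs. \<tau> (labp x)) = (\<Sum>x\<leftarrow>ys. \<tau> (labp x))"
    if "\<And>x y. \<tau> (x + y) = \<tau> x + \<tau> y" "\<tau> 0 = 0" "\<And>x y. x \<in> Fn n \<Longrightarrow> y \<in> Fn n \<Longrightarrow> \<tau> (x * y) = \<tau> (y * x)"
    for \<tau> :: "q2alg \<Rightarrow> complex"
    using matrix_trace[OF that subalgebra_Fn w(1)] unfolding w
      trace_diag[of \<tau>, OF that(2) len(1)] trace_diag[of \<tau>, OF that(2) len(2)] .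
  have of_int: "(\<Sum>x\<leftarrow>zs. complex_of_int (f x)) = of_int (\<Sum>x\<leftarrow>zs. f x)" for f :: "lab \<Rightarrow> int" and zs
    by (induction zs) simp_all
  have cong: "(\<Sum>x\<leftarrow>zs. \<tau> (labp x)) = of_int (\<Sum>x\<leftarrow>zs. f x)"
    if "\<And>x. level x \<le> n \<Longrightarrow> \<tau> (labp x) = of_int (f x)" "set zs \<subseteq> set (xs @ ys)"
    for \<tau> :: "q2alg \<Rightarrow> complex" and f :: "lab \<Rightarrow> int" and zs
  proof -
    have "map (\<lambda>x. \<tau> (labp x)) zs = map (\<lambda>x. complex_of_int (f x)) zs" using that lev by auto
    then show ?thesis using of_int by metis
  qed
  have eq: "(\<Sum>x\<leftarrow>xs. f x) = (\<Sum>x\<leftarrow>ys. f x)"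
    if "\<And>x y. \<tau> (x + y) = \<tau> x + \<tau> y" "\<tau> 0 = 0" "\<And>x y. x \<in> Fn n \<Longrightarrow> y \<in> Fn n \<Longrightarrow> \<tau> (x * y) = \<tau> (y * x)"
      "\<And>x. level x \<le> n \<Longrightarrow> \<tau> (labp x) = of_int (f x)" for \<tau> :: "q2alg \<Rightarrow> complex" and f
  proof -
    have "complex_of_int (\<Sum>x\<leftarrow>xs. f x) = of_int (\<Sum>x\<leftarrow>ys. f x)"
      using trace[OF that(1,2,3)] cong[of \<tau> f xs, OF that(4)] cong[of \<tau> f ys, OF that(4)] by simp
    then show ?thesis by (simp only: of_int_eq_iff)
  qed
  have 0: "Poly_Mapping.lookup (vals xs) 0 = Poly_Mapping.lookup (vals ys) 0"
    unfolding lookup_vals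
    by (rule eq[of "coef (C (Suc n)) (C (Suc n))"]) (simp_all add: coef_simps stage_traces traces_labp)
  have "(\<Sum>x\<leftarrow>xs. int (Suc n) * Poly_Mapping.lookup (val x) 0 + Poly_Mapping.lookup (val x) (Suc 0))
      = (\<Sum>x\<leftarrow>ys. int (Suc n) * Poly_Mapping.lookup (val x) 0 + Poly_Mapping.lookup (val x) (Suc 0))"
    by (rule eq[of "\<lambda>x. \<Sum>i\<le>n. coef (B i) (B i) x"])
      (simp_all only: coef_simps coef_0 sum.distrib sum.neutral_const stage_traces traces_labp)
  then have 1: "Poly_Mapping.lookup (vals xs) (Suc 0) = Poly_Mapping.lookup (vals ys) (Suc 0)"
    using 0 by (simp only: sum_list_addf sum_list_const_mult lookup_vals)
  have 2: "Poly_Mapping.lookup (vals xs) (Suc (Suc s)) = Poly_Mapping.lookup (vals ys) (Suc (Suc s))" for s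
  proof (cases "s \<le> n")
    case True
    have "(\<Sum>x\<leftarrow>xs. Poly_Mapping.lookup (val x) 0 + Poly_Mapping.lookup (val x) (Suc (Suc s)))
      = (\<Sum>x\<leftarrow>ys. Poly_Mapping.lookup (val x) 0 + Poly_Mapping.lookup (val x) (Suc (Suc s)))"
      using True by (intro eq[of "coef (C s) (C s)"]) (simp_all only: coef_simps coef_0 stage_traces traces_labp)
    then show ?thesis using 0 by (simp only: sum_list_addf lookup_vals)
  next
    \<comment> \<open>Beyond the stage the coordinate is 0 on both sides, since all levels are at
      most \<open>n\<close>.\<close>
    case False
    have "Poly_Mapping.lookup (val x) (Suc (Suc s)) = 0" if "x \<in> set (xs @ ys)" for x
      using lev[OF that] False by (cases x) (auto simp: lookup_single lookup_one lookup_val_LA simp del: val.simps(4))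
    then have "(\<Sum>x\<leftarrow>zs. Poly_Mapping.lookup (val x) (Suc (Suc s))) = 0" if "set zs \<subseteq> set (xs @ ys)" for zs
      using that by (induction zs) auto
    from this[of xs] this[of ys] show ?thesis by (simp add: lookup_vals)
  qed
  show ?thesis
  proof (rule poly_mapping_eqI)
    fix i
    show "Poly_Mapping.lookup (vals xs) i = Poly_Mapping.lookup (vals ys) i"
      using 0 1 2 by (metis not0_implies_Suc)
  qed
qed

section \<open>Stable equivalence of projections with equal invariant\<close>

lemma diag_refl: "mvn CF (diag xs) (diag xs)"
  by (rule mvn_refl[OF is_proj_diag diag_in_CF])

lemma mvn_diag_append:
  assumes "mvn CF (diag xs) (diag xs')" "mvn CF (diag ys) (diag ys')"
  shows "mvn CF (diag (xs @ ys)) (diag (xs' @ ys'))"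
proof -
  have sh: "mvn CF (diag zs) (shift n (diag zs))" for zs n
    by (rule mvn_shift[OF subalgebra_core is_proj_diag diag_in_CF])
  have "mvn CF (shift (length xs) (diag ys)) (shift (length xs') (diag ys'))"
    by (rule mvn_trans[OF CF mvn_sym[OF CF sh] mvn_trans[OF CF assms(2) sh]])
  then show ?thesis unfolding diag_append using assms(1) by (intro mvn_add[OF CF]) (simp_all add: diag_orth)
qed

lemma mvn_diag_swap: "mvn CF (diag (xs @ ys)) (diag (ys @ xs))"
proof -
  have sh: "mvn CF (diag zs) (shift n (diag zs))" for zs n
    by (rule mvn_shift[OF subalgebra_core is_proj_diag diag_in_CF])
  have "shift (length ys) (diag xs) * diag ys = 0"
    by (rule orth_commute[OF is_proj_diag is_proj_shift[OF is_proj_diag] diag_orth])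
  then have "mvn CF (diag xs + shift (length xs) (diag ys)) (shift (length ys) (diag xs) + diag ys)"
    by (intro mvn_add[OF CF] sh mvn_sym[OF CF sh] diag_orth)
  then show ?thesis by (simp add: diag_append add.commute)
qed

lemma mvn_diag_perm: "mset xs = mset ys \<Longrightarrow> mvn CF (diag xs) (diag ys)"
proof (induction xs arbitrary: ys)
  case Nil then show ?case using diag_refl[of "[]"] by simp
next
  case (Cons x xs)
  then have "x \<in> set ys" by (metis list.set_intros(1) set_mset_mset)
  then obtain us vs where ys: "ys = us @ x # vs" by (meson split_list)
  then have "mset xs = mset (vs @ us)" using Cons.prems by simp
  then have "mvn CF (diag ([x] @ xs)) (diag ([x] @ (vs @ us)))"
    by (intro mvn_diag_append diag_refl Cons.IH)
  moreover have "mvn CF (diag ((x # vs) @ us)) (diag (us @ (x # vs)))" by (rule mvn_diag_swap)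
  ultimately show ?case using mvn_trans[OF CF] by (simp add: ys)
qed

text \<open>The summands that complete \<open>aa n\<close> to the unit, as in
  \<open>One_split\<close>.\<close>

fun completion :: "lab \<Rightarrow> lab list" where
  "completion (LA n) = replicate (Suc n) LB @ map LC [0..<Suc n]"
| "completion _ = []"

fun completed :: "lab \<Rightarrow> lab" where
  "completed (LA n) = LU"
| "completed x = x"

lemma One_split: "One = aa n + (\<Sum>i<Suc n. ee i i) + (\<Sum>i<Suc n. cc i)"
proof (induction n)
  case 0 show ?case by (simp add: One_def gens_0)
next
  case (Suc n) then show ?case by (subst (asm) aa_Suc) (simp add: algebra_simps)
qed

text \<open>\<open>One_split\<close> read as an orthogonal decomposition, in which every
  \<open>ee i i\<close> counts as \<open>LB\<close>.\<close>

lemma mvn_completion: "mvn CF (diag (x # completion x)) (diag [completed x])"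
proof (cases x)
  case (LA n)
  have orth: "(\<Sum>i<m. f i) * y = 0" if "\<And>i. i < m \<Longrightarrow> f i * y = 0" for f :: "nat \<Rightarrow> q2alg" and y m
    using that by (simp add: sum_distrib_right)
  have emat_orth: "emat 0 0 a * emat 0 0 b = 0" if "a * b = 0" for a b :: q2alg
    using that by (simp add: emat_mult)
  have a: "dec (emat 0 0 (aa n)) [LA n]"
    by (intro dec_single[of "aa n"]) (simp_all add: core_gens_in_core core_gens_mult is_proj_core_gens)
  have e1: "dec (emat 0 0 (ee i i)) [LB]" for i
    by (intro dec_single[of "ee 0 i"]) (simp_all add: core_gens_in_core core_gens_mult is_proj_core_gens)
  have c1: "dec (emat 0 0 (cc i)) [LC i]" for i
    by (intro dec_single[of "cc i"]) (simp_all add: core_gens_in_core core_gens_mult is_proj_core_gens)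
  have e: "dec (emat 0 0 (\<Sum>i<m. ee i i)) (replicate m LB)" for m
  proof (induction m)
    case (Suc m)
    have "dec (emat 0 0 (\<Sum>i<m. ee i i) + emat 0 0 (ee m m)) (replicate m LB @ [LB])"
      by (intro dec_add Suc e1 emat_orth orth) (simp add: core_gens_mult)
    then show ?case by (simp add: emat_add replicate_append_same)
  qed (simp add: dec_0)
  have c: "dec (emat 0 0 (\<Sum>i<m. cc i)) (map LC [0..<m])" for m
  proof (induction m)
    case (Suc m)
    have "dec (emat 0 0 (\<Sum>i<m. cc i) + emat 0 0 (cc m)) (map LC [0..<m] @ [LC m])"
      by (intro dec_add Suc c1 emat_orth orth) (simp add: core_gens_mult)
    then show ?case by (simp add: emat_add)
  qed (simp add: dec_0)
  have ec: "dec (emat 0 0 (\<Sum>i<Suc n. ee i i) + emat 0 0 (\<Sum>i<Suc n. cc i)) (replicate (Suc n) LB @ map LC [0..<Suc n])"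
    by (intro dec_add e c emat_orth orth) (simp add: sum_distrib_left core_gens_mult del: sum.lessThan_Suc)
  have "aa n * ((\<Sum>i<Suc n. ee i i) + (\<Sum>i<Suc n. cc i)) = 0"
    unfolding distrib_left sum_distrib_left by (simp add: core_gens_mult del: sum.lessThan_Suc)
  then have "emat 0 0 (aa n) * (emat 0 0 (\<Sum>i<Suc n. ee i i) + emat 0 0 (\<Sum>i<Suc n. cc i)) = 0"
    by (simp only: emat_add[symmetric] emat_orth)
  with a ec have "dec (emat 0 0 (aa n) + (emat 0 0 (\<Sum>i<Suc n. ee i i) + emat 0 0 (\<Sum>i<Suc n. cc i)))
      ([LA n] @ replicate (Suc n) LB @ map LC [0..<Suc n])"
    by (rule dec_add)
  moreover have "emat 0 0 (aa n) + (emat 0 0 (\<Sum>i<Suc n. ee i i) + emat 0 0 (\<Sum>i<Suc n. cc i)) = diag [LU]"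
    by (simp only: emat_add[symmetric] add.assoc[symmetric] One_split[of n, symmetric]) simp
  ultimately have "mvn CF (diag [LU]) (diag (LA n # completion (LA n)))" unfolding dec_def by simp
  then show ?thesis using mvn_sym[OF CF] LA by simp
qed (simp_all add: diag_refl del: diag.simps)

lemma vals_completion: "vals (x # completion x) = val (completed x)"
proof (cases x)
  case (LA n)
  have "vals (replicate m LB) = Poly_Mapping.single 1 (int m)" for m
    by (induction m) (simp_all add: single_add[symmetric])
  moreover have "vals (map LC [0..<m]) = (\<Sum>i<m. Poly_Mapping.single (i + 2) 1)" for m
    by (induction m) simp_all
  ultimately show ?thesis using LA
    by (simp add: lessThan_Suc_atMost add.commute del: replicate.simps upt_Suc sum.lessThan_Suc)
qed simp_all

lemma mvn_completions: "mvn CF (diag (xs @ concat (map completion xs))) (diag (map completed xs))"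
proof (induction xs)
  case Nil show ?case using diag_refl[of "[]"] by simp
next
  case (Cons x xs)
  have "mvn CF (diag ((x # xs) @ concat (map completion (x # xs))))
      (diag ((x # completion x) @ (xs @ concat (map completion xs))))"
    by (rule mvn_diag_perm) simp
  moreover have "mvn CF (diag ((x # completion x) @ (xs @ concat (map completion xs)))) (diag ([completed x] @ map completed xs))"
    by (intro mvn_diag_append mvn_completion Cons)
  ultimately show ?case using mvn_trans[OF CF] by simp
qed

lemma vals_completions: "vals xs + vals (concat (map completion xs)) = vals (map completed xs)"
proof (induction xs)
  case (Cons x xs)
  then show ?case using vals_completion[of x] by (simp add: algebra_simps)
qed simp

text \<open>Apart from the \<open>LA n\<close>, distinct labels have distinct basis vectors as
  values, so the coordinates count occurrences.\<close>

lemma mset_eq_of_vals: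
  assumes "vals xs = vals ys" "\<And>n. LA n \<notin> set xs" "\<And>n. LA n \<notin> set ys"
  shows "mset xs = mset ys"
proof (rule multiset_eqI)
  \<comment> \<open>The index at \<open>LA n\<close> is a dummy.\<close>
  define idx where "idx x = (case x of LU \<Rightarrow> 0 | LB \<Rightarrow> 1 | LC i \<Rightarrow> i + 2 | LA n \<Rightarrow> 0)" for x
  have cnt: "int (count (mset zs) x) = Poly_Mapping.lookup (vals zs) (idx x)"
    if "\<And>n. LA n \<notin> set zs" "\<And>n. x \<noteq> LA n" for zs x
    using that(1)
  proof (induction zs)
    case (Cons z zs)
    have "z \<noteq> LA n" for n using Cons.prems[of n] by auto
    then have "Poly_Mapping.lookup (val z) (idx x) = (if z = x then 1 else 0)"
      using that(2) by (cases z; cases x) (auto simp: idx_def lookup_single lookup_one)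
    then show ?case using Cons by (simp add: lookup_add)
  qed simp
  fix x
  show "count (mset xs) x = count (mset ys) x"
  proof (cases "\<exists>n. x = LA n")
    case True then show ?thesis using assms(2,3) by (metis count_eq_zero_iff set_mset_mset)
  next
    case False
    then have "int (count (mset xs) x) = int (count (mset ys) x)"
      using cnt[of xs x] cnt[of ys x] assms by simp
    then show ?thesis by simp
  qed
qed

text \<open>Adding the completions of both lists to both sides turns every \<open>LA n\<close> of
  \<open>xs\<close> and \<open>ys\<close> into \<open>LU\<close>. The resulting lists have equal
  values and no \<open>LA\<close>, so they are permutations of each other.\<close>

lemma stably_mvn:
  assumes "vals xs = vals ys"
  shows "\<exists>zs. mvn CF (diag (xs @ zs)) (diag (ys @ zs))"
proof -
  define cx where "cx = concat (map completion xs)"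
  define cy where "cy = concat (map completion ys)"
  have no_LA: "LA n \<notin> set (map completed zs)" "LA n \<notin> set (concat (map completion zs))" for n zs
  proof -
    have "LA n \<noteq> completed z" "LA n \<notin> set (completion z)" for z by (cases z; auto)+
    then show "LA n \<notin> set (map completed zs)" "LA n \<notin> set (concat (map completion zs))" by auto
  qed
  have 1: "mvn CF (diag ((xs @ cx) @ cy)) (diag (map completed xs @ cy))"
    unfolding cx_def by (intro mvn_diag_append mvn_completions diag_refl)
  have "mvn CF (diag (ys @ cx @ cy)) (diag ((ys @ cy) @ cx))" by (rule mvn_diag_perm) simp
  moreover have "mvn CF (diag ((ys @ cy) @ cx)) (diag (map completed ys @ cx))"
    unfolding cy_def by (intro mvn_diag_append mvn_completions diag_refl)
  ultimately have 2: "mvn CF (diag (ys @ cx @ cy)) (diag (map completed ys @ cx))" by (rule mvn_trans[OF CF])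
  have "vals (map completed xs @ cy) = vals (map completed ys @ cx)"
    using assms vals_completions[of xs] vals_completions[of ys] by (simp add: cx_def cy_def flip: vals_completions)
  then have "mset (map completed xs @ cy) = mset (map completed ys @ cx)"
    by (rule mset_eq_of_vals) (use no_LA in \<open>auto simp: cx_def cy_def\<close>)
  then have 3: "mvn CF (diag (map completed xs @ cy)) (diag (map completed ys @ cx))" by (rule mvn_diag_perm)
  have "mvn CF (diag (xs @ cx @ cy)) (diag (ys @ cx @ cy))"
    using mvn_trans[OF CF mvn_trans[OF CF 1 3] mvn_sym[OF CF 2]] by simp
  then show ?thesis by blast
qed

text \<open>The differences form a subgroup, and the values of \<open>LU\<close>, \<open>LB\<close>
  and the \<open>LC k\<close> are all the basis vectors.\<close>

lemma vals_surj: "\<exists>xs ys. f = vals xs - vals ys"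
proof -
  define S where "S = {f. \<exists>xs ys. f = vals xs - vals ys}"
  have add: "f + g \<in> S" if fg: "f \<in> S" "g \<in> S" for f g
  proof -
    obtain xs ys xs' ys' where "f = vals xs - vals ys" "g = vals xs' - vals ys'" using fg by (auto simp: S_def)
    then have "f + g = vals (xs @ xs') - vals (ys @ ys')" by simp
    then show ?thesis unfolding S_def by blast
  qed
  have minus: "- f \<in> S" if f: "f \<in> S" for f
  proof -
    obtain xs ys where "f = vals xs - vals ys" using f by (auto simp: S_def)
    then have "- f = vals ys - vals xs" by simp
    then show ?thesis unfolding S_def by blast
  qed
  have basis: "\<exists>x. Poly_Mapping.single i 1 = val x" for i
  proof (cases i)
    case 0 then show ?thesis by (intro exI[of _ LU]) simp
  next
    case (Suc j)
    show ?thesis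
    proof (cases j)
      case 0 then show ?thesis using Suc by (intro exI[of _ LB]) simp
    next
      case (Suc k) then show ?thesis using \<open>i = Suc j\<close> by (intro exI[of _ "LC k"]) simp
    qed
  qed
  have nat: "Poly_Mapping.single i (int m) \<in> S" for i m
  proof (induction m)
    case 0
    have "0 = vals [] - vals []" by simp
    then show ?case unfolding S_def single_zero of_nat_0 by blast
  next
    case (Suc m)
    obtain x where "Poly_Mapping.single i 1 = val x" using basis by blast
    then have "Poly_Mapping.single i (1::int) = vals [x] - vals []" by simp
    then have "Poly_Mapping.single i (1::int) \<in> S" unfolding S_def by blast
    from add[OF this Suc] show ?case by (simp add: single_add[symmetric])
  qed
  have int: "Poly_Mapping.single i m \<in> S" for i m
    using nat[of i "nat m"] minus[OF nat[of i "nat (- m)"]] by (cases "m \<ge> 0") (auto simp: single_uminus)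
  have "f \<in> S"
  proof (induction f rule: update_induct)
    case const then show ?case using int[of 0 0] by simp
  next
    case (update f a b)
    have "Poly_Mapping.update a b f = f + Poly_Mapping.single a b"
      using update.hyps(1)
      by (intro poly_mapping_eqI) (auto simp: lookup_update lookup_add lookup_single when_def in_keys_iff)
    then show ?case using add[OF update.IH int] by simp
  qed
  then show ?thesis by (simp add: S_def)
qed

section \<open>Transfer to matrices over the gauge-invariant subalgebra\<close>

abbreviation (input) "A \<equiv> gauge_fixed Q2"

lemma carrier_A: "carrier A = Rep_q2 ` core"
proof -
  have "Rep_q2 ` UNIV = carrier (graph_cstar Q2)"
    using type_definition.Rep_range[OF type_definition_q2alg] by simp
  then have "carrier A = {X \<in> Rep_q2 ` UNIV. \<forall>c. cmod c = 1 \<longrightarrow> gauge Q2 c X = X}"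
    by (simp add: gauge_fixed_def)
  also have "\<dots> = Rep_q2 ` core"
    by (auto simp: core_def Rep_q2_inject simp flip: Rep_gauge)
  finally show ?thesis .
qed

lemma A_ops:
  "Rep_q2 x \<otimes>\<^bsub>A\<^esub> Rep_q2 y = Rep_q2 (x * y)" "Rep_q2 x \<oplus>\<^bsub>A\<^esub> Rep_q2 y = Rep_q2 (x + y)"
  "\<zero>\<^bsub>A\<^esub> = Rep_q2 0" "star_op A (Rep_q2 x) = Rep_q2 (x\<^sup>\<star>)"
proof -
  obtain x' where x: "x' \<in> cauchy_seqs R2" "x = cl x'" by (rule q2_cases)
  obtain y' where y: "y' \<in> cauchy_seqs R2" "y = cl y'" by (rule q2_cases)
  show "Rep_q2 x \<otimes>\<^bsub>A\<^esub> Rep_q2 y = Rep_q2 (x * y)" "Rep_q2 x \<oplus>\<^bsub>A\<^esub> Rep_q2 y = Rep_q2 (x + y)"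
    "star_op A (Rep_q2 x) = Rep_q2 (x\<^sup>\<star>)"
    using x y by (simp_all add: gauge_fixed_def graph_cstar_def Rep_cl Q2.mult_cls Q2.add_cls Q2.star_cls cl_simps star_cl)
  show "\<zero>\<^bsub>A\<^esub> = Rep_q2 0"
    by (simp add: gauge_fixed_def graph_cstar_def Q2.U_simps(1) zero_q2alg_def Rep_cl)
qed

text \<open>\<open>mat_prod\<close> adds with the \<open>finsum\<close> of the structure, whose
  rules presuppose this.\<close>

lemma abelian_monoid_A: "abelian_monoid A"
  by (rule abelian_monoidI)
    (auto simp: carrier_A A_ops add_ac intro: subalgebraD[OF subalgebra_core])

lemma finsum_A:
  fixes n :: nat
  assumes "\<And>k. k < n \<Longrightarrow> f k \<in> core"
  shows "(\<Oplus>\<^bsub>A\<^esub>k\<in>{..<n}. Rep_q2 (f k)) = Rep_q2 (\<Sum>k<n. f k)"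
  using assms
proof (induction n)
  case 0
  then show ?case using abelian_monoid.finsum_empty[OF abelian_monoid_A] by (simp add: A_ops)
next
  case (Suc n)
  have "(\<Oplus>\<^bsub>A\<^esub>k\<in>insert n {..<n}. Rep_q2 (f k)) = Rep_q2 (f n) \<oplus>\<^bsub>A\<^esub> (\<Oplus>\<^bsub>A\<^esub>k\<in>{..<n}. Rep_q2 (f k))"
    using Suc.prems by (intro abelian_monoid.finsum_insert[OF abelian_monoid_A]) (auto simp: carrier_A)
  then show ?case using Suc by (simp add: lessThan_Suc A_ops)
qed

text \<open>\<open>toF\<close> and \<open>ofF\<close> translate between matrices with dimensions and
  \<open>fmat\<close>. The frame in \<open>rect m n\<close> keeps the dimensions that
  \<open>fmat\<close> forgets.\<close>

definition toF :: "(nat \<Rightarrow> q2_poly) set mat \<Rightarrow> q2alg fmat" where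
  "toF M = Fmat (\<lambda>i j. if i < dim_row M \<and> j < dim_col M then Abs_q2 (M $$ (i, j)) else 0)"

definition ofF :: "nat \<Rightarrow> nat \<Rightarrow> q2alg fmat \<Rightarrow> (nat \<Rightarrow> q2_poly) set mat" where
  "ofF m n F = mat m n (\<lambda>(i, j). Rep_q2 (ent F i j))"

definition rect :: "nat \<Rightarrow> nat \<Rightarrow> q2alg fmat \<Rightarrow> bool" where
  "rect m n F \<longleftrightarrow> (\<forall>i j. ent F i j \<noteq> 0 \<longrightarrow> i < m \<and> j < n)"

lemma dim_ofF [simp]: "dim_row (ofF m n F) = m" "dim_col (ofF m n F) = n"
  by (simp_all add: ofF_def)

lemma index_ofF [simp]: "i < m \<Longrightarrow> j < n \<Longrightarrow> ofF m n F $$ (i, j) = Rep_q2 (ent F i j)"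
  by (simp add: ofF_def)

lemma ent_toF: "ent (toF M) i j = (if i < dim_row M \<and> j < dim_col M then Abs_q2 (M $$ (i, j)) else 0)"
  unfolding toF_def
proof (subst Fmat_inverse)
  have "\<forall>i j. (if i < dim_row M \<and> j < dim_col M then Abs_q2 (M $$ (i, j)) else 0) \<noteq> 0 \<longrightarrow>
      i < dim_row M + dim_col M \<and> j < dim_row M + dim_col M" by auto
  then show "(\<lambda>i j. if i < dim_row M \<and> j < dim_col M then Abs_q2 (M $$ (i, j)) else 0)
      \<in> {f. \<exists>k. \<forall>i j. f i j \<noteq> 0 \<longrightarrow> i < k \<and> j < k}" by blast
qed simp

lemma rect_toF: "rect (dim_row M) (dim_col M) (toF M)"
  by (simp add: rect_def ent_toF)

lemma toF_ofF: "rect m n F \<Longrightarrow> toF (ofF m n F) = F"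
  by (rule fmat_eqI) (auto simp: ent_toF rect_def Rep_q2_inverse)

lemma ofF_inject: "rect m n F \<Longrightarrow> rect m n G \<Longrightarrow> ofF m n F = ofF m n G \<Longrightarrow> F = G"
  by (metis toF_ofF)

lemma rect_zero: "rect m n F \<Longrightarrow> n \<le> j \<Longrightarrow> ent F i j = 0"
  using leD unfolding rect_def by blast

lemma rect_supp: "rect n n F \<longleftrightarrow> supp n F"
  by (simp add: rect_def supp_def)

lemma mats_over_A: "M \<in> mats_over A m n \<longleftrightarrow> (\<exists>F\<in>CF. rect m n F \<and> M = ofF m n F)"
proof
  assume M: "M \<in> mats_over A m n"
  then have dim: "M \<in> carrier_mat m n" "dim_row M = m" "dim_col M = n" by (auto simp: mats_over_def)
  have el: "M $$ (i, j) \<in> Rep_q2 ` core" if "i < m" "j < n" for i j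
    using M elements_matI[OF dim(1) that refl] by (auto simp: mats_over_def carrier_A)
  then have "Abs_q2 (M $$ (i, j)) \<in> core" "Rep_q2 (Abs_q2 (M $$ (i, j))) = M $$ (i, j)" if "i < m" "j < n" for i j
    using el[OF that] by (auto simp: Rep_q2_inverse)
  then have "toF M \<in> CF" "M = ofF m n (toF M)"
    using dim subalgebraD(1)[OF subalgebra_core] by (auto simp: fmats_def ent_toF intro!: eq_matI)
  then show "\<exists>F\<in>CF. rect m n F \<and> M = ofF m n F" using rect_toF[of M] dim by auto
next
  assume "\<exists>F\<in>CF. rect m n F \<and> M = ofF m n F"
  then obtain F where F: "F \<in> CF" "M = ofF m n F" by blast
  then show "M \<in> mats_over A m n"
    by (auto simp: mats_over_def carrier_A fmats_def intro!: carrier_matI dest!: elements_matD)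
qed

lemma mat_prod_ofF:
  assumes "F \<in> CF" "G \<in> CF" "rect m n F"
  shows "mat_prod A (ofF m n F) (ofF n l G) = ofF m l (F * G)"
proof (rule eq_matI)
  fix i j assume ij: "i < dim_row (ofF m l (F * G))" "j < dim_col (ofF m l (F * G))"
  have prod: "ent F i k * ent G k j \<in> core" for k
    using assms by (auto simp: fmats_def intro: subalgebraD[OF subalgebra_core])
  have "mat_prod A (ofF m n F) (ofF n l G) $$ (i, j)
      = (\<Oplus>\<^bsub>A\<^esub>k\<in>{..<n}. ofF m n F $$ (i, k) \<otimes>\<^bsub>A\<^esub> ofF n l G $$ (k, j))"
    using ij by (simp add: mat_prod_def)
  also have "\<dots> = (\<Oplus>\<^bsub>A\<^esub>k\<in>{..<n}. Rep_q2 (ent F i k * ent G k j))"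
    using ij prod by (intro abelian_monoid.finsum_cong'[OF abelian_monoid_A]) (auto simp: A_ops carrier_A)
  also have "\<dots> = Rep_q2 (\<Sum>k<n. ent F i k * ent G k j)" by (rule finsum_A[OF prod])
  also have "(\<Sum>k<n. ent F i k * ent G k j) = (\<Sum>k<m + n. ent F i k * ent G k j)"
    using assms(3) by (intro sum.mono_neutral_left) (auto simp: rect_zero)
  also have "\<dots> = ent (F * G) i j"
    using assms(3) by (intro ent_times[symmetric]) (force simp: rect_def supp_def)
  finally show "mat_prod A (ofF m n F) (ofF n l G) $$ (i, j) = ofF m l (F * G) $$ (i, j)" using ij by simp
qed (simp_all add: mat_prod_def)

lemma mat_star_ofF: "mat_star A (ofF m n F) = ofF n m (F\<^sup>\<star>)"
  by (rule eq_matI) (simp_all add: mat_star_def A_ops)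

lemma rect_star: "rect m n F \<Longrightarrow> rect n m (F\<^sup>\<star>)"
  by (auto simp: rect_def)

lemma rect_times: assumes "rect m n F" "rect n l G" shows "rect m l (F * G)"
  unfolding rect_def
proof (intro allI impI)
  fix i j assume nz: "ent (F * G) i j \<noteq> 0"
  have "supp (m + n) F" using assms(1) by (force simp: rect_def supp_def)
  then have "ent (F * G) i j = (\<Sum>k<m + n. ent F i k * ent G k j)" by (rule ent_times)
  with nz obtain k where "ent F i k * ent G k j \<noteq> 0" by (auto elim: sum.not_neutral_contains_not_neutral)
  then have "ent F i k \<noteq> 0" "ent G k j \<noteq> 0" by auto
  then show "i < m \<and> j < l" using assms by (auto simp: rect_def)
qed

text \<open>\<open>n\<close> is the size that a member of \<open>projections\<close> carries; by
  \<open>murray_von_neumann_A\<close> equivalence sees \<open>F\<close> alone.\<close>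

definition stage_proj :: "nat \<Rightarrow> q2alg fmat \<Rightarrow> bool" where
  "stage_proj n F \<longleftrightarrow> n > 0 \<and> F \<in> CF \<and> supp n F \<and> is_proj F"

lemma projections_A: "p \<in> projections A \<longleftrightarrow> (\<exists>n F. stage_proj n F \<and> p = ofF n n F)"
proof
  assume "p \<in> projections A"
  then obtain n where n: "n > 0" "p \<in> mats_over A n n" "mat_star A p = p" "mat_prod A p p = p"
    by (auto simp: projections_def)
  then obtain F where F: "F \<in> CF" "rect n n F" "p = ofF n n F" by (auto simp: mats_over_A)
  have "ofF n n (F\<^sup>\<star>) = ofF n n F" using n(3) by (simp add: F mat_star_ofF)
  then have 1: "F\<^sup>\<star> = F" using F rect_star by (intro ofF_inject) auto
  have "ofF n n (F * F) = ofF n n F" using n(4) F by (simp add: mat_prod_ofF)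
  then have "F * F = F" using F rect_times by (intro ofF_inject) auto
  then have "stage_proj n F" using 1 n F by (simp add: stage_proj_def rect_supp is_proj_def)
  then show "\<exists>n F. stage_proj n F \<and> p = ofF n n F" using F by blast
next
  assume "\<exists>n F. stage_proj n F \<and> p = ofF n n F"
  then obtain n F where F: "n > 0" "F \<in> CF" "rect n n F" "F\<^sup>\<star> = F" "F * F = F" "p = ofF n n F"
    by (auto simp: stage_proj_def rect_supp is_proj_def)
  then show "p \<in> projections A"
    by (auto simp: projections_def mats_over_A mat_star_ofF mat_prod_ofF intro!: exI[of _ n])
qed

lemma murray_von_neumann_A:
  assumes F: "stage_proj n F" and G: "stage_proj m G"
  shows "(ofF n n F, ofF m m G) \<in> murray_von_neumann A \<longleftrightarrow> mvn CF F G"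
proof
  note FF = F[unfolded stage_proj_def] and GG = G[unfolded stage_proj_def]
  assume "(ofF n n F, ofF m m G) \<in> murray_von_neumann A"
  then obtain v where v: "v \<in> mats_over A m n" "mat_prod A (mat_star A v) v = ofF n n F"
    "mat_prod A v (mat_star A v) = ofF m m G"
    by (auto simp: murray_von_neumann_def)
  then obtain V where V: "V \<in> CF" "rect m n V" "v = ofF m n V" by (auto simp: mats_over_A)
  have Vs: "V\<^sup>\<star> \<in> CF" using V by (intro subalgebraD[OF CF])
  have "ofF n n (V\<^sup>\<star> * V) = ofF n n F"
    using v(2) V Vs rect_star[OF V(2)] by (simp add: mat_star_ofF mat_prod_ofF)
  then have "V\<^sup>\<star> * V = F"
    using FF by (intro ofF_inject[OF rect_times[OF rect_star[OF V(2)] V(2)]]) (auto simp: rect_supp)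
  moreover have "ofF m m (V * V\<^sup>\<star>) = ofF m m G"
    using v(3) V Vs by (simp add: mat_star_ofF mat_prod_ofF)
  then have "V * V\<^sup>\<star> = G"
    using GG by (intro ofF_inject[OF rect_times[OF V(2) rect_star[OF V(2)]]]) (auto simp: rect_supp)
  ultimately show "mvn CF F G" using FF GG V by (intro mvnI[of _ _ V]) auto
next
  note FF = F[unfolded stage_proj_def] and GG = G[unfolded stage_proj_def]
  assume mvn: "mvn CF F G"
  obtain V where V: "V \<in> CF" "V\<^sup>\<star> * V = F" "V * V\<^sup>\<star> = G" "V * F = V" "G * V = V"
    using mvn_normalize[OF CF mvn] by auto
  obtain k where k: "supp k V" using supp_ex by blast
  \<comment> \<open>A normalized witness satisfies \<open>V = G * V\<close> and
    \<open>V = V * F\<close>, which confines it to \<open>m\<close> rows and \<open>n\<close>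
    columns.\<close>
  have "rect m k (G * V)"
  proof (rule rect_times[of m "m + k"])
    show "rect m (m + k) G" using FF GG by (auto simp: rect_def supp_def trans_less_add1)
    show "rect (m + k) k V" using k by (auto simp: rect_def supp_def trans_less_add2)
  qed
  then have 1: "rect m k V" using V by simp
  have "rect k n (V * F)"
  proof (rule rect_times[of k "k + n"])
    show "rect (k + n) n F" using FF GG by (auto simp: rect_def supp_def trans_less_add2)
    show "rect k (k + n) V" using k by (auto simp: rect_def supp_def trans_less_add1)
  qed
  then have "rect k n V" using V by simp
  with 1 have V': "rect m n V" by (auto simp: rect_def)
  have Vs: "V\<^sup>\<star> \<in> CF" using V by (intro subalgebraD[OF CF])
  have "ofF m n V \<in> mats_over A m n" using V V' by (auto simp: mats_over_A)
  moreover have "mat_prod A (mat_star A (ofF m n V)) (ofF m n V) = ofF n n F"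
    "mat_prod A (ofF m n V) (mat_star A (ofF m n V)) = ofF m m G"
    using V V' Vs rect_star[OF V'] by (simp_all add: mat_star_ofF mat_prod_ofF)
  ultimately show "(ofF n n F, ofF m m G) \<in> murray_von_neumann A"
    using F G by (auto simp: murray_von_neumann_def projections_A)
qed

lemma mat_dsum_ofF:
  assumes "supp n F"
  shows "mat_dsum A (ofF n n F) (ofF m m G) = ofF (n + m) (n + m) (F + shift n G)"
proof (rule eq_matI)
  fix i j assume "i < dim_row (ofF (n + m) (n + m) (F + shift n G))" "j < dim_col (ofF (n + m) (n + m) (F + shift n G))"
  then have ij: "i < n + m" "j < n + m" by simp_all
  show "mat_dsum A (ofF n n F) (ofF m m G) $$ (i, j) = ofF (n + m) (n + m) (F + shift n G) $$ (i, j)"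
    using ij suppD[OF assms]
    by (auto simp: mat_dsum_def mat_zero_def ent_shift A_ops not_less)
qed (simp_all add: mat_dsum_def)

lemma stage_proj_dsum:
  assumes "stage_proj n F" "stage_proj m G" shows "stage_proj (n + m) (F + shift n G)"
proof -
  have "F * shift n G = 0" using assms by (intro shift_orth) (simp add: stage_proj_def)
  moreover have "supp (n + m) F" using assms supp_mono[of n F "n + m"] by (simp add: stage_proj_def)
  ultimately show ?thesis
    using assms by (auto simp: stage_proj_def intro!: supp_add supp_shift is_proj_add is_proj_shift
        subalgebraD[OF CF] shift_in_fmats[OF subalgebra_core])
qed

text \<open>An arbitrary decomposition is chosen; \<open>vals_eqI\<close> makes the value
  independent of the choice.\<close>

definition valF :: "q2alg fmat \<Rightarrow> nat \<Rightarrow>\<^sub>0 int" where "valF F = vals (SOME xs. dec F xs)"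

lemma valF_dec: assumes "dec F xs" shows "valF F = vals xs"
proof -
  have "dec F (SOME xs. dec F xs)" using assms by (rule someI)
  then have "mvn CF (diag (SOME xs. dec F xs)) (diag xs)"
    using assms mvn_trans[OF CF mvn_sym[OF CF]] unfolding dec_def by blast
  then show ?thesis unfolding valF_def by (rule vals_eqI)
qed

lemma stage_proj_dec: "stage_proj n F \<Longrightarrow> \<exists>xs. dec F xs"
  using proj_decomposes by (auto simp: stage_proj_def)

lemma valF_mvn: "stage_proj n G \<Longrightarrow> mvn CF F G \<Longrightarrow> valF F = valF G"
  using stage_proj_dec valF_dec dec_mvn by metis

lemma mvn_shift_proj: "stage_proj n F \<Longrightarrow> mvn CF F (shift m F)"
  by (intro mvn_shift subalgebra_core) (auto simp: stage_proj_def)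

lemma dec_dsum:
  assumes F: "stage_proj n F" "dec F xs" and G: "stage_proj m G" "dec G ys"
  shows "dec (F + shift n G) (xs @ ys)"
proof (rule dec_add)
  show "dec F xs" by fact
  show "dec (shift n G) ys" by (rule dec_mvn[OF mvn_sym[OF CF mvn_shift_proj[OF G(1)]] G(2)])
  show "F * shift n G = 0" using F by (intro shift_orth) (simp add: stage_proj_def)
qed

lemma mvn_dsum:
  assumes "stage_proj n F" "stage_proj m G" "stage_proj n' F'" "stage_proj m' G'" "mvn CF F F'" "mvn CF G G'"
  shows "mvn CF (F + shift n G) (F' + shift n' G')"
proof (rule mvn_add[OF CF assms(5)])
  show "mvn CF (shift n G) (shift n' G')"
    by (rule mvn_trans[OF CF mvn_sym[OF CF mvn_shift_proj[OF assms(2)]] mvn_trans[OF CF assms(6) mvn_shift_proj[OF assms(4)]]])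
  show "F * shift n G = 0" "F' * shift n' G' = 0" using assms by (auto intro: shift_orth simp: stage_proj_def)
qed

lemma equiv_murray_von_neumann: "equiv (projections A) (murray_von_neumann A)"
proof (rule equivI)
  show "murray_von_neumann A \<subseteq> projections A \<times> projections A" by (auto simp: murray_von_neumann_def)
  show "refl_on (projections A) (murray_von_neumann A)"
  proof (rule refl_onI)
    fix p assume "p \<in> projections A"
    then obtain n F where "stage_proj n F" "p = ofF n n F" by (auto simp: projections_A)
    then show "(p, p) \<in> murray_von_neumann A"
      using mvn_refl[of F CF] by (simp add: murray_von_neumann_A stage_proj_def)
  qed
  have obt: "\<exists>n F m G. stage_proj n F \<and> stage_proj m G \<and> p = ofF n n F \<and> q = ofF m m G"
    if "(p, q) \<in> murray_von_neumann A" for p q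
    using that unfolding murray_von_neumann_def projections_A by blast
  show "sym (murray_von_neumann A)"
  proof (rule symI)
    fix p q assume pq: "(p, q) \<in> murray_von_neumann A"
    then obtain n F m G where "stage_proj n F" "stage_proj m G" "p = ofF n n F" "q = ofF m m G" using obt by blast
    then show "(q, p) \<in> murray_von_neumann A"
      using pq mvn_sym[OF CF] by (simp add: murray_von_neumann_A)
  qed
  show "trans (murray_von_neumann A)"
  proof (rule transI)
    fix p q r assume pq: "(p, q) \<in> murray_von_neumann A" and qr: "(q, r) \<in> murray_von_neumann A"
    obtain n F m G where F: "stage_proj n F" "stage_proj m G" "p = ofF n n F" "q = ofF m m G" using obt[OF pq] by blast
    have "r \<in> projections A" using qr by (auto simp: murray_von_neumann_def)
    then obtain l H where H: "stage_proj l H" "r = ofF l l H" by (auto simp: projections_A)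
    show "(p, r) \<in> murray_von_neumann A"
      using pq qr F H mvn_trans[OF CF] by (auto simp: murray_von_neumann_A)
  qed
qed

section \<open>The monoid of equivalence classes\<close>

definition pcls :: "nat \<Rightarrow> q2alg fmat \<Rightarrow> (nat \<Rightarrow> q2_poly) set mat set" where
  "pcls n F = murray_von_neumann A `` {ofF n n F}"

lemma pcls_eq_iff: "stage_proj n F \<Longrightarrow> stage_proj m G \<Longrightarrow> pcls n F = pcls m G \<longleftrightarrow> mvn CF F G"
  unfolding pcls_def
  by (subst eq_equiv_class_iff[OF equiv_murray_von_neumann]) (auto simp: projections_A murray_von_neumann_A)

lemma in_pcls: "stage_proj n F \<Longrightarrow> p \<in> pcls n F \<longleftrightarrow> (\<exists>m G. stage_proj m G \<and> p = ofF m m G \<and> mvn CF F G)"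
proof
  assume F: "stage_proj n F" and "p \<in> pcls n F"
  then have p: "(ofF n n F, p) \<in> murray_von_neumann A" by (simp add: pcls_def)
  then have "p \<in> projections A" by (auto simp: murray_von_neumann_def)
  then obtain m G where G: "stage_proj m G" "p = ofF m m G" by (auto simp: projections_A)
  then show "\<exists>m G. stage_proj m G \<and> p = ofF m m G \<and> mvn CF F G"
    using p F by (auto simp: murray_von_neumann_A)
next
  assume F: "stage_proj n F" and "\<exists>m G. stage_proj m G \<and> p = ofF m m G \<and> mvn CF F G"
  then show "p \<in> pcls n F" by (auto simp: pcls_def murray_von_neumann_A)
qed

lemma carrier_projection_monoid:
  "X \<in> carrier (projection_monoid A) \<longleftrightarrow> (\<exists>n F. stage_proj n F \<and> X = pcls n F)"
proof -
  have "X \<in> carrier (projection_monoid A) \<longleftrightarrow> (\<exists>p\<in>projections A. X = murray_von_neumann A `` {p})"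
    by (simp add: projection_monoid_def quotient_def)
  also have "\<dots> \<longleftrightarrow> (\<exists>p. (\<exists>n F. stage_proj n F \<and> p = ofF n n F) \<and> X = murray_von_neumann A `` {p})"
    by (simp only: Bex_def projections_A)
  finally show ?thesis unfolding pcls_def by blast
qed

lemma proj_in_pcls: assumes "stage_proj n F" shows "ofF n n F \<in> pcls n F"
  unfolding in_pcls[OF assms]
  by (rule exI[of _ n], rule exI[of _ F]) (use assms in \<open>simp add: stage_proj_def mvn_refl\<close>)

lemma UN_UN_const:
  assumes "x \<in> X" "y \<in> Y" "\<And>x y. x \<in> X \<Longrightarrow> y \<in> Y \<Longrightarrow> f x y = c"
  shows "(\<Union>x\<in>X. \<Union>y\<in>Y. f x y) = c"
  using assms by blast

lemma mult_projection_monoid: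
  assumes F: "stage_proj n F" and G: "stage_proj m G"
  shows "pcls n F \<otimes>\<^bsub>projection_monoid A\<^esub> pcls m G = pcls (n + m) (F + shift n G)"
proof -
  have cls: "murray_von_neumann A `` {mat_dsum A p q} = pcls (n + m) (F + shift n G)"
    if p: "p \<in> pcls n F" and q: "q \<in> pcls m G" for p q
  proof -
    obtain n' F' where F': "stage_proj n' F'" "p = ofF n' n' F'" "mvn CF F F'"
      using p unfolding in_pcls[OF F] by blast
    obtain m' G' where G': "stage_proj m' G'" "q = ofF m' m' G'" "mvn CF G G'"
      using q unfolding in_pcls[OF G] by blast
    have "mat_dsum A p q = ofF (n' + m') (n' + m') (F' + shift n' G')"
      unfolding F'(2) G'(2) using F'(1) by (intro mat_dsum_ofF) (simp add: stage_proj_def)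
    then have "murray_von_neumann A `` {mat_dsum A p q} = pcls (n' + m') (F' + shift n' G')"
      by (simp add: pcls_def)
    also have "\<dots> = pcls (n + m) (F + shift n G)"
      by (subst pcls_eq_iff[OF stage_proj_dsum[OF F'(1) G'(1)] stage_proj_dsum[OF F G]])
        (rule mvn_sym[OF CF mvn_dsum[OF F G F'(1) G'(1) F'(3) G'(3)]])
    finally show ?thesis .
  qed
  have "pcls n F \<otimes>\<^bsub>projection_monoid A\<^esub> pcls m G
      = (\<Union>p\<in>pcls n F. \<Union>q\<in>pcls m G. murray_von_neumann A `` {mat_dsum A p q})"
    by (simp add: projection_monoid_def)
  also have "\<dots> = pcls (n + m) (F + shift n G)"
    by (rule UN_UN_const[OF proj_in_pcls[OF F] proj_in_pcls[OF G] cls])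
  finally show ?thesis .
qed

definition clsval :: "(nat \<Rightarrow> q2_poly) set mat set \<Rightarrow> nat \<Rightarrow>\<^sub>0 int" where
  "clsval X = valF (toF (SOME p. p \<in> X))"

lemma clsval_pcls: assumes F: "stage_proj n F" shows "clsval (pcls n F) = valF F"
proof -
  have "(SOME p. p \<in> pcls n F) \<in> pcls n F" using proj_in_pcls[OF F] by (rule someI)
  then obtain m G where G: "stage_proj m G" "(SOME p. p \<in> pcls n F) = ofF m m G" "mvn CF F G"
    unfolding in_pcls[OF F] by blast
  then have "toF (SOME p. p \<in> pcls n F) = G" by (simp add: toF_ofF rect_supp stage_proj_def)
  then show ?thesis using valF_mvn[OF G(1) G(3)] by (simp add: clsval_def)
qed

section \<open>The Grothendieck group\<close>

text \<open>Under \<open>f\<close> the Grothendieck relation becomes equality of the differences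
  \<open>f a - f b\<close>: cancellation up to a summand gives one direction, additivity the other.
  That the relation is an equivalence, that the product is well defined and that the induced map is
  injective can then be read off.\<close>

lemma grothendieck_group_iso:
  fixes M :: "('a, 'm) monoid_scheme" and f :: "'a \<Rightarrow> ('b \<Rightarrow>\<^sub>0 int)"
  assumes closed: "\<And>x y. x \<in> carrier M \<Longrightarrow> y \<in> carrier M \<Longrightarrow> x \<otimes>\<^bsub>M\<^esub> y \<in> carrier M"
    and hom: "\<And>x y. x \<in> carrier M \<Longrightarrow> y \<in> carrier M \<Longrightarrow> f (x \<otimes>\<^bsub>M\<^esub> y) = f x + f y"
    and canc: "\<And>x y. x \<in> carrier M \<Longrightarrow> y \<in> carrier M \<Longrightarrow> f x = f y \<Longrightarrow>
      \<exists>z\<in>carrier M. x \<otimes>\<^bsub>M\<^esub> z = y \<otimes>\<^bsub>M\<^esub> z"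
    and surj: "\<And>g. \<exists>x\<in>carrier M. \<exists>y\<in>carrier M. g = f x - f y"
  shows "grothendieck_group M \<cong> free_Abelian_group (UNIV :: 'b set)"
proof -
  let ?D = "\<lambda>(a, b). f a - f b"
  let ?R = "grothendieck_rel M"
  have rel: "?R = {(x, y). x \<in> carrier M \<times> carrier M \<and> y \<in> carrier M \<times> carrier M \<and> ?D x = ?D y}"
  proof -
    have "(\<exists>z\<in>carrier M. a \<otimes>\<^bsub>M\<^esub> d \<otimes>\<^bsub>M\<^esub> z = c \<otimes>\<^bsub>M\<^esub> b \<otimes>\<^bsub>M\<^esub> z) \<longleftrightarrow> f a - f b = f c - f d"
      if "a \<in> carrier M" "b \<in> carrier M" "c \<in> carrier M" "d \<in> carrier M" for a b c d
    proof
      assume "\<exists>z\<in>carrier M. a \<otimes>\<^bsub>M\<^esub> d \<otimes>\<^bsub>M\<^esub> z = c \<otimes>\<^bsub>M\<^esub> b \<otimes>\<^bsub>M\<^esub> z"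
      then obtain z where z: "z \<in> carrier M" "a \<otimes>\<^bsub>M\<^esub> d \<otimes>\<^bsub>M\<^esub> z = c \<otimes>\<^bsub>M\<^esub> b \<otimes>\<^bsub>M\<^esub> z" by blast
      have "f (a \<otimes>\<^bsub>M\<^esub> d \<otimes>\<^bsub>M\<^esub> z) = f (c \<otimes>\<^bsub>M\<^esub> b \<otimes>\<^bsub>M\<^esub> z)" by (simp only: z(2))
      then have "f a + f d = f c + f b" using that z(1) by (simp add: hom closed)
      then show "f a - f b = f c - f d" by (simp add: algebra_simps)
    next
      assume "f a - f b = f c - f d"
      then have "f (a \<otimes>\<^bsub>M\<^esub> d) = f (c \<otimes>\<^bsub>M\<^esub> b)" using that by (simp add: hom algebra_simps)
      then show "\<exists>z\<in>carrier M. a \<otimes>\<^bsub>M\<^esub> d \<otimes>\<^bsub>M\<^esub> z = c \<otimes>\<^bsub>M\<^esub> b \<otimes>\<^bsub>M\<^esub> z"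
        using that by (intro canc closed)
    qed
    then show ?thesis unfolding grothendieck_rel_def by (simp add: split_def set_eq_iff) blast
  qed
  have eqR: "equiv (carrier M \<times> carrier M) ?R"
    unfolding rel by (auto intro!: equivI simp: refl_on_def sym_def trans_def)
  define h where "h X = ?D (SOME x. x \<in> X)" for X
  have h: "h (?R `` {x}) = ?D x" if "x \<in> carrier M \<times> carrier M" for x
  proof -
    have "x \<in> ?R `` {x}" using that by (auto simp: rel)
    then have "(SOME y. y \<in> ?R `` {x}) \<in> ?R `` {x}" by (rule someI)
    then show ?thesis unfolding h_def using that by (auto simp: rel)
  qed
  have carr: "carrier (grothendieck_group M) = (\<lambda>x. ?R `` {x}) ` (carrier M \<times> carrier M)"
    by (auto simp: grothendieck_group_def quotient_def)
  have mult: "?R `` {(a, b)} \<otimes>\<^bsub>grothendieck_group M\<^esub> ?R `` {(c, d)} = ?R `` {(a \<otimes>\<^bsub>M\<^esub> c, b \<otimes>\<^bsub>M\<^esub> d)}"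
    if "a \<in> carrier M" "b \<in> carrier M" "c \<in> carrier M" "d \<in> carrier M" for a b c d
  proof -
    have "?R `` {(a' \<otimes>\<^bsub>M\<^esub> c', b' \<otimes>\<^bsub>M\<^esub> d')} = ?R `` {(a \<otimes>\<^bsub>M\<^esub> c, b \<otimes>\<^bsub>M\<^esub> d)}"
      if "(a', b') \<in> ?R `` {(a, b)}" "(c', d') \<in> ?R `` {(c, d)}" for a' b' c' d'
    proof (rule equiv_class_eq[OF eqR])
      from that have mem: "a' \<in> carrier M" "b' \<in> carrier M" "c' \<in> carrier M" "d' \<in> carrier M"
        and eq: "f a - f b = f a' - f b'" "f c - f d = f c' - f d'" by (auto simp: rel)
      have "f a' + f c' - (f b' + f d') = (f a' - f b') + (f c' - f d')" by simp
      also have "\<dots> = f a + f c - (f b + f d)" by (simp flip: eq)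
      finally show "((a' \<otimes>\<^bsub>M\<^esub> c', b' \<otimes>\<^bsub>M\<^esub> d'), (a \<otimes>\<^bsub>M\<^esub> c, b \<otimes>\<^bsub>M\<^esub> d)) \<in> ?R"
        using mem \<open>a \<in> carrier M\<close> \<open>b \<in> carrier M\<close> \<open>c \<in> carrier M\<close> \<open>d \<in> carrier M\<close>
        by (simp add: rel closed hom)
    qed
    moreover have "(a, b) \<in> ?R `` {(a, b)}" "(c, d) \<in> ?R `` {(c, d)}" using that by (auto simp: rel)
    moreover have "?R `` {(a, b)} \<otimes>\<^bsub>grothendieck_group M\<^esub> ?R `` {(c, d)}
        = (\<Union>(a', b')\<in>?R `` {(a, b)}. \<Union>(c', d')\<in>?R `` {(c, d)}. ?R `` {(a' \<otimes>\<^bsub>M\<^esub> c', b' \<otimes>\<^bsub>M\<^esub> d')})"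
      by (simp add: grothendieck_group_def)
    ultimately show ?thesis by fast
  qed
  have "h \<in> iso (grothendieck_group M) (free_Abelian_group UNIV)"
  proof (rule isoI)
    show "h \<in> hom (grothendieck_group M) (free_Abelian_group UNIV)"
    proof (rule homI)
      fix X Y assume "X \<in> carrier (grothendieck_group M)" "Y \<in> carrier (grothendieck_group M)"
      then obtain a b c d where X: "a \<in> carrier M" "b \<in> carrier M" "X = ?R `` {(a, b)}"
        and Y: "c \<in> carrier M" "d \<in> carrier M" "Y = ?R `` {(c, d)}"
        unfolding carr by auto
      then show "h (X \<otimes>\<^bsub>grothendieck_group M\<^esub> Y) = h X \<otimes>\<^bsub>free_Abelian_group UNIV\<^esub> h Y"
        by (simp add: mult h closed hom)
    qed simp
    show "bij_betw h (carrier (grothendieck_group M)) (carrier (free_Abelian_group UNIV))"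
    proof (rule bij_betw_imageI)
      show "inj_on h (carrier (grothendieck_group M))"
      proof (rule inj_onI)
        fix X Y assume XY: "X \<in> carrier (grothendieck_group M)" "Y \<in> carrier (grothendieck_group M)" "h X = h Y"
        then obtain x y where x: "x \<in> carrier M \<times> carrier M" "X = ?R `` {x}"
          and y: "y \<in> carrier M \<times> carrier M" "Y = ?R `` {y}" unfolding carr by blast
        then have "?D x = ?D y" using XY(3) h by simp
        then have "(x, y) \<in> ?R" using x y by (simp add: rel)
        then show "X = Y" using x y equiv_class_eq[OF eqR] by simp
      qed
      show "h ` carrier (grothendieck_group M) = carrier (free_Abelian_group UNIV)"
      proof (intro equalityI subsetI)
        fix g :: "'b \<Rightarrow>\<^sub>0 int"
        obtain x y where "x \<in> carrier M" "y \<in> carrier M" "g = f x - f y" using surj by blast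
        then have "g = h (?R `` {(x, y)})" "?R `` {(x, y)} \<in> carrier (grothendieck_group M)"
          using h[of "(x, y)"] by (auto simp: carr)
        then show "g \<in> h ` carrier (grothendieck_group M)" by blast
      qed simp
    qed
  qed
  then show ?thesis by (rule is_isoI)
qed

text \<open>The frame exceeds the length by one because sizes must be positive even for the empty
  list.\<close>

lemma stage_proj_diag: "stage_proj (Suc (length xs)) (diag xs)"
  using supp_mono[OF supp_diag[of xs], of "Suc (length xs)"]
  by (simp add: stage_proj_def diag_in_CF is_proj_diag)

lemma valF_diag: "valF (diag xs) = vals xs"
  by (rule valF_dec) (simp add: dec_def diag_refl)

theorem proposition3p2:
  shows "K0 (gauge_fixed Q2) \<cong> free_Abelian_group (UNIV :: nat set)"
  unfolding K0_def
proof (rule grothendieck_group_iso)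
  let ?M = "projection_monoid A"
  fix X Y assume "X \<in> carrier ?M" "Y \<in> carrier ?M"
  then obtain n F m G where F: "stage_proj n F" "X = pcls n F" and G: "stage_proj m G" "Y = pcls m G"
    by (auto simp: carrier_projection_monoid)
  obtain xs ys where xs: "dec F xs" and ys: "dec G ys" using stage_proj_dec F G by blast
  note XY = F(2) G(2) mult_projection_monoid[OF F(1) G(1)]
  show "X \<otimes>\<^bsub>?M\<^esub> Y \<in> carrier ?M"
    unfolding XY carrier_projection_monoid using stage_proj_dsum[OF F(1) G(1)] by blast
  show "clsval (X \<otimes>\<^bsub>?M\<^esub> Y) = clsval X + clsval Y"
    unfolding XY using valF_dec[OF dec_dsum[OF F(1) xs G(1) ys]] valF_dec[OF xs] valF_dec[OF ys]
    by (simp add: clsval_pcls F G stage_proj_dsum)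
  \<comment> \<open>The list \<open>zs\<close> from \<open>stably_mvn\<close> becomes the class that
    is added on both sides in the Grothendieck relation.\<close>
  assume "clsval X = clsval Y"
  then have "vals xs = vals ys" using valF_dec[OF xs] valF_dec[OF ys] F G by (simp add: clsval_pcls)
  then obtain zs where zs: "mvn CF (diag (xs @ zs)) (diag (ys @ zs))" using stably_mvn by blast
  define k where "k = Suc (length zs)"
  have Z: "stage_proj k (diag zs)" unfolding k_def by (rule stage_proj_diag)
  have zz: "dec (diag zs) zs" by (simp add: dec_def diag_refl)
  have "mvn CF (F + shift n (diag zs)) (G + shift m (diag zs))"
    using mvn_trans[OF CF mvn_trans[OF CF dec_dsum[OF F(1) xs Z zz, unfolded dec_def] zs]
        mvn_sym[OF CF dec_dsum[OF G(1) ys Z zz, unfolded dec_def]]] .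
  then have "X \<otimes>\<^bsub>?M\<^esub> pcls k (diag zs) = Y \<otimes>\<^bsub>?M\<^esub> pcls k (diag zs)"
    unfolding F(2) G(2) mult_projection_monoid[OF F(1) Z] mult_projection_monoid[OF G(1) Z]
    by (simp add: pcls_eq_iff stage_proj_dsum F G Z)
  moreover have "pcls k (diag zs) \<in> carrier ?M" using Z by (auto simp: carrier_projection_monoid)
  ultimately show "\<exists>Z\<in>carrier ?M. X \<otimes>\<^bsub>?M\<^esub> Z = Y \<otimes>\<^bsub>?M\<^esub> Z" by blast
next
  fix g :: "nat \<Rightarrow>\<^sub>0 int"
  obtain xs ys where g: "g = vals xs - vals ys" using vals_surj by blast
  let ?c = "\<lambda>xs. pcls (Suc (length xs)) (diag xs)"
  have "?c zs \<in> carrier (projection_monoid A)" "clsval (?c zs) = vals zs" for zs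
    using stage_proj_diag[of zs] by (auto simp: carrier_projection_monoid clsval_pcls valF_diag)
  then show "\<exists>x\<in>carrier (projection_monoid A). \<exists>y\<in>carrier (projection_monoid A). g = clsval x - clsval y"
    unfolding g by metis
qed

end
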